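(* Let $(R,\mathfrak{m})$ be a local ring with dimension $t$ and depth $r \geq 1$, possessing a (normalized) dualizing complex $D^{\bullet}$. Let $M \neq 0$ and $N$ be finitely generated $R$-modules with $\operatorname{pd}_R M < \infty$ and $\operatorname{pd}_R N < \infty$, satisfying $$\operatorname{Ext}_R^{j}(N, M\otimes_R^{\mathrm{L}} D^{\bullet}) = 0, \quad j = t-r+i, \ldots, t,$$ for some positive integer $i \leq r$. Then $\operatorname{pd}_R N < i$.
   Context: All rings are Noetherian, commutative, with $1 \neq 0$. A dualizing complex $D^{\bullet}$ of $R$ is regarded as a bounded complex of injective $R$-modules with finitely generated cohomology, normalized so that $\mathrm{R}\Gamma_{\mathfrak{m}}(D^{\bullet}) \cong E[-t]$, where $t=\dim R$ and $E=E(R/\mathfrak{m})$ is the injective hull of the residue field; i.e. local duality reads $H^i_{\mathfrak{m}}(X) \cong \operatorname{Hom}_R(\operatorname{Ext}^{t-i}_R(X,D^{\bullet}),E)$ for complexes $X$ with finitely generated cohomology. For a complex $Y$, $\operatorname{Ext}^j_R(N,Y) = H^j(\operatorname{RHom}_R(N,Y))$. *)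

theory Defs
  imports
    "HOL-Algebra.Module"
    "HOL-Algebra.Ideal_Product"
    "HOL-Algebra.Ring_Divisibility"
    "HOL-Library.Extended_Nat"
begin

section \<open>Local rings, dimension, depth\<close>

locale noetherian_local_ring = cring R + noetherian_ring R
  for R :: "('a, 'r) ring_scheme" (structure) and m :: "'a set" +
  assumes maximal: "maximalideal m R"
    and unique_maximal: "maximalideal J R \<Longrightarrow> J = m"

definition krull_dim :: "('a, 'r) ring_scheme \<Rightarrow> enat" where
  "krull_dim R = Sup {enat n | n. \<exists>P :: nat \<Rightarrow> 'a set.
     (\<forall>k\<le>n. primeideal (P k) R) \<and> (\<forall>k<n. P k \<subset> P (Suc k))}"

text \<open>The usual condition \<open>R / (xs) \<noteq> 0\<close> is not listed: below, all entries lie in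
  the maximal ideal.\<close>

definition regular_sequence :: "('a, 'r) ring_scheme \<Rightarrow> 'a list \<Rightarrow> bool" where
  "regular_sequence R xs \<longleftrightarrow> set xs \<subseteq> carrier R \<and>
     (\<forall>k < length xs. \<forall>y \<in> carrier R.
        xs ! k \<otimes>\<^bsub>R\<^esub> y \<in> Idl\<^bsub>R\<^esub> (set (take k xs)) \<longrightarrow> y \<in> Idl\<^bsub>R\<^esub> (set (take k xs)))"

definition depth :: "('a, 'r) ring_scheme \<Rightarrow> 'a set \<Rightarrow> enat" where
  "depth R m = Sup {enat (length xs) | xs. set xs \<subseteq> m \<and> regular_sequence R xs}"

primrec ideal_power :: "('a, 'r) ring_scheme \<Rightarrow> 'a set \<Rightarrow> nat \<Rightarrow> 'a set" where
  "ideal_power R I 0 = carrier R"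
| "ideal_power R I (Suc n) = ideal_prod R (ideal_power R I n) I"


section \<open>Modules\<close>

text \<open>The record of modules extends the record of rings; its fields \<open>mult\<close> and \<open>one\<close> play
  no role for modules and are left undefined in the constructions below. A submodule \<open>H\<close> of \<open>M\<close>
  is regarded as the module \<open>M\<lparr>carrier := H\<rparr>\<close>.\<close>

definition zero_module :: "('a, 'm) module \<Rightarrow> bool" where
  "zero_module M \<longleftrightarrow> carrier M = {\<zero>\<^bsub>M\<^esub>}"

definition mod_hom ::
    "('a, 'r) ring_scheme \<Rightarrow> ('a, 'm) module \<Rightarrow> ('a, 'n) module \<Rightarrow> ('m \<Rightarrow> 'n) set" where
  "mod_hom R M N = {f \<in> carrier M \<rightarrow> carrier N.
     (\<forall>x \<in> carrier M. \<forall>y \<in> carrier M. f (x \<oplus>\<^bsub>M\<^esub> y) = f x \<oplus>\<^bsub>N\<^esub> f y) \<and>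
     (\<forall>a \<in> carrier R. \<forall>x \<in> carrier M. f (a \<odot>\<^bsub>M\<^esub> x) = a \<odot>\<^bsub>N\<^esub> f x)}"

definition module_span :: "('a, 'r) ring_scheme \<Rightarrow> ('a, 'm) module \<Rightarrow> 'm set \<Rightarrow> 'm set" where
  "module_span R M S = \<Inter>{H. submodule H R M \<and> S \<subseteq> H}"

definition finitely_generated :: "('a, 'r) ring_scheme \<Rightarrow> ('a, 'm) module \<Rightarrow> bool" where
  "finitely_generated R M \<longleftrightarrow>
     module R M \<and> (\<exists>S \<subseteq> carrier M. finite S \<and> module_span R M S = carrier M)"

definition ring_module :: "('a, 'r) ring_scheme \<Rightarrow> ('a, 'a) module" where
  "ring_module R = \<lparr>carrier = carrier R, monoid.mult = monoid.mult R, one = \<one>\<^bsub>R\<^esub>,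
     zero = \<zero>\<^bsub>R\<^esub>, add = add R, smult = monoid.mult R\<rparr>"

definition quotient_module :: "('a, 'm) module \<Rightarrow> 'm set \<Rightarrow> ('a, 'm set) module" where
  "quotient_module M H = \<lparr>carrier = a_rcosets\<^bsub>M\<^esub> H, monoid.mult = undefined, one = undefined,
     zero = H, add = set_add M, smult = (\<lambda>a X. \<Union>x\<in>X. H +>\<^bsub>M\<^esub> (a \<odot>\<^bsub>M\<^esub> x))\<rparr>"

definition product_module :: "('i \<Rightarrow> ('a, 'm) module) \<Rightarrow> ('a, 'i \<Rightarrow> 'm) module" where
  "product_module M = \<lparr>carrier = {f. \<forall>p. f p \<in> carrier (M p)},
     monoid.mult = undefined, one = undefined, zero = (\<lambda>p. \<zero>\<^bsub>M p\<^esub>),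
     add = (\<lambda>f g p. f p \<oplus>\<^bsub>M p\<^esub> g p), smult = (\<lambda>a f p. a \<odot>\<^bsub>M p\<^esub> f p)\<rparr>"

definition sum_module :: "('i \<Rightarrow> ('a, 'm) module) \<Rightarrow> ('a, 'i \<Rightarrow> 'm) module" where
  "sum_module M = (product_module M)
     \<lparr>carrier := {f. (\<forall>p. f p \<in> carrier (M p)) \<and> finite {p. f p \<noteq> \<zero>\<^bsub>M p\<^esub>}}\<rparr>"

definition hom_module ::
    "('a, 'r) ring_scheme \<Rightarrow> ('a, 'm) module \<Rightarrow> ('a, 'n) module \<Rightarrow> ('a, 'm \<Rightarrow> 'n) module" where
  "hom_module R M N = \<lparr>carrier = mod_hom R M N \<inter> extensional (carrier M),
     monoid.mult = undefined, one = undefined, zero = (\<lambda>x\<in>carrier M. \<zero>\<^bsub>N\<^esub>),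
     add = (\<lambda>f g. \<lambda>x\<in>carrier M. f x \<oplus>\<^bsub>N\<^esub> g x),
     smult = (\<lambda>a f. \<lambda>x\<in>carrier M. a \<odot>\<^bsub>N\<^esub> f x)\<rparr>"


subsection \<open>Tensor products\<close>

definition free_module :: "('a, 'r) ring_scheme \<Rightarrow> 's set \<Rightarrow> ('a, 's \<Rightarrow> 'a) module" where
  "free_module R S =
     \<lparr>carrier = {f. (\<forall>s. f s \<in> carrier R) \<and> finite {s. f s \<noteq> \<zero>\<^bsub>R\<^esub>} \<and> {s. f s \<noteq> \<zero>\<^bsub>R\<^esub>} \<subseteq> S},
      monoid.mult = undefined, one = undefined, zero = (\<lambda>s. \<zero>\<^bsub>R\<^esub>),
      add = (\<lambda>f g s. f s \<oplus>\<^bsub>R\<^esub> g s), smult = (\<lambda>a f s. a \<otimes>\<^bsub>R\<^esub> f s)\<rparr>"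

definition free_gen :: "('a, 'r) ring_scheme \<Rightarrow> 's \<Rightarrow> 's \<Rightarrow> 'a" where
  "free_gen R s = (\<lambda>u. if u = s then \<one>\<^bsub>R\<^esub> else \<zero>\<^bsub>R\<^esub>)"

definition tensor_relations ::
    "('a, 'r) ring_scheme \<Rightarrow> ('a, 'm) module \<Rightarrow> ('a, 'n) module \<Rightarrow> ('m \<times> 'n \<Rightarrow> 'a) set" where
  "tensor_relations R M N = (let F = free_module R (carrier M \<times> carrier N); e = free_gen R in
     {e (x \<oplus>\<^bsub>M\<^esub> x', y) \<ominus>\<^bsub>F\<^esub> (e (x, y) \<oplus>\<^bsub>F\<^esub> e (x', y)) | x x' y.
        x \<in> carrier M \<and> x' \<in> carrier M \<and> y \<in> carrier N} \<union>
     {e (x, y \<oplus>\<^bsub>N\<^esub> y') \<ominus>\<^bsub>F\<^esub> (e (x, y) \<oplus>\<^bsub>F\<^esub> e (x, y')) | x y y'.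
        x \<in> carrier M \<and> y \<in> carrier N \<and> y' \<in> carrier N} \<union>
     {e (a \<odot>\<^bsub>M\<^esub> x, y) \<ominus>\<^bsub>F\<^esub> a \<odot>\<^bsub>F\<^esub> e (x, y) | a x y.
        a \<in> carrier R \<and> x \<in> carrier M \<and> y \<in> carrier N} \<union>
     {e (x, a \<odot>\<^bsub>N\<^esub> y) \<ominus>\<^bsub>F\<^esub> a \<odot>\<^bsub>F\<^esub> e (x, y) | a x y.
        a \<in> carrier R \<and> x \<in> carrier M \<and> y \<in> carrier N})"

definition tensor_submodule ::
    "('a, 'r) ring_scheme \<Rightarrow> ('a, 'm) module \<Rightarrow> ('a, 'n) module \<Rightarrow> ('m \<times> 'n \<Rightarrow> 'a) set" where
  "tensor_submodule R M N =
     module_span R (free_module R (carrier M \<times> carrier N)) (tensor_relations R M N)"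

definition tensor ::
    "('a, 'r) ring_scheme \<Rightarrow> ('a, 'm) module \<Rightarrow> ('a, 'n) module \<Rightarrow> ('a, ('m \<times> 'n \<Rightarrow> 'a) set) module"
  where "tensor R M N =
     quotient_module (free_module R (carrier M \<times> carrier N)) (tensor_submodule R M N)"

definition pure_tensor ::
    "('a, 'r) ring_scheme \<Rightarrow> ('a, 'm) module \<Rightarrow> ('a, 'n) module \<Rightarrow> 'm \<Rightarrow> 'n \<Rightarrow> ('m \<times> 'n \<Rightarrow> 'a) set"
  where "pure_tensor R M N x y =
     tensor_submodule R M N +>\<^bsub>free_module R (carrier M \<times> carrier N)\<^esub> free_gen R (x, y)"

text \<open>The map \<open>f \<otimes> g\<close> from \<open>M \<otimes> N\<close> to \<open>M' \<otimes> N'\<close>.\<close>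

definition tensor_map ::
    "('a, 'r) ring_scheme \<Rightarrow> ('a, 'm) module \<Rightarrow> ('a, 'n) module \<Rightarrow>
     ('a, 'k) module \<Rightarrow> ('a, 'l) module \<Rightarrow> ('m \<Rightarrow> 'k) \<Rightarrow> ('n \<Rightarrow> 'l) \<Rightarrow>
     ('m \<times> 'n \<Rightarrow> 'a) set \<Rightarrow> ('k \<times> 'l \<Rightarrow> 'a) set" where
  "tensor_map R M N M' N' f g =
     (THE h. h \<in> mod_hom R (tensor R M N) (tensor R M' N') \<inter> extensional (carrier (tensor R M N)) \<and>
        (\<forall>x \<in> carrier M. \<forall>y \<in> carrier N.
           h (pure_tensor R M N x y) = pure_tensor R M' N' (f x) (g y)))"


subsection \<open>Projective and injective modules\<close>

text \<open>The test modules in the two lifting properties have to range over the modules carried by some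
  fixed type. For a module carried by \<open>'m\<close> this is the type \<open>'m \<Rightarrow> 'a\<close>. Over a nonzero ring it is
  large enough for both properties to imply the lifting property against all modules: it
  contains the free module on the elements of \<open>P\<close> together with a copy of \<open>P\<close> (an epimorphism
  from this free module onto \<open>P\<close> then splits), and a copy of \<open>R\<close> and of its ideals
  (Baer's criterion).\<close>

definition projective_module :: "('a, 'r) ring_scheme \<Rightarrow> ('a, 'm) module \<Rightarrow> bool" where
  "projective_module R P \<longleftrightarrow> module R P \<and>
     (\<forall>(A :: ('a, 'm \<Rightarrow> 'a) module) (B :: ('a, 'm \<Rightarrow> 'a) module) g f.
        module R A \<and> module R B \<and> g \<in> mod_hom R A B \<and> g ` carrier A = carrier B \<and>
        f \<in> mod_hom R P B \<longrightarrow>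
        (\<exists>h \<in> mod_hom R P A. \<forall>x \<in> carrier P. g (h x) = f x))"

definition injective_module :: "('a, 'r) ring_scheme \<Rightarrow> ('a, 'm) module \<Rightarrow> bool" where
  "injective_module R I \<longleftrightarrow> module R I \<and>
     (\<forall>(A :: ('a, 'm \<Rightarrow> 'a) module) (B :: ('a, 'm \<Rightarrow> 'a) module) g f.
        module R A \<and> module R B \<and> g \<in> mod_hom R A B \<and> inj_on g (carrier A) \<and>
        f \<in> mod_hom R A I \<longrightarrow>
        (\<exists>h \<in> mod_hom R B I. \<forall>x \<in> carrier A. h (g x) = f x))"

definition injective_hull ::
    "('a, 'r) ring_scheme \<Rightarrow> ('a, 'k) module \<Rightarrow> ('a, 'm) module \<Rightarrow> bool" where
  "injective_hull R K E \<longleftrightarrow> injective_module R E \<and>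
     (\<exists>h \<in> mod_hom R K E. inj_on h (carrier K) \<and>
        (\<forall>H. submodule H R E \<and> H \<noteq> {\<zero>\<^bsub>E\<^esub>} \<longrightarrow> H \<inter> h ` carrier K \<noteq> {\<zero>\<^bsub>E\<^esub>}))"


section \<open>Complexes\<close>

text \<open>Complexes are graded cohomologically: \<open>diff C n\<close> maps \<open>obj C n\<close> to \<open>obj C (n + 1)\<close>.\<close>

record ('a, 'm) cochain_complex =
  obj :: "int \<Rightarrow> ('a, 'm) module"
  diff :: "int \<Rightarrow> 'm \<Rightarrow> 'm"

definition is_complex :: "('a, 'r) ring_scheme \<Rightarrow> ('a, 'm) cochain_complex \<Rightarrow> bool" where
  "is_complex R C \<longleftrightarrow> (\<forall>n. module R (obj C n) \<and>
     diff C n \<in> mod_hom R (obj C n) (obj C (n + 1)) \<and>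
     (\<forall>x \<in> carrier (obj C n). diff C (n + 1) (diff C n x) = \<zero>\<^bsub>obj C (n + 2)\<^esub>))"

definition cocycles :: "('a, 'm) cochain_complex \<Rightarrow> int \<Rightarrow> 'm set" where
  "cocycles C n = {x \<in> carrier (obj C n). diff C n x = \<zero>\<^bsub>obj C (n + 1)\<^esub>}"

definition coboundaries :: "('a, 'm) cochain_complex \<Rightarrow> int \<Rightarrow> 'm set" where
  "coboundaries C n = diff C (n - 1) ` carrier (obj C (n - 1))"

definition cohomology :: "('a, 'm) cochain_complex \<Rightarrow> int \<Rightarrow> ('a, 'm set) module" where
  "cohomology C n = quotient_module ((obj C n)\<lparr>carrier := cocycles C n\<rparr>) (coboundaries C n)"

definition chain_map :: "('a, 'r) ring_scheme \<Rightarrow>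
    ('a, 'm) cochain_complex \<Rightarrow> ('a, 'n) cochain_complex \<Rightarrow> (int \<Rightarrow> 'm \<Rightarrow> 'n) \<Rightarrow> bool" where
  "chain_map R C C' f \<longleftrightarrow> (\<forall>n. f n \<in> mod_hom R (obj C n) (obj C' n) \<and>
     (\<forall>x \<in> carrier (obj C n). f (n + 1) (diff C n x) = diff C' n (f n x)))"

definition cohomology_map ::
    "('a, 'n) cochain_complex \<Rightarrow> (int \<Rightarrow> 'm \<Rightarrow> 'n) \<Rightarrow> int \<Rightarrow> 'm set \<Rightarrow> 'n set" where
  "cohomology_map C' f n X = (\<Union>x\<in>X. coboundaries C' n +>\<^bsub>obj C' n\<^esub> f n x)"

definition quasi_isomorphism :: "('a, 'r) ring_scheme \<Rightarrow>
    ('a, 'm) cochain_complex \<Rightarrow> ('a, 'n) cochain_complex \<Rightarrow> (int \<Rightarrow> 'm \<Rightarrow> 'n) \<Rightarrow> bool" where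
  "quasi_isomorphism R C C' f \<longleftrightarrow> chain_map R C C' f \<and>
     (\<forall>n. bij_betw (cohomology_map C' f n)
            (carrier (cohomology C n)) (carrier (cohomology C' n)))"

text \<open>\<open>stalk_complex M n\<close> is \<open>M[-n]\<close>, the module \<open>M\<close> placed in degree \<open>n\<close>.\<close>

definition stalk_complex :: "('a, 'm) module \<Rightarrow> int \<Rightarrow> ('a, 'm) cochain_complex" where
  "stalk_complex M n =
     \<lparr>obj = (\<lambda>k. if k = n then M else M\<lparr>carrier := {\<zero>\<^bsub>M\<^esub>}\<rparr>), diff = (\<lambda>k x. \<zero>\<^bsub>M\<^esub>)\<rparr>"

definition signed :: "('a, 'm) module \<Rightarrow> int \<Rightarrow> 'm \<Rightarrow> 'm" where
  "signed M n x = (if even n then x else \<ominus>\<^bsub>M\<^esub> x)"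

text \<open>Total tensor complex: in degree \<open>n\<close> the sum of all \<open>X\<^sup>p \<otimes> Y\<^sup>n\<^sup>-\<^sup>p\<close>, with
  \<open>d (x \<otimes> y) = d x \<otimes> y + (-1)\<^sup>p x \<otimes> d y\<close> for \<open>x \<in> X\<^sup>p\<close>.\<close>

definition tensor_complex :: "('a, 'r) ring_scheme \<Rightarrow>
    ('a, 'm) cochain_complex \<Rightarrow> ('a, 'n) cochain_complex \<Rightarrow>
    ('a, int \<Rightarrow> ('m \<times> 'n \<Rightarrow> 'a) set) cochain_complex" where
  "tensor_complex R X Y =
     \<lparr>obj = (\<lambda>n. sum_module (\<lambda>p. tensor R (obj X p) (obj Y (n - p)))),
      diff = (\<lambda>n z p.
        tensor_map R (obj X (p - 1)) (obj Y (n + 1 - p)) (obj X p) (obj Y (n + 1 - p))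
          (diff X (p - 1)) (\<lambda>y. y) (z (p - 1))
        \<oplus>\<^bsub>tensor R (obj X p) (obj Y (n + 1 - p))\<^esub>
        signed (tensor R (obj X p) (obj Y (n + 1 - p))) p
          (tensor_map R (obj X p) (obj Y (n - p)) (obj X p) (obj Y (n + 1 - p))
             (\<lambda>x. x) (diff Y (n - p)) (z p)))\<rparr>"

text \<open>Hom complex: in degree \<open>n\<close> the product of all \<open>Hom(X\<^sup>p, Y\<^sup>p\<^sup>+\<^sup>n)\<close>, with
  \<open>d f = d\<^sub>Y f - (-1)\<^sup>n f d\<^sub>X\<close>.\<close>

definition hom_complex :: "('a, 'r) ring_scheme \<Rightarrow>
    ('a, 'm) cochain_complex \<Rightarrow> ('a, 'n) cochain_complex \<Rightarrow>
    ('a, int \<Rightarrow> 'm \<Rightarrow> 'n) cochain_complex" where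
  "hom_complex R X Y =
     \<lparr>obj = (\<lambda>n. product_module (\<lambda>p. hom_module R (obj X p) (obj Y (p + n)))),
      diff = (\<lambda>n f p. \<lambda>x\<in>carrier (obj X p).
        diff Y (p + n) (f p x) \<ominus>\<^bsub>obj Y (p + n + 1)\<^esub>
        signed (obj Y (p + n + 1)) n (f (p + 1) (diff X p x)))\<rparr>"


section \<open>Projective dimension and derived functors\<close>

text \<open>A projective resolution \<open>\<dots> \<rightarrow> P\<^sub>1 \<rightarrow> P\<^sub>0 \<rightarrow> M \<rightarrow> 0\<close> is regarded as a complex
  with \<open>P\<^sub>k\<close> in degree \<open>-k\<close>, together with a quasi-isomorphism to \<open>M\<close>.\<close>

definition projective_resolution :: "('a, 'r) ring_scheme \<Rightarrow> ('a, 'm) module \<Rightarrow>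
    ('a, 'p) cochain_complex \<Rightarrow> (int \<Rightarrow> 'p \<Rightarrow> 'm) \<Rightarrow> bool" where
  "projective_resolution R M P e \<longleftrightarrow> is_complex R P \<and>
     (\<forall>n. projective_module R (obj P n)) \<and> (\<forall>n>0. zero_module (obj P n)) \<and>
     quasi_isomorphism R P (stalk_complex M 0) e"

text \<open>Resolutions of a module carried by \<open>'m\<close> are taken with terms carried by
  \<open>'m \<times> nat \<Rightarrow> 'a\<close>. Over a nonzero ring this type is at least as large as \<open>'a\<close>, \<open>'m\<close> and \<open>nat\<close>;
  hence, up to isomorphism, it accommodates a free resolution of every module,
  and a projective resolution of minimal length.\<close>

text \<open>With values in \<^typ>\<open>enat\<close>, the zero module gets projective dimension 0 rather than
  minus infinity.\<close>

definition proj_dim :: "('a, 'r) ring_scheme \<Rightarrow> ('a, 'm) module \<Rightarrow> enat" where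
  "proj_dim R M = Inf {enat n | n.
     \<exists>(P :: ('a, 'm \<times> nat \<Rightarrow> 'a) cochain_complex) e.
        projective_resolution R M P e \<and> (\<forall>k < - int n. zero_module (obj P k))}"

definition resolution ::
    "('a, 'r) ring_scheme \<Rightarrow> ('a, 'm) module \<Rightarrow> ('a, 'm \<times> nat \<Rightarrow> 'a) cochain_complex" where
  "resolution R M = (SOME P. \<exists>e. projective_resolution R M P e)"

text \<open>\<open>M \<otimes>\<^sup>L Y\<close> and \<open>Ext\<^sup>j(N, Y) = H\<^sup>j(RHom(N, Y))\<close> for modules \<open>M\<close>, \<open>N\<close> and a complex \<open>Y\<close>.\<close>

definition derived_tensor :: "('a, 'r) ring_scheme \<Rightarrow> ('a, 'm) module \<Rightarrow>
    ('a, 'n) cochain_complex \<Rightarrow>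
    ('a, int \<Rightarrow> (('m \<times> nat \<Rightarrow> 'a) \<times> 'n \<Rightarrow> 'a) set) cochain_complex" where
  "derived_tensor R M Y = tensor_complex R (resolution R M) Y"

definition Ext :: "('a, 'r) ring_scheme \<Rightarrow> ('a, 'm) module \<Rightarrow>
    ('a, 'n) cochain_complex \<Rightarrow> int \<Rightarrow> ('a, (int \<Rightarrow> ('m \<times> nat \<Rightarrow> 'a) \<Rightarrow> 'n) set) module" where
  "Ext R N Y j = cohomology (hom_complex R (resolution R N) Y) j"


section \<open>Dualizing complexes\<close>

definition torsion_part :: "('a, 'r) ring_scheme \<Rightarrow> 'a set \<Rightarrow> ('a, 'm) module \<Rightarrow> 'm set" where
  "torsion_part R m M =
     {x \<in> carrier M. \<exists>k. \<forall>a \<in> ideal_power R m k. a \<odot>\<^bsub>M\<^esub> x = \<zero>\<^bsub>M\<^esub>}"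

definition torsion_complex ::
    "('a, 'r) ring_scheme \<Rightarrow> 'a set \<Rightarrow> ('a, 'm) cochain_complex \<Rightarrow> ('a, 'm) cochain_complex" where
  "torsion_complex R m C =
     C\<lparr>obj := (\<lambda>n. (obj C n)\<lparr>carrier := torsion_part R m (obj C n)\<rparr>)\<rparr>"

text \<open>The homothety morphism from \<open>R\<close> to \<open>Hom(C, C)\<close>.\<close>

definition homothety ::
    "('a, 'm) cochain_complex \<Rightarrow> int \<Rightarrow> 'a \<Rightarrow> int \<Rightarrow> 'm \<Rightarrow> 'm" where
  "homothety C n a = (\<lambda>p. \<lambda>x\<in>carrier (obj C p).
     if n = 0 then a \<odot>\<^bsub>obj C p\<^esub> x else \<zero>\<^bsub>obj C (p + n)\<^esub>)"

text \<open>Since the terms of \<open>D\<close> are injective and \<open>D\<close> is bounded, \<open>RHom(D, D)\<close> is the complex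
  \<open>Hom(D, D)\<close>.\<close>

definition dualizing_complex ::
    "('a, 'r) ring_scheme \<Rightarrow> ('a, 'd) cochain_complex \<Rightarrow> bool" where
  "dualizing_complex R D \<longleftrightarrow> is_complex R D \<and>
     (\<exists>a b. \<forall>n. n < a \<or> b < n \<longrightarrow> zero_module (obj D n)) \<and>
     (\<forall>n. injective_module R (obj D n)) \<and>
     (\<forall>n. finitely_generated R (cohomology D n)) \<and>
     quasi_isomorphism R (stalk_complex (ring_module R) 0) (hom_complex R D D) (homothety D)"

text \<open>Normalization in dimension \<open>t\<close>: \<open>R\<Gamma>\<^sub>m(D) \<cong> E[-t]\<close>, where \<open>E\<close> is an injective hull of
  \<open>R/m\<close>. As \<open>D\<close> is a bounded complex of injective modules, \<open>R\<Gamma>\<^sub>m(D)\<close> is \<open>\<Gamma>\<^sub>m(D)\<close>; and as \<open>E\<close> is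
  injective, an isomorphism to \<open>E[-t]\<close> in the derived category is given by a
  quasi-isomorphism of complexes. Such an \<open>E\<close> is isomorphic to a subquotient of the degree-\<open>t\<close> term
  of \<open>D\<close>, so it can be found in the type carrying \<open>D\<close>.\<close>

definition normalized_dualizing_complex ::
    "('a, 'r) ring_scheme \<Rightarrow> 'a set \<Rightarrow> nat \<Rightarrow> ('a, 'd) cochain_complex \<Rightarrow> bool" where
  "normalized_dualizing_complex R m t D \<longleftrightarrow> dualizing_complex R D \<and>
     (\<exists>(E :: ('a, 'd) module) f.
        injective_hull R (quotient_module (ring_module R) m) E \<and>
        quasi_isomorphism R (torsion_complex R m D) (stalk_complex E (int t)) f)"

end

theory Submission
  imports Defs
begin

text \<open>Put \<open>s = t - r\<close>. For an ideal \<open>I\<close> and \<open>a \<in> R\<close>, the elements of a complex of injective modules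
  that are killed by \<open>I + (a)\<close>, by \<open>I\<close>, and by \<open>I : a\<close> form a short exact sequence of complexes.
  Climbing along these sequences from the normalization of \<open>D\<close> at \<open>R/m\<close>, one finds that \<open>D\<close> is exact
  above degree \<open>s\<close> and has a cocycle \<open>z\<close> of degree \<open>s\<close> outside \<open>m Z\<^sup>s + B\<^sup>s\<close>; this takes the place of
  local duality.

  Let \<open>G \<rightarrow> N\<close> and \<open>F \<rightarrow> M\<close> be minimal free resolutions, and let \<open>q\<close> be the length of \<open>G\<close>. Since
  \<open>Tor\<^sub>j(N, R/(x\<^sub>1, \<dots>, x\<^sub>r)) = 0\<close> for \<open>j > r\<close> and a regular sequence of maximal length, \<open>q \<le> r\<close>.
  A basis element of \<open>G\<^sub>q\<close>, a basis element of \<open>F\<^sub>0\<close> and \<open>z\<close> define a cocycle of degree \<open>s + q\<close> in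
  \<open>Hom(G, F \<otimes> D)\<close>. If it were a coboundary, then, since \<open>D\<close> is exact above degree \<open>s\<close>, it would be the
  boundary of a cochain that involves \<open>D\<close> in degrees at most \<open>s\<close> only, and minimality of \<open>G\<close> and \<open>F\<close>
  would yield \<open>z \<in> m Z\<^sup>s + B\<^sup>s\<close>. So \<open>Ext\<close> does not vanish in degree \<open>t - r + q\<close>, and \<open>i \<le> q\<close> is
  impossible.\<close>

section \<open>Modules and ideals\<close>

text \<open>The degree \<open>s + q\<close> is a corner: \<open>D\<close> has no cohomology above
  \<open>s\<close>, the complex \<open>G\<close> ends at \<open>q\<close> and \<open>F\<close>
  starts at \<open>0\<close>, so only Hom(\<open>G\<^sub>q\<close>,
  \<open>F\<^sub>0 \<otimes> H\<^sup>s(D)\<close>) can contribute there, and minimality makes the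
  maps into it vanish modulo \<open>m\<close>. The obstacle is that \<open>Ext\<close> is computed
  with the resolutions chosen by \<open>SOME\<close>, which need not be minimal; the corner is not
  visible in the complex whose cohomology is assumed to vanish. Comparison maps bridge the gap in
  three places: the test cocycle is built on the chosen resolution of \<open>N\<close> through its
  map to \<open>G\<close>; a cochain bounding it is restricted to the images of the basis elements
  of \<open>G\<close>; its values are pushed from the chosen resolution of \<open>M\<close> to
  \<open>F\<close>. About these maps it is enough to know that the composite from \<open>G\<close>
  to itself is the identity modulo \<open>m\<close>, and that some element in degree
  \<open>0\<close> has a coordinate outside \<open>m\<close> in \<open>F\<^sub>0\<close>: the value
  at the corner is then a unit times \<open>z\<close>.\<close>

lemma (in cring) ideal_if_closed:
  assumes "I \<subseteq> carrier R" "\<zero> \<in> I" "\<And>a b. a \<in> I \<Longrightarrow> b \<in> I \<Longrightarrow> a \<oplus> b \<in> I"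
    "\<And>a x. a \<in> I \<Longrightarrow> x \<in> carrier R \<Longrightarrow> x \<otimes> a \<in> I"
  shows "ideal I R"
proof (rule idealI[OF ring_axioms])
  show "subgroup I (add_monoid R)"
  proof (rule add.subgroupI)
    show "I \<noteq> {}" using assms(2) by blast
    fix a assume a: "a \<in> I"
    hence "(\<ominus> \<one>) \<otimes> a \<in> I" by (intro assms(4)) auto
    thus "\<ominus> a \<in> I" using assms(1) a by (simp add: l_minus subset_iff)
  qed (rule assms(1), rule assms(3))
next
  fix a x assume "a \<in> I" "x \<in> carrier R"
  thus "x \<otimes> a \<in> I" "a \<otimes> x \<in> I" using assms(1,4) m_comm[of a x] by auto
qed

text \<open>Only the notation differs from \<open>module\<close>: unsubscripted operations belong to
  \<open>M\<close>, and those of \<open>R\<close> carry a subscript. The record type of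
  \<open>M\<close> is fixed to one without further fields.\<close>

locale pmodule = module R M
  for R :: "('a, 'r) ring_scheme" and M :: "('a, 'm) module" (structure)

lemma mod_hom_closed: "f \<in> mod_hom R M N \<Longrightarrow> x \<in> carrier M \<Longrightarrow> f x \<in> carrier N"
  by (auto simp: mod_hom_def)

lemma mod_hom_add: "f \<in> mod_hom R M N \<Longrightarrow> x \<in> carrier M \<Longrightarrow> y \<in> carrier M \<Longrightarrow> f (x \<oplus>\<^bsub>M\<^esub> y) = f x \<oplus>\<^bsub>N\<^esub> f y"
  by (auto simp: mod_hom_def)

lemma mod_hom_smult: "f \<in> mod_hom R M N \<Longrightarrow> a \<in> carrier R \<Longrightarrow> x \<in> carrier M \<Longrightarrow> f (a \<odot>\<^bsub>M\<^esub> x) = a \<odot>\<^bsub>N\<^esub> f x"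
  by (auto simp: mod_hom_def)

lemma mod_homI:
  assumes "\<And>x. x \<in> carrier M \<Longrightarrow> f x \<in> carrier N"
    and "\<And>x y. x \<in> carrier M \<Longrightarrow> y \<in> carrier M \<Longrightarrow> f (x \<oplus>\<^bsub>M\<^esub> y) = f x \<oplus>\<^bsub>N\<^esub> f y"
    and "\<And>a x. a \<in> carrier R \<Longrightarrow> x \<in> carrier M \<Longrightarrow> f (a \<odot>\<^bsub>M\<^esub> x) = a \<odot>\<^bsub>N\<^esub> f x"
  shows "f \<in> mod_hom R M N"
  using assms by (auto simp: mod_hom_def)

lemma mod_hom_zero:
  assumes "module R M" "module R N" "f \<in> mod_hom R M N"
  shows "f \<zero>\<^bsub>M\<^esub> = \<zero>\<^bsub>N\<^esub>"
proof -
  interpret M: pmodule R M by (rule pmodule.intro) fact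
  interpret N: pmodule R N by (rule pmodule.intro) fact
  have "f (\<zero>\<^bsub>R\<^esub> \<odot>\<^bsub>M\<^esub> \<zero>\<^bsub>M\<^esub>) = \<zero>\<^bsub>R\<^esub> \<odot>\<^bsub>N\<^esub> f \<zero>\<^bsub>M\<^esub>"
    using assms(3) by (intro mod_hom_smult) auto
  thus ?thesis using mod_hom_closed[OF assms(3)] by simp
qed

lemma mod_hom_minus:
  assumes "module R M" "module R N" "f \<in> mod_hom R M N" "x \<in> carrier M"
  shows "f (\<ominus>\<^bsub>M\<^esub> x) = \<ominus>\<^bsub>N\<^esub> f x"
proof -
  interpret M: pmodule R M by (rule pmodule.intro) fact
  interpret N: pmodule R N by (rule pmodule.intro) fact
  have "f (\<ominus>\<^bsub>M\<^esub> x) \<oplus>\<^bsub>N\<^esub> f x = \<zero>\<^bsub>N\<^esub>"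
    using mod_hom_add[OF assms(3), of "\<ominus>\<^bsub>M\<^esub> x" x] mod_hom_zero[OF assms(1-3)] assms(4)
    by (simp add: M.M.l_neg)
  thus ?thesis
    using mod_hom_closed[OF assms(3)] assms(4) N.M.minus_equality by (metis M.M.a_inv_closed)
qed

lemma mod_hom_diff:
  assumes "module R M" "module R N" "f \<in> mod_hom R M N" "x \<in> carrier M" "y \<in> carrier M"
  shows "f (x \<ominus>\<^bsub>M\<^esub> y) = f x \<ominus>\<^bsub>N\<^esub> f y"
proof -
  interpret M: pmodule R M by (rule pmodule.intro) fact
  show ?thesis using assms by (simp add: a_minus_def mod_hom_add mod_hom_minus)
qed

lemma mod_hom_finsum:
  assumes "module R M" "module R N" "f \<in> mod_hom R M N" "g \<in> A \<rightarrow> carrier M"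
  shows "f (\<Oplus>\<^bsub>M\<^esub>i\<in>A. g i) = (\<Oplus>\<^bsub>N\<^esub>i\<in>A. f (g i))"
proof -
  interpret M: pmodule R M by (rule pmodule.intro) fact
  interpret N: pmodule R N by (rule pmodule.intro) fact
  show ?thesis
  proof (cases "finite A")
    case True
    thus ?thesis using assms(4)
    proof (induction A)
      case empty
      show ?case using mod_hom_zero[OF assms(1-3)] by simp
    next
      case (insert a A)
      have 1: "g \<in> A \<rightarrow> carrier M" "g a \<in> carrier M" using insert by auto
      have 2: "(\<lambda>i. f (g i)) \<in> A \<rightarrow> carrier N" "f (g a) \<in> carrier N"
        using 1 mod_hom_closed[OF assms(3)] by auto
      show ?case using insert 1 2
        by (simp add: mod_hom_add[OF assms(3)])
    qed
  next
    case False
    thus ?thesis using mod_hom_zero[OF assms(1-3)] by (simp add: M.M.finsum_infinite N.M.finsum_infinite)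
  qed
qed

lemma mod_hom_compose:
  "f \<in> mod_hom R L M \<Longrightarrow> g \<in> mod_hom R M N \<Longrightarrow> (\<lambda>x. g (f x)) \<in> mod_hom R L N"
  by (auto simp: mod_hom_def Pi_def)

lemma mod_hom_id: "(\<lambda>x. x) \<in> mod_hom R M M"
  by (auto simp: mod_hom_def)

lemma mod_hom_cong:
  assumes "module R M" "f \<in> mod_hom R M N" "\<And>x. x \<in> carrier M \<Longrightarrow> g x = f x"
  shows "g \<in> mod_hom R M N"
proof -
  interpret M: pmodule R M by (rule pmodule.intro) fact
  show ?thesis using assms(2,3) by (auto simp: mod_hom_def Pi_def)
qed

lemma mod_hom_zero_map:
  assumes "module R N"
  shows "(\<lambda>x. \<zero>\<^bsub>N\<^esub>) \<in> mod_hom R M N"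
proof -
  interpret N: pmodule R N by (rule pmodule.intro) fact
  show ?thesis by (auto simp: mod_hom_def)
qed

lemma mod_hom_plus:
  assumes "module R N" "f \<in> mod_hom R M N" "g \<in> mod_hom R M N"
  shows "(\<lambda>x. f x \<oplus>\<^bsub>N\<^esub> g x) \<in> mod_hom R M N"
proof -
  interpret N: pmodule R N by (rule pmodule.intro) fact
  show ?thesis
    using mod_hom_closed[OF assms(2)] mod_hom_closed[OF assms(3)]
    by (intro mod_homI)
       (simp_all add: mod_hom_add[OF assms(2)] mod_hom_add[OF assms(3)] mod_hom_smult[OF assms(2)]
         mod_hom_smult[OF assms(3)] N.smult_r_distr N.M.a_ac)
qed

lemma mod_hom_scale:
  assumes "module R N" "f \<in> mod_hom R M N" "a \<in> carrier R"
  shows "(\<lambda>x. a \<odot>\<^bsub>N\<^esub> f x) \<in> mod_hom R M N"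
proof -
  interpret N: pmodule R N by (rule pmodule.intro) fact
  show ?thesis
    using mod_hom_closed[OF assms(2)] assms(3)
    by (intro mod_homI)
       (simp_all add: mod_hom_add[OF assms(2)] mod_hom_smult[OF assms(2)] N.smult_r_distr
         N.smult_assoc1[symmetric] N.R.m_comm)
qed

lemma mod_hom_uminus:
  assumes "module R N" "f \<in> mod_hom R M N"
  shows "(\<lambda>x. \<ominus>\<^bsub>N\<^esub> f x) \<in> mod_hom R M N"
proof -
  interpret N: pmodule R N by (rule pmodule.intro) fact
  show ?thesis
    using mod_hom_closed[OF assms(2)]
    by (intro mod_homI)
       (simp_all add: mod_hom_add[OF assms(2)] mod_hom_smult[OF assms(2)] N.smult_r_minus N.M.minus_add)
qed

lemma mod_hom_minus_map:
  assumes "module R N" "f \<in> mod_hom R M N" "g \<in> mod_hom R M N"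
  shows "(\<lambda>x. f x \<ominus>\<^bsub>N\<^esub> g x) \<in> mod_hom R M N"
  unfolding a_minus_def by (intro mod_hom_plus mod_hom_uminus assms)

context pmodule
begin

lemma mod_hom_finsum_map:
  assumes "module R N" "finite A" "\<And>i. i \<in> A \<Longrightarrow> f i \<in> mod_hom R N M"
  shows "(\<lambda>x. \<Oplus>i\<in>A. f i x) \<in> mod_hom R N M"
  using assms(2,3)
proof (induction A)
  case empty
  show ?case using mod_hom_zero_map[OF module_axioms] by simp
next
  case (insert a A)
  have "(\<lambda>x. f a x \<oplus> (\<Oplus>i\<in>A. f i x)) \<in> mod_hom R N M"
    by (intro mod_hom_plus insert module_axioms) auto
  thus ?case
    using insert by (elim mod_hom_cong[OF assms(1)], subst finsum_insert)
      (auto simp: Pi_def intro: mod_hom_closed[of _ R N M])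
qed

lemma submodule_zero: "submodule H R M \<Longrightarrow> \<zero> \<in> H"
  by (metis submodule.axioms(1) subgroup.one_closed monoid.simps(2))

lemma submodule_diff: "submodule H R M \<Longrightarrow> x \<in> H \<Longrightarrow> y \<in> H \<Longrightarrow> x \<ominus> y \<in> H"
  by (simp add: a_minus_def submoduleE(3,5))

lemma submoduleI':
  assumes "H \<subseteq> carrier M" "\<zero> \<in> H" "\<And>x y. x \<in> H \<Longrightarrow> y \<in> H \<Longrightarrow> x \<oplus> y \<in> H"
    "\<And>a x. a \<in> carrier R \<Longrightarrow> x \<in> H \<Longrightarrow> a \<odot> x \<in> H"
  shows "submodule H R M"
proof (rule submoduleI)
  fix x assume x: "x \<in> H"
  have "(\<ominus>\<^bsub>R\<^esub> \<one>\<^bsub>R\<^esub>) \<odot> x \<in> H" using assms(4) x by simp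
  thus "\<ominus> x \<in> H" using assms(1) x by (auto simp: smult_l_minus)
qed (use assms in auto)

lemma submodule_finsum:
  assumes "submodule H R M" "f \<in> A \<rightarrow> H"
  shows "(\<Oplus>i\<in>A. f i) \<in> H"
proof (cases "finite A")
  case True
  thus ?thesis using assms(2)
  proof (induction A)
    case (insert a A)
    thus ?case using submoduleE(1,5)[OF assms(1)] by (subst finsum_insert) auto
  qed (simp add: submodule_zero[OF assms(1)])
qed (simp add: finsum_infinite submodule_zero[OF assms(1)])

lemma submodule_Inter:
  assumes "\<And>H. H \<in> C \<Longrightarrow> submodule H R M" "C \<noteq> {}"
  shows "submodule (\<Inter>C) R M"
proof (rule submoduleI')
  show "\<Inter>C \<subseteq> carrier M" using assms submoduleE(1) by blast
  show "\<zero> \<in> \<Inter>C" using assms(1) submodule_zero by simp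
  show "x \<oplus> y \<in> \<Inter>C" if "x \<in> \<Inter>C" "y \<in> \<Inter>C" for x y
    using that submoduleE(5)[OF assms(1)] by simp
  show "a \<odot> x \<in> \<Inter>C" if "a \<in> carrier R" "x \<in> \<Inter>C" for a x
    using that submoduleE(4)[OF assms(1)] by simp
qed

lemma submodule_Int: "submodule H R M \<Longrightarrow> submodule K R M \<Longrightarrow> submodule (H \<inter> K) R M"
  using submodule_Inter[of "{H, K}"] by auto

lemma span_submodule: "S \<subseteq> carrier M \<Longrightarrow> submodule (module_span R M S) R M"
  unfolding module_span_def using carrier_is_submodule by (intro submodule_Inter) auto

lemma span_incl: "S \<subseteq> module_span R M S"
  by (auto simp: module_span_def)

lemma span_minimal: "submodule H R M \<Longrightarrow> S \<subseteq> H \<Longrightarrow> module_span R M S \<subseteq> H"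
  by (auto simp: module_span_def)

lemma span_mono: "S \<subseteq> T \<Longrightarrow> T \<subseteq> carrier M \<Longrightarrow> module_span R M S \<subseteq> module_span R M T"
  by (meson order_trans span_incl span_minimal span_submodule)

lemma span_of_submodule: "submodule H R M \<Longrightarrow> module_span R M H = H"
  by (simp add: span_incl span_minimal subset_antisym)

lemma span_insert:
  assumes "s \<in> carrier M" "S \<subseteq> carrier M"
  shows "module_span R M (insert s S) = {c \<odot> s \<oplus> u | c u. c \<in> carrier R \<and> u \<in> module_span R M S}"
    (is "_ = ?H")
proof
  note sub = span_submodule[OF assms(2)]
  note subD = submoduleE[OF sub] submodule_zero[OF sub]
  show "module_span R M (insert s S) \<subseteq> ?H"
  proof (rule span_minimal)
    show "submodule ?H R M"
    proof (rule submoduleI')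
      show "?H \<subseteq> carrier M" using subD(1) assms by auto
      have "\<zero> = \<zero>\<^bsub>R\<^esub> \<odot> s \<oplus> \<zero>" using assms by simp
      thus "\<zero> \<in> ?H" using subD(7) R.zero_closed by blast
    next
      fix x y assume "x \<in> ?H" "y \<in> ?H"
      then obtain c u c' u' where 1: "c \<in> carrier R" "c' \<in> carrier R" "u \<in> module_span R M S"
          "u' \<in> module_span R M S" "x = c \<odot> s \<oplus> u" "y = c' \<odot> s \<oplus> u'" by auto
      hence "x \<oplus> y = (c \<oplus>\<^bsub>R\<^esub> c') \<odot> s \<oplus> (u \<oplus> u')"
        using subD(1) assms by (simp add: subset_iff smult_l_distr M.a_ac)
      thus "x \<oplus> y \<in> ?H" using 1 subD(5) by blast
    next
      fix a x assume a: "a \<in> carrier R" and "x \<in> ?H"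
      then obtain c u where 1: "c \<in> carrier R" "u \<in> module_span R M S" "x = c \<odot> s \<oplus> u" by auto
      hence "a \<odot> x = (a \<otimes>\<^bsub>R\<^esub> c) \<odot> s \<oplus> a \<odot> u"
        using subD(1) assms a by (simp add: subset_iff smult_r_distr smult_assoc1)
      thus "a \<odot> x \<in> ?H" using 1 a subD(4) by blast
    qed
    show "insert s S \<subseteq> ?H"
    proof
      fix x assume "x \<in> insert s S"
      thus "x \<in> ?H"
      proof
        assume "x = s"
        hence "x = \<one>\<^bsub>R\<^esub> \<odot> s \<oplus> \<zero>" using assms by simp
        thus ?thesis using subD(7) R.one_closed by blast
      next
        assume "x \<in> S"
        hence "x = \<zero>\<^bsub>R\<^esub> \<odot> s \<oplus> x" "x \<in> module_span R M S" using assms span_incl[of S] by auto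
        thus ?thesis using R.zero_closed by blast
      qed
    qed
  qed
  have "submodule (module_span R M (insert s S)) R M" using assms by (intro span_submodule) auto
  note D = submoduleE(4,5)[OF this]
  have "module_span R M S \<subseteq> module_span R M (insert s S)" by (rule span_mono) (use assms in auto)
  moreover have "s \<in> module_span R M (insert s S)" using span_incl by blast
  ultimately show "?H \<subseteq> module_span R M (insert s S)" using D by blast
qed

lemma smult_in_ideal_sub:
  assumes "submodule H R M" "s \<in> carrier M"
  shows "ideal {a \<in> carrier R. a \<odot> s \<in> H} R"
proof (rule R.ideal_if_closed)
  fix a x assume "a \<in> {a \<in> carrier R. a \<odot> s \<in> H}" "x \<in> carrier R"
  hence "x \<odot> (a \<odot> s) \<in> H" "a \<in> carrier R" "x \<in> carrier R" using submoduleE(4)[OF assms(1)] by auto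
  thus "x \<otimes>\<^bsub>R\<^esub> a \<in> {a \<in> carrier R. a \<odot> s \<in> H}"
    using assms(2) by (auto simp: smult_assoc1)
next
  fix a b assume "a \<in> {a \<in> carrier R. a \<odot> s \<in> H}" "b \<in> {a \<in> carrier R. a \<odot> s \<in> H}"
  thus "a \<oplus>\<^bsub>R\<^esub> b \<in> {a \<in> carrier R. a \<odot> s \<in> H}"
    using assms(2) submoduleE(5)[OF assms(1)] by (simp add: smult_l_distr)
qed (use assms(2) submodule_zero[OF assms(1)] in simp_all)

lemma ann_ideal:
  assumes "x \<in> carrier M"
  shows "ideal {a \<in> carrier R. a \<odot> x = \<zero>} R"
proof -
  have "submodule {\<zero>} R M" by (rule submoduleI') auto
  from smult_in_ideal_sub[OF this assms] show ?thesis by simp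
qed

end

section \<open>Noetherian induction, Nakayama's lemma and finitely generated submodules\<close>

context noetherian_local_ring
begin

lemma m_ideal: "ideal m R" by (rule maximalideal.axioms(1)[OF maximal])

lemma m_sub: "a \<in> m \<Longrightarrow> a \<in> carrier R"
  by (rule ideal.Icarr[OF m_ideal])

text \<open>The form in which Noetherian induction is used throughout. Zorn's lemma applies to an
  arbitrary \<open>P\<close>, because a nonempty chain of ideals already contains its union.\<close>

lemma noetherian_maximal:
  assumes "P I" "\<And>I. P I \<Longrightarrow> ideal I R"
  shows "\<exists>J. P J \<and> I \<subseteq> J \<and> (\<forall>K. P K \<longrightarrow> J \<subseteq> K \<longrightarrow> K = J)"
proof -
  define A where "A = {J. P J \<and> I \<subseteq> J}"
  have IA: "I \<in> A" using assms(1) by (simp add: A_def)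
  have "\<exists>J\<in>A. \<forall>X\<in>A. J \<subseteq> X \<longrightarrow> X = J"
  proof (rule subset_Zorn_nonempty)
    show "A \<noteq> {}" using IA by blast
    fix C assume C: "C \<noteq> {}" "subset.chain A C"
    have "A \<subseteq> {I. ideal I R}" using assms(2) by (simp add: A_def subset_iff)
    hence "subset.chain {I. ideal I R} C" using C(2) unfolding pred_on.chain_def by blast
    hence "\<Union>C \<in> C" by (rule ideal_chain_is_trivial[OF C(1)])
    thus "\<Union>C \<in> A" using C(2) unfolding pred_on.chain_def by blast
  qed
  then obtain J where J: "J \<in> A" "\<forall>X\<in>A. J \<subseteq> X \<longrightarrow> X = J" by (elim bexE)
  have "K = J" if "P K" "J \<subseteq> K" for K
  proof -
    have "K \<in> A" using J(1) that unfolding A_def by blast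
    thus ?thesis using J(2) that(2) by simp
  qed
  thus ?thesis using J(1) unfolding A_def by (intro exI[of _ J]) simp
qed

lemma proper_ideal_in_m:
  assumes "ideal I R" "I \<noteq> carrier R"
  shows "I \<subseteq> m"
proof -
  have "\<exists>J. (ideal J R \<and> J \<noteq> carrier R) \<and> I \<subseteq> J \<and> (\<forall>K. ideal K R \<and> K \<noteq> carrier R \<longrightarrow> J \<subseteq> K \<longrightarrow> K = J)"
    by (rule noetherian_maximal) (use assms in simp_all)
  then obtain J where J: "ideal J R" "J \<noteq> carrier R" "I \<subseteq> J"
    "\<forall>K. ideal K R \<and> K \<noteq> carrier R \<longrightarrow> J \<subseteq> K \<longrightarrow> K = J" by (elim exE conjE)
  have "maximalideal J R"
    by (rule maximalidealI) (use J in auto)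
  thus ?thesis using J(3) unique_maximal by simp
qed

lemma one_notin_m: "\<one> \<notin> m"
  using ideal.one_imp_carrier[OF m_ideal] maximalideal.I_notcarr[OF maximal] by auto

lemma unit_if_notin_m:
  assumes "a \<in> carrier R" "a \<notin> m"
  obtains b where "b \<in> carrier R" "b \<otimes> a = \<one>"
proof -
  have "PIdl a = carrier R"
    using proper_ideal_in_m[OF cgenideal_ideal[OF assms(1)]] cgenideal_self[OF assms(1)] assms by auto
  hence "\<one> \<in> PIdl a" by simp
  thus ?thesis using that by (auto simp: cgenideal_def)
qed

lemma one_minus_unit:
  assumes "a \<in> m"
  obtains b where "b \<in> carrier R" "b \<otimes> (\<one> \<ominus> a) = \<one>"
proof -
  have "\<one> \<ominus> a \<notin> m"
  proof
    assume "\<one> \<ominus> a \<in> m"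
    hence "(\<one> \<ominus> a) \<oplus> a \<in> m"
      using assms additive_subgroup.a_closed[OF ideal.axioms(1)[OF m_ideal]] by simp
    moreover have "(\<one> \<ominus> a) \<oplus> a = \<one>" using m_sub[OF assms] by (simp add: a_minus_def a_assoc l_neg)
    ultimately show False using one_notin_m by simp
  qed
  thus ?thesis using unit_if_notin_m[of "\<one> \<ominus> a"] m_sub[OF assms] that by auto
qed

text \<open>Stated relative to a submodule \<open>B\<close>, so that it applies to cocycles modulo
  coboundaries without forming the quotient. The generators in \<open>S\<close> are discarded one
  after the other.\<close>

lemma nakayama:
  assumes "module R M" "finite S" "S \<subseteq> Z" "submodule Z R M" "submodule B R M" "B \<subseteq> Z"
    "Z \<subseteq> module_span R M (S \<union> B)"
    "Z \<subseteq> module_span R M ({a \<odot>\<^bsub>M\<^esub> z | a z. a \<in> m \<and> z \<in> Z} \<union> B)"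
  shows "Z = B"
proof -
  interpret M: pmodule R M by (rule pmodule.intro) fact
  have Zc: "Z \<subseteq> carrier M" using M.submoduleE(1) assms by auto
  show ?thesis
    using assms(2,3,7)
  proof (induction S)
    case empty
    thus ?case using M.span_of_submodule assms(5,6) by auto
  next
    case (insert s S)
    let ?T = "module_span R M (S \<union> B)"
    have c: "S \<union> B \<subseteq> carrier M" "s \<in> carrier M" using insert Zc assms(6) by auto
    note T = M.span_submodule[OF c(1)]
    let ?H = "{a \<odot>\<^bsub>M\<^esub> s \<oplus>\<^bsub>M\<^esub> u | a u. a \<in> m \<and> u \<in> ?T}"
    have T0: "\<zero>\<^bsub>M\<^esub> \<in> ?T" using M.submodule_zero T by blast
    note TD = M.submoduleE[OF T]
    note mD = additive_subgroup.a_closed[OF ideal.axioms(1)[OF m_ideal]]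
      additive_subgroup.zero_closed[OF ideal.axioms(1)[OF m_ideal]] ideal.I_l_closed[OF m_ideal]
      ideal.I_r_closed[OF m_ideal]
    have eq: "module_span R M (insert s S \<union> B) = {c \<odot>\<^bsub>M\<^esub> s \<oplus>\<^bsub>M\<^esub> u | c u. c \<in> carrier R \<and> u \<in> ?T}"
      using M.span_insert[OF c(2,1)] by simp
    have "submodule ?H R M"
    proof (rule M.submoduleI')
      show "?H \<subseteq> carrier M" using TD(1) c m_sub by auto
      have "\<zero>\<^bsub>M\<^esub> = \<zero> \<odot>\<^bsub>M\<^esub> s \<oplus>\<^bsub>M\<^esub> \<zero>\<^bsub>M\<^esub>" using c by simp
      thus "\<zero>\<^bsub>M\<^esub> \<in> ?H" using T0 mD(2) by blast
    next
      fix x y assume "x \<in> ?H" "y \<in> ?H"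
      then obtain c0 u c' u' where 1: "c0 \<in> m" "c' \<in> m" "u \<in> ?T"
          "u' \<in> ?T" "x = c0 \<odot>\<^bsub>M\<^esub> s \<oplus>\<^bsub>M\<^esub> u" "y = c' \<odot>\<^bsub>M\<^esub> s \<oplus>\<^bsub>M\<^esub> u'" by auto
      hence "x \<oplus>\<^bsub>M\<^esub> y = (c0 \<oplus> c') \<odot>\<^bsub>M\<^esub> s \<oplus>\<^bsub>M\<^esub> (u \<oplus>\<^bsub>M\<^esub> u')"
        using TD(1) c m_sub by (simp add: subset_iff M.smult_l_distr M.M.a_ac)
      thus "x \<oplus>\<^bsub>M\<^esub> y \<in> ?H" using 1 TD(5) mD by blast
    next
      fix a x assume a: "a \<in> carrier R" and "x \<in> ?H"
      then obtain c0 u where 1: "c0 \<in> m" "u \<in> ?T" "x = c0 \<odot>\<^bsub>M\<^esub> s \<oplus>\<^bsub>M\<^esub> u" by auto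
      hence "a \<odot>\<^bsub>M\<^esub> x = (a \<otimes> c0) \<odot>\<^bsub>M\<^esub> s \<oplus>\<^bsub>M\<^esub> a \<odot>\<^bsub>M\<^esub> u"
        using TD(1) c m_sub a by (simp add: subset_iff M.smult_r_distr M.smult_assoc1)
      thus "a \<odot>\<^bsub>M\<^esub> x \<in> ?H" using 1 a TD(4) mD by blast
    qed
    moreover have "{a \<odot>\<^bsub>M\<^esub> z | a z. a \<in> m \<and> z \<in> Z} \<union> B \<subseteq> ?H"
    proof (intro Un_least subsetI)
      fix x assume "x \<in> {a \<odot>\<^bsub>M\<^esub> z | a z. a \<in> m \<and> z \<in> Z}"
      then obtain a z where 1: "a \<in> m" "z \<in> Z" "x = a \<odot>\<^bsub>M\<^esub> z" by auto
      then obtain c0 u where 2: "c0 \<in> carrier R" "u \<in> ?T" "z = c0 \<odot>\<^bsub>M\<^esub> s \<oplus>\<^bsub>M\<^esub> u"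
        using insert.prems eq by blast
      have "x = (a \<otimes> c0) \<odot>\<^bsub>M\<^esub> s \<oplus>\<^bsub>M\<^esub> a \<odot>\<^bsub>M\<^esub> u"
        using 1 2 TD(1) c m_sub by (simp add: subset_iff M.smult_r_distr M.smult_assoc1)
      moreover have "a \<otimes> c0 \<in> m" "a \<odot>\<^bsub>M\<^esub> u \<in> ?T" using 1 2 TD(4) mD(4) m_sub by simp_all
      ultimately show "x \<in> ?H" by blast
    next
      fix x assume "x \<in> B"
      hence "x \<in> ?T" "x \<in> carrier M" using M.span_incl c by blast+
      hence "x = \<zero> \<odot>\<^bsub>M\<^esub> s \<oplus>\<^bsub>M\<^esub> x" "x \<in> ?T" using c by auto
      thus "x \<in> ?H" using mD(2) by blast
    qed
    ultimately have "Z \<subseteq> ?H" using assms(8) M.span_minimal by blast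
    then obtain a u where 1: "a \<in> m" "u \<in> ?T" "s = a \<odot>\<^bsub>M\<^esub> s \<oplus>\<^bsub>M\<^esub> u" using insert.prems by blast
    obtain b where b: "b \<in> carrier R" "b \<otimes> (\<one> \<ominus> a) = \<one>" using one_minus_unit[OF 1(1)] by blast
    have uc: "u \<in> carrier M" "a \<in> carrier R" using 1 TD(1) m_sub by auto
    have "(\<one> \<ominus> a) \<odot>\<^bsub>M\<^esub> s = s \<ominus>\<^bsub>M\<^esub> a \<odot>\<^bsub>M\<^esub> s"
      using uc c by (simp add: a_minus_def M.smult_l_distr M.smult_l_minus)
    also have "\<dots> = (a \<odot>\<^bsub>M\<^esub> s \<oplus>\<^bsub>M\<^esub> u) \<ominus>\<^bsub>M\<^esub> a \<odot>\<^bsub>M\<^esub> s" using 1(3) by simp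
    also have "\<dots> = u" using uc c by (simp add: a_minus_def M.M.a_ac M.M.r_neg M.M.r_neg1 M.M.r_neg2)
    finally have "b \<odot>\<^bsub>M\<^esub> ((\<one> \<ominus> a) \<odot>\<^bsub>M\<^esub> s) = b \<odot>\<^bsub>M\<^esub> u" by simp
    hence "s = b \<odot>\<^bsub>M\<^esub> u" using b uc c by (simp add: M.smult_assoc1[symmetric])
    hence "s \<in> ?T" using TD(4) b 1 by simp
    hence "module_span R M (insert s S \<union> B) \<subseteq> ?T"
      using M.span_minimal[OF T] M.span_incl[of "S \<union> B"] by auto
    thus ?case using insert by auto
  qed
qed

text \<open>Induction on the generators, again relative to \<open>B\<close>: \<open>U\<close> is
  controlled by its intersection with the span \<open>V\<close> of the remaining generators and
  \<open>B\<close>, and by an ideal of coefficients of \<open>s\<close>.\<close>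

lemma noetherian_submodule:
  assumes "module R M" "finite S" "S \<subseteq> carrier M" "submodule B R M" "submodule U R M" "B \<subseteq> U"
    "U \<subseteq> module_span R M (S \<union> B)"
  shows "\<exists>T\<subseteq>U. finite T \<and> U \<subseteq> module_span R M (T \<union> B)"
proof -
  interpret M: pmodule R M by (rule pmodule.intro) fact
  have Bc: "B \<subseteq> carrier M" using M.submoduleE(1) assms by auto
  show ?thesis
    using assms(2,3,5,6,7)
  proof (induction S arbitrary: U)
    case empty
    thus ?case by (intro exI[of _ "{}"]) auto
  next
    case (insert s S)
    let ?V = "module_span R M (S \<union> B)"
    have c: "S \<union> B \<subseteq> carrier M" "s \<in> carrier M" using insert Bc by auto
    note V = M.span_submodule[OF c(1)]
    note VD = M.submoduleE[OF V] and V0 = M.submodule_zero[OF V]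
    note UD = M.submoduleE[OF insert.prems(2)]
    have eq: "module_span R M (insert s S \<union> B) = {c \<odot>\<^bsub>M\<^esub> s \<oplus>\<^bsub>M\<^esub> u | c u. c \<in> carrier R \<and> u \<in> ?V}"
      using M.span_insert[OF c(2,1)] by simp
    have "submodule (U \<inter> ?V) R M" using M.submodule_Int V insert.prems by auto
    moreover have "B \<subseteq> U \<inter> ?V" using insert.prems M.span_incl[of "S \<union> B"] by auto
    ultimately obtain T where T: "T \<subseteq> U \<inter> ?V" "finite T" "U \<inter> ?V \<subseteq> module_span R M (T \<union> B)"
      using insert.IH[of "U \<inter> ?V"] insert.prems by auto
    \<comment> \<open>\<open>J W\<close> consists of the coefficients at \<open>s\<close> of the
      elements of \<open>W\<close> written modulo \<open>V\<close>. Generators of \<open>J U\<close>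
      are realised by elements of \<open>U\<close>; an element of \<open>U\<close> minus a
      combination of these with the same coefficient at \<open>s\<close> lies in
      \<open>U \<inter> V\<close>.\<close>
    define J where "J W = {a \<in> carrier R. \<exists>u\<in>?V. a \<odot>\<^bsub>M\<^esub> s \<oplus>\<^bsub>M\<^esub> u \<in> W}" for W
    have J: "ideal (J W) R" if W: "submodule W R M" for W
    proof -
      note WD = M.submoduleE[OF W] and W0 = M.submodule_zero[OF W]
      have smul: "x \<otimes> a \<in> J W" if ax: "a \<in> J W" "x \<in> carrier R" for a x
      proof -
        obtain u where u: "u \<in> ?V" "a \<odot>\<^bsub>M\<^esub> s \<oplus>\<^bsub>M\<^esub> u \<in> W" "a \<in> carrier R"
          using ax unfolding J_def by blast
        hence "x \<odot>\<^bsub>M\<^esub> (a \<odot>\<^bsub>M\<^esub> s \<oplus>\<^bsub>M\<^esub> u) \<in> W" "x \<odot>\<^bsub>M\<^esub> u \<in> ?V" using VD WD that by auto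
        moreover have "x \<odot>\<^bsub>M\<^esub> (a \<odot>\<^bsub>M\<^esub> s \<oplus>\<^bsub>M\<^esub> u) = (x \<otimes> a) \<odot>\<^bsub>M\<^esub> s \<oplus>\<^bsub>M\<^esub> x \<odot>\<^bsub>M\<^esub> u"
          using u that VD c by (simp add: subset_iff M.smult_r_distr M.smult_assoc1)
        ultimately show ?thesis using u that unfolding J_def by auto
      qed
      have addJ: "a \<oplus> b \<in> J W" if ab: "a \<in> J W" "b \<in> J W" for a b
      proof -
        obtain u v where u: "u \<in> ?V" "a \<odot>\<^bsub>M\<^esub> s \<oplus>\<^bsub>M\<^esub> u \<in> W" "a \<in> carrier R"
          "v \<in> ?V" "b \<odot>\<^bsub>M\<^esub> s \<oplus>\<^bsub>M\<^esub> v \<in> W" "b \<in> carrier R" using ab unfolding J_def by blast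
        hence "(a \<odot>\<^bsub>M\<^esub> s \<oplus>\<^bsub>M\<^esub> u) \<oplus>\<^bsub>M\<^esub> (b \<odot>\<^bsub>M\<^esub> s \<oplus>\<^bsub>M\<^esub> v) \<in> W" "u \<oplus>\<^bsub>M\<^esub> v \<in> ?V" using VD WD by auto
        moreover have "(a \<odot>\<^bsub>M\<^esub> s \<oplus>\<^bsub>M\<^esub> u) \<oplus>\<^bsub>M\<^esub> (b \<odot>\<^bsub>M\<^esub> s \<oplus>\<^bsub>M\<^esub> v) = (a \<oplus> b) \<odot>\<^bsub>M\<^esub> s \<oplus>\<^bsub>M\<^esub> (u \<oplus>\<^bsub>M\<^esub> v)"
          using u that VD c by (simp add: subset_iff M.smult_l_distr M.M.a_ac)
        ultimately show ?thesis using u unfolding J_def by auto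
      qed
      have zeroJ: "\<zero> \<in> J W" unfolding J_def using V0 W0 c by simp (metis M.M.l_zero M.M.zero_closed)
      have Jc: "J W \<subseteq> carrier R" by (auto simp: J_def)
      show ?thesis by (rule ideal_if_closed[OF Jc zeroJ addJ smul])
    qed
    obtain A where A: "A \<subseteq> carrier R" "finite A" "J U = Idl A"
      using finetely_gen[OF J[OF insert.prems(2)]] by blast
    have "\<forall>a\<in>A. \<exists>u\<in>?V. a \<odot>\<^bsub>M\<^esub> s \<oplus>\<^bsub>M\<^esub> u \<in> U"
      using A genideal_self[OF A(1)] by (auto simp: J_def)
    then obtain g where g: "\<And>a. a \<in> A \<Longrightarrow> g a \<in> ?V \<and> a \<odot>\<^bsub>M\<^esub> s \<oplus>\<^bsub>M\<^esub> g a \<in> U" by metis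
    let ?Q = "(\<lambda>a. a \<odot>\<^bsub>M\<^esub> s \<oplus>\<^bsub>M\<^esub> g a) ` A"
    have Q: "?Q \<subseteq> U" using g by auto
    have Qc: "?Q \<subseteq> carrier M" using Q UD by auto
    have "A \<subseteq> J (module_span R M ?Q)" using A g M.span_incl[of ?Q] unfolding J_def by blast
    hence JU: "J U \<subseteq> J (module_span R M ?Q)"
      unfolding A(3) by (rule genideal_minimal[OF J[OF M.span_submodule[OF Qc]]])
    have QU: "module_span R M ?Q \<subseteq> U" using M.span_minimal Q insert.prems by auto
    have TQ: "T \<union> ?Q \<union> B \<subseteq> carrier M" using T UD Qc Bc by auto
    have "U \<subseteq> module_span R M (T \<union> ?Q \<union> B)"
    proof
      fix y assume y: "y \<in> U"
      then obtain c0 u where 1: "c0 \<in> carrier R" "u \<in> ?V" "y = c0 \<odot>\<^bsub>M\<^esub> s \<oplus>\<^bsub>M\<^esub> u"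
        using insert.prems eq by blast
      hence "c0 \<in> J U" using y by (auto simp: J_def)
      then obtain v where v: "v \<in> ?V" "c0 \<odot>\<^bsub>M\<^esub> s \<oplus>\<^bsub>M\<^esub> v \<in> module_span R M ?Q"
        using JU by (auto simp: J_def)
      let ?w = "c0 \<odot>\<^bsub>M\<^esub> s \<oplus>\<^bsub>M\<^esub> v"
      have uv: "u \<in> carrier M" "v \<in> carrier M" using 1 v VD by auto
      have "y \<ominus>\<^bsub>M\<^esub> ?w = u \<ominus>\<^bsub>M\<^esub> v"
        using 1 uv c by (simp add: a_minus_def M.M.a_ac M.M.r_neg M.M.r_neg1 M.M.r_neg2 M.M.minus_add)
      moreover have "u \<ominus>\<^bsub>M\<^esub> v \<in> ?V" using M.submodule_diff V 1 v by auto
      moreover have "y \<ominus>\<^bsub>M\<^esub> ?w \<in> U" using M.submodule_diff insert.prems y v QU by auto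
      ultimately have "y \<ominus>\<^bsub>M\<^esub> ?w \<in> module_span R M (T \<union> B)" using T by auto
      hence 2: "y \<ominus>\<^bsub>M\<^esub> ?w \<in> module_span R M (T \<union> ?Q \<union> B)"
        using M.span_mono[of "T \<union> B" "T \<union> ?Q \<union> B"] TQ by blast
      have 3: "?w \<in> module_span R M (T \<union> ?Q \<union> B)"
        using M.span_mono[of "?Q" "T \<union> ?Q \<union> B"] TQ v by blast
      have "(y \<ominus>\<^bsub>M\<^esub> ?w) \<oplus>\<^bsub>M\<^esub> ?w = y" using 1 uv c
        by (simp add: a_minus_def M.M.a_ac M.M.r_neg M.M.r_neg1 M.M.r_neg2 M.M.minus_add)
      thus "y \<in> module_span R M (T \<union> ?Q \<union> B)"
        using M.submoduleE(5)[OF M.span_submodule[OF TQ] 2 3] by simp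
    qed
    thus ?case using T Q A by (intro exI[of _ "T \<union> ?Q"]) auto
  qed
qed

end

section \<open>Colon ideals, prime ideals and powers of an ideal\<close>

definition colon :: "('a, 'r) ring_scheme \<Rightarrow> 'a set \<Rightarrow> 'a \<Rightarrow> 'a set" where
  "colon R I x = {a \<in> carrier R. a \<otimes>\<^bsub>R\<^esub> x \<in> I}"

lemma (in cring) colon_ideal:
  assumes "ideal I R" "x \<in> carrier R"
  shows "ideal (colon R I x) R"
proof (rule ideal_if_closed)
  note I = additive_subgroup.a_closed[OF ideal.axioms(1)[OF assms(1)]]
    additive_subgroup.zero_closed[OF ideal.axioms(1)[OF assms(1)]] ideal.I_l_closed[OF assms(1)]
  show "colon R I x \<subseteq> carrier R" "\<zero> \<in> colon R I x"
    using assms(2) I(2) by (auto simp: colon_def)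
  show "a \<oplus> b \<in> colon R I x" if "a \<in> colon R I x" "b \<in> colon R I x" for a b
    using that assms(2) I(1) by (auto simp: colon_def l_distr)
  show "y \<otimes> a \<in> colon R I x" if "a \<in> colon R I x" "y \<in> carrier R" for a y
    using that assms(2) I(3) by (auto simp: colon_def m_assoc)
qed

lemma (in cring) colon_superset:
  assumes "ideal I R" "x \<in> carrier R"
  shows "I \<subseteq> colon R I x"
  using assms ideal.Icarr[OF assms(1)] ideal.I_r_closed[OF assms(1)] by (auto simp: colon_def)

text \<open>Otherwise a product of elements of the \<open>Q\<close> outside \<open>P\<close> lies in
  every \<open>Q\<close> but not in \<open>P\<close>. The intersection is taken inside
  \<open>carrier R\<close>, which gives the whole ring for empty \<open>F\<close>.\<close>

lemma (in cring) prime_contains_Inter: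
  assumes "primeideal P R" "finite F" "\<And>Q. Q \<in> F \<Longrightarrow> ideal Q R"
    "{x \<in> carrier R. \<forall>Q\<in>F. x \<in> Q} \<subseteq> P"
  shows "\<exists>Q\<in>F. Q \<subseteq> P"
proof (rule ccontr)
  assume no: "\<not> (\<exists>Q\<in>F. Q \<subseteq> P)"
  have "\<exists>x \<in> carrier R - P. \<forall>Q\<in>F. x \<in> Q" using assms(2,3) no
  proof (induction F)
    case empty
    have "\<one> \<notin> P"
      using primeideal.I_notcarr[OF assms(1)] ideal.one_imp_carrier[OF primeideal.axioms(1)[OF assms(1)]]
      by auto
    thus ?case by auto
  next
    case (insert Q F)
    then obtain x where x: "x \<in> carrier R" "x \<notin> P" "\<forall>Q\<in>F. x \<in> Q" by auto
    obtain y where y: "y \<in> Q" "y \<notin> P" using insert by auto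
    have yc: "y \<in> carrier R" using insert.prems(1)[of Q] y(1) ideal.Icarr by fastforce
    have "x \<otimes> y \<notin> P" using primeideal.I_prime[OF assms(1) x(1) yc] x y by auto
    moreover have "x \<otimes> y \<in> Q" using ideal.I_l_closed[of Q R y x] insert.prems(1) y x by simp
    moreover have "x \<otimes> y \<in> Q'" if "Q' \<in> F" for Q'
      using ideal.I_r_closed[of Q' R x y] insert.prems(1)[of Q'] that x yc by simp
    ultimately show ?case using x yc by (intro bexI[of _ "x \<otimes> y"]) auto
  qed
  thus False using assms(4) by auto
qed

lemma (in cring) prime_avoidance:
  assumes "finite F" "\<And>P. P \<in> F \<Longrightarrow> primeideal P R" "\<And>P Q. P \<in> F \<Longrightarrow> Q \<in> F \<Longrightarrow> P \<subseteq> Q \<Longrightarrow> P = Q"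
    "ideal J R" "\<And>P. P \<in> F \<Longrightarrow> \<not> J \<subseteq> P"
  shows "\<exists>z\<in>J. \<forall>P\<in>F. z \<notin> P"
  using assms(1-3,5)
proof (induction F)
  case empty
  thus ?case using additive_subgroup.zero_closed[OF ideal.axioms(1)[OF assms(4)]] by auto
next
  case (insert P F)
  have "\<exists>z\<in>J. \<forall>P\<in>F. z \<notin> P" by (rule insert.IH) (use insert.prems in auto)
  then obtain z where z: "z \<in> J" "\<forall>P\<in>F. z \<notin> P" by auto
  show ?case
  proof (cases "z \<in> P")
    case False
    thus ?thesis using z by auto
  next
    case True
    have pr: "primeideal P R" using insert.prems by auto
    \<comment> \<open>As the primes are pairwise incomparable, neither \<open>J\<close> nor any
      \<open>Q\<close> in \<open>F\<close> lies in \<open>P\<close>, so some \<open>w\<close> in all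
      of them is outside \<open>P\<close>. Then \<open>z \<oplus> w\<close> avoids \<open>P\<close>,
      and modulo each \<open>Q\<close> in \<open>F\<close> it is still \<open>z\<close>.\<close>
    have "\<not> {x \<in> carrier R. \<forall>Q\<in>insert J F. x \<in> Q} \<subseteq> P"
    proof
      assume "{x \<in> carrier R. \<forall>Q\<in>insert J F. x \<in> Q} \<subseteq> P"
      hence "\<exists>Q\<in>insert J F. Q \<subseteq> P"
        using insert.hyps(1) assms(4) insert.prems(1) primeideal.axioms(1)
        by (intro prime_contains_Inter[OF pr]) auto
      then obtain Q where "Q \<in> insert J F" "Q \<subseteq> P" by auto
      thus False using insert.prems insert.hyps by (metis insert_iff)
    qed
    then obtain w where w: "w \<in> carrier R" "w \<in> J" "\<forall>Q\<in>F. w \<in> Q" "w \<notin> P" by auto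
    have zc: "z \<in> carrier R" using ideal.Icarr[OF assms(4) z(1)] .
    have canc: "b \<in> Q" if "ideal Q R" "a \<in> Q" "a \<oplus> b \<in> Q" "b \<in> carrier R" for Q a b
    proof -
      have "\<ominus> a \<in> Q" using additive_subgroup.a_inv_closed[OF ideal.axioms(1)[OF that(1)] that(2)] .
      hence "\<ominus> a \<oplus> (a \<oplus> b) \<in> Q" using additive_subgroup.a_closed[OF ideal.axioms(1)[OF that(1)]] that by auto
      thus ?thesis using ideal.Icarr[OF that(1,2)] that(4) by (simp add: r_neg1)
    qed
    have "z \<oplus> w \<notin> P" using canc[of P z w] primeideal.axioms(1)[OF pr] True w by auto
    moreover have "z \<oplus> w \<notin> Q" if "Q \<in> F" for Q
      using canc[of Q w z] primeideal.axioms(1)[of Q R] insert.prems(1)[of Q] that w z zc a_comm[of z w] by auto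
    moreover have "z \<oplus> w \<in> J" using additive_subgroup.a_closed[OF ideal.axioms(1)[OF assms(4)]] z w by auto
    ultimately show ?thesis by (intro bexI[of _ "z \<oplus> w"]) auto
  qed
qed

lemma (in cring) ideal_power_ideal: "ideal I R \<Longrightarrow> ideal (ideal_power R I n) R"
  by (induction n) (auto simp: oneideal ideal_prod_is_ideal)

lemma (in cring) ideal_power_add:
  "ideal I R \<Longrightarrow> ideal_power R I (k + l) = ideal_prod R (ideal_power R I k) (ideal_power R I l)"
proof (induction l)
  case 0
  thus ?case using ideal_prod_one[OF ideal_power_ideal[of I k]] by simp
next
  case (Suc l)
  thus ?case
    using ideal_prod_assoc[OF ideal_power_ideal[of I k] ideal_power_ideal[of I l], of I] by simp
qed

lemma (in cring) ideal_power_1: "ideal I R \<Longrightarrow> ideal_power R I (Suc 0) = I"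
  using ideal_prod_one ideal_prod_commute[OF oneideal] by simp

lemma (in cring) power_in_ideal_power:
  "ideal I R \<Longrightarrow> a \<in> I \<Longrightarrow> a [^] n \<in> ideal_power R I n"
proof (induction n)
  case 0
  show ?case by simp
next
  case (Suc n)
  thus ?case by (auto intro: ideal_prod.prod)
qed

lemma (in cring) ideal_prod_subset:
  assumes "ideal V R" "\<And>i j. i \<in> I \<Longrightarrow> j \<in> J \<Longrightarrow> i \<otimes> j \<in> V"
  shows "ideal_prod R I J \<subseteq> V"
proof
  fix x assume "x \<in> ideal_prod R I J"
  thus "x \<in> V"
    by induction (use assms additive_subgroup.a_closed[OF ideal.axioms(1)[OF assms(1)]] in auto)
qed

lemma (in cring) ideal_power_antimono:
  assumes "ideal I R" "k \<le> l"
  shows "ideal_power R I l \<subseteq> ideal_power R I k"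
proof -
  obtain d where d: "l = k + d" using assms(2) le_Suc_ex by blast
  show ?thesis unfolding d ideal_power_add[OF assms(1)]
    using ideal_prod_inter[OF ideal_power_ideal[OF assms(1)] ideal_power_ideal[OF assms(1)]] by blast
qed

section \<open>Zero divisors, powers of the maximal ideal, maximal regular sequences\<close>

context noetherian_local_ring
begin

text \<open>A maximal annihilator \<open>I : y\<close> is prime. There are only finitely many of these, so if they cover
  \<open>m\<close>, one of them contains it.\<close>

lemma socle_element:
  assumes I: "ideal I R" and zd: "\<And>x. x \<in> m \<Longrightarrow> \<exists>y \<in> carrier R - I. x \<otimes> y \<in> I"
  shows "\<exists>y \<in> carrier R - I. \<forall>a\<in>m. a \<otimes> y \<in> I"
proof -
  define As where "As = {P. (\<exists>y\<in>carrier R - I. P = colon R I y) \<and>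
    (\<forall>K. (\<exists>y\<in>carrier R - I. K = colon R I y) \<longrightarrow> P \<subseteq> K \<longrightarrow> K = P)}"
  have cov: "\<exists>P\<in>As. x \<in> P" if x: "x \<in> m" for x
  proof -
    obtain y where y: "y \<in> carrier R - I" "x \<otimes> y \<in> I" using zd[OF x] by blast
    have "\<exists>P. (\<exists>y\<in>carrier R - I. P = colon R I y) \<and> colon R I y \<subseteq> P \<and>
      (\<forall>K. (\<exists>y\<in>carrier R - I. K = colon R I y) \<longrightarrow> P \<subseteq> K \<longrightarrow> K = P)"
    proof (rule noetherian_maximal)
      show "\<exists>z\<in>carrier R - I. colon R I y = colon R I z" using y by blast
      show "ideal K R" if "\<exists>y\<in>carrier R - I. K = colon R I y" for K
        using that colon_ideal[OF I] by blast
    qed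
    then obtain P where "P \<in> As" "colon R I y \<subseteq> P" unfolding As_def by blast
    thus ?thesis using y m_sub[OF x] by (auto simp: colon_def)
  qed
  have max_eq: "P = Q" if "P \<in> As" "Q \<in> As" "P \<subseteq> Q" for P Q
    using that unfolding As_def by (elim CollectE conjE) metis
  have id: "ideal P R" if "P \<in> As" for P using that colon_ideal[OF I] by (auto simp: As_def)
  have prime: "primeideal P R" if P: "P \<in> As" for P
  proof -
    obtain y where y: "y \<in> carrier R" "y \<notin> I" "P = colon R I y" using P by (auto simp: As_def)
    have mx: "K = P" if "z \<in> carrier R - I" "K = colon R I z" "P \<subseteq> K" for K z
      using P that by (auto simp: As_def)
    show ?thesis
    proof (rule primeidealI[OF id[OF P] is_cring])
      have "\<one> \<notin> P" using y by (auto simp: colon_def)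
      thus "carrier R \<noteq> P" by auto
      fix a b assume ab: "a \<in> carrier R" "b \<in> carrier R" "a \<otimes> b \<in> P"
      show "a \<in> P \<or> b \<in> P"
      proof (cases "b \<in> P")
        case False
        hence bI: "b \<otimes> y \<in> carrier R - I" using ab y by (auto simp: colon_def)
        have "P \<subseteq> colon R I (b \<otimes> y)"
        proof
          fix c assume c: "c \<in> P"
          hence "c \<in> carrier R" "b \<otimes> (c \<otimes> y) \<in> I"
            using y ab ideal.I_l_closed[OF I] by (auto simp: colon_def)
          thus "c \<in> colon R I (b \<otimes> y)" using ab y m_lcomm[of b c y] by (simp add: colon_def)
        qed
        hence "colon R I (b \<otimes> y) = P" using mx[OF bI] by simp
        moreover have "a \<in> colon R I (b \<otimes> y)" using ab y by (auto simp: colon_def m_assoc)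
        ultimately show ?thesis by simp
      qed simp
    qed
  qed
  have "\<forall>P\<in>As. \<exists>y. y \<in> carrier R - I \<and> P = colon R I y" by (auto simp: As_def)
  then obtain g where g: "\<And>P. P \<in> As \<Longrightarrow> g P \<in> carrier R - I \<and> P = colon R I (g P)" by metis
  \<comment> \<open>Finiteness of \<open>As\<close>: choose a finite \<open>F\<close> such that the
    ideal generated by the \<open>g Q\<close> with \<open>Q\<close> in \<open>F\<close> is maximal.
    It then contains every \<open>g P\<close>, so whatever multiplies all these \<open>g Q\<close>
    into \<open>I\<close> does the same to \<open>g P\<close>. Hence \<open>P\<close> contains the
    intersection of \<open>F\<close>, thus some member of \<open>F\<close>, and equals it.\<close>
  have "\<exists>J. (\<exists>F\<subseteq>As. finite F \<and> J = Idl (g ` F)) \<and> Idl (g ` {}) \<subseteq> J \<and>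
    (\<forall>K. (\<exists>F\<subseteq>As. finite F \<and> K = Idl (g ` F)) \<longrightarrow> J \<subseteq> K \<longrightarrow> K = J)"
  proof (rule noetherian_maximal)
    show "\<exists>F\<subseteq>As. finite F \<and> Idl (g ` {}) = Idl (g ` F)" by (intro exI[of _ "{}"]) simp
    show "ideal K R" if "\<exists>F\<subseteq>As. finite F \<and> K = Idl (g ` F)" for K
      using that g by (auto intro!: genideal_ideal)
  qed
  then obtain J F where F: "F \<subseteq> As" "finite F" "J = Idl (g ` F)"
    and J: "\<forall>K. (\<exists>F\<subseteq>As. finite F \<and> K = Idl (g ` F)) \<longrightarrow> J \<subseteq> K \<longrightarrow> K = J"
    by (elim exE conjE)
  have mx: "Idl (g ` G) = Idl (g ` F)" if "G \<subseteq> As" "finite G" "Idl (g ` F) \<subseteq> Idl (g ` G)" for G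
    using J[THEN spec, of "Idl (g ` G)"] that F(3) by blast
  have gc: "g ` G \<subseteq> carrier R" if "G \<subseteq> As" for G using that g by auto
  have AF: "P \<in> F" if P: "P \<in> As" for P
  proof -
    have "Idl (g ` F) \<subseteq> Idl (g ` insert P F)"
      using subset_Idl_subset[of "g ` insert P F" "g ` F"] gc[of "insert P F"] P F by auto
    hence "Idl (g ` insert P F) = Idl (g ` F)" using mx[of "insert P F"] P F by auto
    hence gP: "g P \<in> Idl (g ` F)" using genideal_self[OF gc[of "insert P F"]] P F by auto
    have "\<exists>Q\<in>F. Q \<subseteq> P"
    proof (rule prime_contains_Inter[OF prime[OF P] F(2)])
      show "ideal Q R" if "Q \<in> F" for Q using that id F by auto
      show "{x \<in> carrier R. \<forall>Q\<in>F. x \<in> Q} \<subseteq> P"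
      proof
        fix x assume x: "x \<in> {x \<in> carrier R. \<forall>Q\<in>F. x \<in> Q}"
        hence xc: "x \<in> carrier R" by simp
        have "g ` F \<subseteq> colon R I x"
        proof
          fix u assume "u \<in> g ` F"
          then obtain Q where Q: "Q \<in> F" "u = g Q" by blast
          hence "x \<in> colon R I (g Q)" "g Q \<in> carrier R" using x g[of Q] F by auto
          thus "u \<in> colon R I x" using Q xc by (auto simp: colon_def m_comm)
        qed
        hence "Idl (g ` F) \<subseteq> colon R I x" by (rule genideal_minimal[OF colon_ideal[OF I xc]])
        hence "g P \<otimes> x \<in> I" using gP by (auto simp: colon_def)
        hence "x \<in> colon R I (g P)" using xc g[OF P] by (auto simp: colon_def m_comm)
        thus "x \<in> P" using g[OF P] by simp
      qed
    qed
    then obtain Q where Q: "Q \<in> F" "Q \<subseteq> P" by blast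
    hence "P = Q" using max_eq[of Q P] P F by auto
    thus ?thesis using Q by simp
  qed
  have "\<exists>P\<in>As. m \<subseteq> P"
  proof (rule ccontr)
    assume no: "\<not> (\<exists>P\<in>As. m \<subseteq> P)"
    have "\<exists>z\<in>m. \<forall>P\<in>As. z \<notin> P"
    proof (rule prime_avoidance[OF _ prime _ m_ideal])
      show "finite As" using F AF by (metis finite_subset subsetI)
      show "P = Q" if "P \<in> As" "Q \<in> As" "P \<subseteq> Q" for P Q
        by (rule max_eq[OF that])
      show "\<not> m \<subseteq> P" if "P \<in> As" for P using no that by blast
    qed
    then obtain z where z: "z \<in> m" "\<forall>P\<in>As. z \<notin> P" by blast
    thus False using cov[OF z(1)] by blast
  qed
  then obtain P where P: "P \<in> As" "m \<subseteq> P" by blast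
  show ?thesis
  proof (rule bexI[of _ "g P"])
    show "g P \<in> carrier R - I" using g[OF P(1)] by simp
    have "m \<subseteq> colon R I (g P)" using g[OF P(1)] P(2) by simp
    thus "\<forall>a\<in>m. a \<otimes> g P \<in> I" by (auto simp: colon_def)
  qed
qed

text \<open>Let \<open>V\<close> be maximal among the ideals above \<open>U\<close> containing no
  power of \<open>m\<close>, and \<open>a\<close> an element of \<open>m\<close> outside
  \<open>V\<close>. The product of \<open>V + (a)\<close> and \<open>V : a\<close> lies in
  \<open>V\<close>; if both are larger than \<open>V\<close>, both contain powers of
  \<open>m\<close>, and so does \<open>V\<close>. If \<open>V : a = V\<close>, then a power of
  \<open>a\<close> lying in \<open>V\<close> yields \<open>1 \<in> V\<close>.\<close>

lemma ideal_power_subset_if_radical: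
  assumes U: "ideal U R" and rad: "\<And>a. a \<in> m \<Longrightarrow> \<exists>j::nat. a [^] j \<in> U"
  shows "\<exists>l. ideal_power R m l \<subseteq> U"
proof (rule ccontr)
  assume no: "\<not> ?thesis"
  let ?P = "\<lambda>J. ideal J R \<and> U \<subseteq> J \<and> (\<forall>l. \<not> ideal_power R m l \<subseteq> J)"
  have "\<exists>J. ?P J \<and> U \<subseteq> J \<and> (\<forall>K. ?P K \<longrightarrow> J \<subseteq> K \<longrightarrow> K = J)"
    by (rule noetherian_maximal) (use U no in auto)
  then obtain V where V: "ideal V R" "U \<subseteq> V" "\<And>l. \<not> ideal_power R m l \<subseteq> V"
    and "\<forall>K. ?P K \<longrightarrow> V \<subseteq> K \<longrightarrow> K = V" by (elim exE conjE) simp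
  hence mx: "K = V" if "?P K" "V \<subseteq> K" for K using that by simp
  have "\<not> m \<subseteq> V" using V(3)[of "Suc 0"] ideal_power_1[OF m_ideal] by simp
  then obtain a where a: "a \<in> m" "a \<notin> V" by blast
  have ac: "a \<in> carrier R" using m_sub a by blast
  have Vc: "V \<subseteq> carrier R" using ideal.Icarr[OF V(1)] by blast
  let ?K = "Idl (insert a V)"
  have c: "insert a V \<subseteq> carrier R" using ac Vc by simp
  have K: "ideal ?K R" "insert a V \<subseteq> ?K" using genideal_ideal[OF c] genideal_self[OF c] by auto
  hence "?K \<noteq> V" using a by auto
  hence "\<not> ?P ?K" using mx[of ?K] K by auto
  then obtain l where l: "ideal_power R m l \<subseteq> ?K" using K V by auto
  have C: "ideal (colon R V a) R" "V \<subseteq> colon R V a"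
    using colon_ideal[OF V(1) ac] colon_superset[OF V(1) ac] by auto
  show False
  proof (cases "colon R V a = V")
    case True
    obtain j :: nat where "a [^] j \<in> V" using rad[OF a(1)] V by auto
    hence "\<one> \<in> V"
    proof (induction j)
      case (Suc j)
      hence "a [^] j \<in> colon R V a" using ac by (simp add: colon_def)
      thus ?case using True Suc by simp
    qed simp
    hence "V = carrier R" using ideal.one_imp_carrier[OF V(1)] by simp
    thus False using V(3)[of 0] by simp
  next
    case False
    hence "\<not> ?P (colon R V a)" using mx[of "colon R V a"] C by auto
    then obtain l' where l': "ideal_power R m l' \<subseteq> colon R V a" using C V by auto
    have "ideal_power R m (l + l') \<subseteq> V"
      unfolding ideal_power_add[OF m_ideal]
    proof (rule ideal_prod_subset[OF V(1)])
      fix i j assume i: "i \<in> ideal_power R m l" and j: "j \<in> ideal_power R m l'"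
      have jc: "j \<in> carrier R" using j ideal.Icarr[OF ideal_power_ideal[OF m_ideal]] by blast
      have "insert a V \<subseteq> colon R V j"
        using colon_superset[OF V(1) jc] l' j ac jc by (auto simp: colon_def m_comm)
      hence "?K \<subseteq> colon R V j" by (rule genideal_minimal[OF colon_ideal[OF V(1) jc]])
      thus "i \<otimes> j \<in> V" using i l by (auto simp: colon_def)
    qed
    thus False using V(3) by blast
  qed
qed

text \<open>A regular sequence that attains the supremum cannot be prolonged, so every element of
  \<open>m\<close> is a zero divisor modulo it and \<open>socle_element\<close> applies. The pair
  \<open>xs\<close>, \<open>y\<close> serves twice: for the top degree of \<open>D\<close> and for
  the bound on the length of \<open>G\<close>.\<close>

lemma depth_witness:
  assumes "depth R m = enat r"
  shows "\<exists>xs y. length xs = r \<and> set xs \<subseteq> m \<and> regular_sequence R xs \<and> y \<in> carrier R \<and>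
    y \<notin> Idl (set xs) \<and> (\<forall>a\<in>m. a \<otimes> y \<in> Idl (set xs))"
proof -
  define A where "A = {enat (length xs) | xs. set xs \<subseteq> m \<and> regular_sequence R xs}"
  have "enat (length ([] :: 'a list)) \<in> A"
    unfolding A_def by (intro CollectI exI[of _ "[]"]) (simp add: regular_sequence_def)
  hence ne: "A \<noteq> {}" by blast
  have sup: "Sup A = enat r" using assms by (simp add: depth_def A_def)
  \<comment> \<open>An infinite set of values would have supremum infinity; so \<open>A\<close> is
    finite and its supremum is attained.\<close>
  have fin: "finite A" using sup ne by (simp add: Sup_enat_def split: if_splits)
  have "Max A = enat r" using sup fin ne by (simp add: Sup_enat_def)
  hence "enat r \<in> A" using Max_in[OF fin ne] by simp
  then obtain xs where xs: "length xs = r" "set xs \<subseteq> m" "regular_sequence R xs"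
    unfolding A_def by auto
  have xc: "set xs \<subseteq> carrier R" using xs m_sub by auto
  have "\<exists>y \<in> carrier R - Idl (set xs). \<forall>a\<in>m. a \<otimes> y \<in> Idl (set xs)"
  proof (rule socle_element[OF genideal_ideal[OF xc]])
    fix x assume x: "x \<in> m"
    show "\<exists>y \<in> carrier R - Idl (set xs). x \<otimes> y \<in> Idl (set xs)"
    proof (rule ccontr)
      assume no: "\<not> ?thesis"
      have "regular_sequence R (xs @ [x])"
        unfolding regular_sequence_def
      proof (intro conjI allI impI ballI)
        show "set (xs @ [x]) \<subseteq> carrier R" using xc x m_sub by auto
        fix k y assume k: "k < length (xs @ [x])" and y: "y \<in> carrier R"
          "(xs @ [x]) ! k \<otimes> y \<in> Idl (set (take k (xs @ [x])))"
        show "y \<in> Idl (set (take k (xs @ [x])))"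
        proof (cases "k = length xs")
          case True
          thus ?thesis using no y by auto
        next
          case False
          thus ?thesis using k y xs(3) by (auto simp: regular_sequence_def nth_append)
        qed
      qed
      hence "enat (length (xs @ [x])) \<in> A"
        unfolding A_def using xs x by (intro CollectI exI[of _ "xs @ [x]"]) auto
      hence "enat (length (xs @ [x])) \<le> enat r" using Sup_upper[of _ A] sup by metis
      thus False using xs by simp
    qed
  qed
  then obtain y where "y \<in> carrier R - Idl (set xs)" "\<forall>a\<in>m. a \<otimes> y \<in> Idl (set xs)"
    by (elim bexE)
  thus ?thesis using xs by (intro exI[of _ xs] exI[of _ y]) simp
qed

end

section \<open>Cosets and quotient modules\<close>

context pmodule
begin

lemma diff_add_diff:
  "x \<in> carrier M \<Longrightarrow> y \<in> carrier M \<Longrightarrow> z \<in> carrier M \<Longrightarrow>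
    (x \<ominus> y) \<oplus> (y \<ominus> z) = x \<ominus> z"
  by (simp add: a_minus_def M.a_assoc M.r_neg1)

lemma diff_add_cancel': "x \<in> carrier M \<Longrightarrow> y \<in> carrier M \<Longrightarrow> (x \<ominus> y) \<oplus> y = x"
  by (simp add: a_minus_def M.a_assoc M.l_neg)

lemma add_diff_cancel': "x \<in> carrier M \<Longrightarrow> y \<in> carrier M \<Longrightarrow> (x \<oplus> y) \<ominus> y = x"
  by (simp add: a_minus_def M.a_assoc M.r_neg)

lemma diff_eq_zero_iff: "x \<in> carrier M \<Longrightarrow> y \<in> carrier M \<Longrightarrow> x \<ominus> y = \<zero> \<longleftrightarrow> x = y"
  by (metis M.r_neg a_minus_def diff_add_cancel' M.l_zero)

lemma diff_self: "x \<in> carrier M \<Longrightarrow> x \<ominus> x = \<zero>"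
  by (simp add: a_minus_def M.r_neg)

lemma minus_zero': "\<ominus> \<zero> = \<zero>"
  using M.minus_equality[of "\<zero>" "\<zero>"] by simp

lemma diff_zero: "x \<in> carrier M \<Longrightarrow> x \<ominus> \<zero> = x"
  by (simp add: a_minus_def minus_zero')

lemma minus_diff: "x \<in> carrier M \<Longrightarrow> y \<in> carrier M \<Longrightarrow> \<ominus> (x \<ominus> y) = y \<ominus> x"
  by (simp add: a_minus_def M.minus_add M.a_comm)

lemma smult_diff:
  "a \<in> carrier R \<Longrightarrow> x \<in> carrier M \<Longrightarrow> y \<in> carrier M \<Longrightarrow>
    a \<odot> (x \<ominus> y) = a \<odot> x \<ominus> a \<odot> y"
  by (simp add: a_minus_def smult_r_distr smult_r_minus)

lemma coset_iff:
  assumes H: "submodule H R M" and x: "x \<in> carrier M"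
  shows "y \<in> H +> x \<longleftrightarrow> y \<in> carrier M \<and> y \<ominus> x \<in> H"
proof
  assume "y \<in> H +> x"
  then obtain h where h: "h \<in> H" "y = h \<oplus> x" by (auto simp: a_r_coset_def')
  moreover have "h \<in> carrier M" using h submoduleE(1)[OF H] by auto
  ultimately show "y \<in> carrier M \<and> y \<ominus> x \<in> H"
    using x by (simp add: a_minus_def M.a_assoc M.r_neg)
next
  assume y: "y \<in> carrier M \<and> y \<ominus> x \<in> H"
  hence "y = (y \<ominus> x) \<oplus> x" using x by (simp add: a_minus_def M.a_assoc M.l_neg)
  thus "y \<in> H +> x" using y by (auto simp: a_r_coset_def')
qed

lemma coset_self: "submodule H R M \<Longrightarrow> x \<in> carrier M \<Longrightarrow> x \<in> H +> x"
  by (simp add: coset_iff submodule_zero a_minus_def M.r_neg)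

lemma coset_eq_iff:
  assumes H: "submodule H R M" and x: "x \<in> carrier M" and y: "y \<in> carrier M"
  shows "H +> x = H +> y \<longleftrightarrow> x \<ominus> y \<in> H"
proof
  assume "H +> x = H +> y"
  hence "x \<in> H +> y" using coset_self[OF H x] by simp
  thus "x \<ominus> y \<in> H" using coset_iff[OF H y] by simp
next
  assume xy: "x \<ominus> y \<in> H"
  have yx: "y \<ominus> x \<in> H"
    using submoduleE(3)[OF H xy] x y by (simp add: minus_diff)
  have 1: "z \<ominus> y = (z \<ominus> x) \<oplus> (x \<ominus> y)"
    "z \<ominus> x = (z \<ominus> y) \<oplus> (y \<ominus> x)" if "z \<in> carrier M" for z
    using that x y by (simp_all add: diff_add_diff)
  show "H +> x = H +> y"
  proof (intro equalityI subsetI)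
    fix z assume "z \<in> H +> x"
    thus "z \<in> H +> y" using 1(1)[of z] submoduleE(5)[OF H _ xy, of "z \<ominus> x"] by (simp add: coset_iff[OF H x] coset_iff[OF H y])
  next
    fix z assume "z \<in> H +> y"
    thus "z \<in> H +> x" using 1(2)[of z] submoduleE(5)[OF H _ yx, of "z \<ominus> y"] by (simp add: coset_iff[OF H x] coset_iff[OF H y])
  qed
qed

lemma coset_zero: "submodule H R M \<Longrightarrow> H +> \<zero> = H"
  using submoduleE(1) by (auto simp: coset_iff a_minus_def)

lemma quotient_carrier: "carrier (quotient_module M H) = (\<lambda>x. H +> x) ` carrier M"
  by (auto simp: quotient_module_def A_RCOSETS_def RCOSETS_def a_r_coset_def)

lemma quotient_zero: "\<zero>\<^bsub>quotient_module M H\<^esub> = H"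
  by (simp add: quotient_module_def)

lemma quotient_add:
  assumes H: "submodule H R M" and x: "x \<in> carrier M" and y: "y \<in> carrier M"
  shows "(H +> x) \<oplus>\<^bsub>quotient_module M H\<^esub> (H +> y) = H +> (x \<oplus> y)"
proof -
  have Hc: "H \<subseteq> carrier M" using submoduleE(1)[OF H] .
  have "(H +> x) <+>\<^bsub>M\<^esub> (H +> y) = H +> (x \<oplus> y)"
  proof (intro equalityI subsetI)
    fix z assume "z \<in> (H +> x) <+>\<^bsub>M\<^esub> (H +> y)"
    then obtain h k where hk: "h \<in> H" "k \<in> H" "z = (h \<oplus> x) \<oplus> (k \<oplus> y)"
      by (auto simp: set_add_def' a_r_coset_def')
    hence "z = (h \<oplus> k) \<oplus> (x \<oplus> y)" using x y Hc by (simp add: subset_iff M.a_ac)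
    thus "z \<in> H +> (x \<oplus> y)" using submoduleE(5)[OF H hk(1,2)] by (auto simp: a_r_coset_def')
  next
    fix z assume "z \<in> H +> (x \<oplus> y)"
    then obtain h where h: "h \<in> H" "z = h \<oplus> (x \<oplus> y)" by (auto simp: a_r_coset_def')
    hence "z = (h \<oplus> x) \<oplus> (\<zero> \<oplus> y)" using x y Hc by (simp add: subset_iff M.a_ac)
    thus "z \<in> (H +> x) <+>\<^bsub>M\<^esub> (H +> y)"
      using h submodule_zero[OF H] unfolding set_add_def' a_r_coset_def' by blast
  qed
  thus ?thesis by (simp add: quotient_module_def)
qed

lemma quotient_smult:
  assumes H: "submodule H R M" and x: "x \<in> carrier M" and a: "a \<in> carrier R"
  shows "a \<odot>\<^bsub>quotient_module M H\<^esub> (H +> x) = H +> (a \<odot> x)"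
proof -
  have "H +> (a \<odot> y) = H +> (a \<odot> x)" if y: "y \<in> H +> x" for y
  proof -
    have yc: "y \<in> carrier M" "y \<ominus> x \<in> H" using y coset_iff[OF H x] by auto
    have "a \<odot> y \<ominus> a \<odot> x = a \<odot> (y \<ominus> x)"
      using yc x a by (simp add: a_minus_def smult_r_distr smult_r_minus)
    also have "\<dots> \<in> H" using submoduleE(4)[OF H a yc(2)] .
    finally show ?thesis using coset_eq_iff[OF H] yc x a by simp
  qed
  hence "(\<Union>y\<in>H +> x. H +> (a \<odot> y)) = (\<Union>y\<in>H +> x. H +> (a \<odot> x))"
    by (intro SUP_cong) simp_all
  also have "\<dots> = H +> (a \<odot> x)" using coset_self[OF H x] by blast
  finally show ?thesis by (simp add: quotient_module_def)
qed

lemma quotient_is_module: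
  assumes H: "submodule H R M"
  shows "module R (quotient_module M H)"
proof -
  let ?Q = "quotient_module M H"
  let ?c = "\<lambda>x. H +> x"
  have ex: "\<exists>x\<in>carrier M. X = ?c x" if "X \<in> carrier ?Q" for X
    using that by (auto simp: quotient_carrier)
  have cl: "?c x \<in> carrier ?Q" if "x \<in> carrier M" for x using that by (simp add: quotient_carrier)
  note qa = quotient_add[OF H] and qs = quotient_smult[OF H]
  have z: "?c \<zero> = \<zero>\<^bsub>?Q\<^esub>" using coset_zero[OF H] by (simp add: quotient_zero)
  have grp: "abelian_group ?Q"
  proof (rule abelian_groupI)
    show "\<zero>\<^bsub>?Q\<^esub> \<in> carrier ?Q" using cl[OF M.zero_closed] z by simp
    fix X assume "X \<in> carrier ?Q"
    then obtain x where x: "x \<in> carrier M" "X = ?c x" using ex by blast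
    show "\<zero>\<^bsub>?Q\<^esub> \<oplus>\<^bsub>?Q\<^esub> X = X" using x by (simp add: z[symmetric] qa)
    have "?c (\<ominus> x) \<oplus>\<^bsub>?Q\<^esub> X = \<zero>\<^bsub>?Q\<^esub>" using x by (simp add: z[symmetric] qa M.l_neg)
    thus "\<exists>Y\<in>carrier ?Q. Y \<oplus>\<^bsub>?Q\<^esub> X = \<zero>\<^bsub>?Q\<^esub>" using cl[of "\<ominus> x"] x by blast
    fix Y assume "Y \<in> carrier ?Q"
    then obtain y where y: "y \<in> carrier M" "Y = ?c y" using ex by blast
    show "X \<oplus>\<^bsub>?Q\<^esub> Y \<in> carrier ?Q" using x y by (simp add: qa cl)
    show "X \<oplus>\<^bsub>?Q\<^esub> Y = Y \<oplus>\<^bsub>?Q\<^esub> X" using x y by (simp add: qa M.a_comm)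
    fix Z assume "Z \<in> carrier ?Q"
    then obtain w where w: "w \<in> carrier M" "Z = ?c w" using ex by blast
    show "X \<oplus>\<^bsub>?Q\<^esub> Y \<oplus>\<^bsub>?Q\<^esub> Z = X \<oplus>\<^bsub>?Q\<^esub> (Y \<oplus>\<^bsub>?Q\<^esub> Z)" using x y w by (simp add: qa M.a_assoc)
  qed
  show ?thesis
  proof (rule moduleI[OF R.is_cring grp])
    fix a b X Y assume a: "a \<in> carrier R" and b: "b \<in> carrier R"
      and X: "X \<in> carrier ?Q" and Y: "Y \<in> carrier ?Q"
    obtain x y where x: "x \<in> carrier M" "X = ?c x" and y: "y \<in> carrier M" "Y = ?c y"
      using ex X Y by blast
    show "(a \<oplus>\<^bsub>R\<^esub> b) \<odot>\<^bsub>?Q\<^esub> X = a \<odot>\<^bsub>?Q\<^esub> X \<oplus>\<^bsub>?Q\<^esub> b \<odot>\<^bsub>?Q\<^esub> X"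
      using a b x by (simp add: qs qa smult_l_distr)
    show "a \<odot>\<^bsub>?Q\<^esub> (X \<oplus>\<^bsub>?Q\<^esub> Y) = a \<odot>\<^bsub>?Q\<^esub> X \<oplus>\<^bsub>?Q\<^esub> a \<odot>\<^bsub>?Q\<^esub> Y"
      using a x y by (simp add: qs qa smult_r_distr)
    show "(a \<otimes>\<^bsub>R\<^esub> b) \<odot>\<^bsub>?Q\<^esub> X = a \<odot>\<^bsub>?Q\<^esub> (b \<odot>\<^bsub>?Q\<^esub> X)"
      using a b x by (simp add: qs smult_assoc1)
    show "a \<odot>\<^bsub>?Q\<^esub> X \<in> carrier ?Q" using a x by (simp add: qs cl)
  next
    fix X assume "X \<in> carrier ?Q"
    then obtain x where x: "x \<in> carrier M" "X = ?c x" using ex by blast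
    show "\<one>\<^bsub>R\<^esub> \<odot>\<^bsub>?Q\<^esub> X = X" using x by (simp add: qs)
  qed
qed

lemma quotient_proj: "submodule H R M \<Longrightarrow> (\<lambda>x. H +> x) \<in> mod_hom R M (quotient_module M H)"
  by (rule mod_homI) (auto simp: quotient_carrier quotient_add quotient_smult)

end

text \<open>\<open>cohomology\<close> forms its cosets inside the submodule of cocycles; by this
  lemma they can be computed in the whole term.\<close>

lemma coset_carrier_update: "H +>\<^bsub>M\<lparr>carrier := K\<rparr>\<^esub> x = H +>\<^bsub>M\<^esub> x"
  by (simp add: a_r_coset_def')

lemma sub_is_pmodule: "module R M \<Longrightarrow> submodule K R M \<Longrightarrow> pmodule R (M\<lparr>carrier := K\<rparr>)"
  using submodule.submodule_is_module by (auto simp: pmodule_def)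

section \<open>Cohomology\<close>

lemma submodule_in_submodule:
  fixes M :: "('a, 'm) module"
  assumes "module R M" "submodule K R M" "submodule H R M" "H \<subseteq> K"
  shows "submodule H R (M\<lparr>carrier := K\<rparr>)"
proof -
  interpret M: pmodule R M by (rule pmodule.intro) fact
  interpret K: pmodule R "M\<lparr>carrier := K\<rparr>" by (rule sub_is_pmodule[OF assms(1,2)])
  show ?thesis
    by (rule K.submoduleI') (use assms M.submoduleE[OF assms(3)] M.submodule_zero[OF assms(3)] in auto)
qed

lemma kernel_submodule:
  assumes "module R M" "module R N" "f \<in> mod_hom R M N"
  shows "submodule {x \<in> carrier M. f x = \<zero>\<^bsub>N\<^esub>} R M"
proof -
  interpret M: pmodule R M by (rule pmodule.intro) fact
  interpret N: pmodule R N by (rule pmodule.intro) fact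
  show ?thesis
    by (rule M.submoduleI') (auto simp: mod_hom_add[OF assms(3)] mod_hom_smult[OF assms(3)] mod_hom_zero[OF assms])
qed

lemma image_submodule:
  assumes "module R M" "module R N" "f \<in> mod_hom R M N" "submodule H R M"
  shows "submodule (f ` H) R N"
proof -
  interpret M: pmodule R M by (rule pmodule.intro) fact
  interpret N: pmodule R N by (rule pmodule.intro) fact
  note HD = M.submoduleE[OF assms(4)] M.submodule_zero[OF assms(4)]
  show ?thesis
  proof (rule N.submoduleI')
    show "f ` H \<subseteq> carrier N" using HD(1) mod_hom_closed[OF assms(3)] by auto
    show "\<zero>\<^bsub>N\<^esub> \<in> f ` H" using HD(7) mod_hom_zero[OF assms(1-3)] by force
  next
    fix x y assume "x \<in> f ` H" "y \<in> f ` H"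
    then obtain u v where u: "u \<in> H" "v \<in> H" "x = f u" "y = f v" by auto
    hence "x \<oplus>\<^bsub>N\<^esub> y = f (u \<oplus>\<^bsub>M\<^esub> v)" using HD(1) by (simp add: mod_hom_add[OF assms(3)] subset_iff)
    thus "x \<oplus>\<^bsub>N\<^esub> y \<in> f ` H" using HD(5) u by auto
  next
    fix a x assume a: "a \<in> carrier R" and "x \<in> f ` H"
    then obtain u where u: "u \<in> H" "x = f u" by auto
    hence "a \<odot>\<^bsub>N\<^esub> x = f (a \<odot>\<^bsub>M\<^esub> u)" using HD(1) a by (simp add: mod_hom_smult[OF assms(3)] subset_iff)
    thus "a \<odot>\<^bsub>N\<^esub> x \<in> f ` H" using HD(4) u a by auto
  qed
qed

lemma is_complexD:
  assumes "is_complex R C"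
  shows "module R (obj C n)" "diff C n \<in> mod_hom R (obj C n) (obj C (n + 1))"
    "x \<in> carrier (obj C n) \<Longrightarrow> diff C (n + 1) (diff C n x) = \<zero>\<^bsub>obj C (n + 2)\<^esub>"
  using assms by (auto simp: is_complex_def)

context
  fixes R :: "('a, 'r) ring_scheme" and C :: "('a, 'm) cochain_complex"
  assumes C: "is_complex R C"
begin

lemma cocycles_submodule: "submodule (cocycles C n) R (obj C n)"
  unfolding cocycles_def
  by (rule kernel_submodule[OF is_complexD(1)[OF C] is_complexD(1)[OF C] is_complexD(2)[OF C]])

lemma diff_prev: "diff C (n - 1) \<in> mod_hom R (obj C (n - 1)) (obj C n)"
  using is_complexD(2)[OF C, of "n - 1"] by simp

lemma diff_diff_prev: "x \<in> carrier (obj C (n - 1)) \<Longrightarrow> diff C n (diff C (n - 1) x) = \<zero>\<^bsub>obj C (n + 1)\<^esub>"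
  using is_complexD(3)[OF C, of x "n - 1"] by (simp add: add.commute)

lemma coboundaries_submodule: "submodule (coboundaries C n) R (obj C n)"
proof -
  interpret M: pmodule R "obj C (n - 1)" by (rule pmodule.intro) (rule is_complexD(1)[OF C])
  show ?thesis unfolding coboundaries_def
    by (rule image_submodule[OF is_complexD(1)[OF C] is_complexD(1)[OF C] diff_prev M.carrier_is_submodule])
qed

lemma coboundaries_cocycles: "coboundaries C n \<subseteq> cocycles C n"
  using mod_hom_closed[OF diff_prev] diff_diff_prev by (auto simp: coboundaries_def cocycles_def)

lemma cohomology_carrier:
  "carrier (cohomology C n) = (\<lambda>x. coboundaries C n +>\<^bsub>obj C n\<^esub> x) ` cocycles C n"
proof -
  interpret K: pmodule R "(obj C n)\<lparr>carrier := cocycles C n\<rparr>"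
    by (rule sub_is_pmodule[OF is_complexD(1)[OF C] cocycles_submodule])
  show ?thesis unfolding cohomology_def K.quotient_carrier coset_carrier_update by simp
qed

text \<open>Expresses finiteness by cocycles and coboundaries, the form that the relative version of
  Nakayama's lemma takes.\<close>

lemma finitely_generated_cohomology:
  assumes "finitely_generated R (cohomology C n)"
  shows "\<exists>F\<subseteq>cocycles C n. finite F \<and> cocycles C n \<subseteq> module_span R (obj C n) (F \<union> coboundaries C n)"
proof -
  interpret M: pmodule R "obj C n" by (rule pmodule.intro) (rule is_complexD(1)[OF C])
  let ?Z = "cocycles C n" and ?B = "coboundaries C n" and ?M = "(obj C n)\<lparr>carrier := cocycles C n\<rparr>"
  interpret K: pmodule R ?M
    by (rule sub_is_pmodule[OF is_complexD(1)[OF C] cocycles_submodule])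
  have BK: "submodule ?B R ?M"
    by (rule submodule_in_submodule[OF is_complexD(1)[OF C] cocycles_submodule coboundaries_submodule
          coboundaries_cocycles])
  interpret Q: pmodule R "cohomology C n"
    unfolding cohomology_def by (rule pmodule.intro) (rule K.quotient_is_module[OF BK])
  have Zc: "?Z \<subseteq> carrier (obj C n)" by (auto simp: cocycles_def)
  obtain S where S: "S \<subseteq> carrier (cohomology C n)" "finite S"
    "module_span R (cohomology C n) S = carrier (cohomology C n)"
    using assms by (auto simp: finitely_generated_def)
  have "\<forall>X\<in>S. \<exists>x\<in>?Z. X = ?B +>\<^bsub>obj C n\<^esub> x" using S(1) cohomology_carrier by auto
  then obtain g where g: "\<And>X. X \<in> S \<Longrightarrow> g X \<in> ?Z \<and> X = ?B +>\<^bsub>obj C n\<^esub> g X" by metis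
  let ?F = "g ` S"
  let ?T = "module_span R (obj C n) (?F \<union> ?B)"
  have F: "?F \<subseteq> ?Z" using g by auto
  have FB: "?F \<union> ?B \<subseteq> carrier (obj C n)" using F Zc coboundaries_cocycles by blast
  note T = M.span_submodule[OF FB]
  note TD = M.submoduleE[OF T]
  have BT: "?B \<subseteq> ?T" "?F \<subseteq> ?T" using M.span_incl[of "?F \<union> ?B"] by auto
  \<comment> \<open>The image of \<open>Z \<inter> T\<close> in the cohomology module. It is a
    submodule containing the generators \<open>S\<close>, hence everything, so each cocycle differs
    from an element of \<open>T\<close> by a coboundary.\<close>
  define W where "W = (\<lambda>x. ?B +>\<^bsub>obj C n\<^esub> x) ` (?Z \<inter> ?T)"
  have "submodule W R (cohomology C n)"
  proof (rule Q.submoduleI')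
    show "W \<subseteq> carrier (cohomology C n)" by (auto simp: W_def cohomology_carrier)
    have "?B +>\<^bsub>obj C n\<^esub> \<zero>\<^bsub>obj C n\<^esub> \<in> W" unfolding W_def
      using M.submodule_zero[OF cocycles_submodule] M.submodule_zero[OF T] by (intro imageI) simp
    thus "\<zero>\<^bsub>cohomology C n\<^esub> \<in> W"
      unfolding cohomology_def K.quotient_zero using M.coset_zero[OF coboundaries_submodule] by simp
  next
    fix X Y assume "X \<in> W" "Y \<in> W"
    then obtain x y where xy: "x \<in> ?Z" "y \<in> ?Z" "x \<in> ?T" "y \<in> ?T" "X = ?B +>\<^bsub>obj C n\<^esub> x"
      "Y = ?B +>\<^bsub>obj C n\<^esub> y" by (auto simp: W_def)
    have "X \<oplus>\<^bsub>cohomology C n\<^esub> Y = ?B +>\<^bsub>obj C n\<^esub> (x \<oplus>\<^bsub>obj C n\<^esub> y)"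
      using K.quotient_add[OF BK, of x y] xy by (simp add: cohomology_def coset_carrier_update)
    moreover have "x \<oplus>\<^bsub>obj C n\<^esub> y \<in> ?Z \<inter> ?T" using xy TD(5) M.submoduleE(5)[OF cocycles_submodule] by simp
    ultimately show "X \<oplus>\<^bsub>cohomology C n\<^esub> Y \<in> W" by (simp add: W_def)
  next
    fix a X assume a: "a \<in> carrier R" and "X \<in> W"
    then obtain x where xy: "x \<in> ?Z" "x \<in> ?T" "X = ?B +>\<^bsub>obj C n\<^esub> x" by (auto simp: W_def)
    have "a \<odot>\<^bsub>cohomology C n\<^esub> X = ?B +>\<^bsub>obj C n\<^esub> (a \<odot>\<^bsub>obj C n\<^esub> x)"
      using K.quotient_smult[OF BK, of x a] xy a by (simp add: cohomology_def coset_carrier_update)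
    moreover have "a \<odot>\<^bsub>obj C n\<^esub> x \<in> ?Z \<inter> ?T" using xy a TD(4) M.submoduleE(4)[OF cocycles_submodule] by simp
    ultimately show "a \<odot>\<^bsub>cohomology C n\<^esub> X \<in> W" by (simp add: W_def)
  qed
  moreover have "S \<subseteq> W"
  proof
    fix X assume X: "X \<in> S"
    have "g X \<in> ?Z \<inter> ?T" using g[OF X] BT(2) X by auto
    thus "X \<in> W" using g[OF X] by (auto simp: W_def)
  qed
  ultimately have CW: "carrier (cohomology C n) \<subseteq> W" using Q.span_minimal S(3) by metis
  have "?Z \<subseteq> ?T"
  proof
    fix z assume z: "z \<in> ?Z"
    hence "?B +>\<^bsub>obj C n\<^esub> z \<in> W" using CW cohomology_carrier by auto
    then obtain x where x: "x \<in> ?Z" "x \<in> ?T" "?B +>\<^bsub>obj C n\<^esub> z = ?B +>\<^bsub>obj C n\<^esub> x" by (auto simp: W_def)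
    have zx: "z \<in> carrier (obj C n)" "x \<in> carrier (obj C n)" using z x Zc by auto
    have "z \<ominus>\<^bsub>obj C n\<^esub> x \<in> ?T" using x(3) M.coset_eq_iff[OF coboundaries_submodule zx] BT by auto
    hence "(z \<ominus>\<^bsub>obj C n\<^esub> x) \<oplus>\<^bsub>obj C n\<^esub> x \<in> ?T" using TD(5) x by simp
    thus "z \<in> ?T" using zx by (simp add: a_minus_def M.M.a_assoc M.M.l_neg)
  qed
  thus ?thesis using F S(2) by (intro exI[of _ ?F]) auto
qed

end

text \<open>Replaces cosets by elements: the last two clauses are injectivity and surjectivity on
  cohomology.\<close>

lemma quasi_isomorphism_iff:
  assumes C: "is_complex R C" and C': "is_complex R C'"
  shows "quasi_isomorphism R C C' f \<longleftrightarrow> chain_map R C C' f \<and>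
    (\<forall>n. \<forall>z\<in>cocycles C n. f n z \<in> coboundaries C' n \<longrightarrow> z \<in> coboundaries C n) \<and>
    (\<forall>n. \<forall>z'\<in>cocycles C' n. \<exists>z\<in>cocycles C n. z' \<ominus>\<^bsub>obj C' n\<^esub> f n z \<in> coboundaries C' n)"
proof (cases "chain_map R C C' f")
  case False
  thus ?thesis by (simp add: quasi_isomorphism_def)
next
  case True
  have "bij_betw (cohomology_map C' f n) (carrier (cohomology C n)) (carrier (cohomology C' n)) \<longleftrightarrow>
    (\<forall>z\<in>cocycles C n. f n z \<in> coboundaries C' n \<longrightarrow> z \<in> coboundaries C n) \<and>
    (\<forall>z'\<in>cocycles C' n. \<exists>z\<in>cocycles C n. z' \<ominus>\<^bsub>obj C' n\<^esub> f n z \<in> coboundaries C' n)" for n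
  proof -
    interpret M: pmodule R "obj C n" by (rule pmodule.intro) (rule is_complexD(1)[OF C])
    interpret M': pmodule R "obj C' n" by (rule pmodule.intro) (rule is_complexD(1)[OF C'])
    let ?Z = "cocycles C n" and ?B = "coboundaries C n" and ?Z' = "cocycles C' n" and ?B' = "coboundaries C' n"
    note B = coboundaries_submodule[OF C, of n] and B' = coboundaries_submodule[OF C', of n]
    note Z = cocycles_submodule[OF C, of n] and Z' = cocycles_submodule[OF C', of n]
    have Zc: "?Z \<subseteq> carrier (obj C n)" "?Z' \<subseteq> carrier (obj C' n)" by (auto simp: cocycles_def)
    have hom: "f k \<in> mod_hom R (obj C k) (obj C' k)" for k using True by (simp add: chain_map_def)
    have comm: "x \<in> carrier (obj C k) \<Longrightarrow> f (k + 1) (diff C k x) = diff C' k (f k x)" for k x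
      using True by (simp add: chain_map_def)
    have fZ: "f n z \<in> ?Z'" if "z \<in> ?Z" for z
      using that mod_hom_closed[OF hom] comm[of z n] mod_hom_zero[OF is_complexD(1)[OF C] is_complexD(1)[OF C'] hom, of "n + 1"]
      by (auto simp: cocycles_def)
    have fB: "f n b \<in> ?B'" if "b \<in> ?B" for b
    proof -
      obtain y where y: "y \<in> carrier (obj C (n - 1))" "b = diff C (n - 1) y"
        using \<open>b \<in> ?B\<close> by (auto simp: coboundaries_def)
      thus ?thesis using comm[of y "n - 1"] mod_hom_closed[OF hom] by (auto simp: coboundaries_def)
    qed
    have cm: "cohomology_map C' f n (?B +>\<^bsub>obj C n\<^esub> z) = ?B' +>\<^bsub>obj C' n\<^esub> f n z" if z: "z \<in> ?Z" for z
    proof -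
      have zc: "z \<in> carrier (obj C n)" using z Zc by auto
      have "?B' +>\<^bsub>obj C' n\<^esub> f n y = ?B' +>\<^bsub>obj C' n\<^esub> f n z" if y: "y \<in> ?B +>\<^bsub>obj C n\<^esub> z" for y
      proof -
        have yc: "y \<in> carrier (obj C n)" "y \<ominus>\<^bsub>obj C n\<^esub> z \<in> ?B" using y M.coset_iff[OF B zc] by auto
        have "f n y \<ominus>\<^bsub>obj C' n\<^esub> f n z = f n (y \<ominus>\<^bsub>obj C n\<^esub> z)"
          using mod_hom_diff[OF is_complexD(1)[OF C] is_complexD(1)[OF C'] hom yc(1) zc] by simp
        thus ?thesis
          using M'.coset_eq_iff[OF B', of "f n y" "f n z"] fB[OF yc(2)] mod_hom_closed[OF hom] yc zc by auto
      qed
      hence "cohomology_map C' f n (?B +>\<^bsub>obj C n\<^esub> z) = (\<Union>y\<in>?B +>\<^bsub>obj C n\<^esub> z. ?B' +>\<^bsub>obj C' n\<^esub> f n z)"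
        unfolding cohomology_map_def by (intro SUP_cong) simp_all
      thus ?thesis using M.coset_self[OF B zc] by blast
    qed
    have inj: "inj_on (cohomology_map C' f n) (carrier (cohomology C n)) \<longleftrightarrow>
      (\<forall>z\<in>?Z. f n z \<in> ?B' \<longrightarrow> z \<in> ?B)"
    proof
      assume inj: "inj_on (cohomology_map C' f n) (carrier (cohomology C n))"
      show "\<forall>z\<in>?Z. f n z \<in> ?B' \<longrightarrow> z \<in> ?B"
      proof (intro ballI impI)
        fix z assume z: "z \<in> ?Z" "f n z \<in> ?B'"
        have 0: "\<zero>\<^bsub>obj C n\<^esub> \<in> ?Z" using M.submodule_zero[OF Z] .
        have f0: "f n \<zero>\<^bsub>obj C n\<^esub> = \<zero>\<^bsub>obj C' n\<^esub>"
          by (rule mod_hom_zero[OF is_complexD(1)[OF C] is_complexD(1)[OF C'] hom])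
        have "?B' +>\<^bsub>obj C' n\<^esub> f n z = ?B' +>\<^bsub>obj C' n\<^esub> f n \<zero>\<^bsub>obj C n\<^esub>"
          using M'.coset_eq_iff[OF B', of "f n z" "\<zero>\<^bsub>obj C' n\<^esub>"] z fZ[OF z(1)] Zc f0
          by (simp add: M'.diff_zero subset_iff)
        hence "cohomology_map C' f n (?B +>\<^bsub>obj C n\<^esub> z) = cohomology_map C' f n (?B +>\<^bsub>obj C n\<^esub> \<zero>\<^bsub>obj C n\<^esub>)"
          using cm z 0 by simp
        hence "?B +>\<^bsub>obj C n\<^esub> z = ?B +>\<^bsub>obj C n\<^esub> \<zero>\<^bsub>obj C n\<^esub>"
          using inj z 0 by (auto simp: inj_on_def cohomology_carrier[OF C])
        thus "z \<in> ?B" using M.coset_self[OF B, of z] M.coset_zero[OF B] z Zc by auto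
      qed
    next
      assume a: "\<forall>z\<in>?Z. f n z \<in> ?B' \<longrightarrow> z \<in> ?B"
      show "inj_on (cohomology_map C' f n) (carrier (cohomology C n))"
      proof (rule inj_onI)
        fix X Y assume "X \<in> carrier (cohomology C n)" "Y \<in> carrier (cohomology C n)"
          and eq: "cohomology_map C' f n X = cohomology_map C' f n Y"
        then obtain x y where xy: "x \<in> ?Z" "y \<in> ?Z" "X = ?B +>\<^bsub>obj C n\<^esub> x" "Y = ?B +>\<^bsub>obj C n\<^esub> y"
          by (auto simp: cohomology_carrier[OF C])
        have xyc: "x \<in> carrier (obj C n)" "y \<in> carrier (obj C n)" using xy Zc by auto
        have "?B' +>\<^bsub>obj C' n\<^esub> f n x = ?B' +>\<^bsub>obj C' n\<^esub> f n y" using eq xy cm by simp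
        hence "f n x \<ominus>\<^bsub>obj C' n\<^esub> f n y \<in> ?B'"
          using M'.coset_eq_iff[OF B'] mod_hom_closed[OF hom] xyc by auto
        hence "f n (x \<ominus>\<^bsub>obj C n\<^esub> y) \<in> ?B'"
          using mod_hom_diff[OF is_complexD(1)[OF C] is_complexD(1)[OF C'] hom xyc] by simp
        hence "x \<ominus>\<^bsub>obj C n\<^esub> y \<in> ?B" using a M.submodule_diff[OF Z xy(1,2)] by auto
        thus "X = Y" using M.coset_eq_iff[OF B xyc] xy by simp
      qed
    qed
    have surj: "cohomology_map C' f n ` carrier (cohomology C n) = carrier (cohomology C' n) \<longleftrightarrow>
      (\<forall>z'\<in>?Z'. \<exists>z\<in>?Z. z' \<ominus>\<^bsub>obj C' n\<^esub> f n z \<in> ?B')"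
    proof -
      have img: "cohomology_map C' f n ` carrier (cohomology C n) = (\<lambda>z. ?B' +>\<^bsub>obj C' n\<^esub> f n z) ` ?Z"
        unfolding cohomology_carrier[OF C] image_image using cm by (intro image_cong) auto
      have "(\<lambda>z. ?B' +>\<^bsub>obj C' n\<^esub> f n z) ` ?Z = (\<lambda>x. ?B' +>\<^bsub>obj C' n\<^esub> x) ` ?Z' \<longleftrightarrow>
        (\<forall>z'\<in>?Z'. \<exists>z\<in>?Z. ?B' +>\<^bsub>obj C' n\<^esub> z' = ?B' +>\<^bsub>obj C' n\<^esub> f n z)"
      proof
        assume eq: "(\<lambda>z. ?B' +>\<^bsub>obj C' n\<^esub> f n z) ` ?Z = (\<lambda>x. ?B' +>\<^bsub>obj C' n\<^esub> x) ` ?Z'"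
        show "\<forall>z'\<in>?Z'. \<exists>z\<in>?Z. ?B' +>\<^bsub>obj C' n\<^esub> z' = ?B' +>\<^bsub>obj C' n\<^esub> f n z"
        proof
          fix z' assume "z' \<in> ?Z'"
          hence "?B' +>\<^bsub>obj C' n\<^esub> z' \<in> (\<lambda>z. ?B' +>\<^bsub>obj C' n\<^esub> f n z) ` ?Z" unfolding eq by (rule imageI)
          thus "\<exists>z\<in>?Z. ?B' +>\<^bsub>obj C' n\<^esub> z' = ?B' +>\<^bsub>obj C' n\<^esub> f n z" by (simp add: image_iff)
        qed
      next
        assume eq: "\<forall>z'\<in>?Z'. \<exists>z\<in>?Z. ?B' +>\<^bsub>obj C' n\<^esub> z' = ?B' +>\<^bsub>obj C' n\<^esub> f n z"
        show "(\<lambda>z. ?B' +>\<^bsub>obj C' n\<^esub> f n z) ` ?Z = (\<lambda>x. ?B' +>\<^bsub>obj C' n\<^esub> x) ` ?Z'"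
          using eq fZ by (intro equalityI image_subsetI) (simp_all add: image_iff, blast)
      qed
      also have "\<dots> \<longleftrightarrow> (\<forall>z'\<in>?Z'. \<exists>z\<in>?Z. z' \<ominus>\<^bsub>obj C' n\<^esub> f n z \<in> ?B')"
        using M'.coset_eq_iff[OF B'] Zc fZ by (intro ball_cong bex_cong) (auto simp: subset_iff)
      finally show ?thesis unfolding img cohomology_carrier[OF C'] .
    qed
    show ?thesis unfolding bij_betw_def inj surj by blast
  qed
  thus ?thesis using True unfolding quasi_isomorphism_def by blast
qed

section \<open>Complexes of injective modules\<close>

text \<open>This is Hom(\<open>R / (S)\<close>, \<open>M\<close>), realised as a submodule of
  \<open>M\<close>.\<close>

definition killed :: "('a, 'm) module \<Rightarrow> 'a set \<Rightarrow> 'm set" where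
  "killed M S = {x \<in> carrier M. \<forall>a\<in>S. a \<odot>\<^bsub>M\<^esub> x = \<zero>\<^bsub>M\<^esub>}"

text \<open>Injectivity with respect to the embeddings of \<open>R / (I : x)\<close> into
  \<open>R / I\<close> given by multiplication by \<open>x\<close>. Phrased as solvability of
  equations, it is what the exact sequences of killed elements need, it mentions no test modules,
  and it passes to torsion parts.\<close>

definition baer :: "('a, 'r) ring_scheme \<Rightarrow> ('a, 'm) module \<Rightarrow> bool" where
  "baer R M \<longleftrightarrow> (\<forall>I x. ideal I R \<longrightarrow> x \<in> carrier R \<longrightarrow>
     (\<forall>d \<in> killed M (colon R I x). \<exists>e \<in> killed M I. x \<odot>\<^bsub>M\<^esub> e = d))"

lemma baerD:
  "baer R M \<Longrightarrow> ideal I R \<Longrightarrow> x \<in> carrier R \<Longrightarrow> d \<in> killed M (colon R I x) \<Longrightarrow>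
    \<exists>e \<in> killed M I. x \<odot>\<^bsub>M\<^esub> e = d"
  by (simp add: baer_def)

lemma killed_insert: "killed M (insert a S) = {x \<in> killed M S. a \<odot>\<^bsub>M\<^esub> x = \<zero>\<^bsub>M\<^esub>}"
  by (auto simp: killed_def)

context pmodule
begin

lemma smult_lcomm:
  "a \<in> carrier R \<Longrightarrow> b \<in> carrier R \<Longrightarrow> x \<in> carrier M \<Longrightarrow>
    a \<odot> (b \<odot> x) = b \<odot> (a \<odot> x)"
  by (simp add: smult_assoc1[symmetric] R.m_comm)

lemma killed_submodule:
  assumes "S \<subseteq> carrier R"
  shows "submodule (killed M S) R M"
proof (rule submoduleI')
  fix a x assume a: "a \<in> carrier R" and x: "x \<in> killed M S"
  have "b \<odot> (a \<odot> x) = \<zero>" if b: "b \<in> S" for b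
  proof -
    have "b \<odot> (a \<odot> x) = a \<odot> (b \<odot> x)"
      using a b x assms smult_lcomm[of b a x] by (auto simp: killed_def)
    thus ?thesis using x b a by (simp add: killed_def)
  qed
  thus "a \<odot> x \<in> killed M S" using a x by (simp add: killed_def)
qed (use assms in \<open>auto simp: killed_def smult_r_distr subset_iff\<close>)

lemma killed_Idl:
  assumes "S \<subseteq> carrier R"
  shows "killed M (Idl\<^bsub>R\<^esub> S) = killed M S"
proof (intro equalityI subsetI)
  fix x assume "x \<in> killed M (Idl\<^bsub>R\<^esub> S)"
  thus "x \<in> killed M S" using R.genideal_self[OF assms] by (auto simp: killed_def)
next
  fix x assume x: "x \<in> killed M S"
  hence "S \<subseteq> {a \<in> carrier R. a \<odot> x = \<zero>}" using assms by (auto simp: killed_def)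
  hence "Idl\<^bsub>R\<^esub> S \<subseteq> {a \<in> carrier R. a \<odot> x = \<zero>}"
    using x by (intro R.genideal_minimal ann_ideal) (auto simp: killed_def)
  thus "x \<in> killed M (Idl\<^bsub>R\<^esub> S)" using x by (auto simp: killed_def)
qed

lemma smult_killed_colon:
  assumes "x \<in> killed M I" "a \<in> carrier R"
  shows "a \<odot> x \<in> killed M (colon R I a)"
  using assms by (auto simp: killed_def colon_def smult_assoc1[symmetric])

end

lemma mod_hom_killed:
  assumes "module R M" "module R N" "f \<in> mod_hom R M N" "S \<subseteq> carrier R" "x \<in> killed M S"
  shows "f x \<in> killed N S"
proof -
  have "a \<odot>\<^bsub>N\<^esub> f x = \<zero>\<^bsub>N\<^esub>" if "a \<in> S" for a
    using mod_hom_smult[OF assms(3), of a x] mod_hom_zero[OF assms(1-3)] that assms(4,5)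
    by (auto simp: killed_def)
  thus ?thesis using mod_hom_closed[OF assms(3)] assms(5) by (simp add: killed_def)
qed

lemma (in cring) Idl_insert:
  assumes "ideal I R" "x \<in> carrier R"
  shows "Idl (insert x I) = {i \<oplus> b \<otimes> x | i b. i \<in> I \<and> b \<in> carrier R}" (is "_ = ?K")
proof
  note I = additive_subgroup.a_closed[OF ideal.axioms(1)[OF assms(1)]]
    additive_subgroup.zero_closed[OF ideal.axioms(1)[OF assms(1)]] ideal.I_l_closed[OF assms(1)]
    ideal.Icarr[OF assms(1)]
  have Ic: "insert x I \<subseteq> carrier R" using assms(2) I(4) by blast
  have "ideal ?K R"
  proof (rule ideal_if_closed)
    show "?K \<subseteq> carrier R" using I(4) assms(2) by auto
    have "\<zero> = \<zero> \<oplus> \<zero> \<otimes> x" using assms(2) by simp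
    thus "\<zero> \<in> ?K" using I(2) by blast
  next
    fix a b assume "a \<in> ?K" "b \<in> ?K"
    then obtain i c j e where 1: "i \<in> I" "c \<in> carrier R" "a = i \<oplus> c \<otimes> x" "j \<in> I" "e \<in> carrier R"
      "b = j \<oplus> e \<otimes> x" by auto
    hence "a \<oplus> b = (i \<oplus> j) \<oplus> (c \<oplus> e) \<otimes> x" using assms(2) I(4) by (simp add: l_distr a_ac)
    thus "a \<oplus> b \<in> ?K" using 1 I(1) by blast
  next
    fix a y assume "a \<in> ?K" and y: "y \<in> carrier R"
    then obtain i c where 1: "i \<in> I" "c \<in> carrier R" "a = i \<oplus> c \<otimes> x" by auto
    hence "y \<otimes> a = (y \<otimes> i) \<oplus> (y \<otimes> c) \<otimes> x" using assms(2) I(4) y by (simp add: r_distr m_assoc)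
    moreover have "y \<otimes> i \<in> I" "y \<otimes> c \<in> carrier R" using 1 y I(3) by auto
    ultimately show "y \<otimes> a \<in> ?K" by blast
  qed
  moreover have "insert x I \<subseteq> ?K"
  proof
    fix y assume "y \<in> insert x I"
    thus "y \<in> ?K"
    proof
      assume "y = x"
      hence "y = \<zero> \<oplus> \<one> \<otimes> x" using assms(2) by simp
      thus ?thesis using I(2) one_closed by blast
    next
      assume y: "y \<in> I"
      hence "y = y \<oplus> \<zero> \<otimes> x" using assms(2) I(4) by simp
      thus ?thesis using y zero_closed by blast
    qed
  qed
  ultimately show "Idl (insert x I) \<subseteq> ?K" by (rule genideal_minimal)
  show "?K \<subseteq> Idl (insert x I)"
  proof
    fix y assume "y \<in> ?K"
    then obtain i b where 1: "i \<in> I" "b \<in> carrier R" "y = i \<oplus> b \<otimes> x" by blast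
    note J = genideal_ideal[OF Ic]
    have "i \<in> Idl (insert x I)" "x \<in> Idl (insert x I)" using genideal_self[OF Ic] 1 by auto
    thus "y \<in> Idl (insert x I)"
      using additive_subgroup.a_closed[OF ideal.axioms(1)[OF J]] ideal.I_l_closed[OF J] 1 by simp
  qed
qed

text \<open>An ideal, carried by constant functions, so that it can serve as a test module in the
  definition of injectivity.\<close>

definition const_module :: "('a, 'r) ring_scheme \<Rightarrow> 'a set \<Rightarrow> ('a, 'm \<Rightarrow> 'a) module" where
  "const_module R K = \<lparr>carrier = (\<lambda>r _. r) ` K, monoid.mult = undefined, one = undefined,
     zero = (\<lambda>_. \<zero>\<^bsub>R\<^esub>), add = (\<lambda>f g p. f p \<oplus>\<^bsub>R\<^esub> g p), smult = (\<lambda>a f p. a \<otimes>\<^bsub>R\<^esub> f p)\<rparr>"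

lemma (in cring) const_module:
  assumes "ideal K R"
  shows "module R (const_module R K :: ('a, 'm \<Rightarrow> 'a) module)"
proof -
  note K = additive_subgroup.a_closed[OF ideal.axioms(1)[OF assms]]
    additive_subgroup.zero_closed[OF ideal.axioms(1)[OF assms]] ideal.I_l_closed[OF assms]
    ideal.Icarr[OF assms] additive_subgroup.a_inv_closed[OF ideal.axioms(1)[OF assms]]
  let ?C = "const_module R K :: ('a, 'm \<Rightarrow> 'a) module"
  have ex: "\<exists>r\<in>K. h = (\<lambda>_. r)" if "h \<in> carrier ?C" for h
    using that by (auto simp: const_module_def)
  have cl: "(\<lambda>_. r) \<in> carrier ?C" if "r \<in> K" for r using that by (auto simp: const_module_def)
  have ops: "(\<lambda>_. r) \<oplus>\<^bsub>?C\<^esub> (\<lambda>_. s) = (\<lambda>_. r \<oplus> s)" "a \<odot>\<^bsub>?C\<^esub> (\<lambda>_. r) = (\<lambda>_. a \<otimes> r)"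
    "\<zero>\<^bsub>?C\<^esub> = (\<lambda>_. \<zero>)" for a r s
    by (simp_all add: const_module_def)
  have grp: "abelian_group ?C"
  proof (rule abelian_groupI)
    show "\<zero>\<^bsub>?C\<^esub> \<in> carrier ?C" using K(2) by (simp add: ops cl)
    fix f :: "'m \<Rightarrow> 'a" assume "f \<in> carrier ?C"
    then obtain r where r: "r \<in> K" "f = (\<lambda>_. r)" using ex by blast
    show "\<zero>\<^bsub>?C\<^esub> \<oplus>\<^bsub>?C\<^esub> f = f" using r K(4) by (simp add: ops)
    have "(\<lambda>_. \<ominus> r) \<oplus>\<^bsub>?C\<^esub> f = \<zero>\<^bsub>?C\<^esub>" using r K(4) by (simp add: ops l_neg)
    thus "\<exists>g\<in>carrier ?C. g \<oplus>\<^bsub>?C\<^esub> f = \<zero>\<^bsub>?C\<^esub>" using cl[OF K(5)[OF r(1)]] by blast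
    fix g :: "'m \<Rightarrow> 'a" assume "g \<in> carrier ?C"
    then obtain s where s: "s \<in> K" "g = (\<lambda>_. s)" using ex by blast
    show "f \<oplus>\<^bsub>?C\<^esub> g \<in> carrier ?C" using r s K(1) by (simp add: ops cl)
    show "f \<oplus>\<^bsub>?C\<^esub> g = g \<oplus>\<^bsub>?C\<^esub> f" using r s K(4) by (simp add: ops a_comm)
    fix h :: "'m \<Rightarrow> 'a" assume "h \<in> carrier ?C"
    then obtain t where t: "t \<in> K" "h = (\<lambda>_. t)" using ex by blast
    show "f \<oplus>\<^bsub>?C\<^esub> g \<oplus>\<^bsub>?C\<^esub> h = f \<oplus>\<^bsub>?C\<^esub> (g \<oplus>\<^bsub>?C\<^esub> h)" using r s t K(4) by (simp add: ops a_assoc)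
  qed
  show ?thesis
    by (rule moduleI[OF is_cring grp])
       (use K in \<open>auto simp: const_module_def l_distr r_distr m_assoc\<close>)
qed

text \<open>Sending \<open>i \<oplus> b \<otimes> x\<close> to \<open>b d\<close> is well defined on
  \<open>I + (x)\<close>, because \<open>I : x\<close> kills \<open>d\<close>. An extension of this
  map to \<open>R\<close> sends \<open>1\<close> to the required \<open>e\<close>.\<close>

lemma (in cring) injective_baer:
  fixes M :: "('a, 'm) module"
  assumes inj: "injective_module R M"
  shows "baer R M"
  unfolding baer_def
proof (intro allI impI ballI)
  fix I x d
  assume I: "ideal I R" and x: "x \<in> carrier R" and d: "d \<in> killed M (colon R I x)"
  interpret M: pmodule R M using inj by (simp add: injective_module_def pmodule_def)
  have dc: "d \<in> carrier M" using d by (simp add: killed_def)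
  note ID = additive_subgroup.a_closed[OF ideal.axioms(1)[OF I]]
    additive_subgroup.zero_closed[OF ideal.axioms(1)[OF I]] ideal.I_l_closed[OF I]
    ideal.Icarr[OF I] additive_subgroup.a_inv_closed[OF ideal.axioms(1)[OF I]]
  have c: "insert x I \<subseteq> carrier R" using x ID(4) by auto
  let ?K = "Idl (insert x I)"
  have K: "ideal ?K R" by (rule genideal_ideal[OF c])
  have wd: "b \<odot>\<^bsub>M\<^esub> d = b' \<odot>\<^bsub>M\<^esub> d"
    if "i \<in> I" "b \<in> carrier R" "i' \<in> I" "b' \<in> carrier R" "i \<oplus> b \<otimes> x = i' \<oplus> b' \<otimes> x" for i b i' b'
  proof -
    have ic: "i \<in> carrier R" "i' \<in> carrier R" using that ID(4) by auto
    have "(b \<ominus> b') \<otimes> x = b \<otimes> x \<ominus> b' \<otimes> x" using that x by (simp add: a_minus_def l_distr l_minus)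
    also have "b \<otimes> x = \<ominus> i \<oplus> (i' \<oplus> b' \<otimes> x)" using that ic x by (simp add: that(5)[symmetric] r_neg1)
    also have "\<dots> \<ominus> b' \<otimes> x = \<ominus> i \<oplus> i'" using that ic x by (simp add: a_minus_def a_assoc r_neg)
    finally have "(b \<ominus> b') \<otimes> x \<in> I" using ID(1)[OF ID(5)[OF that(1)] that(3)] by simp
    hence "b \<ominus> b' \<in> colon R I x" using that by (simp add: colon_def)
    hence "(b \<ominus> b') \<odot>\<^bsub>M\<^esub> d = \<zero>\<^bsub>M\<^esub>" using d by (simp add: killed_def)
    hence "b \<odot>\<^bsub>M\<^esub> d \<ominus>\<^bsub>M\<^esub> b' \<odot>\<^bsub>M\<^esub> d = \<zero>\<^bsub>M\<^esub>"
      using that dc by (simp add: a_minus_def M.smult_l_distr M.smult_l_minus)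
    thus ?thesis using that dc M.diff_eq_zero_iff by simp
  qed
  define \<phi> where "\<phi> r = (THE y. \<exists>i\<in>I. \<exists>b\<in>carrier R. r = i \<oplus> b \<otimes> x \<and> y = b \<odot>\<^bsub>M\<^esub> d)" for r
  have phi: "\<phi> (i \<oplus> b \<otimes> x) = b \<odot>\<^bsub>M\<^esub> d" if ib: "i \<in> I" "b \<in> carrier R" for i b
    unfolding \<phi>_def
  proof (rule the_equality)
    show "\<exists>i'\<in>I. \<exists>b'\<in>carrier R. i \<oplus> b \<otimes> x = i' \<oplus> b' \<otimes> x \<and> b \<odot>\<^bsub>M\<^esub> d = b' \<odot>\<^bsub>M\<^esub> d" using ib by blast
    fix y assume "\<exists>i'\<in>I. \<exists>b'\<in>carrier R. i \<oplus> b \<otimes> x = i' \<oplus> b' \<otimes> x \<and> y = b' \<odot>\<^bsub>M\<^esub> d"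
    then obtain i' b' where 2: "i' \<in> I" "b' \<in> carrier R" "i \<oplus> b \<otimes> x = i' \<oplus> b' \<otimes> x" "y = b' \<odot>\<^bsub>M\<^esub> d" by blast
    show "y = b \<odot>\<^bsub>M\<^esub> d" using wd[OF ib 2(1-3)] 2(4) by simp
  qed
  have KE: "\<exists>i\<in>I. \<exists>b\<in>carrier R. r = i \<oplus> b \<otimes> x" if "r \<in> ?K" for r
    using that Idl_insert[OF I x] by blast
  let ?A = "const_module R ?K :: ('a, 'm \<Rightarrow> 'a) module"
  let ?B = "const_module R (carrier R) :: ('a, 'm \<Rightarrow> 'a) module"
  \<comment> \<open>The elements of the test module are constant functions; evaluation at any point,
    here \<open>undefined\<close>, returns the ring element.\<close>
  let ?f = "\<lambda>h :: 'm \<Rightarrow> 'a. \<phi> (h undefined)"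
  have AB: "module R ?A" "module R ?B" using const_module K oneideal by auto
  have "?f \<in> mod_hom R ?A M"
  proof (rule mod_homI)
    fix h assume "h \<in> carrier ?A"
    then obtain r where "r \<in> ?K" "h = (\<lambda>_. r)" by (auto simp: const_module_def)
    thus "?f h \<in> carrier M" using KE[of r] phi dc by auto
  next
    fix h k assume "h \<in> carrier ?A" "k \<in> carrier ?A"
    then obtain r s where rs: "r \<in> ?K" "h = (\<lambda>_. r)" "s \<in> ?K" "k = (\<lambda>_. s)" by (auto simp: const_module_def)
    obtain i b where ib: "i \<in> I" "b \<in> carrier R" "r = i \<oplus> b \<otimes> x" using KE[OF rs(1)] by blast
    obtain j c where jc: "j \<in> I" "c \<in> carrier R" "s = j \<oplus> c \<otimes> x" using KE[OF rs(3)] by blast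
    have "r \<oplus> s = (i \<oplus> j) \<oplus> (b \<oplus> c) \<otimes> x" using ib jc x ID(4) by (simp add: l_distr a_ac)
    hence "\<phi> (r \<oplus> s) = (b \<oplus> c) \<odot>\<^bsub>M\<^esub> d" using phi[OF ID(1)[OF ib(1) jc(1)], of "b \<oplus> c"] ib jc by simp
    also have "\<dots> = \<phi> r \<oplus>\<^bsub>M\<^esub> \<phi> s" using phi ib jc dc by (simp add: M.smult_l_distr)
    finally show "?f (h \<oplus>\<^bsub>?A\<^esub> k) = ?f h \<oplus>\<^bsub>M\<^esub> ?f k" using rs by (simp add: const_module_def)
  next
    fix a h assume a: "a \<in> carrier R" and "h \<in> carrier ?A"
    then obtain r where rs: "r \<in> ?K" "h = (\<lambda>_. r)" by (auto simp: const_module_def)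
    obtain i b where ib: "i \<in> I" "b \<in> carrier R" "r = i \<oplus> b \<otimes> x" using KE[OF rs(1)] by blast
    have "a \<otimes> r = (a \<otimes> i) \<oplus> (a \<otimes> b) \<otimes> x" using ib a x ID(4) by (simp add: r_distr m_assoc)
    hence "\<phi> (a \<otimes> r) = (a \<otimes> b) \<odot>\<^bsub>M\<^esub> d" using phi[OF ID(3)[OF ib(1) a], of "a \<otimes> b"] ib a by simp
    also have "\<dots> = a \<odot>\<^bsub>M\<^esub> \<phi> r" using phi ib dc a by (simp add: M.smult_assoc1)
    finally show "?f (a \<odot>\<^bsub>?A\<^esub> h) = a \<odot>\<^bsub>M\<^esub> ?f h" using rs by (simp add: const_module_def)
  qed
  moreover have "(\<lambda>h. h) \<in> mod_hom R ?A ?B"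
    using ideal.Icarr[OF K] by (intro mod_homI) (auto simp: const_module_def)
  moreover have "inj_on (\<lambda>h. h) (carrier ?A)" by simp
  ultimately have "\<exists>h \<in> mod_hom R ?B M. \<forall>u \<in> carrier ?A. h u = ?f u"
    using inj AB unfolding injective_module_def by blast
  then obtain h where h: "h \<in> mod_hom R ?B M" "\<And>u. u \<in> carrier ?A \<Longrightarrow> h u = ?f u" by blast
  let ?e = "h (\<lambda>_. \<one>)"
  have 1: "(\<lambda>_. \<one>) \<in> carrier ?B" by (auto simp: const_module_def)
  have e: "?e \<in> carrier M" by (rule mod_hom_closed[OF h(1) 1])
  have he: "a \<odot>\<^bsub>M\<^esub> ?e = \<phi> a" if a: "a \<in> ?K" for a
  proof -
    have ac: "a \<in> carrier R" using a ideal.Icarr[OF K] by blast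
    have "a \<odot>\<^bsub>M\<^esub> ?e = h (a \<odot>\<^bsub>?B\<^esub> (\<lambda>_. \<one>))" using mod_hom_smult[OF h(1) ac 1] by simp
    also have "a \<odot>\<^bsub>?B\<^esub> (\<lambda>_. \<one>) = (\<lambda>_. a)" using ac by (simp add: const_module_def)
    also have "h (\<lambda>_. a) = \<phi> a" using h(2)[of "\<lambda>_. a"] a by (simp add: const_module_def)
    finally show ?thesis .
  qed
  have sub: "insert x I \<subseteq> ?K" by (rule genideal_self[OF c])
  have "\<phi> x = d" using phi[OF ID(2) one_closed] x dc by simp
  hence xe: "x \<odot>\<^bsub>M\<^esub> ?e = d" using he[of x] sub by simp
  have "i \<odot>\<^bsub>M\<^esub> ?e = \<zero>\<^bsub>M\<^esub>" if i: "i \<in> I" for i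
  proof -
    have "\<phi> i = \<zero>\<^bsub>M\<^esub>" using phi[OF i zero_closed] x dc ID(4)[OF i] by simp
    moreover have "i \<in> ?K" using sub i by blast
    ultimately show ?thesis using he[of i] by simp
  qed
  hence "?e \<in> killed M I" using e by (simp add: killed_def)
  thus "\<exists>e\<in>killed M I. x \<odot>\<^bsub>M\<^esub> e = d" using xe by blast
qed

section \<open>The torsion part with respect to the maximal ideal\<close>

context noetherian_local_ring
begin

lemma torsion_submodule:
  assumes "module R M"
  shows "submodule (torsion_part R m M) R M"
proof -
  interpret M: pmodule R M by (rule pmodule.intro) fact
  have E: "torsion_part R m M = (\<Union>k. killed M (ideal_power R m k))"
    by (auto simp: torsion_part_def killed_def)
  have sub: "submodule (killed M (ideal_power R m k)) R M" for k
    using ideal.Icarr[OF ideal_power_ideal[OF m_ideal]] by (intro M.killed_submodule) blast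
  have mono: "killed M (ideal_power R m k) \<subseteq> killed M (ideal_power R m l)" if "k \<le> l" for k l
    using ideal_power_antimono[OF m_ideal that] by (auto simp: killed_def)
  show ?thesis unfolding E
  proof (rule M.submoduleI')
    show "(\<Union>k. killed M (ideal_power R m k)) \<subseteq> carrier M" by (auto simp: killed_def)
    show "\<zero>\<^bsub>M\<^esub> \<in> (\<Union>k. killed M (ideal_power R m k))" using M.submodule_zero[OF sub[of 0]] by blast
  next
    fix x y assume "x \<in> (\<Union>k. killed M (ideal_power R m k))" "y \<in> (\<Union>k. killed M (ideal_power R m k))"
    then obtain k l where kl: "x \<in> killed M (ideal_power R m k)" "y \<in> killed M (ideal_power R m l)" by blast
    hence "x \<in> killed M (ideal_power R m (max k l))" "y \<in> killed M (ideal_power R m (max k l))"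
      using mono[of k "max k l"] mono[of l "max k l"] by auto
    thus "x \<oplus>\<^bsub>M\<^esub> y \<in> (\<Union>k. killed M (ideal_power R m k))" using M.submoduleE(5)[OF sub] by blast
  next
    fix a x assume "a \<in> carrier R" "x \<in> (\<Union>k. killed M (ideal_power R m k))"
    thus "a \<odot>\<^bsub>M\<^esub> x \<in> (\<Union>k. killed M (ideal_power R m k))" using M.submoduleE(4)[OF sub] by blast
  qed
qed

text \<open>A solution \<open>e\<close> of \<open>I e = 0\<close>, \<open>x e = d\<close> whose annihilator \<open>U\<close> is maximal is
  torsion: if \<open>b d = 0\<close>, then for large \<open>j\<close> the equations \<open>(U + b\<^sup>j) e' = 0\<close>, \<open>x e' = d\<close>
  are still solvable, whence \<open>b\<^sup>j \<in> U\<close>.\<close>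

lemma baer_torsion:
  assumes "module R M" "baer R M"
  shows "baer R (M\<lparr>carrier := torsion_part R m M\<rparr>)"
  unfolding baer_def
proof (intro allI impI ballI)
  interpret M: pmodule R M by (rule pmodule.intro) fact
  fix I x d
  assume I: "ideal I R" and x: "x \<in> carrier R"
    and "d \<in> killed (M\<lparr>carrier := torsion_part R m M\<rparr>) (colon R I x)"
  hence dk: "d \<in> killed M (colon R I x)" and dt: "d \<in> torsion_part R m M"
    using M.submoduleE(1)[OF torsion_submodule[OF assms(1)]] by (auto simp: killed_def)
  define ann where "ann e = {a \<in> carrier R. a \<odot>\<^bsub>M\<^esub> e = \<zero>\<^bsub>M\<^esub>}" for e
  have annI: "ideal (ann e) R" if "e \<in> carrier M" for e unfolding ann_def by (rule M.ann_ideal[OF that])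
  let ?P = "\<lambda>J. \<exists>e\<in>killed M I. x \<odot>\<^bsub>M\<^esub> e = d \<and> J = ann e"
  obtain e0 where e0: "e0 \<in> killed M I" "x \<odot>\<^bsub>M\<^esub> e0 = d" using baerD[OF assms(2) I x dk] by blast
  have "\<exists>J. ?P J \<and> ann e0 \<subseteq> J \<and> (\<forall>K. ?P K \<longrightarrow> J \<subseteq> K \<longrightarrow> K = J)"
    by (rule noetherian_maximal) (use e0 annI in \<open>auto simp: killed_def\<close>)
  then obtain J where J: "?P J" "\<forall>K. ?P K \<longrightarrow> J \<subseteq> K \<longrightarrow> K = J" by (elim exE conjE) simp
  then obtain e where e: "e \<in> killed M I" "x \<odot>\<^bsub>M\<^esub> e = d" "J = ann e" by blast
  have mx: "ann e' = ann e" if "e' \<in> killed M I" "x \<odot>\<^bsub>M\<^esub> e' = d" "ann e \<subseteq> ann e'" for e'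
    using J(2)[THEN spec, of "ann e'"] e(3) that by blast
  have ec: "e \<in> carrier M" using e by (simp add: killed_def)
  note U = annI[OF ec]
  obtain k where k: "\<forall>a \<in> ideal_power R m k. a \<odot>\<^bsub>M\<^esub> d = \<zero>\<^bsub>M\<^esub>" using dt by (auto simp: torsion_part_def)
  have "\<exists>j::nat. a [^] j \<in> ann e" if a: "a \<in> m" for a
  proof -
    have ac: "a \<in> carrier R" using m_sub[OF a] .
    define b where "b = a [^] k"
    have b: "b \<in> carrier R" "b \<odot>\<^bsub>M\<^esub> d = \<zero>\<^bsub>M\<^esub>"
      using ac k power_in_ideal_power[OF m_ideal a, of k] by (auto simp: b_def)
    let ?Q = "\<lambda>J. \<exists>j::nat. J = ann (b [^] j \<odot>\<^bsub>M\<^esub> e)"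
    have "\<exists>J. ?Q J \<and> ann (b [^] (0::nat) \<odot>\<^bsub>M\<^esub> e) \<subseteq> J \<and> (\<forall>K. ?Q K \<longrightarrow> J \<subseteq> K \<longrightarrow> K = J)"
    proof (rule noetherian_maximal)
      show "?Q (ann (b [^] (0::nat) \<odot>\<^bsub>M\<^esub> e))" by (rule exI[of _ 0]) simp
      show "ideal J R" if "?Q J" for J using that annI b ec by auto
    qed
    then obtain J' where "?Q J'" and J': "\<forall>K. ?Q K \<longrightarrow> J' \<subseteq> K \<longrightarrow> K = J'" by blast
    then obtain j :: nat where j: "J' = ann (b [^] j \<odot>\<^bsub>M\<^esub> e)" by blast
    let ?b = "b [^] j"
    have bc: "?b \<in> carrier R" using b by simp
    have step: "b [^] Suc j \<odot>\<^bsub>M\<^esub> e = b \<odot>\<^bsub>M\<^esub> (?b \<odot>\<^bsub>M\<^esub> e)"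
      using b ec by (simp add: M.smult_assoc1[symmetric] m_comm)
    have "ann (?b \<odot>\<^bsub>M\<^esub> e) \<subseteq> ann (b [^] Suc j \<odot>\<^bsub>M\<^esub> e)"
    proof
      fix c assume c: "c \<in> ann (?b \<odot>\<^bsub>M\<^esub> e)"
      hence cc: "c \<in> carrier R" "c \<odot>\<^bsub>M\<^esub> (?b \<odot>\<^bsub>M\<^esub> e) = \<zero>\<^bsub>M\<^esub>" by (auto simp: ann_def)
      have "c \<odot>\<^bsub>M\<^esub> (b \<odot>\<^bsub>M\<^esub> (?b \<odot>\<^bsub>M\<^esub> e)) = b \<odot>\<^bsub>M\<^esub> (c \<odot>\<^bsub>M\<^esub> (?b \<odot>\<^bsub>M\<^esub> e))"
        using b cc(1) bc ec by (intro M.smult_lcomm) auto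
      thus "c \<in> ann (b [^] Suc j \<odot>\<^bsub>M\<^esub> e)" unfolding step using cc b by (simp add: ann_def)
    qed
    moreover have "?Q (ann (b [^] Suc j \<odot>\<^bsub>M\<^esub> e))" by (rule exI[of _ "Suc j"]) simp
    ultimately have stab: "ann (b [^] Suc j \<odot>\<^bsub>M\<^esub> e) = ann (?b \<odot>\<^bsub>M\<^esub> e)" using J' j by simp
    let ?V = "Idl (insert ?b (ann e))"
    have Vc: "insert ?b (ann e) \<subseteq> carrier R" using bc by (auto simp: ann_def)
    have V: "ideal ?V R" "insert ?b (ann e) \<subseteq> ?V" using genideal_ideal[OF Vc] genideal_self[OF Vc] by auto
    \<comment> \<open>If \<open>c x = u + v b^j\<close> with \<open>u e = 0\<close>, then
      \<open>c d = v b^j e\<close>. Since \<open>b = a^k\<close> kills \<open>d\<close>, it kills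
      \<open>c d\<close>, that is, \<open>v b^(j+1) e = 0\<close>; as the ascending annihilators of
      the \<open>b^j e\<close> are stationary at \<open>j\<close>, already
      \<open>v b^j e = 0\<close>.\<close>
    have "d \<in> killed M (colon R ?V x)"
    proof -
      have "c \<odot>\<^bsub>M\<^esub> d = \<zero>\<^bsub>M\<^esub>" if c: "c \<in> colon R ?V x" for c
      proof -
        have cc: "c \<in> carrier R" "c \<otimes> x \<in> ?V" using c by (auto simp: colon_def)
        then obtain u v where uv: "u \<in> ann e" "v \<in> carrier R" "c \<otimes> x = u \<oplus> v \<otimes> ?b"
          using Idl_insert[OF U bc] by blast
        have uc: "u \<in> carrier R" "u \<odot>\<^bsub>M\<^esub> e = \<zero>\<^bsub>M\<^esub>" using uv by (auto simp: ann_def)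
        have cd: "c \<odot>\<^bsub>M\<^esub> d = v \<odot>\<^bsub>M\<^esub> (?b \<odot>\<^bsub>M\<^esub> e)"
        proof -
          have "c \<odot>\<^bsub>M\<^esub> d = (c \<otimes> x) \<odot>\<^bsub>M\<^esub> e" using e(2) cc x ec by (simp add: M.smult_assoc1)
          also have "\<dots> = u \<odot>\<^bsub>M\<^esub> e \<oplus>\<^bsub>M\<^esub> v \<odot>\<^bsub>M\<^esub> (?b \<odot>\<^bsub>M\<^esub> e)"
            unfolding uv(3) using uv uc bc ec by (simp add: M.smult_l_distr M.smult_assoc1)
          finally show ?thesis using uc uv bc ec by simp
        qed
        have "v \<odot>\<^bsub>M\<^esub> (b [^] Suc j \<odot>\<^bsub>M\<^esub> e) = b \<odot>\<^bsub>M\<^esub> (c \<odot>\<^bsub>M\<^esub> d)"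
          unfolding step cd using b bc uv ec by (simp add: M.smult_assoc1[symmetric] m_comm m_lcomm)
        also have "\<dots> = c \<odot>\<^bsub>M\<^esub> (b \<odot>\<^bsub>M\<^esub> d)"
          using b cc dk by (intro M.smult_lcomm) (auto simp: killed_def)
        also have "\<dots> = \<zero>\<^bsub>M\<^esub>" using b cc by simp
        finally have "v \<in> ann (b [^] Suc j \<odot>\<^bsub>M\<^esub> e)" using uv by (simp add: ann_def)
        hence "v \<odot>\<^bsub>M\<^esub> (?b \<odot>\<^bsub>M\<^esub> e) = \<zero>\<^bsub>M\<^esub>" unfolding stab by (simp add: ann_def)
        thus ?thesis using cd by simp
      qed
      thus ?thesis using dk by (simp add: killed_def)
    qed
    then obtain e' where e': "e' \<in> killed M ?V" "x \<odot>\<^bsub>M\<^esub> e' = d" using baerD[OF assms(2) V(1) x] by blast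
    have Va: "?V \<subseteq> ann e'"
      using e' ideal.Icarr[OF V(1)] by (auto simp: killed_def ann_def)
    have "I \<subseteq> ann e" using e ideal.Icarr[OF I] by (auto simp: killed_def ann_def)
    hence "e' \<in> killed M I" using Va V e' by (auto simp: killed_def)
    moreover have "ann e \<subseteq> ann e'" using Va V by blast
    ultimately have "ann e' = ann e" using mx e' by simp
    hence "?b \<in> ann e" using Va V by blast
    thus ?thesis unfolding b_def using ac by (auto simp: nat_pow_pow)
  qed
  then obtain l where l: "ideal_power R m l \<subseteq> ann e" using ideal_power_subset_if_radical[OF U] by blast
  have "e \<in> torsion_part R m M" unfolding torsion_part_def using ec l by (auto simp: ann_def)
  hence "e \<in> killed (M\<lparr>carrier := torsion_part R m M\<rparr>) I" using e by (simp add: killed_def)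
  thus "\<exists>e\<in>killed (M\<lparr>carrier := torsion_part R m M\<rparr>) I. x \<odot>\<^bsub>M\<lparr>carrier := torsion_part R m M\<rparr>\<^esub> e = d"
    using e by auto
qed

end

lemma (in pmodule) span_union_submodule:
  assumes "T \<subseteq> carrier M" "submodule B R M"
  shows "module_span R M (T \<union> B) \<subseteq> {w \<oplus> b | w b. w \<in> module_span R M T \<and> b \<in> B}" (is "_ \<subseteq> ?H")
proof (rule span_minimal)
  note T = submoduleE[OF span_submodule[OF assms(1)]] submodule_zero[OF span_submodule[OF assms(1)]]
  note B = submoduleE[OF assms(2)] submodule_zero[OF assms(2)]
  show "submodule ?H R M"
  proof (rule submoduleI')
    show "?H \<subseteq> carrier M" using T(1) B(1) by auto
    have "\<zero> = \<zero> \<oplus> \<zero>" by simp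
    thus "\<zero> \<in> ?H" using T(7) B(7) by blast
  next
    fix x y assume "x \<in> ?H" "y \<in> ?H"
    then obtain w b w' b' where 1: "w \<in> module_span R M T" "b \<in> B" "x = w \<oplus> b"
      "w' \<in> module_span R M T" "b' \<in> B" "y = w' \<oplus> b'" by blast
    hence "x \<oplus> y = (w \<oplus> w') \<oplus> (b \<oplus> b')"
      using T(1) B(1) by (simp add: subset_iff M.a_ac)
    thus "x \<oplus> y \<in> ?H" using T(5)[OF 1(1,4)] B(5)[OF 1(2,5)] by blast
  next
    fix a x assume a: "a \<in> carrier R" and "x \<in> ?H"
    then obtain w b where 1: "w \<in> module_span R M T" "b \<in> B" "x = w \<oplus> b" by blast
    hence "a \<odot> x = a \<odot> w \<oplus> a \<odot> b"
      using T(1) B(1) a by (simp add: subset_iff smult_r_distr)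
    thus "a \<odot> x \<in> ?H" using T(4)[OF a 1(1)] B(4)[OF a 1(2)] by blast
  qed
  show "T \<union> B \<subseteq> ?H"
  proof
    fix x assume "x \<in> T \<union> B"
    thus "x \<in> ?H"
    proof
      assume x: "x \<in> T"
      hence "x = x \<oplus> \<zero>" "x \<in> module_span R M T" using assms span_incl by auto
      thus ?thesis using B(7) by blast
    next
      assume x: "x \<in> B"
      hence "x = \<zero> \<oplus> x" using B(1) by auto
      thus ?thesis using T(7) x by blast
    qed
  qed
qed

text \<open>Instantiated with \<open>D\<close> and with its \<open>m\<close>-torsion part. For the
  latter, \<open>baer\<close> is what is at hand in place of injectivity of the terms.\<close>

locale baer_complex = noetherian_local_ring R m
  for R :: "('a, 'r) ring_scheme" (structure) and m :: "'a set" +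
  fixes X :: "int \<Rightarrow> ('a, 'd) module" and \<delta> :: "int \<Rightarrow> 'd \<Rightarrow> 'd"
  assumes X_module: "module R (X n)"
    and diff_hom: "\<delta> n \<in> mod_hom R (X n) (X (n + 1))"
    and diff_diff: "x \<in> carrier (X n) \<Longrightarrow> \<delta> (n + 1) (\<delta> n x) = \<zero>\<^bsub>X (n + 1 + 1)\<^esub>"
    and baer: "baer R (X n)"
    and bounded_below: "\<exists>a. \<forall>n<a. zero_module (X n)"
begin

lemma X_pmodule: "pmodule R (X n)"
  by (rule pmodule.intro) (rule X_module)

lemmas X_simps =
  pmodule.diff_self[OF X_pmodule] pmodule.diff_zero[OF X_pmodule]
  pmodule.add_diff_cancel'[OF X_pmodule] pmodule.diff_add_cancel'[OF X_pmodule]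
  module.smult_r_null[OF X_module]
  abelian_monoid.r_zero[OF abelian_group.axioms(1)[OF module.axioms(2)[OF X_module]]]
  abelian_monoid.l_zero[OF abelian_group.axioms(1)[OF module.axioms(2)[OF X_module]]]

lemma diff_closed: "x \<in> carrier (X n) \<Longrightarrow> \<delta> n x \<in> carrier (X (n + 1))"
  by (rule mod_hom_closed[OF diff_hom])

lemma diff_zero: "\<delta> n \<zero>\<^bsub>X n\<^esub> = \<zero>\<^bsub>X (n + 1)\<^esub>"
  by (rule mod_hom_zero[OF X_module X_module diff_hom])

lemma diff_minus: "x \<in> carrier (X n) \<Longrightarrow> y \<in> carrier (X n) \<Longrightarrow> \<delta> n (x \<ominus>\<^bsub>X n\<^esub> y) = \<delta> n x \<ominus>\<^bsub>X (n + 1)\<^esub> \<delta> n y"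
  by (rule mod_hom_diff[OF X_module X_module diff_hom])

lemma diff_killed: "S \<subseteq> carrier R \<Longrightarrow> x \<in> killed (X n) S \<Longrightarrow> \<delta> n x \<in> killed (X (n + 1)) S"
  by (rule mod_hom_killed[OF X_module X_module diff_hom])

lemma killed_carrier: "x \<in> killed (X n) S \<Longrightarrow> x \<in> carrier (X n)"
  by (simp add: killed_def)

lemma ideal_sub: "ideal I R \<Longrightarrow> I \<subseteq> carrier R"
  using ideal.Icarr[of I R] by blast

text \<open>Double induction, on the degree and, within a degree, on the number of generators. The
  long exact sequence relates \<open>I + (c)\<close> in degree \<open>n + 1\<close> to
  \<open>I\<close> in the same degree and to \<open>I : c\<close> in degree \<open>n\<close>; the
  number of generators of \<open>I : c\<close> is out of control, but the degree has dropped. Since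
  \<open>Q\<close> depends on the killed elements only (\<open>congr\<close>), a set and the ideal
  it generates are interchangeable.\<close>

lemma killed_induct:
  fixes Q :: "'a set \<Rightarrow> int \<Rightarrow> bool"
  assumes low: "\<And>S n. S \<subseteq> carrier R \<Longrightarrow> n < a \<Longrightarrow> Q S n"
    and base: "\<And>n. Q {} n"
    and congr: "\<And>S T n. S \<subseteq> carrier R \<Longrightarrow> T \<subseteq> carrier R \<Longrightarrow>
      (\<And>k. killed (X k) S = killed (X k) T) \<Longrightarrow> Q S n \<Longrightarrow> Q T n"
    and step: "\<And>I c n. ideal I R \<Longrightarrow> c \<in> carrier R \<Longrightarrow> Q (colon R I c) n \<Longrightarrow> Q I (n + 1) \<Longrightarrow> Q (insert c I) (n + 1)"
    and S: "S \<subseteq> carrier R"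
  shows "Q S n"
proof -
  have kI: "killed (X k) (Idl T) = killed (X k) T" if "T \<subseteq> carrier R" for T k
  proof -
    interpret Xk: pmodule R "X k" by (rule X_pmodule)
    show ?thesis using Xk.killed_Idl[OF that] .
  qed
  have main: "\<forall>S. S \<subseteq> carrier R \<longrightarrow> Q S (a - 1 + int k)" for k
  proof (induction k)
    case 0
    show ?case using low by simp
  next
    case (Suc k)
    have fin: "Q A (a - 1 + int k + 1)" if "finite A" "A \<subseteq> carrier R" for A
      using that
    proof (induction A)
      case empty
      show ?case by (rule base)
    next
      case (insert c A)
      have I: "ideal (Idl A) R" using insert.prems by (intro genideal_ideal) auto
      have c: "c \<in> carrier R" using insert.prems by simp
      have "Q (Idl A) (a - 1 + int k + 1)"
        by (rule congr[of A]) (use insert kI[of A] ideal_sub[OF I] in auto)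
      moreover have "Q (colon R (Idl A) c) (a - 1 + int k)"
        using Suc ideal_sub[OF colon_ideal[OF I c]] by simp
      ultimately have "Q (insert c (Idl A)) (a - 1 + int k + 1)" by (intro step I c)
      thus ?case
        by (rule congr[rotated 3]) (use insert.prems kI[of A] ideal_sub[OF I] in \<open>auto simp: killed_insert\<close>)
    qed
    show ?case
    proof (intro allI impI)
      fix S assume S: "S \<subseteq> carrier R"
      obtain A where A: "A \<subseteq> carrier R" "finite A" "Idl S = Idl A"
        using finetely_gen[OF genideal_ideal[OF S]] by blast
      have "Q A (a - 1 + int k + 1)" by (rule fin[OF A(2,1)])
      hence "Q S (a - 1 + int k + 1)"
        by (rule congr[rotated 3]) (use A S kI[of A] kI[of S] in simp_all)
      thus "Q S (a - 1 + int (Suc k))" by (simp add: algebra_simps)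
    qed
  qed
  show ?thesis
  proof (cases "n < a")
    case True
    thus ?thesis using low S by blast
  next
    case False
    hence "n = a - 1 + int (nat (n - a + 1))" by simp
    thus ?thesis using main S by metis
  qed
qed

text \<open>To avoid \<open>n - 1\<close>, the exactness and finiteness conditions with index \<open>n\<close> concern cohomology in
  degree \<open>n + 1\<close>. The maps \<open>f\<close> form a chain map to a complex \<open>E\<close> with zero differentials.\<close>

definition exact_aug :: "(int \<Rightarrow> ('a, 'e) module) \<Rightarrow> (int \<Rightarrow> 'd \<Rightarrow> 'e) \<Rightarrow> 'a set \<Rightarrow> int \<Rightarrow> bool" where
  "exact_aug E f S n \<longleftrightarrow> (\<forall>z \<in> killed (X (n + 1)) S. \<delta> (n + 1) z = \<zero>\<^bsub>X (n + 1 + 1)\<^esub> \<longrightarrow>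
     f (n + 1) z = \<zero>\<^bsub>E (n + 1)\<^esub> \<longrightarrow> (\<exists>y \<in> killed (X n) S. \<delta> n y = z \<and> f n y = \<zero>\<^bsub>E n\<^esub>))"

text \<open>The subcomplexes of elements killed by \<open>I + (a)\<close>, \<open>I\<close>, and \<open>I : a\<close> form a short exact
  sequence, whose surjection is multiplication by \<open>a\<close>.\<close>

lemma exact_aug_step:
  assumes E: "\<And>n. module R (E n)" "\<And>n. f n \<in> mod_hom R (X n) (E n)"
    "\<And>n x. x \<in> carrier (X n) \<Longrightarrow> f (n + 1) (\<delta> n x) = \<zero>\<^bsub>E (n + 1)\<^esub>"
    and I: "ideal I R" and a: "a \<in> carrier R"
    and 1: "exact_aug E f (colon R I a) n" and 2: "exact_aug E f I (n + 1)"
  shows "exact_aug E f (insert a I) (n + 1)"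
  unfolding exact_aug_def
proof (intro ballI impI)
  interpret X1: pmodule R "X (n + 1)" by (rule X_pmodule)
  interpret E1: pmodule R "E (n + 1)" by (rule pmodule.intro) (rule E(1))
  note Ic = ideal_sub[OF I]
  fix z assume z: "z \<in> killed (X (n + 1 + 1)) (insert a I)" "\<delta> (n + 1 + 1) z = \<zero>\<^bsub>X (n + 1 + 1 + 1)\<^esub>"
    "f (n + 1 + 1) z = \<zero>\<^bsub>E (n + 1 + 1)\<^esub>"
  then obtain y where y: "y \<in> killed (X (n + 1)) I" "\<delta> (n + 1) y = z" "f (n + 1) y = \<zero>\<^bsub>E (n + 1)\<^esub>"
    using 2 unfolding exact_aug_def killed_insert by blast
  have yc: "y \<in> carrier (X (n + 1))" by (rule killed_carrier[OF y(1)])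
  \<comment> \<open>\<open>a y\<close> is a cocycle killed by \<open>I : a\<close>, hence the
    boundary of some \<open>w\<close>. Dividing \<open>w\<close> by \<open>a\<close> within the
    elements killed by \<open>I\<close> gives \<open>e\<close>, and \<open>y - \<delta> e\<close>
    has the same boundary as \<open>y\<close> but is also killed by \<open>a\<close>.\<close>
  have "\<delta> (n + 1) (a \<odot>\<^bsub>X (n + 1)\<^esub> y) = \<zero>\<^bsub>X (n + 1 + 1)\<^esub>"
    using mod_hom_smult[OF diff_hom a yc] y(2) z(1) by (simp add: killed_insert)
  moreover have "f (n + 1) (a \<odot>\<^bsub>X (n + 1)\<^esub> y) = \<zero>\<^bsub>E (n + 1)\<^esub>"
    using mod_hom_smult[OF E(2) a yc] y(3) a by simp
  ultimately obtain w where w: "w \<in> killed (X n) (colon R I a)" "\<delta> n w = a \<odot>\<^bsub>X (n + 1)\<^esub> y"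
    using 1 X1.smult_killed_colon[OF y(1) a] unfolding exact_aug_def by blast
  obtain e where e: "e \<in> killed (X n) I" "a \<odot>\<^bsub>X n\<^esub> e = w" using baerD[OF baer I a w(1)] by blast
  have ec: "e \<in> carrier (X n)" by (rule killed_carrier[OF e(1)])
  let ?y = "y \<ominus>\<^bsub>X (n + 1)\<^esub> \<delta> n e"
  have dec: "\<delta> n e \<in> carrier (X (n + 1))" by (rule diff_closed[OF ec])
  have "?y \<in> killed (X (n + 1)) I"
    by (rule X1.submodule_diff[OF X1.killed_submodule[OF Ic] y(1) diff_killed[OF Ic e(1)]])
  moreover have "a \<odot>\<^bsub>X (n + 1)\<^esub> ?y = \<zero>\<^bsub>X (n + 1)\<^esub>"
    using X1.smult_diff[OF a yc dec] mod_hom_smult[OF diff_hom a ec] e w yc a dec by (simp add: X_simps)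
  moreover have "\<delta> (n + 1) ?y = z"
    using diff_minus[OF yc dec] diff_diff[OF ec] y(2) killed_carrier[OF z(1)] by (simp add: X_simps)
  moreover have "f (n + 1) ?y = \<zero>\<^bsub>E (n + 1)\<^esub>"
    using mod_hom_diff[OF X_module E(1) E(2) yc dec] y(3) E(3)[OF ec] by (simp add: E1.diff_self)
  ultimately show "\<exists>y\<in>killed (X (n + 1)) (insert a I). \<delta> (n + 1) y = z \<and> f (n + 1) y = \<zero>\<^bsub>E (n + 1)\<^esub>"
    unfolding killed_insert by blast
qed

lemma exact_aug_all:
  assumes E: "\<And>n. module R (E n)" "\<And>n. f n \<in> mod_hom R (X n) (E n)"
    "\<And>n x. x \<in> carrier (X n) \<Longrightarrow> f (n + 1) (\<delta> n x) = \<zero>\<^bsub>E (n + 1)\<^esub>"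
    and base: "\<And>n. exact_aug E f {} n" and S: "S \<subseteq> carrier R"
  shows "exact_aug E f S n"
proof -
  obtain a where a: "\<forall>n<a. zero_module (X n)" using bounded_below by blast
  show ?thesis
  proof (rule killed_induct[where a = "a - 1" and Q = "exact_aug E f", OF _ base _ _ S])
    fix S n assume S: "S \<subseteq> carrier R" and n: "n < a - 1"
    interpret X0: pmodule R "X n" by (rule X_pmodule)
    have "\<zero>\<^bsub>X n\<^esub> \<in> killed (X n) S" by (rule X0.submodule_zero[OF X0.killed_submodule[OF S]])
    moreover have "carrier (X (n + 1)) = {\<zero>\<^bsub>X (n + 1)\<^esub>}" using a n by (simp add: zero_module_def)
    hence "z = \<zero>\<^bsub>X (n + 1)\<^esub>" if "z \<in> killed (X (n + 1)) S" for z
      using killed_carrier[OF that] by simp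
    ultimately show "exact_aug E f S n"
      unfolding exact_aug_def using diff_zero[of n] mod_hom_zero[OF X_module E(1) E(2), of n] by blast
  next
    fix S T n assume "\<And>k. killed (X k) S = killed (X k) T" "exact_aug E f S n"
    thus "exact_aug E f T n" by (simp add: exact_aug_def)
  next
    fix I c n assume "ideal I R" "c \<in> carrier R" "exact_aug E f (colon R I c) n" "exact_aug E f I (n + 1)"
    thus "exact_aug E f (insert c I) (n + 1)" by (intro exact_aug_step E)
  qed
qed

text \<open>For a complex of injective modules this is the vanishing of \<open>Ext\<close> from
  \<open>R / (S)\<close> to \<open>X\<close> in degree \<open>n + 1\<close>.\<close>

definition exact_killed :: "'a set \<Rightarrow> int \<Rightarrow> bool" where
  "exact_killed S n \<longleftrightarrow> (\<forall>z \<in> killed (X (n + 1)) S. \<delta> (n + 1) z = \<zero>\<^bsub>X (n + 1 + 1)\<^esub> \<longrightarrow>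
     (\<exists>y \<in> killed (X n) S. \<delta> n y = z))"

lemma exact_killed_iff_aug: "exact_killed S n \<longleftrightarrow> exact_aug X (\<lambda>n x. \<zero>\<^bsub>X n\<^esub>) S n"
  by (simp add: exact_killed_def exact_aug_def)

lemma exact_killed_step:
  assumes "ideal I R" "a \<in> carrier R" "exact_killed (colon R I a) n" "exact_killed I (n + 1)"
  shows "exact_killed (insert a I) (n + 1)"
  unfolding exact_killed_iff_aug
  by (rule exact_aug_step)
     (use assms in \<open>auto simp: X_module mod_hom_zero_map exact_killed_iff_aug\<close>)

text \<open>In the long exact sequence, the cohomology for \<open>I\<close> stands between that for
  \<open>I + (a)\<close> and that for \<open>I : a\<close> in the same degree.\<close>

lemma exact_killed_middle:
  assumes I: "ideal I R" and a: "a \<in> carrier R"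
    and 1: "exact_killed (insert a I) n" and 2: "exact_killed (colon R I a) n"
  shows "exact_killed I n"
  unfolding exact_killed_def
proof (intro ballI impI)
  interpret X0: pmodule R "X n" by (rule X_pmodule)
  interpret X1: pmodule R "X (n + 1)" by (rule X_pmodule)
  note Ic = ideal_sub[OF I]
  fix z assume z: "z \<in> killed (X (n + 1)) I" "\<delta> (n + 1) z = \<zero>\<^bsub>X (n + 1 + 1)\<^esub>"
  have zc: "z \<in> carrier (X (n + 1))" by (rule killed_carrier[OF z(1)])
  have "\<delta> (n + 1) (a \<odot>\<^bsub>X (n + 1)\<^esub> z) = \<zero>\<^bsub>X (n + 1 + 1)\<^esub>"
    using mod_hom_smult[OF diff_hom a zc] z(2) a by (simp add: X_simps)
  then obtain w where w: "w \<in> killed (X n) (colon R I a)" "\<delta> n w = a \<odot>\<^bsub>X (n + 1)\<^esub> z"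
    using 2 X1.smult_killed_colon[OF z(1) a] unfolding exact_killed_def by blast
  obtain e where e: "e \<in> killed (X n) I" "a \<odot>\<^bsub>X n\<^esub> e = w" using baerD[OF baer I a w(1)] by blast
  have ec: "e \<in> carrier (X n)" by (rule killed_carrier[OF e(1)])
  have dec: "\<delta> n e \<in> carrier (X (n + 1))" by (rule diff_closed[OF ec])
  let ?z = "z \<ominus>\<^bsub>X (n + 1)\<^esub> \<delta> n e"
  have "?z \<in> killed (X (n + 1)) I"
    by (rule X1.submodule_diff[OF X1.killed_submodule[OF Ic] z(1) diff_killed[OF Ic e(1)]])
  moreover have "a \<odot>\<^bsub>X (n + 1)\<^esub> ?z = \<zero>\<^bsub>X (n + 1)\<^esub>"
    using X1.smult_diff[OF a zc dec] mod_hom_smult[OF diff_hom a ec] e w zc a dec by (simp add: X_simps)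
  moreover have "\<delta> (n + 1) ?z = \<zero>\<^bsub>X (n + 1 + 1)\<^esub>"
    using diff_minus[OF zc dec] diff_diff[OF ec] z(2) by (simp add: pmodule.diff_self[OF X_pmodule] module.axioms(2)[OF X_module] abelian_group.axioms(1) abelian_monoid.zero_closed)
  ultimately obtain y where y: "y \<in> killed (X n) I" "\<delta> n y = ?z"
    using 1 unfolding exact_killed_def killed_insert by blast
  have yc: "y \<in> carrier (X n)" by (rule killed_carrier[OF y(1)])
  have "\<delta> n (y \<oplus>\<^bsub>X n\<^esub> e) = z"
    using mod_hom_add[OF diff_hom yc ec] y(2) zc dec by (simp add: X1.diff_add_cancel')
  moreover have "y \<oplus>\<^bsub>X n\<^esub> e \<in> killed (X n) I"
    by (rule X0.submoduleE(5)[OF X0.killed_submodule[OF Ic] y(1) e(1)])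
  ultimately show "\<exists>y\<in>killed (X n) I. \<delta> n y = z" by blast
qed

text \<open>The connecting map sends \<open>z\<close> to the cohomology for \<open>I + (a)\<close>
  in degree \<open>n + 2\<close>, which is zero by assumption; so the quotient \<open>e\<close> of
  \<open>z\<close> by \<open>a\<close> can be corrected to a cocycle.\<close>

lemma cocycle_divisible:
  assumes I: "ideal I R" and a: "a \<in> carrier R"
    and 1: "exact_killed (insert a I) (n + 1)"
    and z: "z \<in> killed (X (n + 1)) (colon R I a)" "\<delta> (n + 1) z = \<zero>\<^bsub>X (n + 1 + 1)\<^esub>"
  shows "\<exists>y \<in> killed (X (n + 1)) I. \<delta> (n + 1) y = \<zero>\<^bsub>X (n + 1 + 1)\<^esub> \<and> a \<odot>\<^bsub>X (n + 1)\<^esub> y = z"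
proof -
  interpret X1: pmodule R "X (n + 1)" by (rule X_pmodule)
  note Ic = ideal_sub[OF I]
  obtain e where e: "e \<in> killed (X (n + 1)) I" "a \<odot>\<^bsub>X (n + 1)\<^esub> e = z" using baerD[OF baer I a z(1)] by blast
  have ec: "e \<in> carrier (X (n + 1))" by (rule killed_carrier[OF e(1)])
  have "a \<odot>\<^bsub>X (n + 1 + 1)\<^esub> \<delta> (n + 1) e = \<zero>\<^bsub>X (n + 1 + 1)\<^esub>"
    using mod_hom_smult[OF diff_hom a ec] e z by simp
  then obtain y where y: "y \<in> killed (X (n + 1)) (insert a I)" "\<delta> (n + 1) y = \<delta> (n + 1) e"
    using 1 diff_killed[OF Ic e(1)] diff_diff[OF ec] unfolding exact_killed_def killed_insert by blast
  have yI: "y \<in> killed (X (n + 1)) I" "a \<odot>\<^bsub>X (n + 1)\<^esub> y = \<zero>\<^bsub>X (n + 1)\<^esub>" using y(1) by (auto simp: killed_insert)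
  have yc: "y \<in> carrier (X (n + 1))" by (rule killed_carrier[OF yI(1)])
  have "e \<ominus>\<^bsub>X (n + 1)\<^esub> y \<in> killed (X (n + 1)) I"
    by (rule X1.submodule_diff[OF X1.killed_submodule[OF Ic] e(1) yI(1)])
  moreover have "\<delta> (n + 1) (e \<ominus>\<^bsub>X (n + 1)\<^esub> y) = \<zero>\<^bsub>X (n + 1 + 1)\<^esub>"
    using diff_minus[OF ec yc] y(2) diff_closed[OF ec] by (simp add: X_simps)
  moreover have "a \<odot>\<^bsub>X (n + 1)\<^esub> (e \<ominus>\<^bsub>X (n + 1)\<^esub> y) = z"
    using X1.smult_diff[OF a ec yc] yI(2) e(2) killed_carrier[OF z(1)] by (simp add: X1.diff_zero)
  ultimately show ?thesis by blast
qed

definition cocyc :: "'a set \<Rightarrow> int \<Rightarrow> 'd set" where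
  "cocyc S n = {z \<in> killed (X (n + 1)) S. \<delta> (n + 1) z = \<zero>\<^bsub>X (n + 1 + 1)\<^esub>}"

definition cobound :: "'a set \<Rightarrow> int \<Rightarrow> 'd set" where
  "cobound S n = \<delta> n ` killed (X n) S"

lemma exact_killed_alt: "exact_killed S n \<longleftrightarrow> cocyc S n \<subseteq> cobound S n"
  unfolding exact_killed_def cocyc_def cobound_def by blast

lemma cocyc_submodule: "S \<subseteq> carrier R \<Longrightarrow> submodule (cocyc S n) R (X (n + 1))"
proof -
  interpret X1: pmodule R "X (n + 1)" by (rule X_pmodule)
  assume S: "S \<subseteq> carrier R"
  have "cocyc S n = killed (X (n + 1)) S \<inter> {x \<in> carrier (X (n + 1)). \<delta> (n + 1) x = \<zero>\<^bsub>X (n + 1 + 1)\<^esub>}"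
    by (auto simp: cocyc_def killed_def)
  thus ?thesis
    using X1.submodule_Int[OF X1.killed_submodule[OF S] kernel_submodule[OF X_module X_module diff_hom]] by simp
qed

lemma cobound_submodule: "S \<subseteq> carrier R \<Longrightarrow> submodule (cobound S n) R (X (n + 1))"
proof -
  interpret X0: pmodule R "X n" by (rule X_pmodule)
  assume S: "S \<subseteq> carrier R"
  show ?thesis unfolding cobound_def
    by (rule image_submodule[OF X_module X_module diff_hom X0.killed_submodule[OF S]])
qed

lemma cobound_cocyc: "S \<subseteq> carrier R \<Longrightarrow> cobound S n \<subseteq> cocyc S n"
  unfolding cobound_def cocyc_def using diff_killed diff_diff killed_carrier by blast

definition fg_killed :: "'a set \<Rightarrow> int \<Rightarrow> bool" where
  "fg_killed S n \<longleftrightarrow> (\<exists>F \<subseteq> cocyc S n. finite F \<and>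
     cocyc S n \<subseteq> module_span R (X (n + 1)) (F \<union> cobound S n))"

text \<open>By the long exact sequence, the cohomology for \<open>I + (a)\<close> is an extension of
  a submodule of the one for \<open>I\<close> by a quotient of the one for \<open>I : a\<close>, one
  degree lower. Generators of the former lift to \<open>T1\<close>; \<open>T2\<close> consists of
  the connecting images of generators of the latter.\<close>

lemma fg_killed_step:
  assumes I: "ideal I R" and a: "a \<in> carrier R"
    and 1: "fg_killed (colon R I a) n" and 2: "fg_killed I (n + 1)"
  shows "fg_killed (insert a I) (n + 1)"
proof -
  interpret X1: pmodule R "X (n + 1)" by (rule X_pmodule)
  interpret X2: pmodule R "X (n + 1 + 1)" by (rule X_pmodule)
  note Ic = ideal_sub[OF I]
  have Jc: "insert a I \<subseteq> carrier R" using Ic a by simp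
  note Cc = ideal_sub[OF colon_ideal[OF I a]]
  let ?Z = "cocyc (insert a I) (n + 1)" and ?BI = "cobound I (n + 1)" and ?B = "cobound (insert a I) (n + 1)"
  let ?M = "X (n + 1 + 1)" and ?N = "X (n + 1)"
  note Zsub = cocyc_submodule[OF Jc, of "n + 1"] and BIsub = cobound_submodule[OF Ic, of "n + 1"]
  note Bsub = cobound_submodule[OF Jc, of "n + 1"]
  have Zc: "?Z \<subseteq> carrier ?M" and BIc: "?BI \<subseteq> carrier ?M" and Bc: "?B \<subseteq> carrier ?M"
    using X2.submoduleE(1) Zsub BIsub Bsub by auto
  obtain F where F: "F \<subseteq> cocyc I (n + 1)" "finite F"
    "cocyc I (n + 1) \<subseteq> module_span R ?M (F \<union> ?BI)" using 2 unfolding fg_killed_def by blast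
  have Fc: "F \<subseteq> carrier ?M" using F(1) X2.submoduleE(1)[OF cocyc_submodule[OF Ic]] by blast
  have ZI: "?Z \<subseteq> cocyc I (n + 1)" by (auto simp: cocyc_def killed_insert)
  let ?U = "module_span R ?M (?Z \<union> ?BI)"
  have ZBc: "?Z \<union> ?BI \<subseteq> carrier ?M" using Zc BIc by simp
  note Usub = X2.span_submodule[OF ZBc]
  have "?U \<subseteq> cocyc I (n + 1)"
    by (rule X2.span_minimal[OF cocyc_submodule[OF Ic]]) (use ZI cobound_cocyc[OF Ic] in blast)
  hence UF: "?U \<subseteq> module_span R ?M (F \<union> ?BI)" using F(3) by blast
  have BIU: "?BI \<subseteq> ?U" using X2.span_incl by blast
  obtain T where T: "T \<subseteq> ?U" "finite T" "?U \<subseteq> module_span R ?M (T \<union> ?BI)"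
    using noetherian_submodule[OF X_module F(2) Fc BIsub Usub BIU UF] by blast
  have "\<forall>t\<in>T. \<exists>z\<in>?Z. \<exists>b\<in>?BI. t = z \<oplus>\<^bsub>?M\<^esub> b"
  proof
    fix t assume "t \<in> T"
    hence "t \<in> ?U" using T by blast
    then obtain w b where wb: "w \<in> module_span R ?M ?Z" "b \<in> ?BI" "t = w \<oplus>\<^bsub>?M\<^esub> b"
      using X2.span_union_submodule[OF Zc BIsub] by blast
    thus "\<exists>z\<in>?Z. \<exists>b\<in>?BI. t = z \<oplus>\<^bsub>?M\<^esub> b" using X2.span_of_submodule[OF Zsub] by auto
  qed
  then obtain g where g: "\<And>t. t \<in> T \<Longrightarrow> g t \<in> ?Z \<and> (\<exists>b\<in>?BI. t = g t \<oplus>\<^bsub>?M\<^esub> b)" by metis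
  let ?T1 = "g ` T"
  have T1: "?T1 \<subseteq> ?Z" "finite ?T1" using g T by auto
  have T1c: "?T1 \<subseteq> carrier ?M" using T1 Zc by blast
  have T1Bc: "?T1 \<union> ?BI \<subseteq> carrier ?M" using T1c BIc by simp
  have "T \<subseteq> module_span R ?M (?T1 \<union> ?BI)"
  proof
    fix t assume t: "t \<in> T"
    then obtain b where b: "b \<in> ?BI" "t = g t \<oplus>\<^bsub>?M\<^esub> b" using g by blast
    have "g t \<in> module_span R ?M (?T1 \<union> ?BI)" "b \<in> module_span R ?M (?T1 \<union> ?BI)"
      using t b(1) X2.span_incl[of "?T1 \<union> ?BI"] by auto
    thus "t \<in> module_span R ?M (?T1 \<union> ?BI)"
      using X2.submoduleE(5)[OF X2.span_submodule[OF T1Bc]] b(2) by metis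
  qed
  hence "module_span R ?M (T \<union> ?BI) \<subseteq> module_span R ?M (?T1 \<union> ?BI)"
    using X2.span_incl[of "?T1 \<union> ?BI"] by (intro X2.span_minimal[OF X2.span_submodule[OF T1Bc]]) auto
  hence UT1: "?U \<subseteq> module_span R ?M (?T1 \<union> ?BI)" using T by blast
  obtain F2 where F2: "F2 \<subseteq> cocyc (colon R I a) n" "finite F2"
    "cocyc (colon R I a) n \<subseteq> module_span R ?N (F2 \<union> cobound (colon R I a) n)"
    using 1 unfolding fg_killed_def by blast
  have F2c: "F2 \<subseteq> carrier ?N"
    using F2(1) X1.submoduleE(1)[OF cocyc_submodule[OF Cc]] by blast
  have "\<forall>t\<in>F2. \<exists>e\<in>killed ?N I. a \<odot>\<^bsub>?N\<^esub> e = t"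
    using F2(1) baerD[OF baer I a] unfolding cocyc_def by blast
  then obtain h where h: "\<And>t. t \<in> F2 \<Longrightarrow> h t \<in> killed ?N I \<and> a \<odot>\<^bsub>?N\<^esub> h t = t" by metis
  let ?T2 = "(\<lambda>t. \<delta> (n + 1) (h t)) ` F2"
  have T2: "?T2 \<subseteq> ?Z"
  proof
    fix u assume "u \<in> ?T2"
    then obtain t where t: "t \<in> F2" "u = \<delta> (n + 1) (h t)" by blast
    have hc: "h t \<in> carrier ?N" using h[OF t(1)] killed_carrier by blast
    have "a \<odot>\<^bsub>?M\<^esub> u = \<delta> (n + 1) t" using mod_hom_smult[OF diff_hom a hc] h[OF t(1)] t by simp
    also have "\<dots> = \<zero>\<^bsub>?M\<^esub>" using t F2(1) by (auto simp: cocyc_def)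
    finally show "u \<in> ?Z"
      using diff_killed[OF Ic, of "h t" "n + 1"] h[OF t(1)] t diff_diff[OF hc] by (simp add: cocyc_def killed_insert)
  qed
  have T2c: "?T2 \<subseteq> carrier ?M" using T2 Zc by blast
  let ?S = "module_span R ?M (?T1 \<union> ?T2 \<union> ?B)"
  have Sc: "?T1 \<union> ?T2 \<union> ?B \<subseteq> carrier ?M" using T1c T2c Bc by simp
  note Ssub = X2.span_submodule[OF Sc]
  have Sincl: "?T1 \<subseteq> ?S" "?T2 \<subseteq> ?S" "?B \<subseteq> ?S" using X2.span_incl[of "?T1 \<union> ?T2 \<union> ?B"] by auto
  \<comment> \<open>The quotients \<open>h t\<close> by \<open>a\<close> were chosen for the
    generators in \<open>F2\<close> only. The elements that have some quotient with boundary in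
    \<open>?S\<close> form a submodule, which covers the whole span of \<open>F2\<close>.\<close>
  have lift: "\<exists>e\<in>killed ?N I. a \<odot>\<^bsub>?N\<^esub> e = w \<and> \<delta> (n + 1) e \<in> ?S"
    if "w \<in> module_span R ?N F2" for w
  proof -
    let ?H = "{w \<in> carrier ?N. \<exists>e\<in>killed ?N I. a \<odot>\<^bsub>?N\<^esub> e = w \<and> \<delta> (n + 1) e \<in> ?S}"
    note K = X1.submoduleE[OF X1.killed_submodule[OF Ic]] X1.submodule_zero[OF X1.killed_submodule[OF Ic]]
    note SD = X2.submoduleE[OF Ssub] X2.submodule_zero[OF Ssub]
    have "submodule ?H R ?N"
    proof (rule X1.submoduleI')
      show "?H \<subseteq> carrier ?N" by blast
      show "\<zero>\<^bsub>?N\<^esub> \<in> ?H"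
        using K(7) SD(7) a by (auto intro!: bexI[of _ "\<zero>\<^bsub>?N\<^esub>"] simp: diff_zero)
    next
      fix x y assume "x \<in> ?H" "y \<in> ?H"
      then obtain e e' where e: "e \<in> killed ?N I" "a \<odot>\<^bsub>?N\<^esub> e = x" "\<delta> (n + 1) e \<in> ?S"
        "e' \<in> killed ?N I" "a \<odot>\<^bsub>?N\<^esub> e' = y" "\<delta> (n + 1) e' \<in> ?S" "x \<in> carrier ?N"
        "y \<in> carrier ?N" by blast
      have ec: "e \<in> carrier ?N" "e' \<in> carrier ?N" using e killed_carrier by auto
      have "a \<odot>\<^bsub>?N\<^esub> (e \<oplus>\<^bsub>?N\<^esub> e') = x \<oplus>\<^bsub>?N\<^esub> y" using e ec a by (simp add: X1.smult_r_distr)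
      moreover have "\<delta> (n + 1) (e \<oplus>\<^bsub>?N\<^esub> e') \<in> ?S"
        using mod_hom_add[OF diff_hom ec] SD(5)[OF e(3,6)] by simp
      ultimately show "x \<oplus>\<^bsub>?N\<^esub> y \<in> ?H" using K(5)[OF e(1,4)] e(7,8) by blast
    next
      fix c x assume c: "c \<in> carrier R" and "x \<in> ?H"
      then obtain e where e: "e \<in> killed ?N I" "a \<odot>\<^bsub>?N\<^esub> e = x" "\<delta> (n + 1) e \<in> ?S"
        "x \<in> carrier ?N" by blast
      have ec: "e \<in> carrier ?N" using e killed_carrier by auto
      have "a \<odot>\<^bsub>?N\<^esub> (c \<odot>\<^bsub>?N\<^esub> e) = c \<odot>\<^bsub>?N\<^esub> x"
        using X1.smult_lcomm[OF a c ec] e by simp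
      moreover have "\<delta> (n + 1) (c \<odot>\<^bsub>?N\<^esub> e) \<in> ?S"
        using mod_hom_smult[OF diff_hom c ec] SD(4)[OF c e(3)] by simp
      ultimately show "c \<odot>\<^bsub>?N\<^esub> x \<in> ?H" using K(4)[OF c e(1)] e(4) c by blast
    qed
    moreover have "F2 \<subseteq> ?H" using h F2c Sincl by blast
    ultimately have "module_span R ?N F2 \<subseteq> ?H" by (rule X1.span_minimal)
    thus ?thesis using that by blast
  qed
  have "?Z \<subseteq> ?S"
  proof
    fix z assume z: "z \<in> ?Z"
    hence "z \<in> ?U" using X2.span_incl[of "?Z \<union> ?BI"] by blast
    then obtain w b where wb: "w \<in> module_span R ?M ?T1" "b \<in> ?BI" "z = w \<oplus>\<^bsub>?M\<^esub> b"
      using UT1 X2.span_union_submodule[OF T1c BIsub] by blast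
    have wZ: "w \<in> ?Z" using wb(1) X2.span_minimal[OF Zsub T1(1)] by blast
    have wS: "w \<in> ?S" using wb(1) X2.span_minimal[OF Ssub Sincl(1)] by blast
    have wc: "w \<in> carrier ?M" and bc: "b \<in> carrier ?M" using wZ Zc wb BIc by auto
    have "z \<ominus>\<^bsub>?M\<^esub> w = b" using wb(3) wc bc X2.M.a_comm[of w b] by (simp add: X_simps)
    hence bZ: "b \<in> ?Z" using X2.submodule_diff[OF Zsub z wZ] by simp
    obtain y where y: "y \<in> killed ?N I" "b = \<delta> (n + 1) y" using wb(2) by (auto simp: cobound_def)
    have yc: "y \<in> carrier ?N" using y killed_carrier by blast
    have "\<delta> (n + 1) (a \<odot>\<^bsub>?N\<^esub> y) = \<zero>\<^bsub>?M\<^esub>"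
      using mod_hom_smult[OF diff_hom a yc] y(2) bZ by (simp add: cocyc_def killed_insert)
    hence "a \<odot>\<^bsub>?N\<^esub> y \<in> cocyc (colon R I a) n"
      using X1.smult_killed_colon[OF y(1) a] by (simp add: cocyc_def)
    then obtain w2 c where wc2: "w2 \<in> module_span R ?N F2" "c \<in> cobound (colon R I a) n"
      "a \<odot>\<^bsub>?N\<^esub> y = w2 \<oplus>\<^bsub>?N\<^esub> c"
      using F2(3) X1.span_union_submodule[OF F2c cobound_submodule[OF Cc]] by blast
    obtain e where e: "e \<in> killed ?N I" "a \<odot>\<^bsub>?N\<^esub> e = w2" "\<delta> (n + 1) e \<in> ?S"
      using lift[OF wc2(1)] by blast
    obtain v where v: "v \<in> killed (X n) (colon R I a)" "c = \<delta> n v" using wc2(2) by (auto simp: cobound_def)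
    obtain v' where v': "v' \<in> killed (X n) I" "a \<odot>\<^bsub>X n\<^esub> v' = v" using baerD[OF baer I a v(1)] by blast
    have ec: "e \<in> carrier ?N" and vc: "v' \<in> carrier (X n)" using e v' killed_carrier by auto
    let ?dv = "\<delta> n v'"
    have dvc: "?dv \<in> carrier ?N" by (rule diff_closed[OF vc])
    have c_eq: "c = a \<odot>\<^bsub>?N\<^esub> ?dv" using mod_hom_smult[OF diff_hom a vc] v v' by simp
    let ?ev = "e \<oplus>\<^bsub>?N\<^esub> ?dv"
    have evc: "?ev \<in> carrier ?N" using ec dvc by simp
    have evI: "?ev \<in> killed ?N I"
      by (rule X1.submoduleE(5)[OF X1.killed_submodule[OF Ic] e(1) diff_killed[OF Ic v'(1)]])
    have aev: "a \<odot>\<^bsub>?N\<^esub> ?ev = a \<odot>\<^bsub>?N\<^esub> y"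
      using wc2(3) e(2) c_eq X1.smult_r_distr[OF a ec dvc] by simp
    have "y \<ominus>\<^bsub>?N\<^esub> ?ev \<in> killed ?N (insert a I)"
      using X1.submodule_diff[OF X1.killed_submodule[OF Ic] y(1) evI] X1.smult_diff[OF a yc evc] aev yc a
      by (simp add: killed_insert X1.diff_self)
    hence "\<delta> (n + 1) (y \<ominus>\<^bsub>?N\<^esub> ?ev) \<in> ?B" by (simp add: cobound_def)
    hence 3: "b \<ominus>\<^bsub>?M\<^esub> \<delta> (n + 1) ?ev \<in> ?S" using Sincl diff_minus[OF yc evc] y(2) by auto
    have "\<delta> (n + 1) ?ev = \<delta> (n + 1) e"
      using mod_hom_add[OF diff_hom ec dvc] diff_diff[OF vc] diff_closed[OF ec] by (simp add: X_simps)
    hence 4: "\<delta> (n + 1) ?ev \<in> ?S" using e by simp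
    have "(b \<ominus>\<^bsub>?M\<^esub> \<delta> (n + 1) ?ev) \<oplus>\<^bsub>?M\<^esub> \<delta> (n + 1) ?ev = b"
      by (rule X2.diff_add_cancel'[OF bc diff_closed[OF evc]])
    hence "b \<in> ?S" using X2.submoduleE(5)[OF Ssub 3 4] by simp
    thus "z \<in> ?S" using X2.submoduleE(5)[OF Ssub wS] wb(3) by simp
  qed
  thus ?thesis unfolding fg_killed_def using T1 T2 F2(2) by (intro exI[of _ "?T1 \<union> ?T2"]) simp
qed

lemma fg_killed_all:
  assumes base: "\<And>n. fg_killed {} n" and S: "S \<subseteq> carrier R"
  shows "fg_killed S n"
proof -
  obtain a where a: "\<forall>n<a. zero_module (X n)" using bounded_below by blast
  show ?thesis
  proof (rule killed_induct[where a = "a - 1" and Q = "fg_killed", OF _ base _ fg_killed_step S])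
    fix S n assume S: "S \<subseteq> carrier R" and n: "n < a - 1"
    interpret X1: pmodule R "X (n + 1)" by (rule X_pmodule)
    have "cocyc S n \<subseteq> {\<zero>\<^bsub>X (n + 1)\<^esub>}" using a n by (auto simp: zero_module_def cocyc_def killed_def)
    moreover have "\<zero>\<^bsub>X (n + 1)\<^esub> \<in> cobound S n" by (rule X1.submodule_zero[OF cobound_submodule[OF S]])
    ultimately show "fg_killed S n"
      unfolding fg_killed_def using X1.span_incl[of "cobound S n"] by (intro exI[of _ "{}"]) auto
  next
    fix S T n assume "\<And>k. killed (X k) S = killed (X k) T" "fg_killed S n"
    thus "fg_killed T n" by (simp add: fg_killed_def cocyc_def cobound_def)
  qed
qed

lemma nakayama_cocycles:
  assumes fg: "fg_killed S n" and S: "S \<subseteq> carrier R"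
    and m: "cocyc S n \<subseteq> module_span R (X (n + 1)) ({a \<odot>\<^bsub>X (n + 1)\<^esub> z | a z. a \<in> m \<and> z \<in> cocyc S n} \<union> cobound S n)"
  shows "exact_killed S n"
proof -
  obtain F where F: "F \<subseteq> cocyc S n" "finite F" "cocyc S n \<subseteq> module_span R (X (n + 1)) (F \<union> cobound S n)"
    using fg unfolding fg_killed_def by blast
  have "cocyc S n = cobound S n"
    by (rule nakayama[OF X_module F(2,1) cocyc_submodule[OF S] cobound_submodule[OF S] cobound_cocyc[OF S] F(3) m])
  thus ?thesis by (simp add: exact_killed_alt)
qed

end

section \<open>The top degree of Ext from quotients of the ring\<close>

context baer_complex
begin

lemma killed_Idl': "S \<subseteq> carrier R \<Longrightarrow> killed (X n) (Idl S) = killed (X n) S"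
  by (rule pmodule.killed_Idl[OF X_pmodule])

lemma exact_killed_cong:
  assumes "\<And>k. killed (X k) S = killed (X k) T"
  shows "exact_killed S n = exact_killed T n"
  by (simp add: exact_killed_def assms)

lemma exact_killed_Idl: "S \<subseteq> carrier R \<Longrightarrow> exact_killed (Idl S) n = exact_killed S n"
  by (rule exact_killed_cong) (rule killed_Idl')

lemma exact_killed_if_zero:
  assumes "S \<subseteq> carrier R" "killed (X (n + 1)) S \<subseteq> {\<zero>\<^bsub>X (n + 1)\<^esub>}"
  shows "exact_killed S n"
proof -
  interpret X0: pmodule R "X n" by (rule X_pmodule)
  have "\<zero>\<^bsub>X n\<^esub> \<in> killed (X n) S" by (rule X0.submodule_zero[OF X0.killed_submodule[OF assms(1)]])
  thus ?thesis unfolding exact_killed_def using assms(2) diff_zero[of n] by blast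
qed

lemma exact_killed_carrier: "exact_killed (carrier R) n"
proof (rule exact_killed_if_zero)
  interpret X1: pmodule R "X (n + 1)" by (rule X_pmodule)
  show "killed (X (n + 1)) (carrier R) \<subseteq> {\<zero>\<^bsub>X (n + 1)\<^esub>}"
  proof
    fix x assume x: "x \<in> killed (X (n + 1)) (carrier R)"
    hence "\<one> \<odot>\<^bsub>X (n + 1)\<^esub> x = \<zero>\<^bsub>X (n + 1)\<^esub>" by (simp add: killed_def)
    thus "x \<in> {\<zero>\<^bsub>X (n + 1)\<^esub>}" using killed_carrier[OF x] by simp
  qed
qed simp

text \<open>Because \<open>I : x = I\<close>, each cocycle for \<open>I\<close> is \<open>x\<close>
  times another such cocycle, and Nakayama's lemma leaves only coboundaries.\<close>

lemma exact_if_insert_exact: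
  assumes I: "ideal I R" and x: "x \<in> m" and reg: "colon R I x = I"
    and fg: "fg_killed I n" and ex: "exact_killed (insert x I) (n + 1)"
  shows "exact_killed I n"
proof (rule nakayama_cocycles[OF fg ideal_sub[OF I]])
  interpret X1: pmodule R "X (n + 1)" by (rule X_pmodule)
  let ?G = "{a \<odot>\<^bsub>X (n + 1)\<^esub> z | a z. a \<in> m \<and> z \<in> cocyc I n} \<union> cobound I n"
  have "cocyc I n \<subseteq> ?G"
  proof
    fix z assume "z \<in> cocyc I n"
    then obtain y where "y \<in> cocyc I n" "z = x \<odot>\<^bsub>X (n + 1)\<^esub> y"
      using cocycle_divisible[OF I m_sub[OF x] ex, of z] reg unfolding cocyc_def by auto
    thus "z \<in> ?G" using x by blast
  qed
  thus "cocyc I n \<subseteq> module_span R (X (n + 1)) ?G" using X1.span_incl[of ?G] by blast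
qed

text \<open>Vanishing for the residue field spreads to all \<open>R / I\<close> by Noetherian
  induction. For a maximal counterexample \<open>J\<close> and \<open>x\<close> in \<open>m\<close>
  outside \<open>J\<close>, the ideal \<open>J + (x)\<close> is larger, and so is
  \<open>J : x\<close> unless \<open>x\<close> is regular modulo \<open>J\<close>. In the first case
  \<open>exact_killed_middle\<close> applies, in the second \<open>exact_if_insert_exact\<close>;
  the latter uses one degree more, which is why all degrees from \<open>b\<close> on are treated
  together.\<close>

lemma exact_above:
  assumes fg: "\<And>S n. S \<subseteq> carrier R \<Longrightarrow> fg_killed S n"
    and ex: "\<And>n. b \<le> n \<Longrightarrow> exact_killed m n"
    and I: "ideal I R" and n: "b \<le> n"
  shows "exact_killed I n"
proof (rule ccontr)
  assume no: "\<not> exact_killed I n"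
  let ?P = "\<lambda>J. ideal J R \<and> (\<exists>n\<ge>b. \<not> exact_killed J n)"
  have "\<exists>J. ?P J \<and> I \<subseteq> J \<and> (\<forall>K. ?P K \<longrightarrow> J \<subseteq> K \<longrightarrow> K = J)"
    by (rule noetherian_maximal) (use I no n in auto)
  then obtain J where J0: "?P J \<and> I \<subseteq> J \<and> (\<forall>K. ?P K \<longrightarrow> J \<subseteq> K \<longrightarrow> K = J)" by (elim exE)
  note J = J0[THEN conjunct1, THEN conjunct1] J0[THEN conjunct1, THEN conjunct2]
    and mx0 = J0[THEN conjunct2, THEN conjunct2]
  have mx: "exact_killed K k" if "ideal K R" "J \<subseteq> K" "K \<noteq> J" "b \<le> k" for K k
    using mx0[THEN spec, of K] that by blast
  obtain k where k: "b \<le> k" "\<not> exact_killed J k" using J(2) by blast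
  have "J \<noteq> carrier R" using k exact_killed_carrier by metis
  hence "J \<subseteq> m" using proper_ideal_in_m[OF J(1)] by simp
  moreover have "J \<noteq> m" using k ex by metis
  ultimately obtain x where x: "x \<in> m" "x \<notin> J" by blast
  have xc: "x \<in> carrier R" using m_sub[OF x(1)] .
  have c: "insert x J \<subseteq> carrier R" using xc ideal_sub[OF J(1)] by simp
  have ins: "exact_killed (insert x J) l" if "b \<le> l" for l
  proof -
    have "exact_killed (Idl (insert x J)) l"
      using mx[OF genideal_ideal[OF c] _ _ that] genideal_self[OF c] x by blast
    thus ?thesis using exact_killed_Idl[OF c] by simp
  qed
  show False
  proof (cases "colon R J x = J")
    case True
    have "exact_killed (insert x J) (k + 1)" using ins k by simp
    thus False using exact_if_insert_exact[OF J(1) x(1) True fg[OF ideal_sub[OF J(1)]]] k by blast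
  next
    case False
    hence "exact_killed (colon R J x) k"
      using mx[OF colon_ideal[OF J(1) xc] colon_superset[OF J(1) xc] _ k(1)] by simp
    thus False using exact_killed_middle[OF J(1) xc ins[OF k(1)]] k by blast
  qed
qed

text \<open>Here \<open>I : y = m\<close>, so multiplication by \<open>y\<close> embeds
  \<open>R / m\<close> into \<open>R / I\<close> with cokernel \<open>R / (I + (y))\<close>. As the
  latter contributes nothing one degree higher, every class for \<open>m\<close> comes from one for
  \<open>I\<close>.\<close>

lemma socle_not_exact:
  assumes I: "ideal I R" and y: "y \<in> carrier R" "y \<notin> I" "\<forall>a\<in>m. a \<otimes> y \<in> I"
    and ex: "exact_killed (insert y I) (n + 1)" and no: "\<not> exact_killed m n"
  shows "\<not> exact_killed I n"
proof
  assume exI: "exact_killed I n"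
  have "m \<subseteq> colon R I y" using y m_sub by (auto simp: colon_def)
  moreover have "colon R I y \<subseteq> m"
  proof (rule proper_ideal_in_m[OF colon_ideal[OF I y(1)]])
    have "\<one> \<notin> colon R I y" using y by (simp add: colon_def)
    thus "colon R I y \<noteq> carrier R" by auto
  qed
  ultimately have m: "colon R I y = m" by simp
  have "exact_killed m n"
    unfolding exact_killed_def
  proof (intro ballI impI)
    interpret X0: pmodule R "X n" by (rule X_pmodule)
    fix z assume z: "z \<in> killed (X (n + 1)) m" "\<delta> (n + 1) z = \<zero>\<^bsub>X (n + 1 + 1)\<^esub>"
    obtain u where u: "u \<in> killed (X (n + 1)) I" "\<delta> (n + 1) u = \<zero>\<^bsub>X (n + 1 + 1)\<^esub>" "y \<odot>\<^bsub>X (n + 1)\<^esub> u = z"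
      using cocycle_divisible[OF I y(1) ex, of z] z m by auto
    obtain w where w: "w \<in> killed (X n) I" "\<delta> n w = u" using exI u unfolding exact_killed_def by blast
    have "y \<odot>\<^bsub>X n\<^esub> w \<in> killed (X n) m" using X0.smult_killed_colon[OF w(1) y(1)] m by simp
    moreover have "\<delta> n (y \<odot>\<^bsub>X n\<^esub> w) = z"
      using mod_hom_smult[OF diff_hom y(1) killed_carrier[OF w(1)]] w u by simp
    ultimately show "\<exists>y\<in>killed (X n) m. \<delta> n y = z" by blast
  qed
  thus False using no by simp
qed

definition top_degree :: "'a set \<Rightarrow> int \<Rightarrow> bool" where
  "top_degree S n \<longleftrightarrow> \<not> exact_killed S n \<and> (\<forall>k>n. exact_killed S k)"

text \<open>Nakayama's lemma gives the nonvanishing in degree \<open>n + 1\<close>, the long exact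
  sequence the vanishing above it.\<close>

lemma top_degree_insert:
  assumes I: "ideal I R" and x: "x \<in> m" and reg: "colon R I x = I"
    and fg: "fg_killed I n" and top: "top_degree I n"
  shows "top_degree (insert x I) (n + 1)"
  unfolding top_degree_def
proof (intro conjI allI impI)
  show "\<not> exact_killed (insert x I) (n + 1)"
    using exact_if_insert_exact[OF I x reg fg] top by (auto simp: top_degree_def)
  fix k assume k: "k > n + 1"
  have "exact_killed (insert x I) (k - 1 + 1)"
    by (rule exact_killed_step[OF I m_sub[OF x]]) (use top reg k in \<open>auto simp: top_degree_def\<close>)
  thus "exact_killed (insert x I) k" by simp
qed

lemma ex_greatest_int:
  fixes P :: "int \<Rightarrow> bool"
  assumes "P n" "\<forall>k>b. \<not> P k"
  shows "\<exists>s. P s \<and> (\<forall>k>s. \<not> P k)"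
proof -
  let ?A = "{k. P k \<and> n \<le> k}"
  have "?A \<subseteq> {n..b}" using assms(2) by force
  hence fin: "finite ?A" by (rule finite_subset) simp
  have "Max ?A \<in> ?A" using assms(1) by (intro Max_in[OF fin]) auto
  moreover have "\<not> P k" if "k > Max ?A" for k
  proof
    assume "P k"
    moreover have "n \<le> k" using that calculation \<open>Max ?A \<in> ?A\<close> by simp
    ultimately have "k \<le> Max ?A" using fin by (intro Max_ge) auto
    thus False using that by simp
  qed
  ultimately show ?thesis by blast
qed

text \<open>Along the ideals \<open>J k\<close> generated by the first \<open>k\<close> entries, the
  top degree rises by one at each step, and at the end of the sequence it is \<open>b\<close>, the
  one of the residue field, on account of the socle element \<open>y\<close>. Reading this backwards
  gives its value at \<open>{}\<close>.\<close>

lemma top_degree_zero: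
  assumes fg0: "\<And>n. fg_killed {} n"
    and ex: "\<And>n. n > b \<Longrightarrow> exact_killed m n" and no: "\<not> exact_killed m b"
    and xs: "set xs \<subseteq> m" "regular_sequence R xs"
    and y: "y \<in> carrier R" "y \<notin> Idl (set xs)" "\<forall>a\<in>m. a \<otimes> y \<in> Idl (set xs)"
    and above: "\<exists>c. \<forall>n>c. zero_module (X n)"
  shows "top_degree {} (b - int (length xs))"
proof -
  have fg: "fg_killed S n" if "S \<subseteq> carrier R" for S n by (rule fg_killed_all[OF fg0 that])
  have xc: "set xs \<subseteq> carrier R" using xs m_sub by auto
  define J where "J k = Idl (set (take k xs))" for k
  have tk: "set (take k xs) \<subseteq> carrier R" for k using xc set_take_subset[of k xs] by blast
  have J: "ideal (J k) R" for k unfolding J_def by (rule genideal_ideal[OF tk])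
  have exJ: "exact_killed I n" if "ideal I R" "n > b" for I n
    by (rule exact_above[OF fg _ that(1), where b = "b + 1"]) (use ex that in auto)
  have step: "exact_killed (J (Suc k)) n = exact_killed (insert (xs ! k) (J k)) n"
    if k: "k < length xs" for k n
  proof (rule exact_killed_cong)
    fix l
    have "set (take (Suc k) xs) = insert (xs ! k) (set (take k xs))"
      using k by (simp add: take_Suc_conv_app_nth)
    thus "killed (X l) (J (Suc k)) = killed (X l) (insert (xs ! k) (J k))"
      unfolding J_def using killed_Idl'[OF tk, of l] killed_Idl'[OF tk[of "Suc k"], of l]
      by (simp add: killed_insert)
  qed
  have xk: "xs ! k \<in> m" if "k < length xs" for k using that xs by auto
  have reg: "colon R (J k) (xs ! k) = J k" if k: "k < length xs" for k
  proof
    show "J k \<subseteq> colon R (J k) (xs ! k)" by (rule colon_superset[OF J m_sub[OF xk[OF k]]])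
    show "colon R (J k) (xs ! k) \<subseteq> J k"
      using xs(2) k m_sub[OF xk[OF k]] unfolding regular_sequence_def J_def colon_def
      by (auto simp: m_comm)
  qed
  have last: "top_degree (J (length xs)) b"
    unfolding top_degree_def
  proof (intro conjI allI impI)
    have "insert y (J (length xs)) \<subseteq> carrier R" using y(1) ideal_sub[OF J] by simp
    hence "exact_killed (insert y (J (length xs))) (b + 1)"
      using exJ[OF genideal_ideal] exact_killed_Idl by simp
    thus "\<not> exact_killed (J (length xs)) b"
      using y by (intro socle_not_exact[OF J y(1) _ _ _ no]) (auto simp: J_def)
  qed (use exJ J in blast)
  have J0: "exact_killed (J 0) n = exact_killed {} n" for n
    unfolding J_def using exact_killed_Idl[of "{}"] by simp
  \<comment> \<open>\<open>{}\<close> must be shown to have a top degree at all: if it were exact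
    everywhere, all \<open>J k\<close> would be, contrary to \<open>last\<close>. Boundedness above
    then supplies a greatest degree.\<close>
  have "\<exists>n. \<not> exact_killed {} n"
  proof (rule ccontr)
    assume "\<not> ?thesis"
    hence all: "exact_killed {} n" for n by blast
    have "\<forall>n. exact_killed (J k) n" if "k \<le> length xs" for k
      using that
    proof (induction k)
      case 0
      show ?case using all J0 by simp
    next
      case (Suc k)
      have "exact_killed (insert (xs ! k) (J k)) (n - 1 + 1)" for n
        by (rule exact_killed_step[OF J m_sub[OF xk]]) (use Suc reg in auto)
      thus ?case using Suc.prems step[of k] by simp
    qed
    thus False using last by (simp add: top_degree_def)
  qed
  then obtain n0 where n0: "\<not> exact_killed {} n0" by blast
  obtain c where c: "\<forall>n>c. zero_module (X n)" using above by blast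
  have "\<forall>n>c. \<not> \<not> exact_killed {} n"
    using c by (auto simp: zero_module_def killed_def intro!: exact_killed_if_zero)
  then obtain s where "\<not> exact_killed {} s" "\<forall>k>s. \<not> \<not> exact_killed {} k"
    using ex_greatest_int[of "\<lambda>n. \<not> exact_killed {} n", OF n0] by blast
  hence s: "top_degree {} s" by (simp add: top_degree_def)
  have "top_degree (J k) (s + int k)" if "k \<le> length xs" for k
    using that
  proof (induction k)
    case 0
    show ?case using s J0 by (simp add: top_degree_def)
  next
    case (Suc k)
    have "top_degree (insert (xs ! k) (J k)) (s + int k + 1)"
      by (rule top_degree_insert[OF J xk]) (use Suc reg fg[OF ideal_sub[OF J]] in auto)
    thus ?case using Suc.prems step[of k] by (simp add: top_degree_def algebra_simps)
  qed
  hence "top_degree (J (length xs)) (s + int (length xs))" by simp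
  hence "s + int (length xs) = b" using last unfolding top_degree_def by (meson linorder_neqE)
  thus ?thesis using s by (metis add_diff_cancel_right')
qed

text \<open>Together with \<open>exact_aug\<close>, this is the quasi-isomorphism property of
  \<open>f\<close> on the elements killed by \<open>S\<close>.\<close>

definition lifts_aug :: "(int \<Rightarrow> ('a, 'e) module) \<Rightarrow> (int \<Rightarrow> 'd \<Rightarrow> 'e) \<Rightarrow> 'a set \<Rightarrow> int \<Rightarrow> bool" where
  "lifts_aug E f S n \<longleftrightarrow> (\<forall>e \<in> killed (E (n + 1)) S. \<exists>z \<in> killed (X (n + 1)) S.
     \<delta> (n + 1) z = \<zero>\<^bsub>X (n + 1 + 1)\<^esub> \<and> f (n + 1) z = e)"

lemma lifts_aug_step:
  assumes E: "\<And>n. module R (E n)" "\<And>n. f n \<in> mod_hom R (X n) (E n)"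
    "\<And>n x. x \<in> carrier (X n) \<Longrightarrow> f (n + 1) (\<delta> n x) = \<zero>\<^bsub>E (n + 1)\<^esub>"
    and I: "ideal I R" and a: "a \<in> carrier R"
    and 1: "exact_aug E f (colon R I a) n" and 2: "lifts_aug E f I n"
  shows "lifts_aug E f (insert a I) n"
  unfolding lifts_aug_def
proof
  interpret X1: pmodule R "X (n + 1)" by (rule X_pmodule)
  interpret E1: pmodule R "E (n + 1)" by (rule pmodule.intro) (rule E(1))
  note Ic = ideal_sub[OF I]
  fix e assume "e \<in> killed (E (n + 1)) (insert a I)"
  hence e: "e \<in> killed (E (n + 1)) I" "a \<odot>\<^bsub>E (n + 1)\<^esub> e = \<zero>\<^bsub>E (n + 1)\<^esub>" by (auto simp: killed_insert)
  obtain z where z: "z \<in> killed (X (n + 1)) I" "\<delta> (n + 1) z = \<zero>\<^bsub>X (n + 1 + 1)\<^esub>" "f (n + 1) z = e"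
    using 2 e(1) unfolding lifts_aug_def by blast
  have zc: "z \<in> carrier (X (n + 1))" by (rule killed_carrier[OF z(1)])
  have "\<delta> (n + 1) (a \<odot>\<^bsub>X (n + 1)\<^esub> z) = \<zero>\<^bsub>X (n + 1 + 1)\<^esub>"
    using mod_hom_smult[OF diff_hom a zc] z(2) a by (simp add: X_simps)
  moreover have "f (n + 1) (a \<odot>\<^bsub>X (n + 1)\<^esub> z) = \<zero>\<^bsub>E (n + 1)\<^esub>"
    using mod_hom_smult[OF E(2) a zc] z(3) e(2) by simp
  ultimately obtain w where w: "w \<in> killed (X n) (colon R I a)" "\<delta> n w = a \<odot>\<^bsub>X (n + 1)\<^esub> z"
    using 1 X1.smult_killed_colon[OF z(1) a] unfolding exact_aug_def by blast
  obtain e' where e': "e' \<in> killed (X n) I" "a \<odot>\<^bsub>X n\<^esub> e' = w" using baerD[OF baer I a w(1)] by blast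
  have ec: "e' \<in> carrier (X n)" by (rule killed_carrier[OF e'(1)])
  have dec: "\<delta> n e' \<in> carrier (X (n + 1))" by (rule diff_closed[OF ec])
  let ?z = "z \<ominus>\<^bsub>X (n + 1)\<^esub> \<delta> n e'"
  have "?z \<in> killed (X (n + 1)) I"
    by (rule X1.submodule_diff[OF X1.killed_submodule[OF Ic] z(1) diff_killed[OF Ic e'(1)]])
  moreover have "a \<odot>\<^bsub>X (n + 1)\<^esub> ?z = \<zero>\<^bsub>X (n + 1)\<^esub>"
    using X1.smult_diff[OF a zc dec] mod_hom_smult[OF diff_hom a ec] e' w zc a dec by (simp add: X_simps)
  moreover have "\<delta> (n + 1) ?z = \<zero>\<^bsub>X (n + 1 + 1)\<^esub>"
    using diff_minus[OF zc dec] diff_diff[OF ec] z(2)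
    by (simp add: pmodule.diff_self[OF X_pmodule] module.axioms(2)[OF X_module] abelian_group.axioms(1) abelian_monoid.zero_closed)
  moreover have "f (n + 1) ?z = e"
    using mod_hom_diff[OF X_module E(1) E(2) zc dec] z(3) E(3)[OF ec] e(1)
    by (simp add: E1.diff_zero killed_def)
  ultimately show "\<exists>z\<in>killed (X (n + 1)) (insert a I). \<delta> (n + 1) z = \<zero>\<^bsub>X (n + 1 + 1)\<^esub> \<and> f (n + 1) z = e"
    unfolding killed_insert by blast
qed

lemma lifts_aug_finite:
  assumes E: "\<And>n. module R (E n)" "\<And>n. f n \<in> mod_hom R (X n) (E n)"
    "\<And>n x. x \<in> carrier (X n) \<Longrightarrow> f (n + 1) (\<delta> n x) = \<zero>\<^bsub>E (n + 1)\<^esub>"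
    and ex: "\<And>S. S \<subseteq> carrier R \<Longrightarrow> exact_aug E f S n" and base: "lifts_aug E f {} n"
    and A: "finite A" "A \<subseteq> carrier R"
  shows "lifts_aug E f (Idl A) n"
  using A
proof (induction A)
  case empty
  interpret E1: pmodule R "E (n + 1)" by (rule pmodule.intro) (rule E(1))
  show ?case using base killed_Idl'[of "{}"] E1.killed_Idl[of "{}"] by (simp add: lifts_aug_def)
next
  case (insert c A)
  interpret E1: pmodule R "E (n + 1)" by (rule pmodule.intro) (rule E(1))
  have I: "ideal (Idl A) R" and c: "c \<in> carrier R" using insert.prems by (auto intro: genideal_ideal)
  have "lifts_aug E f (insert c (Idl A)) n"
    using insert ex[OF ideal_sub[OF colon_ideal[OF I c]]] by (intro lifts_aug_step E I c) auto
  thus ?case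
    using insert.prems killed_Idl'[of A] killed_Idl'[of "insert c A"]
      E1.killed_Idl[of A] E1.killed_Idl[of "insert c A"]
    by (simp add: lifts_aug_def killed_insert)
qed

end

section \<open>From the normalization to the top cohomology of D\<close>

lemma (in cring) ring_module_module: "module R (ring_module R)"
proof (rule moduleI[OF is_cring])
  show "abelian_group (ring_module R)"
    by (rule abelian_groupI) (auto simp: ring_module_def a_ac intro!: bexI[of _ "\<ominus> _"] l_neg)
qed (auto simp: ring_module_def l_distr r_distr m_assoc)

text \<open>The image of the class of \<open>1\<close> under the embedding of
  \<open>R / m\<close>.\<close>

lemma (in noetherian_local_ring) hull_socle:
  fixes E :: "('a, 'm) module"
  assumes "injective_hull R (quotient_module (ring_module R) m) E"
  shows "\<exists>e \<in> killed E m. e \<noteq> \<zero>\<^bsub>E\<^esub>"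
proof -
  interpret RM: pmodule R "ring_module R" by (rule pmodule.intro) (rule ring_module_module)
  interpret E: pmodule R E using assms by (auto simp: injective_hull_def injective_module_def pmodule_def)
  have sub: "submodule m R (ring_module R)"
    by (rule RM.submoduleI')
       (use m_sub ideal.I_l_closed[OF m_ideal] additive_subgroup.a_closed[OF ideal.axioms(1)[OF m_ideal]]
         additive_subgroup.zero_closed[OF ideal.axioms(1)[OF m_ideal]] in \<open>auto simp: ring_module_def\<close>)
  let ?K = "quotient_module (ring_module R) m"
  obtain h where h: "h \<in> mod_hom R ?K E" "inj_on h (carrier ?K)" using assms by (auto simp: injective_hull_def)
  let ?c = "\<lambda>x. m +>\<^bsub>ring_module R\<^esub> x"
  have cc: "carrier (ring_module R) = carrier R" "zero (ring_module R) = \<zero>"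
    "a \<odot>\<^bsub>ring_module R\<^esub> b = a \<otimes> b" for a b
    by (simp_all add: ring_module_def)
  have cl: "?c x \<in> carrier ?K" if "x \<in> carrier R" for x using that by (simp add: RM.quotient_carrier cc)
  note Kmod = RM.quotient_is_module[OF sub]
  have z: "?c \<zero> = \<zero>\<^bsub>?K\<^esub>" using RM.coset_zero[OF sub] by (simp add: RM.quotient_zero cc)
  have h0: "h (?c \<zero>) = \<zero>\<^bsub>E\<^esub>" using mod_hom_zero[OF Kmod E.module_axioms h(1)] z by simp
  let ?e = "h (?c \<one>)"
  have ec: "?e \<in> carrier E" using mod_hom_closed[OF h(1) cl] by simp
  have "a \<odot>\<^bsub>E\<^esub> ?e = \<zero>\<^bsub>E\<^esub>" if a: "a \<in> m" for a
  proof -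
    have ac: "a \<in> carrier R" using m_sub[OF a] .
    have "a \<odot>\<^bsub>E\<^esub> ?e = h (a \<odot>\<^bsub>?K\<^esub> ?c \<one>)" using mod_hom_smult[OF h(1) ac cl[OF one_closed]] by simp
    also have "a \<odot>\<^bsub>?K\<^esub> ?c \<one> = ?c a" using RM.quotient_smult[OF sub, of \<one> a] ac by (simp add: cc)
    also have "?c a = ?c \<zero>"
      using RM.coset_eq_iff[OF sub, of a \<zero>] RM.diff_zero[of a] ac a by (simp add: cc)
    finally show ?thesis using h0 by simp
  qed
  moreover have "?e \<noteq> \<zero>\<^bsub>E\<^esub>"
  proof
    assume "?e = \<zero>\<^bsub>E\<^esub>"
    hence "?c \<one> = ?c \<zero>" using h(2) h0 cl[of \<one>] cl[of \<zero>] by (auto simp: inj_on_def)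
    hence "\<one> \<in> m" using RM.coset_eq_iff[OF sub, of \<one> \<zero>] RM.diff_zero[of \<one>] by (simp add: cc)
    thus False using one_notin_m by simp
  qed
  ultimately show ?thesis using ec by (intro bexI[of _ ?e]) (auto simp: killed_def)
qed

lemma stalk_is_complex:
  fixes M :: "('a, 'm) module"
  assumes "module R M"
  shows "is_complex R (stalk_complex M n)"
proof -
  interpret M: pmodule R M by (rule pmodule.intro) fact
  have sub: "submodule {\<zero>\<^bsub>M\<^esub>} R M" by (rule M.submoduleI') auto
  have "module R (obj (stalk_complex M n) k)" for k
    using submodule.submodule_is_module[OF sub assms] assms by (simp add: stalk_complex_def)
  thus ?thesis
    unfolding is_complex_def by (auto simp: stalk_complex_def mod_hom_def)
qed

lemma stalk_coboundaries:
  fixes M :: "('a, 'm) module"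
  assumes "module R M"
  shows "coboundaries (stalk_complex M n) k = {\<zero>\<^bsub>obj (stalk_complex M n) k\<^esub>}"
proof -
  interpret M: pmodule R M by (rule pmodule.intro) fact
  have "carrier (obj (stalk_complex M n) (k - 1)) \<noteq> {}" by (auto simp: stalk_complex_def)
  thus ?thesis by (auto simp: coboundaries_def stalk_complex_def)
qed

lemma stalk_cocycles:
  "cocycles (stalk_complex M n) k = carrier (obj (stalk_complex M n) k)"
  by (auto simp: cocycles_def stalk_complex_def)

theorem normalized_dualizing_top:
  fixes R :: "('a, 'r) ring_scheme" and D :: "('a, 'd) cochain_complex"
  assumes loc: "noetherian_local_ring R m" and depth: "depth R m = enat r"
    and norm: "normalized_dualizing_complex R m t D"
  shows "\<forall>n > int t - int r. cocycles D n \<subseteq> coboundaries D n"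
    and "\<exists>z \<in> cocycles D (int t - int r). z \<notin> module_span R (obj D (int t - int r))
      ({a \<odot>\<^bsub>obj D (int t - int r)\<^esub> y | a y. a \<in> m \<and> y \<in> cocycles D (int t - int r)} \<union>
       coboundaries D (int t - int r))"
proof -
  interpret noetherian_local_ring R m by fact
  have dual: "dualizing_complex R D" using norm by (simp add: normalized_dualizing_complex_def)
  obtain E :: "('a, 'd) module" and f where
    hull: "injective_hull R (quotient_module (ring_module R) m) E" and
    qi: "quasi_isomorphism R (torsion_complex R m D) (stalk_complex E (int t)) f"
    using norm by (auto simp: normalized_dualizing_complex_def)
  have C: "is_complex R D" using dual by (simp add: dualizing_complex_def)
  obtain lo hi where bd: "\<And>n. n < lo \<or> hi < n \<Longrightarrow> zero_module (obj D n)"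
    using dual by (auto simp: dualizing_complex_def)
  have inj: "injective_module R (obj D n)" for n using dual by (simp add: dualizing_complex_def)
  have dd: "diff D (n + 1) (diff D n x) = \<zero>\<^bsub>obj D (n + 1 + 1)\<^esub>" if "x \<in> carrier (obj D n)" for n x
    using is_complexD(3)[OF C that] by (simp add: add.commute)
  interpret D: baer_complex R m "obj D" "diff D"
  proof (rule baer_complex.intro[OF loc], rule baer_complex_axioms.intro)
    show "module R (obj D n)" for n by (rule is_complexD(1)[OF C])
    show "diff D n \<in> mod_hom R (obj D n) (obj D (n + 1))" for n by (rule is_complexD(2)[OF C])
    show "baer R (obj D n)" for n by (rule injective_baer[OF inj])
    show "\<exists>a. \<forall>n<a. zero_module (obj D n)" using bd by blast
  qed (rule dd)
  \<comment> \<open>The torsion part of \<open>D\<close>, to which the normalization refers. The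
    elements killed by \<open>m\<close> are the same in \<open>G\<close> and in \<open>D\<close>
    (\<open>km\<close>), so the cohomology for \<open>m\<close> can be computed in \<open>G\<close>
    and used in \<open>D\<close>.\<close>
  define G where "G n = (obj D n)\<lparr>carrier := torsion_part R m (obj D n)\<rparr>" for n
  have Gobj: "obj (torsion_complex R m D) = G" "diff (torsion_complex R m D) = diff D"
    by (simp_all add: torsion_complex_def G_def fun_eq_iff)
  have tsub: "submodule (torsion_part R m (obj D n)) R (obj D n)" for n
    by (rule torsion_submodule[OF D.X_module])
  have tc: "torsion_part R m (obj D n) \<subseteq> carrier (obj D n)" for n by (auto simp: torsion_part_def)
  have Gmod: "module R (G n)" for n
    unfolding G_def by (rule submodule.submodule_is_module[OF tsub D.X_module])
  have Gdiff: "diff D n \<in> mod_hom R (G n) (G (n + 1))" for n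
  proof (rule mod_homI)
    fix x assume "x \<in> carrier (G n)"
    then obtain k where x: "x \<in> carrier (obj D n)" "\<forall>a\<in>ideal_power R m k. a \<odot>\<^bsub>obj D n\<^esub> x = \<zero>\<^bsub>obj D n\<^esub>"
      by (auto simp: G_def torsion_part_def)
    hence "diff D n x \<in> killed (obj D (n + 1)) (ideal_power R m k)"
      by (intro D.diff_killed) (use ideal.Icarr[OF ideal_power_ideal[OF m_ideal]] in \<open>auto simp: killed_def\<close>)
    thus "diff D n x \<in> carrier (G (n + 1))" by (auto simp: G_def torsion_part_def killed_def)
  qed (auto simp: G_def mod_hom_add[OF D.diff_hom] mod_hom_smult[OF D.diff_hom] dest!: tc[THEN subsetD])
  interpret G: baer_complex R m G "diff D"
  proof (rule baer_complex.intro[OF loc], rule baer_complex_axioms.intro)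
    show "module R (G n)" for n by (rule Gmod)
    show "diff D n \<in> mod_hom R (G n) (G (n + 1))" for n by (rule Gdiff)
    show "baer R (G n)" for n unfolding G_def by (rule baer_torsion[OF D.X_module D.baer])
    show "diff D (n + 1) (diff D n x) = \<zero>\<^bsub>G (n + 1 + 1)\<^esub>" if "x \<in> carrier (G n)" for n x
      using dd[of x n] that tc by (auto simp: G_def)
    have "zero_module (G n)" if "n < lo" for n
      using bd[of n] that tc[of n] pmodule.submodule_zero[OF D.X_pmodule tsub, of n]
      by (auto simp: G_def zero_module_def)
    thus "\<exists>a. \<forall>n<a. zero_module (G n)" by blast
  qed
  have CG: "is_complex R (torsion_complex R m D)"
    unfolding is_complex_def Gobj using Gmod Gdiff G.diff_diff by (simp add: add.commute)
  interpret E: pmodule R E using hull by (auto simp: injective_hull_def injective_module_def pmodule_def)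
  let ?S = "stalk_complex E (int t)"
  have CS: "is_complex R ?S" by (rule stalk_is_complex[OF E.module_axioms])
  have Smod: "module R (obj ?S n)" for n by (rule is_complexD(1)[OF CS])
  have Spm: "pmodule R (obj ?S n)" for n by (rule pmodule.intro[OF Smod])
  note q = qi[unfolded quasi_isomorphism_iff[OF CG CS] Gobj]
  have fhom: "f n \<in> mod_hom R (G n) (obj ?S n)" for n using q by (simp add: chain_map_def Gobj)
  have fd: "f (n + 1) (diff D n x) = \<zero>\<^bsub>obj ?S (n + 1)\<^esub>" if "x \<in> carrier (G n)" for n x
    using q that by (simp add: chain_map_def Gobj stalk_complex_def)
  have qinj: "z \<in> coboundaries (torsion_complex R m D) n"
    if "z \<in> cocycles (torsion_complex R m D) n" "f n z = \<zero>\<^bsub>obj ?S n\<^esub>" for n z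
    using q that stalk_coboundaries[OF E.module_axioms, of "int t" n] by auto
  have qsurj: "\<exists>z \<in> carrier (G n). diff D n z = \<zero>\<^bsub>G (n + 1)\<^esub> \<and> f n z = e" if e: "e \<in> carrier (obj ?S n)" for n e
  proof -
    have "e \<in> cocycles ?S n" using e by (simp add: stalk_cocycles)
    hence "\<exists>z\<in>cocycles (torsion_complex R m D) n. e \<ominus>\<^bsub>obj ?S n\<^esub> f n z \<in> coboundaries ?S n"
      using q by blast
    hence "\<exists>z\<in>cocycles (torsion_complex R m D) n. e \<ominus>\<^bsub>obj ?S n\<^esub> f n z = \<zero>\<^bsub>obj ?S n\<^esub>"
      unfolding stalk_coboundaries[OF E.module_axioms] singleton_iff .
    then obtain z where z: "z \<in> carrier (G n)" "diff D n z = \<zero>\<^bsub>G (n + 1)\<^esub>" "e \<ominus>\<^bsub>obj ?S n\<^esub> f n z = \<zero>\<^bsub>obj ?S n\<^esub>"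
      by (auto simp: cocycles_def Gobj)
    have "e = f n z" using z(3) pmodule.diff_eq_zero_iff[OF Spm e mod_hom_closed[OF fhom z(1)]] by simp
    thus ?thesis using z by blast
  qed
  have base: "G.exact_aug (obj ?S) f {} n" for n
    unfolding G.exact_aug_def
  proof (intro ballI impI)
    interpret G0: pmodule R "G n" by (rule G.X_pmodule)
    interpret G1: pmodule R "G (n + 1)" by (rule G.X_pmodule)
    fix z assume z: "z \<in> killed (G (n + 1)) {}" "diff D (n + 1) z = \<zero>\<^bsub>G (n + 1 + 1)\<^esub>"
      "f (n + 1) z = \<zero>\<^bsub>obj ?S (n + 1)\<^esub>"
    have "z \<in> coboundaries (torsion_complex R m D) (n + 1)"
      by (rule qinj) (use z in \<open>auto simp: cocycles_def Gobj killed_def\<close>)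
    then obtain y where y: "y \<in> carrier (G n)" "diff D n y = z" by (auto simp: coboundaries_def Gobj)
    \<comment> \<open>Surjectivity on cohomology provides a cocycle with the same image as
      \<open>y\<close>; subtracting it from \<open>y\<close> achieves \<open>f n y = 0\<close>
      without changing the boundary.\<close>
    obtain z1 where z1: "z1 \<in> carrier (G n)" "diff D n z1 = \<zero>\<^bsub>G (n + 1)\<^esub>" "f n z1 = f n y"
      using qsurj[OF mod_hom_closed[OF fhom y(1)]] by blast
    have "diff D n (y \<ominus>\<^bsub>G n\<^esub> z1) = z"
      using G.diff_minus[OF y(1) z1(1)] y z1 z by (simp add: G1.diff_zero killed_def)
    moreover have "f n (y \<ominus>\<^bsub>G n\<^esub> z1) = \<zero>\<^bsub>obj ?S n\<^esub>"
      using mod_hom_diff[OF G.X_module Smod fhom y(1) z1(1)] z1(3) mod_hom_closed[OF fhom y(1)]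
      by (simp add: pmodule.diff_self[OF Spm])
    ultimately show "\<exists>y\<in>killed (G n) {}. diff D n y = z \<and> f n y = \<zero>\<^bsub>obj ?S n\<^esub>"
      using y(1) z1(1) by (intro bexI[of _ "y \<ominus>\<^bsub>G n\<^esub> z1"]) (auto simp: killed_def)
  qed
  have exG: "G.exact_aug (obj ?S) f S n" if "S \<subseteq> carrier R" for S n
    by (rule G.exact_aug_all[OF Smod fhom fd base that])
  have mR: "m \<subseteq> carrier R" using m_sub by blast
  have km: "killed (G n) m = killed (obj D n) m" for n
  proof -
    have "x \<in> torsion_part R m (obj D n)" if "x \<in> killed (obj D n) m" for x
      using that ideal_power_1[OF m_ideal] unfolding torsion_part_def killed_def
      by (intro CollectI conjI exI[of _ "Suc 0"]) auto
    thus ?thesis using tc by (auto simp: G_def killed_def)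
  qed
  have G0: "\<zero>\<^bsub>G n\<^esub> = \<zero>\<^bsub>obj D n\<^esub>" for n by (simp add: G_def)
  \<comment> \<open>By the index shift in \<open>exact_killed\<close>, the index
    \<open>int t - 1\<close> stands for cohomology in degree \<open>t\<close>.\<close>
  have above: "D.exact_killed m n" if n: "n > int t - 1" for n
    unfolding D.exact_killed_def
  proof (intro ballI impI)
    fix z assume z: "z \<in> killed (obj D (n + 1)) m" "diff D (n + 1) z = \<zero>\<^bsub>obj D (n + 1 + 1)\<^esub>"
    have "f (n + 1) z \<in> carrier (obj ?S (n + 1))"
      using z(1) km by (intro mod_hom_closed[OF fhom]) (auto simp: killed_def)
    hence "f (n + 1) z = \<zero>\<^bsub>obj ?S (n + 1)\<^esub>" using n by (simp add: stalk_complex_def)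
    thus "\<exists>y\<in>killed (obj D n) m. diff D n y = z"
      using exG[OF mR, of n] z unfolding G.exact_aug_def km G0 by blast
  qed
  \<comment> \<open>A nonzero socle element of \<open>E\<close> lifts to a cocycle killed by
    \<open>m\<close>. If that were the boundary of an element killed by \<open>m\<close>, which is
    torsion, then \<open>f\<close> would send it to zero.\<close>
  have not: "\<not> D.exact_killed m (int t - 1)"
  proof
    assume ex: "D.exact_killed m (int t - 1)"
    obtain A where A: "A \<subseteq> carrier R" "finite A" "m = Idl\<^bsub>R\<^esub> A" using finetely_gen[OF m_ideal] by blast
    have "G.lifts_aug (obj ?S) f {} (int t - 1)"
      unfolding G.lifts_aug_def using qsurj by (auto simp: killed_def)
    hence "G.lifts_aug (obj ?S) f m (int t - 1)"
      unfolding A(3) by (intro G.lifts_aug_finite[OF Smod fhom fd exG _ A(2,1)])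
    moreover obtain e where e: "e \<in> killed E m" "e \<noteq> \<zero>\<^bsub>E\<^esub>" using hull_socle[OF hull] by blast
    moreover have "e \<in> killed (obj ?S (int t - 1 + 1)) m" using e by (simp add: stalk_complex_def)
    ultimately obtain z where z: "z \<in> killed (G (int t - 1 + 1)) m"
      "diff D (int t - 1 + 1) z = \<zero>\<^bsub>G (int t - 1 + 1 + 1)\<^esub>" "f (int t - 1 + 1) z = e"
      unfolding G.lifts_aug_def by blast
    obtain y where y: "y \<in> killed (obj D (int t - 1)) m" "diff D (int t - 1) y = z"
      using ex z unfolding D.exact_killed_def km G0 by blast
    have "y \<in> carrier (G (int t - 1))" using y(1) km by (auto simp: killed_def)
    hence "e = \<zero>\<^bsub>obj ?S (int t - 1 + 1)\<^esub>" using fd[of y "int t - 1"] y(2) z(3) by simp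
    thus False using e by (simp add: stalk_complex_def)
  qed
  have cocyc: "D.cocyc {} n = cocycles D (n + 1)" for n
    by (auto simp: D.cocyc_def cocycles_def killed_def)
  have cobound: "D.cobound {} n = coboundaries D (n + 1)" for n
    by (auto simp: D.cobound_def coboundaries_def killed_def)
  have fg: "D.fg_killed {} n" for n
    unfolding D.fg_killed_def cocyc cobound
    using finitely_generated_cohomology[OF C, of "n + 1"] dual by (simp add: dualizing_complex_def)
  obtain xs y where xs: "length xs = r" "set xs \<subseteq> m" "regular_sequence R xs"
    and y: "y \<in> carrier R" "y \<notin> Idl\<^bsub>R\<^esub> (set xs)" "\<forall>a\<in>m. a \<otimes>\<^bsub>R\<^esub> y \<in> Idl\<^bsub>R\<^esub> (set xs)"
    using depth_witness[OF depth] by blast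
  have "D.top_degree {} (int t - 1 - int (length xs))"
    by (rule D.top_degree_zero[OF fg above not xs(2,3) y]) (auto intro!: exI[of _ hi] bd)
  hence top: "D.top_degree {} (int t - int r - 1)" using xs(1) by (simp add: algebra_simps)
  show "\<forall>n > int t - int r. cocycles D n \<subseteq> coboundaries D n"
  proof (intro allI impI)
    fix n assume "n > int t - int r"
    hence "D.exact_killed {} (n - 1)" using top by (simp add: D.top_degree_def)
    thus "cocycles D n \<subseteq> coboundaries D n" unfolding D.exact_killed_alt cocyc cobound by simp
  qed
  let ?s = "int t - int r"
  \<comment> \<open>Nakayama's lemma, contraposed, turns nonzero cohomology in degree
    \<open>?s\<close> into a cocycle outside \<open>m Z + B\<close>.\<close>
  have "\<not> D.exact_killed {} (?s - 1)" using top by (simp add: D.top_degree_def)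
  hence "\<not> cocyc' \<subseteq> span'" if "cocyc' = cocycles D ?s" "span' = module_span R (obj D ?s)
    ({a \<odot>\<^bsub>obj D ?s\<^esub> y | a y. a \<in> m \<and> y \<in> cocycles D ?s} \<union> coboundaries D ?s)" for cocyc' span'
    using D.nakayama_cocycles[OF fg, of "?s - 1"] that unfolding cocyc cobound by auto
  thus "\<exists>z \<in> cocycles D ?s. z \<notin> module_span R (obj D ?s)
      ({a \<odot>\<^bsub>obj D ?s\<^esub> y | a y. a \<in> m \<and> y \<in> cocycles D ?s} \<union> coboundaries D ?s)" by blast
qed

section \<open>Free resolutions\<close>

definition lin_ext :: "('a, 'r) ring_scheme \<Rightarrow> ('a, 'm) module \<Rightarrow> ('s \<Rightarrow> 'm) \<Rightarrow> ('s \<Rightarrow> 'a) \<Rightarrow> 'm" where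
  "lin_ext R M \<phi> f = (\<Oplus>\<^bsub>M\<^esub>s\<in>{s. f s \<noteq> \<zero>\<^bsub>R\<^esub>}. f s \<odot>\<^bsub>M\<^esub> \<phi> s)"

text \<open>A splitting of the canonical epimorphism onto \<open>P\<close> from the free module on
  its own elements. In contrast to \<open>projective_module\<close>, no type of test modules is
  fixed, so lifting is available against modules carried by any type.\<close>

definition free_retract :: "('a, 'r) ring_scheme \<Rightarrow> ('a, 'm) module \<Rightarrow> bool" where
  "free_retract R P \<longleftrightarrow> module R P \<and>
     (\<exists>\<sigma> \<in> mod_hom R P (free_module R (carrier P)). \<forall>x\<in>carrier P. lin_ext R P (\<lambda>s. s) (\<sigma> x) = x)"

text \<open>The submodule \<open>I F\<close> of the free module \<open>F\<close> on
  \<open>S\<close>, described by coordinates.\<close>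

definition ideal_coords :: "('a, 'r) ring_scheme \<Rightarrow> 's set \<Rightarrow> 'a set \<Rightarrow> ('s \<Rightarrow> 'a) set" where
  "ideal_coords R S I = {f \<in> carrier (free_module R S). \<forall>s. f s \<in> I}"

context cring
begin

lemma free_simps:
  "zero (free_module R S) = (\<lambda>s. \<zero>)" "add (free_module R S) f g = (\<lambda>s. f s \<oplus> g s)"
  "smult (free_module R S) a f = (\<lambda>s. a \<otimes> f s)"
  by (simp_all add: free_module_def)

lemma free_carrier:
  "f \<in> carrier (free_module R S) \<longleftrightarrow>
    (\<forall>s. f s \<in> carrier R) \<and> finite {s. f s \<noteq> \<zero>} \<and> (\<forall>s. f s \<noteq> \<zero> \<longrightarrow> s \<in> S)"
  by (auto simp: free_module_def)

lemma free_is_module: "module R (free_module R S :: ('a, 's \<Rightarrow> 'a) module)"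
proof -
  let ?F = "free_module R S :: ('a, 's \<Rightarrow> 'a) module"
  have add: "f \<oplus>\<^bsub>?F\<^esub> g \<in> carrier ?F" if "f \<in> carrier ?F" "g \<in> carrier ?F" for f g
  proof -
    have "{s. f s \<oplus> g s \<noteq> \<zero>} \<subseteq> {s. f s \<noteq> \<zero>} \<union> {s. g s \<noteq> \<zero>}" by auto
    hence "finite {s. f s \<oplus> g s \<noteq> \<zero>}" using that by (rule_tac finite_subset) (auto simp: free_carrier)
    thus ?thesis using that by (auto simp: free_carrier free_simps) (metis l_zero zero_closed)
  qed
  have smul: "a \<odot>\<^bsub>?F\<^esub> f \<in> carrier ?F" if "a \<in> carrier R" "f \<in> carrier ?F" for a f
  proof -
    have nz: "f s \<noteq> \<zero>" if "a \<otimes> f s \<noteq> \<zero>" for s using that \<open>a \<in> carrier R\<close> by auto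
    hence "{s. a \<otimes> f s \<noteq> \<zero>} \<subseteq> {s. f s \<noteq> \<zero>}" by blast
    hence "finite {s. a \<otimes> f s \<noteq> \<zero>}" using that by (rule_tac finite_subset) (auto simp: free_carrier)
    thus ?thesis using that nz by (simp add: free_carrier free_simps)
  qed
  have grp: "abelian_group ?F"
  proof (rule abelian_groupI)
    fix f assume f: "f \<in> carrier ?F"
    have "(\<ominus> \<one>) \<odot>\<^bsub>?F\<^esub> f \<oplus>\<^bsub>?F\<^esub> f = \<zero>\<^bsub>?F\<^esub>" using f by (auto simp: free_carrier free_simps l_minus l_neg)
    thus "\<exists>g\<in>carrier ?F. g \<oplus>\<^bsub>?F\<^esub> f = \<zero>\<^bsub>?F\<^esub>" using smul[OF _ f, of "\<ominus> \<one>"] by blast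
  next
    show "\<zero>\<^bsub>?F\<^esub> \<in> carrier ?F" by (simp add: free_carrier free_simps)
  next
    fix f g h assume f: "f \<in> carrier ?F" and g: "g \<in> carrier ?F" and h: "h \<in> carrier ?F"
    show "f \<oplus>\<^bsub>?F\<^esub> g \<oplus>\<^bsub>?F\<^esub> h = f \<oplus>\<^bsub>?F\<^esub> (g \<oplus>\<^bsub>?F\<^esub> h)"
      using f g h by (simp add: free_carrier free_simps a_assoc)
  next
    fix f g assume f: "f \<in> carrier ?F" and g: "g \<in> carrier ?F"
    show "f \<oplus>\<^bsub>?F\<^esub> g \<in> carrier ?F" by (rule add[OF f g])
    show "f \<oplus>\<^bsub>?F\<^esub> g = g \<oplus>\<^bsub>?F\<^esub> f" using f g by (simp add: free_carrier free_simps a_comm)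
  next
    fix f assume f: "f \<in> carrier ?F"
    show "\<zero>\<^bsub>?F\<^esub> \<oplus>\<^bsub>?F\<^esub> f = f" using f by (simp add: free_carrier free_simps)
  qed
  show ?thesis
  proof (rule moduleI[OF is_cring grp smul])
    fix a b f g assume "a \<in> carrier R" "b \<in> carrier R" "f \<in> carrier ?F" "g \<in> carrier ?F"
    thus "(a \<oplus> b) \<odot>\<^bsub>?F\<^esub> f = a \<odot>\<^bsub>?F\<^esub> f \<oplus>\<^bsub>?F\<^esub> b \<odot>\<^bsub>?F\<^esub> f"
      "a \<odot>\<^bsub>?F\<^esub> (f \<oplus>\<^bsub>?F\<^esub> g) = a \<odot>\<^bsub>?F\<^esub> f \<oplus>\<^bsub>?F\<^esub> a \<odot>\<^bsub>?F\<^esub> g"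
      "(a \<otimes> b) \<odot>\<^bsub>?F\<^esub> f = a \<odot>\<^bsub>?F\<^esub> (b \<odot>\<^bsub>?F\<^esub> f)"
      by (simp_all add: free_carrier free_simps l_distr r_distr m_assoc)
  next
    fix f assume "f \<in> carrier ?F"
    thus "\<one> \<odot>\<^bsub>?F\<^esub> f = f" by (simp add: free_carrier free_simps)
  qed
qed

lemma free_pmodule: "pmodule R (free_module R S :: ('a, 's \<Rightarrow> 'a) module)"
  by (rule pmodule.intro) (rule free_is_module)

lemma free_gen_carrier: "s \<in> S \<Longrightarrow> free_gen R s \<in> carrier (free_module R S)"
  by (auto simp: free_carrier free_gen_def intro: finite_subset[of _ "{s}"])

lemma free_mono: "S \<subseteq> T \<Longrightarrow> carrier (free_module R S) \<subseteq> carrier (free_module R T)"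
  by (intro subsetI) (simp add: free_carrier, blast)

lemma ideal_coords_submodule:
  assumes "ideal I R"
  shows "submodule (ideal_coords R S I) R (free_module R S)"
proof -
  interpret F: pmodule R "free_module R S" by (rule free_pmodule)
  show ?thesis
    using additive_subgroup.a_closed[OF ideal.axioms(1)[OF assms]]
      additive_subgroup.zero_closed[OF ideal.axioms(1)[OF assms]] ideal.I_l_closed[OF assms]
      F.M.a_closed F.smult_closed F.M.zero_closed
    by (intro F.submoduleI') (auto simp: ideal_coords_def free_simps)
qed

lemma ideal_coords_smult:
  assumes "ideal I R" "a \<in> I" "f \<in> carrier (free_module R S)"
  shows "a \<odot>\<^bsub>free_module R S\<^esub> f \<in> ideal_coords R S I"
proof -
  interpret F: pmodule R "free_module R S" by (rule free_pmodule)
  have "a \<in> carrier R" using ideal.Icarr[OF assms(1,2)] .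
  thus ?thesis using F.smult_closed[OF _ assms(3)] assms ideal.I_r_closed[OF assms(1,2)]
    by (auto simp: ideal_coords_def free_simps free_carrier)
qed

end

context pmodule
begin

lemma lin_ext_sum:
  assumes "finite T" "{s. f s \<noteq> \<zero>\<^bsub>R\<^esub>} \<subseteq> T" "\<And>s. s \<in> T \<Longrightarrow> f s \<in> carrier R \<and> \<phi> s \<in> carrier M"
  shows "lin_ext R M \<phi> f = (\<Oplus>s\<in>T. f s \<odot> \<phi> s)"
  unfolding lin_ext_def using assms
  by (intro M.add.finprod_mono_neutral_cong_left) auto

lemma lin_ext_hom:
  assumes "\<And>s. s \<in> S \<Longrightarrow> \<phi> s \<in> carrier M"
  shows "lin_ext R M \<phi> \<in> mod_hom R (free_module R S) M"
proof (rule mod_homI)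
  interpret F: pmodule R "free_module R S" by (rule R.free_pmodule)
  note fc = R.free_carrier
  have le: "lin_ext R M \<phi> f = (\<Oplus>s\<in>T. f s \<odot> \<phi> s)"
    if "f \<in> carrier (free_module R S)" "finite T" "{s. f s \<noteq> \<zero>\<^bsub>R\<^esub>} \<subseteq> T" "T \<subseteq> S" for f T
    using that assms by (intro lin_ext_sum) (auto simp: fc)
  fix f assume f: "f \<in> carrier (free_module R S)"
  show "lin_ext R M \<phi> f \<in> carrier M"
    unfolding lin_ext_def using f assms by (intro M.finsum_closed) (auto simp: fc)
  {
    fix g assume g: "g \<in> carrier (free_module R S)"
    let ?T = "{s. f s \<noteq> \<zero>\<^bsub>R\<^esub>} \<union> {s. g s \<noteq> \<zero>\<^bsub>R\<^esub>}"
    have T: "finite ?T" "?T \<subseteq> S" using f g by (auto simp: fc)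
    have fT: "lin_ext R M \<phi> f = (\<Oplus>s\<in>?T. f s \<odot> \<phi> s)" "lin_ext R M \<phi> g = (\<Oplus>s\<in>?T. g s \<odot> \<phi> s)"
      by (rule le[OF f T(1) _ T(2)], blast, rule le[OF g T(1) _ T(2)], blast)
    have "lin_ext R M \<phi> (f \<oplus>\<^bsub>free_module R S\<^esub> g) = (\<Oplus>s\<in>?T. (f \<oplus>\<^bsub>free_module R S\<^esub> g) s \<odot> \<phi> s)"
      by (rule le[OF F.M.a_closed[OF f g] T(1) _ T(2)]) (auto simp: R.free_simps)
    also have "\<dots> = (\<Oplus>s\<in>?T. f s \<odot> \<phi> s \<oplus> g s \<odot> \<phi> s)"
      using f g assms by (intro M.finsum_cong') (auto simp: R.free_simps fc smult_l_distr)
    also have "\<dots> = lin_ext R M \<phi> f \<oplus> lin_ext R M \<phi> g"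
      unfolding fT using f g assms by (intro M.finsum_addf) (auto simp: fc)
    finally show "lin_ext R M \<phi> (f \<oplus>\<^bsub>free_module R S\<^esub> g) = lin_ext R M \<phi> f \<oplus> lin_ext R M \<phi> g" .
  }
  fix a assume a: "a \<in> carrier R"
  let ?T = "{s. f s \<noteq> \<zero>\<^bsub>R\<^esub>}"
  have T: "finite ?T" "?T \<subseteq> S" using f by (auto simp: fc)
  have "lin_ext R M \<phi> (a \<odot>\<^bsub>free_module R S\<^esub> f) = (\<Oplus>s\<in>?T. (a \<odot>\<^bsub>free_module R S\<^esub> f) s \<odot> \<phi> s)"
    by (rule le[OF F.smult_closed[OF a f] T(1) _ T(2)]) (use a in \<open>auto simp: R.free_simps\<close>)
  also have "\<dots> = (\<Oplus>s\<in>?T. a \<odot> (f s \<odot> \<phi> s))"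
    using f a assms by (intro M.finsum_cong') (auto simp: R.free_simps fc smult_assoc1)
  also have "\<dots> = a \<odot> lin_ext R M \<phi> f"
    unfolding lin_ext_def using f a assms T by (intro finsum_smult_ldistr[symmetric]) (auto simp: fc)
  finally show "lin_ext R M \<phi> (a \<odot>\<^bsub>free_module R S\<^esub> f) = a \<odot> lin_ext R M \<phi> f" .
qed

lemma lin_ext_gen:
  assumes "\<phi> s \<in> carrier M"
  shows "lin_ext R M \<phi> (free_gen R s) = \<phi> s"
proof -
  have "lin_ext R M \<phi> (free_gen R s) = (\<Oplus>u\<in>{s}. free_gen R s u \<odot> \<phi> u)"
    using assms by (intro lin_ext_sum) (auto simp: free_gen_def)
  thus ?thesis using assms by (simp add: free_gen_def)
qed

lemma lin_ext_submodule:
  assumes "submodule H R M" "f \<in> carrier (free_module R S)"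
    "\<And>s. s \<in> S \<Longrightarrow> f s \<odot> \<phi> s \<in> H"
  shows "lin_ext R M \<phi> f \<in> H"
  unfolding lin_ext_def using assms by (intro submodule_finsum) (auto simp: R.free_carrier)

lemma hom_free_expand:
  assumes "g \<in> mod_hom R (free_module R S) M" "f \<in> carrier (free_module R S)"
  shows "g f = lin_ext R M (\<lambda>s. g (free_gen R s)) f"
proof -
  interpret F: pmodule R "free_module R S" by (rule R.free_pmodule)
  let ?F = "free_module R S"
  let ?T = "{s. f s \<noteq> \<zero>\<^bsub>R\<^esub>}"
  have T: "finite ?T" "?T \<subseteq> S" using assms(2) by (auto simp: R.free_carrier)
  have cl: "f s \<odot>\<^bsub>?F\<^esub> free_gen R s \<in> carrier ?F" if "s \<in> ?T" for s
    using that T assms(2) R.free_gen_carrier[of s S] by (auto simp: R.free_carrier[of f])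
  have coord: "(\<Oplus>\<^bsub>?F\<^esub>s\<in>U. f s \<odot>\<^bsub>?F\<^esub> free_gen R s) u = (if u \<in> U then f u else \<zero>\<^bsub>R\<^esub>)"
    if "finite U" "U \<subseteq> ?T" for U u
    using that
  proof (induction U)
    case empty
    show ?case by (simp add: R.free_simps)
  next
    case (insert x U)
    have c: "(\<lambda>s. f s \<odot>\<^bsub>?F\<^esub> free_gen R s) \<in> U \<rightarrow> carrier ?F" "f x \<odot>\<^bsub>?F\<^esub> free_gen R x \<in> carrier ?F"
      using insert.prems cl by auto
    have "(\<Oplus>\<^bsub>?F\<^esub>s\<in>insert x U. f s \<odot>\<^bsub>?F\<^esub> free_gen R s) =
        f x \<odot>\<^bsub>?F\<^esub> free_gen R x \<oplus>\<^bsub>?F\<^esub> (\<Oplus>\<^bsub>?F\<^esub>s\<in>U. f s \<odot>\<^bsub>?F\<^esub> free_gen R s)"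
      by (rule F.M.finsum_insert) (use insert c in auto)
    thus ?case using insert assms(2)
      by (auto simp: R.free_simps free_gen_def R.free_carrier)
  qed
  have "(\<Oplus>\<^bsub>?F\<^esub>s\<in>?T. f s \<odot>\<^bsub>?F\<^esub> free_gen R s) = f"
    using coord[OF T(1) order_refl] by auto
  hence "g f = g (\<Oplus>\<^bsub>?F\<^esub>s\<in>?T. f s \<odot>\<^bsub>?F\<^esub> free_gen R s)" by simp
  also have "\<dots> = (\<Oplus>s\<in>?T. g (f s \<odot>\<^bsub>?F\<^esub> free_gen R s))"
    by (rule mod_hom_finsum[OF F.module_axioms module_axioms assms(1)]) (use cl in auto)
  also have "\<dots> = lin_ext R M (\<lambda>s. g (free_gen R s)) f"
    unfolding lin_ext_def
  proof (rule M.finsum_cong')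
    show "(\<lambda>s. f s \<odot> g (free_gen R s)) \<in> ?T \<rightarrow> carrier M"
      using T assms(2) mod_hom_closed[OF assms(1) R.free_gen_carrier] by (auto simp: R.free_carrier)
    show "g (f s \<odot>\<^bsub>?F\<^esub> free_gen R s) = f s \<odot> g (free_gen R s)" if "s \<in> ?T" for s
      using mod_hom_smult[OF assms(1) _ R.free_gen_carrier, of "f s" s] that T assms(2)
      by (auto simp: R.free_carrier)
  qed simp
  finally show ?thesis .
qed

lemma hom_free_eq:
  assumes "g \<in> mod_hom R (free_module R S) M" "h \<in> mod_hom R (free_module R S) M"
    "\<And>s. s \<in> S \<Longrightarrow> g (free_gen R s) = h (free_gen R s)" "f \<in> carrier (free_module R S)"
  shows "g f = h f"
proof -
  have "lin_ext R M (\<lambda>s. g (free_gen R s)) f = lin_ext R M (\<lambda>s. h (free_gen R s)) f"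
    unfolding lin_ext_def
  proof (rule M.finsum_cong')
    show "(\<lambda>s. f s \<odot> h (free_gen R s)) \<in> {s. f s \<noteq> \<zero>\<^bsub>R\<^esub>} \<rightarrow> carrier M"
      using assms(4) mod_hom_closed[OF assms(2) R.free_gen_carrier] by (auto simp: R.free_carrier)
    show "f s \<odot> g (free_gen R s) = f s \<odot> h (free_gen R s)" if "s \<in> {s. f s \<noteq> \<zero>\<^bsub>R\<^esub>}" for s
      using that assms(3,4) by (auto simp: R.free_carrier)
  qed simp
  thus ?thesis using hom_free_expand[OF assms(1,4)] hom_free_expand[OF assms(2,4)] by simp
qed

lemma hom_free_ideal_coords:
  assumes "g \<in> mod_hom R (free_module R S) (free_module R T)" "ideal I R"
    "f \<in> ideal_coords R S I"
  shows "g f \<in> ideal_coords R T I"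
proof -
  interpret T: pmodule R "free_module R T" by (rule R.free_pmodule)
  have f: "f \<in> carrier (free_module R S)" "\<And>s. f s \<in> I" using assms(3) by (auto simp: ideal_coords_def)
  have "g f = lin_ext R (free_module R T) (\<lambda>s. g (free_gen R s)) f"
    by (rule T.hom_free_expand[OF assms(1) f(1)])
  also have "\<dots> \<in> ideal_coords R T I"
    by (rule T.lin_ext_submodule[OF R.ideal_coords_submodule[OF assms(2)] f(1)])
       (rule R.ideal_coords_smult[OF assms(2) f(2) mod_hom_closed[OF assms(1) R.free_gen_carrier]])
  finally show ?thesis .
qed

end

lemma (in cring) free_retract_lift:
  assumes P: "free_retract R P" and A: "module R A" and B: "module R B"
    and g: "g \<in> mod_hom R A B" and f: "f \<in> mod_hom R P B" and im: "f ` carrier P \<subseteq> g ` carrier A"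
  shows "\<exists>h \<in> mod_hom R P A. \<forall>x \<in> carrier P. g (h x) = f x"
proof -
  interpret P: pmodule R P using P by (simp add: free_retract_def pmodule_def)
  interpret A: pmodule R A by (rule pmodule.intro) fact
  interpret B: pmodule R B by (rule pmodule.intro) fact
  obtain \<sigma> where \<sigma>: "\<sigma> \<in> mod_hom R P (free_module R (carrier P))"
    "\<And>x. x \<in> carrier P \<Longrightarrow> lin_ext R P (\<lambda>s. s) (\<sigma> x) = x"
    using P unfolding free_retract_def by blast
  have "\<forall>s\<in>carrier P. \<exists>a\<in>carrier A. g a = f s" using im by (auto simp: image_iff subset_iff) metis
  then obtain a where a: "\<And>s. s \<in> carrier P \<Longrightarrow> a s \<in> carrier A \<and> g (a s) = f s" by metis
  have la: "lin_ext R A a \<in> mod_hom R (free_module R (carrier P)) A" using a by (intro A.lin_ext_hom) auto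
  have lP: "lin_ext R P (\<lambda>s. s) \<in> mod_hom R (free_module R (carrier P)) P" by (intro P.lin_ext_hom) auto
  have eq: "g (lin_ext R A a u) = f (lin_ext R P (\<lambda>s. s) u)" if "u \<in> carrier (free_module R (carrier P))" for u
    by (rule B.hom_free_eq[OF mod_hom_compose[OF la g] mod_hom_compose[OF lP f] _ that])
       (use a in \<open>simp add: A.lin_ext_gen P.lin_ext_gen\<close>)
  show ?thesis
  proof (intro bexI ballI)
    show "(\<lambda>x. lin_ext R A a (\<sigma> x)) \<in> mod_hom R P A" by (rule mod_hom_compose[OF \<sigma>(1) la])
    show "g (lin_ext R A a (\<sigma> x)) = f x" if "x \<in> carrier P" for x
      using eq[OF mod_hom_closed[OF \<sigma>(1) that]] \<sigma>(2)[OF that] by simp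
  qed
qed

lemma (in cring) free_free_retract: "free_retract R (free_module R S :: ('a, 's \<Rightarrow> 'a) module)"
proof -
  let ?F = "free_module R S :: ('a, 's \<Rightarrow> 'a) module"
  interpret F: pmodule R ?F by (rule free_pmodule)
  interpret FF: pmodule R "free_module R (carrier ?F)" by (rule free_pmodule)
  let ?\<sigma> = "lin_ext R (free_module R (carrier ?F)) (\<lambda>s. free_gen R (free_gen R s))"
  have \<sigma>: "?\<sigma> \<in> mod_hom R ?F (free_module R (carrier ?F))"
    by (intro FF.lin_ext_hom free_gen_carrier)
  have l: "lin_ext R ?F (\<lambda>s. s) \<in> mod_hom R (free_module R (carrier ?F)) ?F" by (intro F.lin_ext_hom) auto
  have "lin_ext R ?F (\<lambda>s. s) (?\<sigma> x) = x" if "x \<in> carrier ?F" for x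
    by (rule F.hom_free_eq[OF mod_hom_compose[OF \<sigma> l] mod_hom_id _ that])
       (simp add: FF.lin_ext_gen F.lin_ext_gen free_gen_carrier)
  thus ?thesis unfolding free_retract_def using F.module_axioms \<sigma> by blast
qed

lemma (in cring) free_retract_projective:
  fixes P :: "('a, 'm) module"
  assumes P: "free_retract R P"
  shows "projective_module R P"
  unfolding projective_module_def
proof (intro conjI allI impI)
  fix A B :: "('a, 'm \<Rightarrow> 'a) module" and g f
  assume h: "module R A \<and> module R B \<and> g \<in> mod_hom R A B \<and>
    g ` carrier A = carrier B \<and> f \<in> mod_hom R P B"
  show "\<exists>h\<in>mod_hom R P A. \<forall>x\<in>carrier P. g (h x) = f x"
    by (rule free_retract_lift[OF P, of A B g f]) (use h mod_hom_closed[of f R P B] in auto)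
qed (use P in \<open>simp add: free_retract_def\<close>)

definition copy_module :: "('m \<Rightarrow> 'k) \<Rightarrow> ('a, 'm) module \<Rightarrow> ('a, 'k) module" where
  "copy_module \<iota> M = (let \<kappa> = inv_into (carrier M) \<iota> in
     \<lparr>carrier = \<iota> ` carrier M, monoid.mult = undefined, one = undefined, zero = \<iota> \<zero>\<^bsub>M\<^esub>,
      add = (\<lambda>x y. \<iota> (\<kappa> x \<oplus>\<^bsub>M\<^esub> \<kappa> y)), smult = (\<lambda>a x. \<iota> (a \<odot>\<^bsub>M\<^esub> \<kappa> x))\<rparr>)"

lemma copy_module:
  assumes M: "module R M" and inj: "inj_on \<iota> (carrier M)"
  shows "module R (copy_module \<iota> M)" and "\<iota> \<in> mod_hom R M (copy_module \<iota> M)"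
proof -
  interpret M: pmodule R M by (rule pmodule.intro) fact
  let ?C = "copy_module \<iota> M"
  have ops: "carrier ?C = \<iota> ` carrier M" "\<zero>\<^bsub>?C\<^esub> = \<iota> \<zero>\<^bsub>M\<^esub>"
    "\<iota> x \<oplus>\<^bsub>?C\<^esub> \<iota> y = \<iota> (x \<oplus>\<^bsub>M\<^esub> y)" "a \<odot>\<^bsub>?C\<^esub> \<iota> x = \<iota> (a \<odot>\<^bsub>M\<^esub> x)"
    if "x \<in> carrier M" "y \<in> carrier M" for x y a
    using that by (simp_all add: copy_module_def Let_def inv_into_f_f[OF inj])
  have car: "carrier ?C = \<iota> ` carrier M" "\<zero>\<^bsub>?C\<^esub> = \<iota> \<zero>\<^bsub>M\<^esub>" by (simp_all add: copy_module_def Let_def)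
  have grp: "abelian_group ?C"
  proof (rule abelian_groupI)
    show "\<zero>\<^bsub>?C\<^esub> \<in> carrier ?C" by (simp add: car)
    fix f assume "f \<in> carrier ?C"
    then obtain x where x: "x \<in> carrier M" "f = \<iota> x" by (auto simp: car)
    show "\<zero>\<^bsub>?C\<^esub> \<oplus>\<^bsub>?C\<^esub> f = f" using x by (simp add: car ops)
    have "\<iota> (\<ominus>\<^bsub>M\<^esub> x) \<oplus>\<^bsub>?C\<^esub> f = \<zero>\<^bsub>?C\<^esub>" using x by (simp add: car ops M.M.l_neg)
    moreover have "\<iota> (\<ominus>\<^bsub>M\<^esub> x) \<in> carrier ?C" using x by (simp add: car)
    ultimately show "\<exists>g\<in>carrier ?C. g \<oplus>\<^bsub>?C\<^esub> f = \<zero>\<^bsub>?C\<^esub>" by blast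
    fix g assume "g \<in> carrier ?C"
    then obtain y where y: "y \<in> carrier M" "g = \<iota> y" by (auto simp: car)
    show "f \<oplus>\<^bsub>?C\<^esub> g \<in> carrier ?C" using x y by (simp add: car ops)
    show "f \<oplus>\<^bsub>?C\<^esub> g = g \<oplus>\<^bsub>?C\<^esub> f" using x y by (simp add: ops M.M.a_comm)
    fix h assume "h \<in> carrier ?C"
    then obtain z where z: "z \<in> carrier M" "h = \<iota> z" by (auto simp: car)
    show "f \<oplus>\<^bsub>?C\<^esub> g \<oplus>\<^bsub>?C\<^esub> h = f \<oplus>\<^bsub>?C\<^esub> (g \<oplus>\<^bsub>?C\<^esub> h)" using x y z by (simp add: ops M.M.a_assoc)
  qed
  show "module R ?C"
  proof (rule moduleI[OF M.R.is_cring grp])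
    fix a b f g assume a: "a \<in> carrier R" and b: "b \<in> carrier R" and "f \<in> carrier ?C" "g \<in> carrier ?C"
    then obtain x y where x: "x \<in> carrier M" "f = \<iota> x" and y: "y \<in> carrier M" "g = \<iota> y" by (auto simp: car)
    show "a \<odot>\<^bsub>?C\<^esub> f \<in> carrier ?C" using a x by (simp add: car ops)
    show "(a \<oplus>\<^bsub>R\<^esub> b) \<odot>\<^bsub>?C\<^esub> f = a \<odot>\<^bsub>?C\<^esub> f \<oplus>\<^bsub>?C\<^esub> b \<odot>\<^bsub>?C\<^esub> f" using a b x by (simp add: ops M.smult_l_distr)
    show "a \<odot>\<^bsub>?C\<^esub> (f \<oplus>\<^bsub>?C\<^esub> g) = a \<odot>\<^bsub>?C\<^esub> f \<oplus>\<^bsub>?C\<^esub> a \<odot>\<^bsub>?C\<^esub> g" using a x y by (simp add: ops M.smult_r_distr)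
    show "(a \<otimes>\<^bsub>R\<^esub> b) \<odot>\<^bsub>?C\<^esub> f = a \<odot>\<^bsub>?C\<^esub> (b \<odot>\<^bsub>?C\<^esub> f)" using a b x by (simp add: ops M.smult_assoc1)
  next
    fix f assume "f \<in> carrier ?C"
    then obtain x where x: "x \<in> carrier M" "f = \<iota> x" by (auto simp: car)
    show "\<one>\<^bsub>R\<^esub> \<odot>\<^bsub>?C\<^esub> f = f" using x by (simp add: ops)
  qed
  show "\<iota> \<in> mod_hom R M ?C" by (rule mod_homI) (simp_all add: car ops)
qed

text \<open>Since the test modules in the definition of projectivity are carried by functions on the
  elements of \<open>P\<close>, the lifting property is applied to a copy of \<open>P\<close> inside the free module
  on its elements.\<close>

lemma (in cring) projective_free_retract:
  fixes P :: "('a, 'm) module"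
  assumes P: "projective_module R P" and nz: "\<one> \<noteq> \<zero>"
  shows "free_retract R P"
proof -
  interpret P: pmodule R P using P by (simp add: projective_module_def pmodule_def)
  let ?\<iota> = "free_gen R :: 'm \<Rightarrow> 'm \<Rightarrow> 'a"
  have inj: "inj_on ?\<iota> (carrier P)"
  proof (rule inj_onI)
    fix x y assume "free_gen R x = free_gen R y"
    hence "free_gen R x x = free_gen R y x" by simp
    thus "x = y" using nz by (auto simp: free_gen_def split: if_splits)
  qed
  let ?B = "copy_module ?\<iota> P" and ?A = "free_module R (carrier P)"
  note B = copy_module[OF P.module_axioms inj]
  have l: "lin_ext R P (\<lambda>s. s) \<in> mod_hom R ?A P" by (intro P.lin_ext_hom) auto
  have g: "(\<lambda>u. ?\<iota> (lin_ext R P (\<lambda>s. s) u)) \<in> mod_hom R ?A ?B" by (rule mod_hom_compose[OF l B(2)])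
  have "(\<lambda>u. ?\<iota> (lin_ext R P (\<lambda>s. s) u)) ` carrier ?A = carrier ?B"
  proof
    show "(\<lambda>u. ?\<iota> (lin_ext R P (\<lambda>s. s) u)) ` carrier ?A \<subseteq> carrier ?B" using mod_hom_closed[OF g] by blast
    show "carrier ?B \<subseteq> (\<lambda>u. ?\<iota> (lin_ext R P (\<lambda>s. s) u)) ` carrier ?A"
    proof
      fix b assume "b \<in> carrier ?B"
      then obtain x where x: "x \<in> carrier P" "b = ?\<iota> x" by (auto simp: copy_module_def Let_def)
      show "b \<in> (\<lambda>u. ?\<iota> (lin_ext R P (\<lambda>s. s) u)) ` carrier ?A"
        using x P.lin_ext_gen[of "\<lambda>s. s" x] free_gen_carrier[OF x(1)] by (intro image_eqI[of _ _ "?\<iota> x"]) auto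
    qed
  qed
  hence "\<exists>h\<in>mod_hom R P ?A. \<forall>x\<in>carrier P. ?\<iota> (lin_ext R P (\<lambda>s. s) (h x)) = ?\<iota> x"
    using P free_is_module B g unfolding projective_module_def by blast
  then obtain h where h: "h \<in> mod_hom R P ?A" "\<And>x. x \<in> carrier P \<Longrightarrow> ?\<iota> (lin_ext R P (\<lambda>s. s) (h x)) = ?\<iota> x"
    by blast
  have "lin_ext R P (\<lambda>s. s) (h x) = x" if "x \<in> carrier P" for x
    using inj_onD[OF inj h(2)[OF that] mod_hom_closed[OF l mod_hom_closed[OF h(1) that]] that] .
  thus ?thesis unfolding free_retract_def using P.module_axioms by (intro conjI bexI[OF _ h(1)]) simp_all
qed

text \<open>Only exactness is demanded here; freeness or projectivity of the terms is assumed
  separately, so that the source and the target of a comparison map can be treated alike. The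
  homological index \<open>k\<close> corresponds to the degree \<open>-k\<close> of a cochain
  complex.\<close>

definition resolves :: "('a, 'r) ring_scheme \<Rightarrow> ('a, 'n) module \<Rightarrow> (nat \<Rightarrow> ('a, 'p) module) \<Rightarrow>
    (nat \<Rightarrow> 'p \<Rightarrow> 'p) \<Rightarrow> ('p \<Rightarrow> 'n) \<Rightarrow> bool" where
  "resolves R N P d e \<longleftrightarrow> (\<forall>k. module R (P k)) \<and> (\<forall>k. d k \<in> mod_hom R (P (Suc k)) (P k)) \<and>
     e \<in> mod_hom R (P 0) N \<and> e ` carrier (P 0) = carrier N \<and>
     {x \<in> carrier (P 0). e x = \<zero>\<^bsub>N\<^esub>} = d 0 ` carrier (P (Suc 0)) \<and>
     (\<forall>k. {x \<in> carrier (P (Suc k)). d k x = \<zero>\<^bsub>P k\<^esub>} = d (Suc k) ` carrier (P (Suc (Suc k))))"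

lemma resolvesD:
  assumes "resolves R N P d e"
  shows "module R (P k)" "d k \<in> mod_hom R (P (Suc k)) (P k)" "e \<in> mod_hom R (P 0) N"
    "e ` carrier (P 0) = carrier N" "x \<in> carrier (P (Suc 0)) \<Longrightarrow> e (d 0 x) = \<zero>\<^bsub>N\<^esub>"
    "x \<in> carrier (P (Suc (Suc k))) \<Longrightarrow> d k (d (Suc k) x) = \<zero>\<^bsub>P k\<^esub>"
    "y \<in> carrier (P 0) \<Longrightarrow> e y = \<zero>\<^bsub>N\<^esub> \<Longrightarrow> y \<in> d 0 ` carrier (P (Suc 0))"
    "y \<in> carrier (P (Suc k)) \<Longrightarrow> d k y = \<zero>\<^bsub>P k\<^esub> \<Longrightarrow> y \<in> d (Suc k) ` carrier (P (Suc (Suc k)))"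
proof -
  show "module R (P k)" "d k \<in> mod_hom R (P (Suc k)) (P k)" "e \<in> mod_hom R (P 0) N"
    "e ` carrier (P 0) = carrier N" using assms by (auto simp: resolves_def)
  have 0: "{x \<in> carrier (P 0). e x = \<zero>\<^bsub>N\<^esub>} = d 0 ` carrier (P (Suc 0))"
    and 1: "{x \<in> carrier (P (Suc k)). d k x = \<zero>\<^bsub>P k\<^esub>} = d (Suc k) ` carrier (P (Suc (Suc k)))"
    using assms by (auto simp: resolves_def)
  show "x \<in> carrier (P (Suc 0)) \<Longrightarrow> e (d 0 x) = \<zero>\<^bsub>N\<^esub>" using 0 by blast
  show "x \<in> carrier (P (Suc (Suc k))) \<Longrightarrow> d k (d (Suc k) x) = \<zero>\<^bsub>P k\<^esub>" using 1 by blast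
  show "y \<in> carrier (P 0) \<Longrightarrow> e y = \<zero>\<^bsub>N\<^esub> \<Longrightarrow> y \<in> d 0 ` carrier (P (Suc 0))" using 0 by blast
  show "y \<in> carrier (P (Suc k)) \<Longrightarrow> d k y = \<zero>\<^bsub>P k\<^esub> \<Longrightarrow> y \<in> d (Suc k) ` carrier (P (Suc (Suc k)))"
    using 1 by blast
qed

lemma (in cring) comparison:
  fixes P :: "nat \<Rightarrow> ('a, 'p) module" and G :: "nat \<Rightarrow> ('a, 'g) module"
  assumes N: "module R N" and P: "\<And>k. free_retract R (P k)"
    and res: "resolves R N P dP eP" and G: "resolves R N G dG eG"
  shows "\<exists>\<alpha>. (\<forall>k. \<alpha> k \<in> mod_hom R (P k) (G k)) \<and> (\<forall>x\<in>carrier (P 0). eG (\<alpha> 0 x) = eP x) \<and>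
    (\<forall>k. \<forall>x\<in>carrier (P (Suc k)). dG k (\<alpha> (Suc k) x) = \<alpha> k (dP k x))"
proof -
  note rP = resolvesD[OF res] and rG = resolvesD[OF G]
  \<comment> \<open>For the choice of the next map, the current one has to send boundaries to
    boundaries; the last clause carries this along. The clause for \<open>k = 0\<close> retains
    compatibility with the augmentations.\<close>
  define Q where "Q k a \<longleftrightarrow> a \<in> mod_hom R (P k) (G k) \<and>
    (k = 0 \<longrightarrow> (\<forall>x\<in>carrier (P k). eG (a x) = eP x)) \<and>
    (\<forall>x\<in>carrier (P (Suc k)). a (dP k x) \<in> dG k ` carrier (G (Suc k)))" for k a
  have "\<exists>\<alpha>. \<forall>k. Q k (\<alpha> k) \<and> (\<forall>x\<in>carrier (P (Suc k)). dG k (\<alpha> (Suc k) x) = \<alpha> k (dP k x))"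
  proof (rule dependent_nat_choice)
    have "eP ` carrier (P 0) \<subseteq> eG ` carrier (G 0)" using rP(4) rG(4) by simp
    then obtain a where a: "a \<in> mod_hom R (P 0) (G 0)" "\<And>x. x \<in> carrier (P 0) \<Longrightarrow> eG (a x) = eP x"
      using free_retract_lift[OF P rG(1) N rG(3) rP(3)] by blast
    have "a (dP 0 x) \<in> dG 0 ` carrier (G (Suc 0))" if x: "x \<in> carrier (P (Suc 0))" for x
    proof (rule rG(7))
      have c: "dP 0 x \<in> carrier (P 0)" by (rule mod_hom_closed[OF rP(2) x])
      show "a (dP 0 x) \<in> carrier (G 0)" by (rule mod_hom_closed[OF a(1) c])
      show "eG (a (dP 0 x)) = \<zero>\<^bsub>N\<^esub>" using a(2)[OF c] rP(5)[OF x] by simp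
    qed
    thus "\<exists>a. Q 0 a" using a unfolding Q_def by blast
  next
    fix a k assume Qa: "Q k a"
    hence a: "a \<in> mod_hom R (P k) (G k)" by (simp add: Q_def)
    have "(\<lambda>x. a (dP k x)) ` carrier (P (Suc k)) \<subseteq> dG k ` carrier (G (Suc k))"
      using Qa by (auto simp: Q_def)
    then obtain b where b: "b \<in> mod_hom R (P (Suc k)) (G (Suc k))"
      "\<And>x. x \<in> carrier (P (Suc k)) \<Longrightarrow> dG k (b x) = a (dP k x)"
      using free_retract_lift[OF P rG(1) rG(1) rG(2) mod_hom_compose[OF rP(2) a]] by blast
    have "b (dP (Suc k) x) \<in> dG (Suc k) ` carrier (G (Suc (Suc k)))"
      if x: "x \<in> carrier (P (Suc (Suc k)))" for x
    proof (rule rG(8))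
      have c: "dP (Suc k) x \<in> carrier (P (Suc k))" by (rule mod_hom_closed[OF rP(2) x])
      show "b (dP (Suc k) x) \<in> carrier (G (Suc k))" by (rule mod_hom_closed[OF b(1) c])
      show "dG k (b (dP (Suc k) x)) = \<zero>\<^bsub>G k\<^esub>"
        using b(2)[OF c] rP(6)[OF x] mod_hom_zero[OF rP(1) rG(1) a] by simp
    qed
    thus "\<exists>b. Q (Suc k) b \<and> (\<forall>x\<in>carrier (P (Suc k)). dG k (b x) = a (dP k x))"
      using b unfolding Q_def by blast
  qed
  then obtain \<alpha> where "\<And>k. Q k (\<alpha> k)" "\<And>k x. x \<in> carrier (P (Suc k)) \<Longrightarrow> dG k (\<alpha> (Suc k) x) = \<alpha> k (dP k x)"
    by blast
  thus ?thesis unfolding Q_def by (intro exI[of _ \<alpha>]) simp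
qed

lemma (in cring) null_homotopy:
  fixes P :: "nat \<Rightarrow> ('a, 'p) module" and G :: "nat \<Rightarrow> ('a, 'g) module"
  assumes P: "\<And>k. free_retract R (P k)" and res: "resolves R N P dP eP" and G: "resolves R N' G dG eG"
    and \<psi>: "\<And>k. \<psi> k \<in> mod_hom R (P k) (G k)" "\<And>x. x \<in> carrier (P 0) \<Longrightarrow> eG (\<psi> 0 x) = \<zero>\<^bsub>N'\<^esub>"
    "\<And>k x. x \<in> carrier (P (Suc k)) \<Longrightarrow> dG k (\<psi> (Suc k) x) = \<psi> k (dP k x)"
  shows "\<exists>s. (\<forall>k. s k \<in> mod_hom R (P k) (G (Suc k))) \<and> (\<forall>x\<in>carrier (P 0). \<psi> 0 x = dG 0 (s 0 x)) \<and>
    (\<forall>k. \<forall>x\<in>carrier (P (Suc k)). \<psi> (Suc k) x \<ominus>\<^bsub>G (Suc k)\<^esub> s k (dP k x) = dG (Suc k) (s (Suc k) x))"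
proof -
  note rP = resolvesD[OF res] and rG = resolvesD[OF G]
  have pG: "pmodule R (G k)" for k by (rule pmodule.intro) (rule rG(1))
  have lift: "\<exists>b\<in>mod_hom R (P k) (G (Suc k)). \<forall>x\<in>carrier (P k). dG k (b x) = f x"
    if "f \<in> mod_hom R (P k) (G k)" "f ` carrier (P k) \<subseteq> dG k ` carrier (G (Suc k))" for f k
    by (rule free_retract_lift[OF P rG(1) rG(1) rG(2) that])
  define Q where "Q k a \<longleftrightarrow> a \<in> mod_hom R (P k) (G (Suc k)) \<and>
    (k = 0 \<longrightarrow> (\<forall>x\<in>carrier (P k). \<psi> k x = dG k (a x))) \<and>
    (\<forall>x\<in>carrier (P (Suc k)). \<psi> (Suc k) x \<ominus>\<^bsub>G (Suc k)\<^esub> a (dP k x) \<in> dG (Suc k) ` carrier (G (Suc (Suc k))))" for k a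
  have "\<exists>s. \<forall>k. Q k (s k) \<and>
    (\<forall>x\<in>carrier (P (Suc k)). dG (Suc k) (s (Suc k) x) = \<psi> (Suc k) x \<ominus>\<^bsub>G (Suc k)\<^esub> s k (dP k x))"
  proof (rule dependent_nat_choice)
    have "\<psi> 0 ` carrier (P 0) \<subseteq> dG 0 ` carrier (G (Suc 0))"
      using rG(7) mod_hom_closed[OF \<psi>(1)] \<psi>(2) by blast
    from lift[OF \<psi>(1) this] obtain a where a0: "a \<in> mod_hom R (P 0) (G (Suc 0))"
      "\<forall>x\<in>carrier (P 0). dG 0 (a x) = \<psi> 0 x" by (elim bexE)
    note a = a0(1) a0(2)[rule_format]
    have "\<psi> (Suc 0) x \<ominus>\<^bsub>G (Suc 0)\<^esub> a (dP 0 x) \<in> dG (Suc 0) ` carrier (G (Suc (Suc 0)))"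
      if x: "x \<in> carrier (P (Suc 0))" for x
    proof (rule rG(8))
      interpret G1: pmodule R "G (Suc 0)" by (rule pG)
      interpret G0: pmodule R "G 0" by (rule pG)
      have c: "dP 0 x \<in> carrier (P 0)" by (rule mod_hom_closed[OF rP(2) x])
      have u: "\<psi> (Suc 0) x \<in> carrier (G (Suc 0))" "a (dP 0 x) \<in> carrier (G (Suc 0))" "\<psi> 0 (dP 0 x) \<in> carrier (G 0)"
        using mod_hom_closed[OF \<psi>(1) x] mod_hom_closed[OF a(1) c] mod_hom_closed[OF \<psi>(1) c] by auto
      show "\<psi> (Suc 0) x \<ominus>\<^bsub>G (Suc 0)\<^esub> a (dP 0 x) \<in> carrier (G (Suc 0))" using u by simp
      show "dG 0 (\<psi> (Suc 0) x \<ominus>\<^bsub>G (Suc 0)\<^esub> a (dP 0 x)) = \<zero>\<^bsub>G 0\<^esub>"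
        using mod_hom_diff[OF rG(1) rG(1) rG(2) u(1,2)] \<psi>(3)[OF x] a(2)[OF c] u(3) by (simp add: G0.diff_self)
    qed
    thus "\<exists>a. Q 0 a" using a unfolding Q_def by (intro exI[of _ a]) simp
  next
    fix a k assume Qa: "Q k a"
    hence a: "a \<in> mod_hom R (P k) (G (Suc k))" by (simp add: Q_def)
    let ?f = "\<lambda>x. \<psi> (Suc k) x \<ominus>\<^bsub>G (Suc k)\<^esub> a (dP k x)"
    have f: "?f \<in> mod_hom R (P (Suc k)) (G (Suc k))"
      by (intro mod_hom_minus_map rG(1) \<psi>(1) mod_hom_compose[OF rP(2) a])
    have "?f ` carrier (P (Suc k)) \<subseteq> dG (Suc k) ` carrier (G (Suc (Suc k)))" using Qa by (auto simp: Q_def)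
    from lift[OF f this] obtain b where b0: "b \<in> mod_hom R (P (Suc k)) (G (Suc (Suc k)))"
      "\<forall>x\<in>carrier (P (Suc k)). dG (Suc k) (b x) = ?f x" by (elim bexE)
    note b = b0(1) b0(2)[rule_format]
    have "\<psi> (Suc (Suc k)) x \<ominus>\<^bsub>G (Suc (Suc k))\<^esub> b (dP (Suc k) x)
        \<in> dG (Suc (Suc k)) ` carrier (G (Suc (Suc (Suc k))))" if x: "x \<in> carrier (P (Suc (Suc k)))" for x
    proof (rule rG(8))
      interpret G1: pmodule R "G (Suc k)" by (rule pG)
      interpret G2: pmodule R "G (Suc (Suc k))" by (rule pG)
      have c: "dP (Suc k) x \<in> carrier (P (Suc k))" by (rule mod_hom_closed[OF rP(2) x])
      have u: "\<psi> (Suc (Suc k)) x \<in> carrier (G (Suc (Suc k)))" "b (dP (Suc k) x) \<in> carrier (G (Suc (Suc k)))"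
        "\<psi> (Suc k) (dP (Suc k) x) \<in> carrier (G (Suc k))"
        using mod_hom_closed[OF \<psi>(1) x] mod_hom_closed[OF b(1) c] mod_hom_closed[OF \<psi>(1) c] by auto
      show "\<psi> (Suc (Suc k)) x \<ominus>\<^bsub>G (Suc (Suc k))\<^esub> b (dP (Suc k) x) \<in> carrier (G (Suc (Suc k)))" using u by simp
      show "dG (Suc k) (\<psi> (Suc (Suc k)) x \<ominus>\<^bsub>G (Suc (Suc k))\<^esub> b (dP (Suc k) x)) = \<zero>\<^bsub>G (Suc k)\<^esub>"
        using mod_hom_diff[OF rG(1) rG(1) rG(2) u(1,2)] \<psi>(3)[OF x] b(2)[OF c] u(3) rP(6)[OF x]
          mod_hom_zero[OF rP(1) rG(1) a] by (simp add: G1.diff_self G1.diff_zero)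
    qed
    thus "\<exists>b. Q (Suc k) b \<and> (\<forall>x\<in>carrier (P (Suc k)). dG (Suc k) (b x) = ?f x)"
      using b unfolding Q_def by (intro exI[of _ b]) simp
  qed
  then obtain s where s: "\<And>k. Q k (s k)"
    "\<And>k x. x \<in> carrier (P (Suc k)) \<Longrightarrow> dG (Suc k) (s (Suc k) x) = \<psi> (Suc k) x \<ominus>\<^bsub>G (Suc k)\<^esub> s k (dP k x)"
    by blast
  have "\<forall>x\<in>carrier (P 0). \<psi> 0 x = dG 0 (s 0 x)" using s(1)[of 0] unfolding Q_def by simp
  moreover have "s k \<in> mod_hom R (P k) (G (Suc k))" for k using s(1)[of k] unfolding Q_def by simp
  ultimately show ?thesis using s(2) by (intro exI[of _ s]) simp
qed

lemma resolves_if_projective_resolution: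
  fixes P :: "('a, 'p) cochain_complex"
  assumes N: "module R N" and res: "projective_resolution R N P e"
  shows "resolves R N (\<lambda>k. obj P (- int k)) (\<lambda>k. diff P (- int (Suc k))) (e 0)"
proof -
  have C: "is_complex R P" and zero: "\<And>n. n > 0 \<Longrightarrow> zero_module (obj P n)"
    and qi: "quasi_isomorphism R P (stalk_complex N 0) e"
    using res by (auto simp: projective_resolution_def)
  interpret N: pmodule R N by (rule pmodule.intro) fact
  let ?S = "stalk_complex N 0"
  have CS: "is_complex R ?S" by (rule stalk_is_complex[OF N])
  have S0: "obj ?S 0 = N" by (simp add: stalk_complex_def)
  note q = qi[unfolded quasi_isomorphism_iff[OF C CS]]
  note cS = stalk_coboundaries[OF N, of 0]
  have e: "e n \<in> mod_hom R (obj P n) (obj ?S n)" for n using q by (simp add: chain_map_def)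
  have e0: "e 0 \<in> mod_hom R (obj P 0) N" using e[of 0] S0 by simp
  have ed: "e (n + 1) (diff P n x) = \<zero>\<^bsub>N\<^esub>" if "x \<in> carrier (obj P n)" for n x
    using q that by (simp add: chain_map_def stalk_complex_def)
  have d: "diff P (- int (Suc k)) \<in> mod_hom R (obj P (- int (Suc k))) (obj P (- int k))" for k
    using is_complexD(2)[OF C, of "- int (Suc k)"] by simp
  have cyc0: "cocycles P 0 = carrier (obj P 0)"
  proof -
    have "diff P 0 x = \<zero>\<^bsub>obj P 1\<^esub>" if "x \<in> carrier (obj P 0)" for x
      using mod_hom_closed[OF is_complexD(2)[OF C, of 0] that] zero[of 1] by (simp add: zero_module_def)
    thus ?thesis by (auto simp: cocycles_def)
  qed
  have cob: "coboundaries P (- int k) = diff P (- int (Suc k)) ` carrier (obj P (- int (Suc k)))" for k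
  proof -
    have "- int k - 1 = - int (Suc k)" by simp
    thus ?thesis by (simp only: coboundaries_def)
  qed
  have surj: "e 0 ` carrier (obj P 0) = carrier N"
  proof
    show "e 0 ` carrier (obj P 0) \<subseteq> carrier N" using mod_hom_closed[OF e0] by blast
    show "carrier N \<subseteq> e 0 ` carrier (obj P 0)"
    proof
      fix y assume y: "y \<in> carrier N"
      hence "y \<in> cocycles ?S 0" by (simp add: stalk_cocycles S0)
      then obtain z where z: "z \<in> cocycles P 0" "y \<ominus>\<^bsub>obj ?S 0\<^esub> e 0 z \<in> coboundaries ?S 0" using q by blast
      hence "y \<ominus>\<^bsub>N\<^esub> e 0 z = \<zero>\<^bsub>N\<^esub>" unfolding cS S0 by simp
      hence "y = e 0 z" using N.diff_eq_zero_iff[OF y] mod_hom_closed[OF e0] z(1) by (simp add: cyc0)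
      thus "y \<in> e 0 ` carrier (obj P 0)" using z(1) by (simp add: cyc0)
    qed
  qed
  have ker0: "{x \<in> carrier (obj P 0). e 0 x = \<zero>\<^bsub>N\<^esub>} = diff P (- int (Suc 0)) ` carrier (obj P (- int (Suc 0)))"
  proof (intro equalityI subsetI)
    fix x assume x: "x \<in> {x \<in> carrier (obj P 0). e 0 x = \<zero>\<^bsub>N\<^esub>}"
    have "e 0 x \<in> coboundaries ?S 0" unfolding cS S0 using x by simp
    hence "x \<in> coboundaries P 0" using q x cyc0 by blast
    thus "x \<in> diff P (- int (Suc 0)) ` carrier (obj P (- int (Suc 0)))" using cob[of 0] by simp
  next
    fix x assume "x \<in> diff P (- int (Suc 0)) ` carrier (obj P (- int (Suc 0)))"
    then obtain y where y: "y \<in> carrier (obj P (- int (Suc 0)))" "x = diff P (- int (Suc 0)) y" by blast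
    thus "x \<in> {x \<in> carrier (obj P 0). e 0 x = \<zero>\<^bsub>N\<^esub>}"
      using ed[OF y(1)] mod_hom_closed[OF d y(1)] by simp
  qed
  have ker: "{x \<in> carrier (obj P (- int (Suc k))). diff P (- int (Suc k)) x = \<zero>\<^bsub>obj P (- int k)\<^esub>} =
    diff P (- int (Suc (Suc k))) ` carrier (obj P (- int (Suc (Suc k))))" for k
  proof -
    have cyc: "{x \<in> carrier (obj P (- int (Suc k))). diff P (- int (Suc k)) x = \<zero>\<^bsub>obj P (- int k)\<^esub>} =
      cocycles P (- int (Suc k))" by (simp add: cocycles_def)
    have "cocycles P (- int (Suc k)) \<subseteq> coboundaries P (- int (Suc k))"
    proof
      fix x assume x: "x \<in> cocycles P (- int (Suc k))"
      hence "e (- int (Suc k)) x \<in> carrier (obj ?S (- int (Suc k)))"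
        by (intro mod_hom_closed[OF e]) (simp add: cocycles_def)
      hence "e (- int (Suc k)) x \<in> coboundaries ?S (- int (Suc k))"
        unfolding cS by (simp add: stalk_complex_def)
      thus "x \<in> coboundaries P (- int (Suc k))" using q x by blast
    qed
    hence "cocycles P (- int (Suc k)) = coboundaries P (- int (Suc k))"
      using coboundaries_cocycles[OF C] by blast
    thus ?thesis unfolding cyc cob .
  qed
  show ?thesis
    unfolding resolves_def using is_complexD(1)[OF C] d e0 surj ker0 ker by simp
qed

section \<open>Construction of minimal free resolutions\<close>

context noetherian_local_ring
begin

lemma finite_submodule_generators:
  assumes "module R M" "finite F" "F \<subseteq> carrier M" "carrier M \<subseteq> module_span R M F" "submodule U R M"
  shows "\<exists>T\<subseteq>U. finite T \<and> U \<subseteq> module_span R M T"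
proof -
  interpret M: pmodule R M by (rule pmodule.intro) fact
  have Z: "submodule {\<zero>\<^bsub>M\<^esub>} R M" by (rule M.submoduleI') auto
  have U: "U \<subseteq> carrier M" "\<zero>\<^bsub>M\<^esub> \<in> U" using M.submoduleE(1)[OF assms(5)] M.submodule_zero[OF assms(5)] by auto
  have "U \<subseteq> module_span R M (F \<union> {\<zero>\<^bsub>M\<^esub>})"
    using U(1) assms(4) M.span_mono[of F "F \<union> {\<zero>\<^bsub>M\<^esub>}"] assms(3) by auto
  then obtain T where "T \<subseteq> U" "finite T" "U \<subseteq> module_span R M (T \<union> {\<zero>\<^bsub>M\<^esub>})"
    using noetherian_submodule[OF assms(1-3) Z assms(5)] U(2) by blast
  thus ?thesis using U(2) by (intro exI[of _ "T \<union> {\<zero>\<^bsub>M\<^esub>}"]) auto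
qed

lemma free_generated:
  "carrier (free_module R S) \<subseteq> module_span R (free_module R S) (free_gen R ` S)"
proof
  interpret F: pmodule R "free_module R S" by (rule free_pmodule)
  have c: "free_gen R ` S \<subseteq> carrier (free_module R S)" by (intro image_subsetI free_gen_carrier)
  note sub = F.span_submodule[OF c]
  fix f assume f: "f \<in> carrier (free_module R S)"
  have "f = lin_ext R (free_module R S) (free_gen R) f" by (rule F.hom_free_expand[OF mod_hom_id f])
  also have "\<dots> \<in> module_span R (free_module R S) (free_gen R ` S)"
  proof (rule F.lin_ext_submodule[OF sub f])
    fix s assume s: "s \<in> S"
    have "f s \<in> carrier R" using f by (simp add: free_carrier)
    thus "f s \<odot>\<^bsub>free_module R S\<^esub> free_gen R s \<in> module_span R (free_module R S) (free_gen R ` S)"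
      using F.submoduleE(4)[OF sub] F.span_incl[of "free_gen R ` S"] s by blast
  qed
  finally show "f \<in> module_span R (free_module R S) (free_gen R ` S)" .
qed

text \<open>With a generating set of least cardinality, a relation having a coefficient outside
  \<open>m\<close> would express one generator by the others. The injection \<open>\<tau>\<close>
  labels the basis, so that the free module can be placed in a prescribed type.\<close>

lemma minimal_cover:
  fixes \<tau> :: "nat \<Rightarrow> 's" and M :: "('a, 'x) module"
  assumes \<tau>: "inj \<tau>" and M: "module R M" and K: "submodule K R M"
    and F0: "finite F0" "F0 \<subseteq> K" "K \<subseteq> module_span R M F0"
  shows "\<exists>n \<phi>. \<phi> \<in> mod_hom R (free_module R (\<tau> ` {..<n})) M \<and>
    \<phi> ` carrier (free_module R (\<tau> ` {..<n})) = K \<and>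
    (\<forall>x\<in>carrier (free_module R (\<tau> ` {..<n})). \<phi> x = \<zero>\<^bsub>M\<^esub> \<longrightarrow> x \<in> ideal_coords R (\<tau> ` {..<n}) m)"
proof -
  interpret M: pmodule R M by (rule pmodule.intro) fact
  let ?Q = "\<lambda>n. \<exists>F. finite F \<and> card F = n \<and> F \<subseteq> K \<and> K \<subseteq> module_span R M F"
  define n where "n = (LEAST n. ?Q n)"
  have "?Q (card F0)" using F0 by blast
  hence "?Q n" unfolding n_def by (rule LeastI)
  then obtain F where F: "finite F" "card F = n" "F \<subseteq> K" "K \<subseteq> module_span R M F" by blast
  have least: "n \<le> card F'" if "finite F'" "F' \<subseteq> K" "K \<subseteq> module_span R M F'" for F'
    unfolding n_def using that by (intro Least_le) blast
  have Kc: "K \<subseteq> carrier M" using M.submoduleE(1)[OF K] .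
  obtain b where "bij_betw b {0..<card F} F" using ex_bij_betw_nat_finite[OF F(1)] by blast
  hence b: "bij_betw b {..<n} F" using F(2) by (simp add: atLeast0LessThan)
  let ?S = "\<tau> ` {..<n}"
  define c where "c s = b (inv_into UNIV \<tau> s)" for s
  have cb: "c (\<tau> j) = b j" for j using inv_f_f[OF \<tau>] by (simp add: c_def)
  have cS: "c s \<in> F" if "s \<in> ?S" for s using that b cb by (auto simp: bij_betw_def)
  have cc: "c s \<in> carrier M" if "s \<in> ?S" for s using cS[OF that] F(3) Kc by blast
  have cinj: "inj_on c ?S" using b cb by (auto simp: inj_on_def bij_betw_def)
  have cF: "c ` ?S = F" using b cb by (auto simp: bij_betw_def image_image)
  interpret FM: pmodule R "free_module R ?S" by (rule free_pmodule)
  let ?\<phi> = "lin_ext R M c"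
  have \<phi>: "?\<phi> \<in> mod_hom R (free_module R ?S) M" by (rule M.lin_ext_hom[OF cc])
  have "?\<phi> ` carrier (free_module R ?S) = K"
  proof
    show "?\<phi> ` carrier (free_module R ?S) \<subseteq> K"
    proof
      fix y assume "y \<in> ?\<phi> ` carrier (free_module R ?S)"
      then obtain f where f: "f \<in> carrier (free_module R ?S)" "y = ?\<phi> f" by blast
      have "?\<phi> f \<in> K"
      proof (rule M.lin_ext_submodule[OF K f(1)])
        fix s assume s: "s \<in> ?S"
        have "f s \<in> carrier R" using f(1) by (simp add: free_carrier)
        thus "f s \<odot>\<^bsub>M\<^esub> c s \<in> K" by (rule M.submoduleE(4)[OF K]) (use cS[OF s] F(3) in blast)
      qed
      thus "y \<in> K" using f by simp
    qed
    have "F \<subseteq> ?\<phi> ` carrier (free_module R ?S)"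
    proof
      fix y assume "y \<in> F"
      then obtain s where s: "s \<in> ?S" "y = c s" using cF by blast
      thus "y \<in> ?\<phi> ` carrier (free_module R ?S)"
        using M.lin_ext_gen[of c s] cc free_gen_carrier[OF s(1)] by (intro image_eqI[of _ _ "free_gen R s"]) auto
    qed
    thus "K \<subseteq> ?\<phi> ` carrier (free_module R ?S)"
      using F(4) M.span_minimal[OF image_submodule[OF FM.module_axioms M \<phi> FM.carrier_is_submodule]] by blast
  qed
  moreover have "x s \<in> m" if x: "x \<in> carrier (free_module R ?S)" "?\<phi> x = \<zero>\<^bsub>M\<^esub>" for x s
  proof (rule ccontr)
    assume sm: "x s \<notin> m"
    have xs: "x s \<in> carrier R" using x by (simp add: free_carrier)
    have "\<zero> \<in> m" using additive_subgroup.zero_closed[OF ideal.axioms(1)[OF m_ideal]] .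
    hence s: "s \<in> ?S" using sm x(1) unfolding free_carrier by metis
    obtain u where u: "u \<in> carrier R" "u \<otimes> x s = \<one>" using unit_if_notin_m[OF xs sm] by blast
    let ?F' = "F - {c s}" and ?S' = "?S - {s}"
    let ?H = "module_span R M ?F'"
    have F'c: "?F' \<subseteq> carrier M" using F(3) Kc by blast
    note H = M.span_submodule[OF F'c]
    define x' where "x' = x(s := \<zero>)"
    have x': "x' \<in> carrier (free_module R ?S')"
      using x(1) by (auto simp: free_carrier x'_def intro: rev_finite_subset)
    have x'S: "x' \<in> carrier (free_module R ?S)" using free_mono[of ?S' ?S] x' by blast
    have dec: "x = x s \<odot>\<^bsub>free_module R ?S\<^esub> free_gen R s \<oplus>\<^bsub>free_module R ?S\<^esub> x'"
      using x(1) by (auto simp: free_simps x'_def free_gen_def free_carrier)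
    have "?\<phi> x' \<in> ?H"
    proof (rule M.lin_ext_submodule[OF H x'])
      fix v assume v: "v \<in> ?S'"
      hence "c v \<in> ?F'" using cS cinj s by (auto simp: inj_on_eq_iff)
      hence "c v \<in> ?H" by (rule subsetD[OF M.span_incl])
      thus "x' v \<odot>\<^bsub>M\<^esub> c v \<in> ?H" using M.submoduleE(4)[OF H] x' by (simp add: free_carrier)
    qed
    moreover have "?\<phi> x = x s \<odot>\<^bsub>M\<^esub> c s \<oplus>\<^bsub>M\<^esub> ?\<phi> x'"
    proof -
      let ?g = "free_gen R s"
      note g = free_gen_carrier[OF s]
      have "?\<phi> x = ?\<phi> (x s \<odot>\<^bsub>free_module R ?S\<^esub> ?g \<oplus>\<^bsub>free_module R ?S\<^esub> x')" by (rule arg_cong[OF dec])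
      also have "\<dots> = x s \<odot>\<^bsub>M\<^esub> ?\<phi> ?g \<oplus>\<^bsub>M\<^esub> ?\<phi> x'"
        by (simp add: mod_hom_add[OF \<phi> FM.smult_closed[OF xs g] x'S] mod_hom_smult[OF \<phi> xs g])
      finally show ?thesis using M.lin_ext_gen[of c s] cc[OF s] by simp
    qed
    ultimately have "x s \<odot>\<^bsub>M\<^esub> c s = \<ominus>\<^bsub>M\<^esub> ?\<phi> x'"
      using x(2) xs cc[OF s] mod_hom_closed[OF \<phi> x'S] by (simp add: M.M.minus_equality)
    moreover have "\<ominus>\<^bsub>M\<^esub> ?\<phi> x' \<in> ?H" using M.submoduleE(3)[OF H] \<open>?\<phi> x' \<in> ?H\<close> by blast
    ultimately have "u \<odot>\<^bsub>M\<^esub> (x s \<odot>\<^bsub>M\<^esub> c s) \<in> ?H" using M.submoduleE(4)[OF H u(1)] by simp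
    hence csH: "c s \<in> ?H" using u xs cc[OF s] by (simp add: M.smult_assoc1[symmetric])
    have "F \<subseteq> ?H" using csH M.span_incl[of ?F'] by blast
    hence "K \<subseteq> ?H" using F(4) M.span_minimal[OF H] by blast
    hence "n \<le> card ?F'" using F by (intro least) auto
    moreover have "card ?F' < n" using F cS[OF s] by (metis card_Diff1_less)
    ultimately show False by simp
  qed
  ultimately show ?thesis using \<phi> by (intro exI[of _ n] exI[of _ ?\<phi>]) (auto simp: ideal_coords_def)
qed

theorem minimal_resolution:
  fixes N :: "('a, 'n) module" and \<tau> :: "nat \<Rightarrow> 's"
  assumes N: "finitely_generated R N" and \<tau>: "inj \<tau>"
  shows "\<exists>rk d e. resolves R N (\<lambda>k. free_module R (\<tau> ` {..<rk k})) d e \<and>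
    (\<forall>x\<in>carrier (free_module R (\<tau> ` {..<rk 0})). e x = \<zero>\<^bsub>N\<^esub> \<longrightarrow> x \<in> ideal_coords R (\<tau> ` {..<rk 0}) m) \<and>
    (\<forall>k. \<forall>x\<in>carrier (free_module R (\<tau> ` {..<rk (Suc k)})). d k x \<in> ideal_coords R (\<tau> ` {..<rk k}) m)"
proof -
  let ?F = "\<lambda>n. free_module R (\<tau> ` {..<n :: nat})"
  have FM: "module R (?F n)" for n by (rule free_is_module)
  interpret N: pmodule R N using N by (simp add: finitely_generated_def pmodule_def)
  obtain S where S: "S \<subseteq> carrier N" "finite S" "module_span R N S = carrier N"
    using N by (auto simp: finitely_generated_def)
  obtain n0 e where e: "e \<in> mod_hom R (?F n0) N" "e ` carrier (?F n0) = carrier N"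
    "\<forall>x\<in>carrier (?F n0). e x = \<zero>\<^bsub>N\<^esub> \<longrightarrow> x \<in> ideal_coords R (\<tau> ` {..<n0}) m"
    using minimal_cover[OF \<tau> N.module_axioms N.carrier_is_submodule S(2,1)] S(3) by blast
  have step: "\<exists>n' d. d \<in> mod_hom R (?F n') (?F n) \<and> d ` carrier (?F n') = K \<and>
    (\<forall>x\<in>carrier (?F n'). d x = \<zero>\<^bsub>?F n\<^esub> \<longrightarrow> x \<in> ideal_coords R (\<tau> ` {..<n'}) m)"
    if K: "submodule K R (?F n)" for n K
  proof -
    have fin: "finite (free_gen R ` \<tau> ` {..<n})" by simp
    have "free_gen R ` \<tau> ` {..<n} \<subseteq> carrier (?F n)" by (intro image_subsetI free_gen_carrier imageI) simp
    from finite_submodule_generators[OF FM fin this free_generated K]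
    obtain T where T: "T \<subseteq> K" "finite T" "K \<subseteq> module_span R (?F n) T" by blast
    show ?thesis by (rule minimal_cover[OF \<tau> FM K T(2,1,3)])
  qed
  define ker where "ker n d z = {x \<in> carrier (?F n). d x = z}" for n :: nat and d :: "('s \<Rightarrow> 'a) \<Rightarrow> 's \<Rightarrow> 'a" and z
  \<comment> \<open>A state consists of the rank \<open>n\<close>, the submodule \<open>K\<close> of
    the free module of that rank to be covered next, and the differential whose kernel is
    \<open>K\<close>. In the initial state \<open>K\<close> is the kernel of \<open>e\<close> and
    the third entry is a dummy.\<close>
  define P where "P (k :: nat) t \<longleftrightarrow> (case t of (n, K, d) \<Rightarrow> submodule K R (?F n) \<and>
    K \<subseteq> ideal_coords R (\<tau> ` {..<n}) m \<and> (k = 0 \<longrightarrow> n = n0 \<and> K = {x \<in> carrier (?F n). e x = \<zero>\<^bsub>N\<^esub>}))"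
    for k and t :: "nat \<times> ('s \<Rightarrow> 'a) set \<times> (('s \<Rightarrow> 'a) \<Rightarrow> 's \<Rightarrow> 'a)"
  define Q where "Q (k :: nat) t t' \<longleftrightarrow> (case t of (n, K, _) \<Rightarrow> case t' of (n', K', d) \<Rightarrow>
    d \<in> mod_hom R (?F n') (?F n) \<and> d ` carrier (?F n') = K \<and> K' = ker n' d \<zero>\<^bsub>?F n\<^esub>)"
    for k and t t' :: "nat \<times> ('s \<Rightarrow> 'a) set \<times> (('s \<Rightarrow> 'a) \<Rightarrow> 's \<Rightarrow> 'a)"
  have "\<exists>f. \<forall>k. P k (f k) \<and> Q k (f k) (f (Suc k))"
  proof (rule dependent_nat_choice)
    have "P 0 (n0, {x \<in> carrier (?F n0). e x = \<zero>\<^bsub>N\<^esub>}, \<lambda>x. x)"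
      unfolding P_def using kernel_submodule[OF FM N.module_axioms e(1)] e(3) by auto
    thus "\<exists>t. P 0 t" by blast
  next
    fix t k assume "P k t"
    then obtain n K d0 where t: "t = (n, K, d0)" "submodule K R (?F n)" unfolding P_def by (cases t) auto
    obtain n' d where d: "d \<in> mod_hom R (?F n') (?F n)" "d ` carrier (?F n') = K"
      "\<forall>x\<in>carrier (?F n'). d x = \<zero>\<^bsub>?F n\<^esub> \<longrightarrow> x \<in> ideal_coords R (\<tau> ` {..<n'}) m"
      using step[OF t(2)] by blast
    have "P (Suc k) (n', ker n' d \<zero>\<^bsub>?F n\<^esub>, d)"
      unfolding P_def ker_def using kernel_submodule[OF FM FM d(1)] d(3) by auto
    moreover have "Q k t (n', ker n' d \<zero>\<^bsub>?F n\<^esub>, d)" unfolding Q_def t using d by simp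
    ultimately show "\<exists>t'. P (Suc k) t' \<and> Q k t t'" by blast
  qed
  then obtain f where f: "\<And>k. P k (f k)" "\<And>k. Q k (f k) (f (Suc k))" by blast
  define rk where "rk k = fst (f k)" for k
  define K where "K k = fst (snd (f k))" for k
  define d where "d k = snd (snd (f (Suc k)))" for k
  have P: "K k \<subseteq> ideal_coords R (\<tau> ` {..<rk k}) m" for k
    using f(1)[of k] by (auto simp: P_def rk_def K_def split: prod.splits)
  have P0: "rk 0 = n0" "K 0 = {x \<in> carrier (?F (rk 0)). e x = \<zero>\<^bsub>N\<^esub>}"
    using f(1)[of 0] by (auto simp: P_def rk_def K_def split: prod.splits)
  have Q: "d k \<in> mod_hom R (?F (rk (Suc k))) (?F (rk k))" "d k ` carrier (?F (rk (Suc k))) = K k"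
    "K (Suc k) = {x \<in> carrier (?F (rk (Suc k))). d k x = \<zero>\<^bsub>?F (rk k)\<^esub>}" for k
    using f(2)[of k] by (auto simp: Q_def rk_def K_def d_def ker_def split: prod.splits)
  have res: "resolves R N (\<lambda>k. ?F (rk k)) d e"
    unfolding resolves_def using FM Q e(1,2) P0 by simp
  moreover have "\<forall>x\<in>carrier (?F (rk 0)). e x = \<zero>\<^bsub>N\<^esub> \<longrightarrow> x \<in> ideal_coords R (\<tau> ` {..<rk 0}) m"
    using e(3) P0 by simp
  moreover have "\<forall>k. \<forall>x\<in>carrier (?F (rk (Suc k))). d k x \<in> ideal_coords R (\<tau> ` {..<rk k}) m"
    using Q(2) P by blast
  ultimately show ?thesis by blast
qed

end

section \<open>Comparison with a minimal resolution and bounds on its length\<close>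

context noetherian_local_ring
begin

text \<open>The composite of \<open>\<beta>\<close> and \<open>\<alpha>\<close> and the identity of
  the free resolution both lift the identity of \<open>N\<close>. Their difference is therefore
  \<open>d s + s d\<close> for a homotopy \<open>s\<close>, and minimality puts both summands into
  \<open>m\<close> times the free module.\<close>

lemma minimal_comparison:
  fixes P :: "nat \<Rightarrow> ('a, 'p) module" and S :: "nat \<Rightarrow> 's set"
  assumes N: "module R N" and P: "\<And>k. free_retract R (P k)" and res: "resolves R N P dP eP"
    and G: "resolves R N (\<lambda>k. free_module R (S k)) d e"
    and min: "\<forall>k. \<forall>x\<in>carrier (free_module R (S (Suc k))). d k x \<in> ideal_coords R (S k) m"
  shows "\<exists>\<alpha> \<beta>. (\<forall>k. \<alpha> k \<in> mod_hom R (P k) (free_module R (S k))) \<and>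
    (\<forall>k. \<beta> k \<in> mod_hom R (free_module R (S k)) (P k)) \<and>
    (\<forall>k. \<forall>x\<in>carrier (P (Suc k)). d k (\<alpha> (Suc k) x) = \<alpha> k (dP k x)) \<and>
    (\<forall>k. \<forall>x\<in>carrier (free_module R (S (Suc k))). dP k (\<beta> (Suc k) x) = \<beta> k (d k x)) \<and>
    (\<forall>k. \<forall>x\<in>carrier (free_module R (S k)). \<alpha> k (\<beta> k x) \<ominus>\<^bsub>free_module R (S k)\<^esub> x \<in> ideal_coords R (S k) m)"
proof -
  let ?G = "\<lambda>k. free_module R (S k)"
  note min = min[rule_format]
  have Gfr: "free_retract R (?G k)" for k by (rule free_free_retract)
  have Gm: "module R (?G k)" for k by (rule free_is_module)
  note rP = resolvesD[OF res] and rG = resolvesD[OF G]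
  from comparison[OF N P res G] obtain \<alpha> where \<alpha>:
    "\<forall>k. \<alpha> k \<in> mod_hom R (P k) (?G k)" "\<forall>x\<in>carrier (P 0). e (\<alpha> 0 x) = eP x"
    "\<forall>k. \<forall>x\<in>carrier (P (Suc k)). d k (\<alpha> (Suc k) x) = \<alpha> k (dP k x)" by (elim exE conjE)
  from comparison[OF N Gfr G res] obtain \<beta> where \<beta>:
    "\<forall>k. \<beta> k \<in> mod_hom R (?G k) (P k)" "\<forall>x\<in>carrier (?G 0). eP (\<beta> 0 x) = e x"
    "\<forall>k. \<forall>x\<in>carrier (?G (Suc k)). dP k (\<beta> (Suc k) x) = \<beta> k (d k x)" by (elim exE conjE)
  have \<alpha>h: "\<alpha> k \<in> mod_hom R (P k) (?G k)" and \<beta>h: "\<beta> k \<in> mod_hom R (?G k) (P k)" for k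
    using \<alpha>(1) \<beta>(1) by auto
  interpret N: pmodule R N by (rule pmodule.intro) fact
  define \<psi> where "\<psi> k x = \<alpha> k (\<beta> k x) \<ominus>\<^bsub>?G k\<^esub> x" for k x
  have hom: "\<psi> k \<in> mod_hom R (?G k) (?G k)" for k
    unfolding \<psi>_def by (intro mod_hom_minus_map Gm mod_hom_compose[OF \<beta>h \<alpha>h] mod_hom_id)
  have \<psi>0: "e (\<psi> 0 x) = \<zero>\<^bsub>N\<^esub>" if x: "x \<in> carrier (?G 0)" for x
  proof -
    have b: "\<beta> 0 x \<in> carrier (P 0)" by (rule mod_hom_closed[OF \<beta>h x])
    have a: "\<alpha> 0 (\<beta> 0 x) \<in> carrier (?G 0)" by (rule mod_hom_closed[OF \<alpha>h b])
    show ?thesis unfolding \<psi>_def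
      using mod_hom_diff[OF Gm N rG(3) a x] \<alpha>(2) \<beta>(2) b x mod_hom_closed[OF rG(3) x] by (simp add: N.diff_self)
  qed
  have comm: "d k (\<psi> (Suc k) x) = \<psi> k (d k x)" if x: "x \<in> carrier (?G (Suc k))" for k x
  proof -
    have b: "\<beta> (Suc k) x \<in> carrier (P (Suc k))" by (rule mod_hom_closed[OF \<beta>h x])
    have a: "\<alpha> (Suc k) (\<beta> (Suc k) x) \<in> carrier (?G (Suc k))" by (rule mod_hom_closed[OF \<alpha>h b])
    have "d k (\<alpha> (Suc k) (\<beta> (Suc k) x)) = \<alpha> k (\<beta> k (d k x))" using \<alpha>(3) \<beta>(3) b x by simp
    thus ?thesis unfolding \<psi>_def using mod_hom_diff[OF Gm Gm rG(2) a x] by simp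
  qed
  have "\<exists>s. (\<forall>k. s k \<in> mod_hom R (?G k) (?G (Suc k))) \<and> (\<forall>x\<in>carrier (?G 0). \<psi> 0 x = d 0 (s 0 x)) \<and>
    (\<forall>k. \<forall>x\<in>carrier (?G (Suc k)). \<psi> (Suc k) x \<ominus>\<^bsub>?G (Suc k)\<^esub> s k (d k x) = d (Suc k) (s (Suc k) x))"
    by (rule null_homotopy[where P = ?G and G = ?G, OF Gfr G G hom \<psi>0 comm])
  then obtain s where s:
    "\<forall>k. s k \<in> mod_hom R (?G k) (?G (Suc k))" "\<forall>x\<in>carrier (?G 0). \<psi> 0 x = d 0 (s 0 x)"
    "\<forall>k. \<forall>x\<in>carrier (?G (Suc k)). \<psi> (Suc k) x \<ominus>\<^bsub>?G (Suc k)\<^esub> s k (d k x) = d (Suc k) (s (Suc k) x)"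
    by (elim exE conjE)
  have sh: "s k \<in> mod_hom R (?G k) (?G (Suc k))" for k using s(1) by simp
  have key: "\<psi> k x \<in> ideal_coords R (S k) m" if x: "x \<in> carrier (?G k)" for k x
  proof (cases k)
    case 0
    thus ?thesis using s(2) x min[OF mod_hom_closed[OF sh, of x 0]] by simp
  next
    case (Suc l)
    interpret G: pmodule R "?G k" by (rule free_pmodule)
    interpret Gl: pmodule R "?G l" by (rule free_pmodule)
    have x': "x \<in> carrier (?G (Suc l))" using x Suc by simp
    have dx: "d l x \<in> carrier (?G l)" by (rule mod_hom_closed[OF rG(2) x'])
    have 1: "\<psi> k x \<ominus>\<^bsub>?G k\<^esub> s l (d l x) \<in> ideal_coords R (S k) m"
      using s(3) x' min[OF mod_hom_closed[OF sh x']] Suc by simp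
    have 2: "s l (d l x) \<in> ideal_coords R (S k) m"
      using Gl.hom_free_ideal_coords[OF sh m_ideal min[OF x']] Suc by simp
    have 3: "(\<psi> k x \<ominus>\<^bsub>?G k\<^esub> s l (d l x)) \<oplus>\<^bsub>?G k\<^esub> s l (d l x) = \<psi> k x"
      by (rule G.diff_add_cancel'[OF mod_hom_closed[OF hom x]]) (use mod_hom_closed[OF sh dx] Suc in simp)
    show ?thesis using G.submoduleE(5)[OF ideal_coords_submodule[OF m_ideal] 1 2] 3 by simp
  qed
  show ?thesis
    using \<alpha>h \<beta>h \<alpha>(3) \<beta>(3) key unfolding \<psi>_def by (intro exI[of _ \<alpha>] exI[of _ \<beta>]) simp
qed

lemma one_neq_zero: "\<one> \<noteq> \<zero>"
  using one_notin_m additive_subgroup.zero_closed[OF ideal.axioms(1)[OF m_ideal]] by auto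

text \<open>Beyond the length of \<open>P\<close>, the composite through \<open>P\<close> is zero,
  but modulo \<open>m\<close> it is the identity; a basis element would have its coordinate
  \<open>1\<close> in \<open>m\<close>.\<close>

lemma minimal_resolution_terminates:
  fixes P :: "('a, 'p) cochain_complex" and S :: "nat \<Rightarrow> 's set"
  assumes N: "module R N" and P: "projective_resolution R N P eP"
    and bd: "\<forall>k < - int n. zero_module (obj P k)"
    and G: "resolves R N (\<lambda>k. free_module R (S k)) d e"
    and min: "\<forall>k. \<forall>x\<in>carrier (free_module R (S (Suc k))). d k x \<in> ideal_coords R (S k) m"
    and k: "k > n"
  shows "S k = {}"
proof (rule ccontr)
  assume "S k \<noteq> {}"
  then obtain s where s: "s \<in> S k" by blast
  let ?P = "\<lambda>k. obj P (- int k)" and ?G = "\<lambda>k. free_module R (S k)"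
  have fr: "free_retract R (?P k)" for k
    using P one_neq_zero by (intro projective_free_retract) (auto simp: projective_resolution_def)
  have res: "resolves R N ?P (\<lambda>k. diff P (- int (Suc k))) (eP 0)"
    by (rule resolves_if_projective_resolution[OF N P])
  from minimal_comparison[OF N fr res G min] obtain \<alpha> \<beta> where
    \<alpha>: "\<forall>k. \<alpha> k \<in> mod_hom R (?P k) (?G k)" and \<beta>: "\<forall>k. \<beta> k \<in> mod_hom R (?G k) (?P k)" and
    c: "\<forall>k. \<forall>x\<in>carrier (?G k). \<alpha> k (\<beta> k x) \<ominus>\<^bsub>?G k\<^esub> x \<in> ideal_coords R (S k) m" by (elim exE conjE)
  interpret G: pmodule R "?G k" by (rule free_pmodule)
  let ?g = "free_gen R s"
  have g: "?g \<in> carrier (?G k)" by (rule free_gen_carrier[OF s])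
  have "\<beta> k ?g \<in> carrier (?P k)" using mod_hom_closed[OF \<beta>[rule_format] g] .
  moreover have "zero_module (?P k)" using bd k by simp
  ultimately have "\<beta> k ?g = \<zero>\<^bsub>?P k\<^esub>" by (simp add: zero_module_def)
  moreover have "\<alpha> k \<zero>\<^bsub>?P k\<^esub> = \<zero>\<^bsub>?G k\<^esub>"
    by (rule mod_hom_zero[OF resolvesD(1)[OF res] G.module_axioms \<alpha>[rule_format]])
  ultimately have z: "\<zero>\<^bsub>?G k\<^esub> \<ominus>\<^bsub>?G k\<^esub> ?g \<in> ideal_coords R (S k) m" using c g by metis
  have "\<ominus>\<^bsub>?G k\<^esub> (\<zero>\<^bsub>?G k\<^esub> \<ominus>\<^bsub>?G k\<^esub> ?g) = ?g" using g by (simp add: G.minus_diff G.diff_zero)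
  hence "?g \<in> ideal_coords R (S k) m"
    using G.submoduleE(3)[OF ideal_coords_submodule[OF m_ideal] z] by simp
  hence "?g s \<in> m" by (simp add: ideal_coords_def)
  thus False using one_notin_m by (simp add: free_gen_def)
qed

lemma free_empty: "carrier (free_module R {}) = {\<lambda>s. \<zero>}"
  by (auto simp: free_carrier)

text \<open>The basis labels are taken in \<open>'n \<times> nat\<close> because
  \<open>proj_dim\<close> admits only resolutions carried by
  \<open>'n \<times> nat \<Rightarrow> 'a\<close>. In positive degrees the complex is continued by
  the free module on the empty basis.\<close>

lemma proj_dim_le_length:
  fixes N :: "('a, 'n) module" and S :: "nat \<Rightarrow> ('n \<times> nat) set"
  assumes N: "module R N" and G: "resolves R N (\<lambda>k. free_module R (S k)) d e"
    and q: "\<forall>k>q. S k = {}"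
  shows "proj_dim R N \<le> enat q"
proof -
  let ?G = "\<lambda>k. free_module R (S k)"
  note rG = resolvesD[OF G]
  interpret N: pmodule R N by (rule pmodule.intro) fact
  define C :: "('a, 'n \<times> nat \<Rightarrow> 'a) cochain_complex" where
    "C = \<lparr>obj = (\<lambda>p. free_module R (if p \<le> 0 then S (nat (- p)) else {})),
          diff = (\<lambda>p. if p < 0 then d (nat (- p) - 1) else (\<lambda>_ _. \<zero>))\<rparr>"
  define f where "f p = (if p = 0 then e else (\<lambda>_. \<zero>\<^bsub>N\<^esub>))" for p :: int
  have Cobj: "obj C (- int k) = ?G k" "obj C 0 = ?G 0" for k by (simp_all add: C_def)
  have Cobj1: "obj C (- int (Suc k) + 1) = ?G k" for k using Cobj(1)[of k] by simp
  have Cdiff: "diff C (- int (Suc k)) = d k" for k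
  proof -
    have "nat (- (- int (Suc k))) - 1 = k" by simp
    moreover have "- int (Suc k) < 0" by simp
    ultimately show ?thesis unfolding C_def cochain_complex.simps by metis
  qed
  have Cobj_pos: "obj C p = free_module R {}" if "p > 0" for p using that by (simp add: C_def)
  have Cdiff_pos: "diff C p = (\<lambda>_ _. \<zero>)" if "p \<ge> 0" for p using that by (simp add: C_def)
  have Czero: "\<zero>\<^bsub>obj C p\<^esub> = (\<lambda>_. \<zero>)" for p by (simp add: C_def free_simps)
  have Cmod: "module R (obj C p)" for p unfolding C_def by (simp add: free_is_module)
  have pcases: "(\<exists>k. p = - int (Suc k)) \<or> p = 0 \<or> p > 0" for p :: int
  proof (cases "p < 0")
    case True
    hence "p = - int (Suc (nat (- p) - 1))" by simp
    thus ?thesis by blast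
  qed auto
  have Chom: "diff C p \<in> mod_hom R (obj C p) (obj C (p + 1))" for p
  proof (cases "p < 0")
    case True
    then obtain k where k: "p = - int (Suc k)" using pcases[of p] by auto
    show ?thesis unfolding k Cdiff Cobj1 Cobj by (rule rG(2))
  next
    case False
    hence "diff C p = (\<lambda>_. \<zero>\<^bsub>obj C (p + 1)\<^esub>)" using Cdiff_pos Czero by auto
    thus ?thesis using mod_hom_zero_map[OF Cmod] by metis
  qed
  have dd: "diff C (p + 1) (diff C p x) = \<zero>\<^bsub>obj C (p + 2)\<^esub>" if x: "x \<in> carrier (obj C p)" for p x
  proof (cases "p + 1 < 0")
    case True
    then obtain k where k: "p + 1 = - int (Suc k)" using pcases[of "p + 1"] by auto
    hence p: "p = - int (Suc (Suc k))" by simp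
    have "d k (d (Suc k) x) = \<zero>\<^bsub>?G k\<^esub>" by (rule rG(6)) (use x p Cobj(1)[of "Suc (Suc k)"] in simp)
    moreover have "diff C p = d (Suc k)" using Cdiff[of "Suc k"] p by simp
    moreover have "diff C (p + 1) = d k" unfolding k by (rule Cdiff)
    ultimately show ?thesis using Czero[of "p + 2"] by (simp add: free_simps)
  next
    case False
    thus ?thesis using Cdiff_pos[of "p + 1"] Czero by simp
  qed
  have C: "is_complex R C" unfolding is_complex_def using Cmod Chom dd by blast
  let ?S = "stalk_complex N 0"
  have CS: "is_complex R ?S" by (rule stalk_is_complex[OF N])
  note cS = stalk_coboundaries[OF N, of 0]
  have S0: "obj ?S 0 = N" "zero (obj ?S p) = \<zero>\<^bsub>N\<^esub>" "p \<noteq> 0 \<Longrightarrow> carrier (obj ?S p) = {\<zero>\<^bsub>N\<^esub>}" for p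
    by (simp_all add: stalk_complex_def)
  have fhom: "f p \<in> mod_hom R (obj C p) (obj ?S p)" for p
  proof (cases "p = 0")
    case True
    thus ?thesis using rG(3) Cobj S0 by (simp add: f_def)
  next
    case False
    thus ?thesis using mod_hom_zero_map[OF is_complexD(1)[OF CS], of p "obj C p"] S0(2) by (simp add: f_def)
  qed
  have fcomm: "f (p + 1) (diff C p x) = diff ?S p (f p x)" if x: "x \<in> carrier (obj C p)" for p x
  proof (cases "p = -1")
    case True
    hence "x \<in> carrier (?G (Suc 0))" using x Cobj(1)[of "Suc 0"] by simp
    thus ?thesis using True rG(5) Cdiff[of 0] by (simp add: f_def stalk_complex_def)
  next
    case False
    thus ?thesis by (simp add: f_def stalk_complex_def)
  qed
  have chain: "chain_map R C ?S f" unfolding chain_map_def using fhom fcomm by blast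
  have inj: "z \<in> coboundaries C p" if z: "z \<in> cocycles C p" "f p z \<in> coboundaries ?S p" for p z
  proof -
    have zc: "z \<in> carrier (obj C p)" "diff C p z = \<zero>\<^bsub>obj C (p + 1)\<^esub>" using z by (auto simp: cocycles_def)
    consider k where "p = - int (Suc k)" | "p = 0" | "p > 0" using pcases[of p] by blast
    thus ?thesis
    proof cases
      case 1
      have "z \<in> d (Suc k) ` carrier (?G (Suc (Suc k)))"
        by (rule rG(8)) (use zc 1 Cobj(1)[of "Suc k"] Cdiff[of k] Cobj1[of k] in auto)
      moreover have "p - 1 = - int (Suc (Suc k))" using 1 by simp
      ultimately show ?thesis unfolding coboundaries_def by (simp only: Cdiff Cobj)
    next
      case 2
      have "z \<in> d 0 ` carrier (?G (Suc 0))"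
        by (rule rG(7)) (use zc 2 Cobj z(2) cS S0 in \<open>auto simp: f_def\<close>)
      moreover have "p - 1 = - int (Suc 0)" using 2 by simp
      ultimately show ?thesis unfolding coboundaries_def by (simp only: Cdiff Cobj)
    next
      case 3
      have "z = (\<lambda>s. \<zero>)" using zc(1) unfolding Cobj_pos[OF 3] free_empty by simp
      hence "z = \<zero>\<^bsub>obj C p\<^esub>" unfolding Czero .
      thus ?thesis
        using pmodule.submodule_zero[OF pmodule.intro[OF Cmod] coboundaries_submodule[OF C]] by simp
    qed
  qed
  have surj: "\<exists>z\<in>cocycles C p. z' \<ominus>\<^bsub>obj ?S p\<^esub> f p z \<in> coboundaries ?S p" if z': "z' \<in> cocycles ?S p" for p z'
  proof -
    interpret Sp: pmodule R "obj ?S p" by (rule pmodule.intro) (rule is_complexD(1)[OF CS])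
    have zc: "z' \<in> carrier (obj ?S p)" using z' by (simp add: stalk_cocycles)
    have "\<exists>z\<in>cocycles C p. f p z = z'"
    proof (cases "p = 0")
      case True
      hence "z' \<in> e ` carrier (?G 0)" using zc S0 rG(4) by simp
      then obtain z where z: "z \<in> carrier (?G 0)" "e z = z'" by blast
      have "z \<in> cocycles C 0" using z Cobj Cdiff_pos[of 0] Czero by (simp add: cocycles_def)
      thus ?thesis using True z by (auto simp: f_def)
    next
      case False
      have "\<zero>\<^bsub>obj C p\<^esub> \<in> cocycles C p"
        by (rule pmodule.submodule_zero[OF pmodule.intro[OF Cmod] cocycles_submodule[OF C]])
      thus ?thesis using False zc S0(3) by (auto simp: f_def)
    qed
    then obtain z where "z \<in> cocycles C p" "f p z = z'" by blast
    thus ?thesis using zc by (intro bexI[of _ z]) (simp_all add: cS Sp.diff_self)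
  qed
  have proj: "projective_module R (obj C p)" for p
    unfolding C_def by (simp add: free_retract_projective free_free_retract)
  have "projective_resolution R N C f"
    unfolding projective_resolution_def
  proof (intro conjI allI impI)
    show "zero_module (obj C p)" if "p > 0" for p
      using Cobj_pos[OF that] Czero[of p] free_empty by (simp add: zero_module_def)
    show "quasi_isomorphism R C ?S f"
      unfolding quasi_isomorphism_iff[OF C CS] using chain inj surj by blast
  qed (use C proj in auto)
  moreover have "zero_module (obj C p)" if "p < - int q" for p
  proof -
    have "S (nat (- p)) = {}" using q that by auto
    hence "obj C p = free_module R {}" by (simp add: C_def)
    thus ?thesis using Czero[of p] free_empty by (simp add: zero_module_def)
  qed
  ultimately have "\<exists>(P :: ('a, 'n \<times> nat \<Rightarrow> 'a) cochain_complex) e.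
      projective_resolution R N P e \<and> (\<forall>k < - int q. zero_module (obj P k))"
    by (intro exI[of _ C] exI[of _ f]) simp
  hence "enat q \<in> {enat n | n. \<exists>(P :: ('a, 'n \<times> nat \<Rightarrow> 'a) cochain_complex) e.
      projective_resolution R N P e \<and> (\<forall>k < - int n. zero_module (obj P k))}"
    by (intro CollectI exI[of _ q]) simp
  thus ?thesis unfolding proj_dim_def by (rule Inf_lower)
qed

text \<open>The induction step of the vanishing of \<open>Tor\<^sub>j(N, R/(x\<^sub>1, \<dots>, x\<^sub>k))\<close> for \<open>j > k\<close>,
  where the complex \<open>G / (x\<^sub>1, \<dots>, x\<^sub>k) G\<close> is exact in degree \<open>j\<close>.\<close>

lemma exact_mod_regular_step:
  fixes S :: "nat \<Rightarrow> 's set"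
  assumes G: "resolves R N (\<lambda>k. free_module R (S k)) d e"
    and I: "ideal I R" and x: "x \<in> carrier R" and reg: "colon R I x = I"
    and J: "ideal J R" "I \<subseteq> J" "x \<in> J" "J \<subseteq> Idl (insert x I)"
    and ex: "\<And>j v. k \<le> j \<Longrightarrow> v \<in> carrier (free_module R (S (Suc j))) \<Longrightarrow> d j v \<in> ideal_coords R (S j) I \<Longrightarrow>
      \<exists>w\<in>carrier (free_module R (S (Suc (Suc j)))).
        v \<ominus>\<^bsub>free_module R (S (Suc j))\<^esub> d (Suc j) w \<in> ideal_coords R (S (Suc j)) I"
    and j: "Suc k \<le> j" and v: "v \<in> carrier (free_module R (S (Suc j)))" "d j v \<in> ideal_coords R (S j) J"
  shows "\<exists>w\<in>carrier (free_module R (S (Suc (Suc j)))).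
        v \<ominus>\<^bsub>free_module R (S (Suc j))\<^esub> d (Suc j) w \<in> ideal_coords R (S (Suc j)) J"
proof -
  obtain i where i: "j = Suc i" "k \<le> i" using j by (cases j) auto
  let ?G = "\<lambda>k. free_module R (S k)"
  note rG = resolvesD[OF G]
  interpret Gi: pmodule R "?G i" by (rule free_pmodule)
  interpret Gj: pmodule R "?G j" by (rule free_pmodule)
  interpret Gs: pmodule R "?G (Suc j)" by (rule free_pmodule)
  note subI = ideal_coords_submodule[OF I] and subJ = ideal_coords_submodule[OF J(1)]
  have ID: "\<zero> \<in> I" using additive_subgroup.zero_closed[OF ideal.axioms(1)[OF I]] .
  let ?u = "d j v"
  have uc: "?u \<in> carrier (?G j)" by (rule mod_hom_closed[OF rG(2) v(1)])
  have uJ: "?u s \<in> J" for s using v(2) by (simp add: ideal_coords_def)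
  \<comment> \<open>Each coordinate of \<open>d j v\<close> lies in \<open>I + (x)\<close> and is
    split accordingly. Taking \<open>b = 0\<close> wherever the coordinate is zero keeps the support
    of \<open>b\<close> finite.\<close>
  have "\<forall>s. \<exists>b. b \<in> carrier R \<and> ?u s \<ominus> b \<otimes> x \<in> I \<and> (?u s = \<zero> \<longrightarrow> b = \<zero>)"
  proof
    fix s
    show "\<exists>b. b \<in> carrier R \<and> ?u s \<ominus> b \<otimes> x \<in> I \<and> (?u s = \<zero> \<longrightarrow> b = \<zero>)"
    proof (cases "?u s = \<zero>")
      case True
      have "?u s \<ominus> \<zero> \<otimes> x = \<zero>" using True x by (simp add: a_minus_def)
      thus ?thesis using ID by (intro exI[of _ \<zero>]) simp
    next
      case False
      have "?u s \<in> Idl (insert x I)" using uJ J(4) by blast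
      then obtain a b where ab: "a \<in> I" "b \<in> carrier R" "?u s = a \<oplus> b \<otimes> x" using Idl_insert[OF I x] by blast
      have "?u s \<ominus> b \<otimes> x = a" using ab x ideal.Icarr[OF I ab(1)] by (simp add: a_minus_def a_assoc r_neg)
      thus ?thesis using ab False by blast
    qed
  qed
  then obtain b where b: "\<And>s. b s \<in> carrier R" "\<And>s. ?u s \<ominus> b s \<otimes> x \<in> I" "\<And>s. ?u s = \<zero> \<Longrightarrow> b s = \<zero>" by metis
  have nz: "?u s \<noteq> \<zero>" if "b s \<noteq> \<zero>" for s using b(3) that by blast
  have bc: "b \<in> carrier (?G j)"
  proof -
    have "{s. b s \<noteq> \<zero>} \<subseteq> {s. ?u s \<noteq> \<zero>}" using nz by blast
    hence "finite {s. b s \<noteq> \<zero>}" using uc by (rule_tac finite_subset) (auto simp: free_carrier)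
    thus ?thesis using uc b(1) nz by (simp add: free_carrier)
  qed
  have xb: "x \<odot>\<^bsub>?G j\<^esub> b \<in> carrier (?G j)" using x bc by simp
  let ?w = "?u \<ominus>\<^bsub>?G j\<^esub> x \<odot>\<^bsub>?G j\<^esub> b"
  have wc: "?w \<in> carrier (?G j)" using uc xb by simp
  have minus_coord: "(f \<ominus>\<^bsub>?G j\<^esub> g) s = f s \<ominus> g s" if "f \<in> carrier (?G j)" "g \<in> carrier (?G j)" for f g s
  proof -
    have "(f \<ominus>\<^bsub>?G j\<^esub> g) = f \<oplus>\<^bsub>?G j\<^esub> (\<ominus> \<one>) \<odot>\<^bsub>?G j\<^esub> g" using that by (simp add: a_minus_def Gj.smult_l_minus)
    thus ?thesis using that by (simp add: free_simps a_minus_def l_minus free_carrier)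
  qed
  have wI: "?w \<in> ideal_coords R (S j) I"
    unfolding ideal_coords_def using wc minus_coord[OF uc xb] b(1,2) x by (simp add: free_simps m_comm)
  \<comment> \<open>From \<open>d d v = 0\<close> and \<open>d v = w + x b\<close> with
    \<open>w\<close> in \<open>I G\<close> it follows that \<open>x d b\<close> is in
    \<open>I G\<close>, hence \<open>d b\<close> by regularity. The hypothesis \<open>ex\<close>,
    one degree lower, gives \<open>b = d c\<close> modulo \<open>I G\<close>, and then the boundary
    of \<open>v - x c\<close> is in \<open>I G\<close>.\<close>
  have "d i ?u = \<zero>\<^bsub>?G i\<^esub>" using rG(6)[of v i] v(1) i(1) by simp
  moreover have "d i ?w = d i ?u \<ominus>\<^bsub>?G i\<^esub> d i (x \<odot>\<^bsub>?G j\<^esub> b)"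
    using mod_hom_diff[OF free_is_module free_is_module rG(2)[of i], of ?u "x \<odot>\<^bsub>?G j\<^esub> b"] uc xb i(1) by simp
  moreover have dib: "d i b \<in> carrier (?G i)" using mod_hom_closed[OF rG(2)[of i]] bc i(1) by simp
  moreover have "d i (x \<odot>\<^bsub>?G j\<^esub> b) = x \<odot>\<^bsub>?G i\<^esub> d i b" using mod_hom_smult[OF rG(2)[of i] x] bc i(1) by simp
  ultimately have "x \<odot>\<^bsub>?G i\<^esub> d i b = \<ominus>\<^bsub>?G i\<^esub> d i ?w"
    using x by (simp add: Gi.minus_diff Gi.diff_zero)
  moreover have "d i ?w \<in> ideal_coords R (S i) I"
    using Gi.hom_free_ideal_coords[OF rG(2)[of i] I] wI i(1) by simp
  ultimately have "x \<odot>\<^bsub>?G i\<^esub> d i b \<in> ideal_coords R (S i) I" using Gi.submoduleE(3)[OF subI] by simp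
  hence "d i b s \<in> colon R I x" for s
    using dib x by (simp add: ideal_coords_def free_simps colon_def free_carrier m_comm)
  hence "d i b \<in> ideal_coords R (S i) I" using reg dib by (simp add: ideal_coords_def)
  then obtain c where c: "c \<in> carrier (?G (Suc j))" "b \<ominus>\<^bsub>?G j\<^esub> d j c \<in> ideal_coords R (S j) I"
    using ex[OF i(2), of b] bc i(1) by auto
  have djc: "d j c \<in> carrier (?G j)" by (rule mod_hom_closed[OF rG(2) c(1)])
  have xc: "x \<odot>\<^bsub>?G (Suc j)\<^esub> c \<in> carrier (?G (Suc j))" using x c by simp
  have "d j (v \<ominus>\<^bsub>?G (Suc j)\<^esub> x \<odot>\<^bsub>?G (Suc j)\<^esub> c) = ?u \<ominus>\<^bsub>?G j\<^esub> x \<odot>\<^bsub>?G j\<^esub> d j c"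
    using mod_hom_diff[OF free_is_module free_is_module rG(2) v(1) xc] mod_hom_smult[OF rG(2) x c(1)] by simp
  also have "\<dots> = ?w \<oplus>\<^bsub>?G j\<^esub> (x \<odot>\<^bsub>?G j\<^esub> b \<ominus>\<^bsub>?G j\<^esub> x \<odot>\<^bsub>?G j\<^esub> d j c)"
    using Gj.diff_add_diff[OF uc xb Gj.smult_closed[OF x djc]] by simp
  also have "\<dots> = ?w \<oplus>\<^bsub>?G j\<^esub> x \<odot>\<^bsub>?G j\<^esub> (b \<ominus>\<^bsub>?G j\<^esub> d j c)" using Gj.smult_diff[OF x bc djc] by simp
  also have "\<dots> \<in> ideal_coords R (S j) I"
    using Gj.submoduleE(5)[OF subI wI] Gj.submoduleE(4)[OF subI x c(2)] by simp
  finally have vcI: "d j (v \<ominus>\<^bsub>?G (Suc j)\<^esub> x \<odot>\<^bsub>?G (Suc j)\<^esub> c) \<in> ideal_coords R (S j) I" .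
  have kj: "k \<le> j" using i by simp
  from ex[OF kj _ vcI] v(1) xc obtain w where w: "w \<in> carrier (?G (Suc (Suc j)))"
    "(v \<ominus>\<^bsub>?G (Suc j)\<^esub> x \<odot>\<^bsub>?G (Suc j)\<^esub> c) \<ominus>\<^bsub>?G (Suc j)\<^esub> d (Suc j) w \<in> ideal_coords R (S (Suc j)) I"
    by auto
  have dw: "d (Suc j) w \<in> carrier (?G (Suc j))" by (rule mod_hom_closed[OF rG(2) w(1)])
  have 1: "(v \<ominus>\<^bsub>?G (Suc j)\<^esub> x \<odot>\<^bsub>?G (Suc j)\<^esub> c) \<ominus>\<^bsub>?G (Suc j)\<^esub> d (Suc j) w \<in> ideal_coords R (S (Suc j)) J"
    using w(2) J(2) by (auto simp: ideal_coords_def)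
  have 2: "x \<odot>\<^bsub>?G (Suc j)\<^esub> c \<in> ideal_coords R (S (Suc j)) J" by (rule ideal_coords_smult[OF J(1,3) c(1)])
  have "((v \<ominus>\<^bsub>?G (Suc j)\<^esub> x \<odot>\<^bsub>?G (Suc j)\<^esub> c) \<ominus>\<^bsub>?G (Suc j)\<^esub> d (Suc j) w) \<oplus>\<^bsub>?G (Suc j)\<^esub> x \<odot>\<^bsub>?G (Suc j)\<^esub> c
    = v \<ominus>\<^bsub>?G (Suc j)\<^esub> d (Suc j) w"
    using v(1) xc dw by (simp add: a_minus_def Gs.M.a_assoc Gs.M.a_comm[of "\<ominus>\<^bsub>?G (Suc j)\<^esub> d (Suc j) w"] Gs.M.r_neg1)
  hence "v \<ominus>\<^bsub>?G (Suc j)\<^esub> d (Suc j) w \<in> ideal_coords R (S (Suc j)) J"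
    using Gs.submoduleE(5)[OF subJ 1 2] by simp
  thus ?thesis using w(1) by blast
qed

text \<open>Let \<open>I\<close> be generated by \<open>xs\<close>. By minimality, \<open>y\<close>
  times a basis element of \<open>G\<^sub>q\<close> has its boundary in \<open>y m G\<close>, hence
  in \<open>I G\<close>. If \<open>q\<close> exceeded the length of \<open>xs\<close>, exactness
  modulo \<open>I\<close> and \<open>G\<^sub>q\<^sub>+\<^sub>1 = 0\<close> would place this element
  in \<open>I G\<close>, forcing \<open>y \<in> I\<close>.\<close>

lemma length_le_regular_sequence:
  fixes S :: "nat \<Rightarrow> 's set"
  assumes G: "resolves R N (\<lambda>k. free_module R (S k)) d e"
    and min: "\<forall>k. \<forall>x\<in>carrier (free_module R (S (Suc k))). d k x \<in> ideal_coords R (S k) m"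
    and q: "S q \<noteq> {}" "S (Suc q) = {}"
    and xs: "set xs \<subseteq> m" "regular_sequence R xs"
    and y: "y \<in> carrier R" "y \<notin> Idl (set xs)" "\<forall>a\<in>m. a \<otimes> y \<in> Idl (set xs)"
  shows "q \<le> length xs"
proof (rule ccontr)
  assume "\<not> q \<le> length xs"
  then obtain j where j: "q = Suc j" "length xs \<le> j" by (cases q) auto
  note min = min[rule_format]
  let ?G = "\<lambda>k. free_module R (S k)"
  note rG = resolvesD[OF G]
  have xc: "set xs \<subseteq> carrier R" using xs m_sub by auto
  define J where "J k = Idl (set (take k xs))" for k
  have tk: "set (take k xs) \<subseteq> carrier R" for k using xc set_take_subset[of k xs] by blast
  have J: "ideal (J k) R" for k unfolding J_def by (rule genideal_ideal[OF tk])
  have main: "\<exists>w\<in>carrier (?G (Suc (Suc j))). v \<ominus>\<^bsub>?G (Suc j)\<^esub> d (Suc j) w \<in> ideal_coords R (S (Suc j)) (J k)"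
    if "k \<le> length xs" "k \<le> j" "v \<in> carrier (?G (Suc j))" "d j v \<in> ideal_coords R (S j) (J k)" for k j v
    using that
  proof (induction k arbitrary: j v)
    case 0
    interpret Gs: pmodule R "?G (Suc j)" by (rule free_pmodule)
    have "J 0 \<subseteq> {\<zero>}" unfolding J_def by (rule genideal_minimal[OF zeroideal]) simp
    hence "d j v = \<zero>\<^bsub>?G j\<^esub>" using 0 by (auto simp: ideal_coords_def free_simps)
    then obtain w where w: "w \<in> carrier (?G (Suc (Suc j)))" "v = d (Suc j) w" using rG(8)[OF 0(3)] by blast
    hence "v \<ominus>\<^bsub>?G (Suc j)\<^esub> d (Suc j) w = \<zero>\<^bsub>?G (Suc j)\<^esub>" using 0 by (simp add: Gs.diff_self)
    thus ?case using w(1) Gs.submodule_zero[OF ideal_coords_submodule[OF J]] by metis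
  next
    case (Suc k)
    have kl: "k < length xs" using Suc.prems by simp
    let ?x = "xs ! k"
    have "?x \<in> set xs" using kl by (rule nth_mem)
    hence xk: "?x \<in> m" "?x \<in> carrier R" using xs(1) m_sub by auto
    have set: "set (take (Suc k) xs) = insert ?x (set (take k xs))"
      using kl by (simp add: take_Suc_conv_app_nth)
    have reg: "colon R (J k) ?x = J k"
    proof
      show "J k \<subseteq> colon R (J k) ?x" by (rule colon_superset[OF J xk(2)])
      show "colon R (J k) ?x \<subseteq> J k"
        using xs(2) kl xk(2) unfolding regular_sequence_def J_def colon_def by (auto simp: m_comm)
    qed
    have Jk: "set (take k xs) \<subseteq> J k" unfolding J_def by (rule genideal_self[OF tk])
    have c: "insert ?x (J k) \<subseteq> carrier R" using xk ideal.Icarr[OF J] by blast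
    have 1: "J k \<subseteq> J (Suc k)" unfolding J_def
      by (rule subset_Idl_subset[OF tk]) (use set in auto)
    have 2: "?x \<in> J (Suc k)" unfolding J_def using genideal_self[OF tk[of "Suc k"]] set by blast
    have 3: "J (Suc k) \<subseteq> Idl (insert ?x (J k))"
      unfolding J_def[of "Suc k"] set
      by (rule genideal_minimal[OF genideal_ideal[OF c]]) (use Jk genideal_self[OF c] in blast)
    show ?case
      by (rule exact_mod_regular_step[OF G J xk(2) reg J 1 2 3 _ Suc.prems(2-4)])
         (use Suc.IH kl in simp)
  qed
  obtain s where s: "s \<in> S q" using q by blast
  interpret Gq: pmodule R "?G q" by (rule free_pmodule)
  let ?g = "free_gen R s" and ?I = "J (length xs)"
  have g: "?g \<in> carrier (?G q)" by (rule free_gen_carrier[OF s])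
  let ?v = "y \<odot>\<^bsub>?G q\<^esub> ?g"
  have v: "?v \<in> carrier (?G q)" using y g by simp
  have I: "?I = Idl (set xs)" by (simp add: J_def)
  have dg: "d j ?g \<in> ideal_coords R (S j) m" using min[of ?g j] g j(1) by simp
  have "d j ?v = y \<odot>\<^bsub>?G j\<^esub> d j ?g" using mod_hom_smult[OF rG(2)[of j] y(1)] g j(1) by simp
  moreover have "y \<odot>\<^bsub>?G j\<^esub> d j ?g \<in> carrier (?G j)"
    using dg by (intro module.smult_closed[OF free_is_module y(1)]) (simp add: ideal_coords_def)
  moreover have "y \<otimes> d j ?g t \<in> ?I" for t
  proof -
    have t: "d j ?g t \<in> m" using dg by (simp add: ideal_coords_def)
    have "d j ?g t \<otimes> y \<in> ?I" using y(3) t by (simp add: I)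
    thus ?thesis using m_comm[OF y(1) m_sub[OF t]] by simp
  qed
  ultimately have "d j ?v \<in> ideal_coords R (S j) ?I" by (simp add: ideal_coords_def free_simps)
  then obtain w where w: "w \<in> carrier (?G (Suc q))" "?v \<ominus>\<^bsub>?G q\<^esub> d q w \<in> ideal_coords R (S q) ?I"
    using main[of "length xs" j ?v] j v by auto
  have "w = \<zero>\<^bsub>?G (Suc q)\<^esub>" using w(1) unfolding q(2) free_empty free_simps by simp
  hence "d q w = \<zero>\<^bsub>?G q\<^esub>" using mod_hom_zero[OF free_is_module free_is_module rG(2)[of q]] by simp
  hence "?v \<in> ideal_coords R (S q) ?I" using w(2) v by (simp add: Gq.diff_zero)
  hence "?v s \<in> ?I" by (simp add: ideal_coords_def)
  thus False using y I by (simp add: free_simps free_gen_def)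
qed

theorem minimal_resolution_of_large_length:
  fixes N :: "('a, 'n) module"
  assumes N: "finitely_generated R N" and pd: "proj_dim R N < \<infinity>" and i: "1 \<le> i" "\<not> proj_dim R N < enat i"
    and depth: "depth R m = enat r"
  shows "\<exists>(S :: nat \<Rightarrow> ('n \<times> nat) set) d e q. resolves R N (\<lambda>k. free_module R (S k)) d e \<and>
    (\<forall>k. finite (S k)) \<and>
    (\<forall>k. \<forall>x\<in>carrier (free_module R (S (Suc k))). d k x \<in> ideal_coords R (S k) m) \<and>
    S q \<noteq> {} \<and> S (Suc q) = {} \<and> i \<le> q \<and> q \<le> r"
proof -
  have Nm: "module R N" using N by (simp add: finitely_generated_def)
  let ?\<tau> = "Pair undefined :: nat \<Rightarrow> 'n \<times> nat"
  have \<tau>: "inj ?\<tau>" by (auto simp: inj_on_def)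
  from minimal_resolution[OF N \<tau>] obtain rk d e where
    res: "resolves R N (\<lambda>k. free_module R (?\<tau> ` {..<rk k})) d e" and
    min: "\<forall>k. \<forall>x\<in>carrier (free_module R (?\<tau> ` {..<rk (Suc k)})). d k x \<in> ideal_coords R (?\<tau> ` {..<rk k}) m"
    by (elim exE conjE)
  define S where "S k = ?\<tau> ` {..<rk k}" for k
  have res: "resolves R N (\<lambda>k. free_module R (S k)) d e" using res by (simp add: S_def)
  have min: "\<forall>k. \<forall>x\<in>carrier (free_module R (S (Suc k))). d k x \<in> ideal_coords R (S k) m"
    using min by (simp add: S_def)
  have fin: "finite (S k)" for k by (simp add: S_def)
  have "{enat n | n. \<exists>(P :: ('a, 'n \<times> nat \<Rightarrow> 'a) cochain_complex) e.
      projective_resolution R N P e \<and> (\<forall>k < - int n. zero_module (obj P k))} \<noteq> {}"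
    using pd unfolding proj_dim_def by (auto simp: Inf_enat_def split: if_splits)
  then obtain n eP and P :: "('a, 'n \<times> nat \<Rightarrow> 'a) cochain_complex" where
    P: "projective_resolution R N P eP" "\<forall>k < - int n. zero_module (obj P k)" by blast
  have vanish: "S k = {}" if "k > n" for k
    by (rule minimal_resolution_terminates[OF Nm P res min that])
  define q where "q = (LEAST q. \<forall>k>q. S k = {})"
  have q: "\<forall>k>q. S k = {}" unfolding q_def by (rule LeastI[of _ n]) (use vanish in blast)
  have "proj_dim R N \<le> enat q" by (rule proj_dim_le_length[OF Nm res q])
  hence "enat i \<le> enat q" using i(2) by (simp add: not_less) (meson order_trans enat_ord_simps(1))
  hence iq: "i \<le> q" by simp
  \<comment> \<open>If \<open>S q\<close> were empty, \<open>q - 1\<close> would satisfy the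
    condition defining \<open>q\<close> as well; by \<open>1 \<le> i \<le> q\<close> it is strictly
    smaller.\<close>
  have Sq: "S q \<noteq> {}"
  proof
    assume "S q = {}"
    hence "\<forall>k>q - 1. S k = {}" using q by (metis Suc_pred' i(1) iq le_trans less_Suc_eq not_less_eq One_nat_def Suc_le_eq zero_less_one less_le_trans not_less)
    hence "q \<le> q - 1" unfolding q_def by (rule Least_le)
    thus False using i(1) iq by simp
  qed
  obtain xs y where xs: "length xs = r" "set xs \<subseteq> m" "regular_sequence R xs"
    and y: "y \<in> carrier R" "y \<notin> Idl (set xs)" "\<forall>a\<in>m. a \<otimes> y \<in> Idl (set xs)"
    using depth_witness[OF depth] by blast
  have "q \<le> r"
    using length_le_regular_sequence[OF res min Sq _ xs(2,3) y] q xs(1) by simp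
  thus ?thesis using res fin min Sq q iq by (intro exI[of _ S] exI[of _ d] exI[of _ e] exI[of _ q]) simp
qed

end

section \<open>The double complex\<close>

lemma product_module_simps:
  "f \<in> carrier (product_module M) \<longleftrightarrow> (\<forall>p. f p \<in> carrier (M p))"
  "zero (product_module M) = (\<lambda>p. \<zero>\<^bsub>M p\<^esub>)"
  "add (product_module M) f g = (\<lambda>p. f p \<oplus>\<^bsub>M p\<^esub> g p)"
  "smult (product_module M) a f = (\<lambda>p. a \<odot>\<^bsub>M p\<^esub> f p)"
  by (simp_all add: product_module_def)

lemma product_module_module:
  fixes M :: "'i \<Rightarrow> ('a, 'm) module"
  assumes R: "cring R" and M: "\<And>p. module R (M p)"
  shows "module R (product_module M)"
proof -
  let ?P = "product_module M"
  have g: "abelian_group (M p)" for p using module.axioms(2)[OF M] .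
  note ge = abelian_groupE[OF g]
  note ps = product_module_simps
  have grp: "abelian_group ?P"
  proof (rule abelian_groupI)
    fix f assume f: "f \<in> carrier ?P"
    have "(\<lambda>p. \<ominus>\<^bsub>M p\<^esub> f p) \<in> carrier ?P" using f abelian_group.a_inv_closed[OF g] by (simp add: ps)
    moreover have "(\<lambda>p. \<ominus>\<^bsub>M p\<^esub> f p) \<oplus>\<^bsub>?P\<^esub> f = \<zero>\<^bsub>?P\<^esub>" using f abelian_group.l_neg[OF g] by (simp add: ps)
    ultimately show "\<exists>h\<in>carrier ?P. h \<oplus>\<^bsub>?P\<^esub> f = \<zero>\<^bsub>?P\<^esub>" by blast
    show "\<zero>\<^bsub>?P\<^esub> \<oplus>\<^bsub>?P\<^esub> f = f" using f ge(5) by (simp add: ps)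
  next
    fix f h assume f: "f \<in> carrier ?P" and h: "h \<in> carrier ?P"
    show "f \<oplus>\<^bsub>?P\<^esub> h \<in> carrier ?P" using f h ge(1) by (simp add: ps)
    show "f \<oplus>\<^bsub>?P\<^esub> h = h \<oplus>\<^bsub>?P\<^esub> f" using f h ge(4) by (simp add: ps)
  next
    fix f h l assume "f \<in> carrier ?P" "h \<in> carrier ?P" "l \<in> carrier ?P"
    thus "f \<oplus>\<^bsub>?P\<^esub> h \<oplus>\<^bsub>?P\<^esub> l = f \<oplus>\<^bsub>?P\<^esub> (h \<oplus>\<^bsub>?P\<^esub> l)" using ge(3) by (simp add: ps)
  next
    show "\<zero>\<^bsub>?P\<^esub> \<in> carrier ?P" using ge(2) by (simp add: ps)
  qed
  show ?thesis
  proof (rule moduleI[OF R grp])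
    fix a b f h assume "a \<in> carrier R" "b \<in> carrier R" "f \<in> carrier ?P" "h \<in> carrier ?P"
    thus "a \<odot>\<^bsub>?P\<^esub> f \<in> carrier ?P"
      "(a \<oplus>\<^bsub>R\<^esub> b) \<odot>\<^bsub>?P\<^esub> f = a \<odot>\<^bsub>?P\<^esub> f \<oplus>\<^bsub>?P\<^esub> b \<odot>\<^bsub>?P\<^esub> f"
      "a \<odot>\<^bsub>?P\<^esub> (f \<oplus>\<^bsub>?P\<^esub> h) = a \<odot>\<^bsub>?P\<^esub> f \<oplus>\<^bsub>?P\<^esub> a \<odot>\<^bsub>?P\<^esub> h"
      "(a \<otimes>\<^bsub>R\<^esub> b) \<odot>\<^bsub>?P\<^esub> f = a \<odot>\<^bsub>?P\<^esub> (b \<odot>\<^bsub>?P\<^esub> f)"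
      using module.smult_closed[OF M] module.smult_l_distr[OF M] module.smult_r_distr[OF M]
        module.smult_assoc1[OF M]
      by (simp_all add: ps)
  next
    fix f assume "f \<in> carrier ?P"
    thus "\<one>\<^bsub>R\<^esub> \<odot>\<^bsub>?P\<^esub> f = f" using module.smult_one[OF M] by (simp add: ps)
  qed
qed

lemma product_proj: "(\<lambda>v. v b) \<in> mod_hom R (product_module M) (M b)"
  by (rule mod_homI) (simp_all add: product_module_simps)

lemma product_hom:
  assumes "\<And>b. (\<lambda>v. F v b) \<in> mod_hom R A (M b)"
  shows "F \<in> mod_hom R A (product_module M)"
  by (rule mod_homI)
     (simp_all add: product_module_simps fun_eq_iff mod_hom_closed[OF assms] mod_hom_add[OF assms] mod_hom_smult[OF assms])

lemma sum_module_module: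
  fixes M :: "'i \<Rightarrow> ('a, 'm) module"
  assumes R: "cring R" and M: "\<And>p. module R (M p)"
  shows "module R (sum_module M)"
proof -
  interpret P: pmodule R "product_module M" by (rule pmodule.intro) (rule product_module_module[OF R M])
  let ?H = "{f. (\<forall>p. f p \<in> carrier (M p)) \<and> finite {p. f p \<noteq> \<zero>\<^bsub>M p\<^esub>}}"
  have g: "abelian_group (M p)" for p using module.axioms(2)[OF M] .
  note ge = abelian_groupE[OF g]
  note ps = product_module_simps
  have "submodule ?H R (product_module M)"
  proof (rule P.submoduleI')
    show "?H \<subseteq> carrier (product_module M)" by (auto simp: ps)
    show "\<zero>\<^bsub>product_module M\<^esub> \<in> ?H" using ge(2) by (simp add: ps)
  next
    fix f h assume f: "f \<in> ?H" and h: "h \<in> ?H"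
    have "{p. f p \<oplus>\<^bsub>M p\<^esub> h p \<noteq> \<zero>\<^bsub>M p\<^esub>} \<subseteq> {p. f p \<noteq> \<zero>\<^bsub>M p\<^esub>} \<union> {p. h p \<noteq> \<zero>\<^bsub>M p\<^esub>}"
      using ge(5)[OF ge(2)] by auto
    hence "finite {p. f p \<oplus>\<^bsub>M p\<^esub> h p \<noteq> \<zero>\<^bsub>M p\<^esub>}" using f h by (rule_tac finite_subset) auto
    thus "f \<oplus>\<^bsub>product_module M\<^esub> h \<in> ?H" using f h ge(1) by (simp add: ps)
  next
    fix a f assume a: "a \<in> carrier R" and f: "f \<in> ?H"
    have "{p. a \<odot>\<^bsub>M p\<^esub> f p \<noteq> \<zero>\<^bsub>M p\<^esub>} \<subseteq> {p. f p \<noteq> \<zero>\<^bsub>M p\<^esub>}" using module.smult_r_null[OF M a] by auto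
    hence "finite {p. a \<odot>\<^bsub>M p\<^esub> f p \<noteq> \<zero>\<^bsub>M p\<^esub>}" using f by (rule_tac finite_subset) auto
    thus "a \<odot>\<^bsub>product_module M\<^esub> f \<in> ?H" using f module.smult_closed[OF M a] by (simp add: ps)
  qed
  thus ?thesis unfolding sum_module_def by (rule submodule.submodule_is_module) (rule P.module_axioms)
qed

lemma sum_module_simps:
  "f \<in> carrier (sum_module M) \<longleftrightarrow> (\<forall>p. f p \<in> carrier (M p)) \<and> finite {p. f p \<noteq> \<zero>\<^bsub>M p\<^esub>}"
  "zero (sum_module M) = (\<lambda>p. \<zero>\<^bsub>M p\<^esub>)"
  "add (sum_module M) f g = (\<lambda>p. f p \<oplus>\<^bsub>M p\<^esub> g p)"
  "smult (sum_module M) a f = (\<lambda>p. a \<odot>\<^bsub>M p\<^esub> f p)"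
  by (simp_all add: sum_module_def product_module_def)

lemma sum_proj: "(\<lambda>v. v b) \<in> mod_hom R (sum_module M) (M b)"
  by (rule mod_homI) (simp_all add: sum_module_simps)

context pmodule
begin

lemma finsum_swap:
  assumes "finite A" "finite B" "\<And>i j. i \<in> A \<Longrightarrow> j \<in> B \<Longrightarrow> y i j \<in> carrier M"
  shows "(\<Oplus>i\<in>A. \<Oplus>j\<in>B. y i j) = (\<Oplus>j\<in>B. \<Oplus>i\<in>A. y i j)"
  using assms(1,3)
proof (induction A)
  case empty
  have "(\<Oplus>j\<in>B. \<Oplus>i\<in>{}. y i j) = (\<Oplus>j\<in>B. \<zero>)" by (intro M.finsum_cong') auto
  thus ?case by simp
next
  case (insert a A)
  have 1: "(\<Oplus>j\<in>B. \<Oplus>i\<in>insert a A. y i j) = (\<Oplus>j\<in>B. y a j \<oplus> (\<Oplus>i\<in>A. y i j))"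
    using insert by (intro M.finsum_cong' M.finsum_insert) (auto intro!: M.finsum_closed)
  also have "\<dots> = (\<Oplus>j\<in>B. y a j) \<oplus> (\<Oplus>j\<in>B. \<Oplus>i\<in>A. y i j)"
    using insert.prems by (intro M.finsum_addf) (auto intro!: M.finsum_closed)
  also have "(\<Oplus>j\<in>B. \<Oplus>i\<in>A. y i j) = (\<Oplus>i\<in>A. \<Oplus>j\<in>B. y i j)" using insert by simp
  finally show ?case using insert by (subst M.finsum_insert) (auto intro!: M.finsum_closed)
qed

lemma finsum_smult_rdistr:
  assumes "finite A" "\<And>i. i \<in> A \<Longrightarrow> a i \<in> carrier R" "x \<in> carrier M"
  shows "(\<Oplus>i\<in>A. a i \<odot> x) = (\<Oplus>\<^bsub>R\<^esub>i\<in>A. a i) \<odot> x"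
  using assms(1,2)
proof (induction A)
  case empty
  show ?case using assms(3) by simp
next
  case (insert b A)
  have "(\<Oplus>i\<in>insert b A. a i \<odot> x) = a b \<odot> x \<oplus> (\<Oplus>i\<in>A. a i \<odot> x)"
    using insert assms(3) by (intro M.finsum_insert) auto
  also have "\<dots> = (a b \<oplus>\<^bsub>R\<^esub> (\<Oplus>\<^bsub>R\<^esub>i\<in>A. a i)) \<odot> x"
    using insert assms(3) by (subst smult_l_distr) (auto intro!: R.finsum_closed)
  also have "a b \<oplus>\<^bsub>R\<^esub> (\<Oplus>\<^bsub>R\<^esub>i\<in>A. a i) = (\<Oplus>\<^bsub>R\<^esub>i\<in>insert b A. a i)"
    using insert by (intro R.finsum_insert[symmetric]) auto
  finally show ?case .
qed

text \<open>Applying two matrices in succession amounts to applying their product; used to reduce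
  squares of differentials to relations between coefficients.\<close>

lemma finsum_smult_finsum:
  assumes "finite A" "finite B" "\<And>i. i \<in> A \<Longrightarrow> a i \<in> carrier R"
    "\<And>i j. i \<in> A \<Longrightarrow> j \<in> B \<Longrightarrow> b i j \<in> carrier R" "\<And>j. j \<in> B \<Longrightarrow> x j \<in> carrier M"
  shows "(\<Oplus>i\<in>A. a i \<odot> (\<Oplus>j\<in>B. b i j \<odot> x j)) = (\<Oplus>j\<in>B. (\<Oplus>\<^bsub>R\<^esub>i\<in>A. a i \<otimes>\<^bsub>R\<^esub> b i j) \<odot> x j)"
proof -
  have "(\<Oplus>i\<in>A. a i \<odot> (\<Oplus>j\<in>B. b i j \<odot> x j)) = (\<Oplus>i\<in>A. \<Oplus>j\<in>B. (a i \<otimes>\<^bsub>R\<^esub> b i j) \<odot> x j)"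
  proof (rule M.finsum_cong')
    fix i assume i: "i \<in> A"
    have "a i \<odot> (\<Oplus>j\<in>B. b i j \<odot> x j) = (\<Oplus>j\<in>B. a i \<odot> (b i j \<odot> x j))"
      using i assms by (intro finsum_smult_ldistr) auto
    also have "\<dots> = (\<Oplus>j\<in>B. (a i \<otimes>\<^bsub>R\<^esub> b i j) \<odot> x j)"
      using i assms by (intro M.finsum_cong') (auto simp: smult_assoc1)
    finally show "a i \<odot> (\<Oplus>j\<in>B. b i j \<odot> x j) = (\<Oplus>j\<in>B. (a i \<otimes>\<^bsub>R\<^esub> b i j) \<odot> x j)" .
  qed (use assms in \<open>auto intro!: M.finsum_closed\<close>)
  also have "\<dots> = (\<Oplus>j\<in>B. \<Oplus>i\<in>A. (a i \<otimes>\<^bsub>R\<^esub> b i j) \<odot> x j)"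
    using assms by (intro finsum_swap) auto
  also have "\<dots> = (\<Oplus>j\<in>B. (\<Oplus>\<^bsub>R\<^esub>i\<in>A. a i \<otimes>\<^bsub>R\<^esub> b i j) \<odot> x j)"
    using assms by (intro M.finsum_cong' finsum_smult_rdistr) auto
  finally show ?thesis .
qed

end

text \<open>Given families \<open>G\<close> and \<open>F\<close> of finite free modules with bases \<open>S k\<close> and \<open>T p\<close>, the
  elements of the total complex of \<open>Hom(G, F \<otimes> D)\<close> are regarded as functions \<open>v (k, g, p, f)\<close>
  of pairs of basis elements. The coefficients \<open>c1\<close> and \<open>c2\<close> are those of the two
  differentials, with signs chosen such that \<open>C\<^sup>2 = 0\<close> while \<open>C\<close> commutes with the differential
  of \<open>D\<close>; hence \<open>(C + d) (C - d) = 0\<close>.\<close>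

locale free_double_complex = cring R
  for R :: "('a, 'r) ring_scheme" (structure) +
  fixes D :: "('a, 'd) cochain_complex"
    and S :: "nat \<Rightarrow> 'g set" and T :: "nat \<Rightarrow> 'f set"
    and c1 :: "nat \<Rightarrow> 'f \<Rightarrow> 'f \<Rightarrow> 'a" and c2 :: "nat \<Rightarrow> nat \<Rightarrow> 'g \<Rightarrow> 'g \<Rightarrow> 'a"
  assumes D: "is_complex R D"
    and fin: "finite (S k)" "finite (T p)"
    and c1_closed: "c1 p f' f \<in> carrier R" and c2_closed: "c2 k p g g' \<in> carrier R"
    and c1_square: "f \<in> T p \<Longrightarrow> f'' \<in> T (Suc (Suc p)) \<Longrightarrow>
      (\<Oplus>f'\<in>T (Suc p). c1 p f' f \<otimes> c1 (Suc p) f'' f') = \<zero>"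
    and c2_square: "g \<in> S (Suc (Suc k)) \<Longrightarrow> g'' \<in> S k \<Longrightarrow>
      (\<Oplus>g'\<in>S (Suc k). c2 (Suc k) p g g' \<otimes> c2 k p g' g'') = \<zero>"
    and anticommute: "c1 p f' f \<otimes> c2 k (Suc p) g g' \<oplus> c2 k p g g' \<otimes> c1 p f' f = \<zero>"
begin

text \<open>Degrees such as \<open>n + 1 + 1\<close> must not be rewritten to \<open>n + 2\<close>, as \<open>DD_Suc_p\<close> and the homomorphism
  properties match only the former.\<close>

declare [[simproc del: int_combine_numerals]]

text \<open>With \<open>G\<^sub>k\<close> in degree \<open>-k\<close> and \<open>F\<^sub>p\<close>
  in degree \<open>-p\<close>, a homomorphism of degree \<open>n\<close> from
  \<open>G\<^sub>k\<close> to \<open>F\<^sub>p \<otimes> D\<close> involves \<open>D\<close> in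
  degree \<open>n - k + p\<close>.\<close>

definition DD :: "int \<Rightarrow> nat \<Rightarrow> nat \<Rightarrow> ('a, 'd) module" where
  "DD n k p = obj D (n - int k + int p)"

lemma DD_Suc_p: "DD n k (Suc p) = DD (n + 1) k p"
  by (simp add: DD_def algebra_simps)

lemma DD_Suc_k: "DD (n + 1) (Suc k) p = DD n k p"
  by (simp add: DD_def algebra_simps)

lemma DD_next: "DD (n + 1) k p = obj D (n - int k + int p + 1)"
  by (simp add: DD_def algebra_simps)

lemma DD_module: "module R (DD n k p)"
  unfolding DD_def by (rule is_complexD(1)[OF D])

lemma DD_pmodule: "pmodule R (DD n k p)"
  by (rule pmodule.intro) (rule DD_module)

definition V :: "int \<Rightarrow> ('a, nat \<times> 'g \<times> nat \<times> 'f \<Rightarrow> 'd) module" where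
  "V n = product_module (\<lambda>(k, g, p, f). DD n k p)"

lemma V_module: "module R (V n)"
  unfolding V_def using DD_module by (intro product_module_module is_cring) auto

lemma V_pmodule: "pmodule R (V n)"
  by (rule pmodule.intro) (rule V_module)

lemma V_proj: "(\<lambda>v. v (k, g, p, f)) \<in> mod_hom R (V n) (DD n k p)"
  using product_proj[of "(k, g, p, f)" R "\<lambda>(k, g, p, f). DD n k p"] by (simp add: V_def)

lemma V_proj_closed: "v \<in> carrier (V n) \<Longrightarrow> v (k, g, p, f) \<in> carrier (DD n k p)"
  by (rule mod_hom_closed[OF V_proj])

lemma V_carrier: "v \<in> carrier (V n) \<longleftrightarrow> (\<forall>k g p f. v (k, g, p, f) \<in> carrier (DD n k p))"
  by (simp add: V_def product_module_simps)

lemma V_hom: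
  assumes "\<And>k g p f. (\<lambda>v. F v (k, g, p, f)) \<in> mod_hom R A (DD n k p)"
  shows "F \<in> mod_hom R A (V n)"
  unfolding V_def using assms by (intro product_hom) auto

lemma V_simps:
  "(v \<oplus>\<^bsub>V n\<^esub> w) (k, g, p, f) = v (k, g, p, f) \<oplus>\<^bsub>DD n k p\<^esub> w (k, g, p, f)"
  "\<zero>\<^bsub>V n\<^esub> (k, g, p, f) = \<zero>\<^bsub>DD n k p\<^esub>"
  by (simp_all add: V_def product_module_simps)

lemma V_minus:
  assumes "v \<in> carrier (V n)" "w \<in> carrier (V n)"
  shows "(v \<ominus>\<^bsub>V n\<^esub> w) (k, g, p, f) = v (k, g, p, f) \<ominus>\<^bsub>DD n k p\<^esub> w (k, g, p, f)"
  by (rule mod_hom_diff[OF V_module DD_module V_proj assms])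

text \<open>\<open>X1\<close> is induced by the differential of \<open>F\<close> and
  \<open>X2\<close> by that of \<open>G\<close>; \<open>Y\<close> applies the differential of
  \<open>D\<close> to every component, without a sign.\<close>

definition X1 :: "int \<Rightarrow> (nat \<times> 'g \<times> nat \<times> 'f \<Rightarrow> 'd) \<Rightarrow> nat \<times> 'g \<times> nat \<times> 'f \<Rightarrow> 'd" where
  "X1 n v = (\<lambda>(k, g, p, f). \<Oplus>\<^bsub>DD (n + 1) k p\<^esub>f'\<in>T (Suc p). c1 p f' f \<odot>\<^bsub>DD (n + 1) k p\<^esub> v (k, g, Suc p, f'))"

definition X2 :: "int \<Rightarrow> (nat \<times> 'g \<times> nat \<times> 'f \<Rightarrow> 'd) \<Rightarrow> nat \<times> 'g \<times> nat \<times> 'f \<Rightarrow> 'd" where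
  "X2 n v = (\<lambda>(k, g, p, f). case k of 0 \<Rightarrow> \<zero>\<^bsub>DD (n + 1) k p\<^esub>
     | Suc k' \<Rightarrow> \<Oplus>\<^bsub>DD (n + 1) k p\<^esub>g'\<in>S k'. c2 k' p g g' \<odot>\<^bsub>DD (n + 1) k p\<^esub> v (k', g', p, f))"

definition Y :: "int \<Rightarrow> (nat \<times> 'g \<times> nat \<times> 'f \<Rightarrow> 'd) \<Rightarrow> nat \<times> 'g \<times> nat \<times> 'f \<Rightarrow> 'd" where
  "Y n v = (\<lambda>(k, g, p, f). diff D (n - int k + int p) (v (k, g, p, f)))"

definition C :: "int \<Rightarrow> (nat \<times> 'g \<times> nat \<times> 'f \<Rightarrow> 'd) \<Rightarrow> nat \<times> 'g \<times> nat \<times> 'f \<Rightarrow> 'd" where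
  "C n v = X1 n v \<oplus>\<^bsub>V (n + 1)\<^esub> X2 n v"

lemma X1_apply: "X1 n v (k, g, p, f) =
    (\<Oplus>\<^bsub>DD (n + 1) k p\<^esub>f'\<in>T (Suc p). c1 p f' f \<odot>\<^bsub>DD (n + 1) k p\<^esub> v (k, g, Suc p, f'))"
  by (simp add: X1_def)

lemma X2_apply:
  "X2 n v (0, g, p, f) = \<zero>\<^bsub>DD (n + 1) 0 p\<^esub>"
  "k = Suc k' \<Longrightarrow> X2 n v (k, g, p, f) =
    (\<Oplus>\<^bsub>DD (n + 1) k p\<^esub>g'\<in>S k'. c2 k' p g g' \<odot>\<^bsub>DD (n + 1) k p\<^esub> v (k', g', p, f))"
  by (simp_all add: X2_def)

lemma Y_diff_hom: "diff D (n - int k + int p) \<in> mod_hom R (DD n k p) (DD (n + 1) k p)"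
  unfolding DD_next unfolding DD_def by (rule is_complexD(2)[OF D])

lemma X1_hom: "X1 n \<in> mod_hom R (V n) (V (n + 1))"
proof (rule V_hom)
  fix k g p f
  interpret Dp: pmodule R "DD (n + 1) k p" by (rule DD_pmodule)
  have "(\<lambda>v. \<Oplus>\<^bsub>DD (n + 1) k p\<^esub>f'\<in>T (Suc p). c1 p f' f \<odot>\<^bsub>DD (n + 1) k p\<^esub> v (k, g, Suc p, f'))
      \<in> mod_hom R (V n) (DD (n + 1) k p)"
    using V_proj[of k g "Suc p" _ n] unfolding DD_Suc_p
    by (intro Dp.mod_hom_finsum_map V_module fin mod_hom_scale DD_module c1_closed)
  thus "(\<lambda>v. X1 n v (k, g, p, f)) \<in> mod_hom R (V n) (DD (n + 1) k p)" by (simp add: X1_def)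
qed

lemma X2_hom: "X2 n \<in> mod_hom R (V n) (V (n + 1))"
proof (rule V_hom)
  fix k g p f
  show "(\<lambda>v. X2 n v (k, g, p, f)) \<in> mod_hom R (V n) (DD (n + 1) k p)"
  proof (cases k)
    case 0
    thus ?thesis using mod_hom_zero_map[OF DD_module, of "n + 1" 0 p "V n"] by (simp add: X2_def)
  next
    case (Suc k')
    interpret Dp: pmodule R "DD n k' p" by (rule DD_pmodule)
    have "(\<lambda>v. \<Oplus>\<^bsub>DD n k' p\<^esub>g'\<in>S k'. c2 k' p g g' \<odot>\<^bsub>DD n k' p\<^esub> v (k', g', p, f)) \<in> mod_hom R (V n) (DD n k' p)"
      by (intro Dp.mod_hom_finsum_map V_module fin mod_hom_scale DD_module c2_closed V_proj)
    thus ?thesis using Suc by (simp add: X2_def DD_Suc_k)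
  qed
qed

lemma C_hom: "C n \<in> mod_hom R (V n) (V (n + 1))"
  unfolding C_def by (intro mod_hom_plus V_module X1_hom X2_hom)

lemma Y_hom: "Y n \<in> mod_hom R (V n) (V (n + 1))"
proof (rule V_hom)
  fix k g p f
  show "(\<lambda>v. Y n v (k, g, p, f)) \<in> mod_hom R (V n) (DD (n + 1) k p)"
    unfolding Y_def using mod_hom_compose[OF V_proj Y_diff_hom] by simp
qed

lemma Y_Y:
  assumes v: "v \<in> carrier (V n)"
  shows "Y (n + 1) (Y n v) = \<zero>\<^bsub>V (n + 1 + 1)\<^esub>"
proof
  fix b :: "nat \<times> 'g \<times> nat \<times> 'f"
  obtain k g p f where b: "b = (k, g, p, f)" by (cases b)
  let ?e = "n - int k + int p"
  have "v (k, g, p, f) \<in> carrier (obj D ?e)" using V_proj_closed[OF v] by (simp add: DD_def)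
  hence "diff D (?e + 1) (diff D ?e (v (k, g, p, f))) = \<zero>\<^bsub>obj D (?e + 2)\<^esub>" by (rule is_complexD(3)[OF D])
  moreover have e: "n + 1 - int k + int p = ?e + 1" "n + 1 + 1 - int k + int p = ?e + 2" by simp_all
  ultimately show "Y (n + 1) (Y n v) b = \<zero>\<^bsub>V (n + 1 + 1)\<^esub> b"
    by (simp only: b V_simps Y_def DD_def prod.case e)
qed

lemma C_Y:
  assumes v: "v \<in> carrier (V n)"
  shows "C (n + 1) (Y n v) = Y (n + 1) (C n v)"
proof
  fix b :: "nat \<times> 'g \<times> nat \<times> 'f"
  obtain k g p f where b: "b = (k, g, p, f)" by (cases b)
  have vc: "v (k, g, p, f) \<in> carrier (DD n k p)" for k g p f by (rule V_proj_closed[OF v])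
  let ?d = "diff D (n + 1 - int k + int p)"
  have dh: "?d \<in> mod_hom R (DD (n + 1) k p) (DD (n + 1 + 1) k p)" by (rule Y_diff_hom)
  interpret D1: pmodule R "DD (n + 1) k p" by (rule DD_pmodule)
  interpret D2: pmodule R "DD (n + 1 + 1) k p" by (rule DD_pmodule)
  have x1: "X1 (n + 1) (Y n v) (k, g, p, f) = ?d (X1 n v (k, g, p, f))"
  proof -
    have cl: "v (k, g, Suc p, f') \<in> carrier (DD (n + 1) k p)" for f' using vc[of k g "Suc p"] by (simp add: DD_Suc_p)
    have yv: "Y n v (k, g, Suc p, f') = ?d (v (k, g, Suc p, f'))" for f'
      by (simp add: Y_def algebra_simps)
    have "?d (X1 n v (k, g, p, f)) =
      (\<Oplus>\<^bsub>DD (n + 1 + 1) k p\<^esub>f'\<in>T (Suc p). ?d (c1 p f' f \<odot>\<^bsub>DD (n + 1) k p\<^esub> v (k, g, Suc p, f')))"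
      unfolding X1_apply using cl c1_closed
      by (intro mod_hom_finsum[OF DD_module DD_module dh]) auto
    also have "\<dots> = (\<Oplus>\<^bsub>DD (n + 1 + 1) k p\<^esub>f'\<in>T (Suc p). c1 p f' f \<odot>\<^bsub>DD (n + 1 + 1) k p\<^esub> ?d (v (k, g, Suc p, f')))"
      using mod_hom_smult[OF dh c1_closed cl] mod_hom_closed[OF dh cl] c1_closed
      by (intro D2.M.finsum_cong') auto
    finally show ?thesis unfolding X1_def by (simp add: yv)
  qed
  have x2: "X2 (n + 1) (Y n v) (k, g, p, f) = ?d (X2 n v (k, g, p, f))"
  proof (cases k)
    case 0
    thus ?thesis using mod_hom_zero[OF DD_module DD_module dh] by (simp add: X2_def)
  next
    case (Suc k')
    have cl: "v (k', g', p, f) \<in> carrier (DD (n + 1) k p)" for g' using vc[of k' g' p f] Suc by (simp add: DD_Suc_k)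
    have yv: "Y n v (k', g', p, f) = ?d (v (k', g', p, f))" for g' using Suc by (simp add: Y_def algebra_simps)
    have "?d (X2 n v (k, g, p, f)) =
      (\<Oplus>\<^bsub>DD (n + 1 + 1) k p\<^esub>g'\<in>S k'. ?d (c2 k' p g g' \<odot>\<^bsub>DD (n + 1) k p\<^esub> v (k', g', p, f)))"
      unfolding X2_apply(2)[OF Suc] using cl c2_closed
      by (intro mod_hom_finsum[OF DD_module DD_module dh]) auto
    also have "\<dots> = (\<Oplus>\<^bsub>DD (n + 1 + 1) k p\<^esub>g'\<in>S k'. c2 k' p g g' \<odot>\<^bsub>DD (n + 1 + 1) k p\<^esub> ?d (v (k', g', p, f)))"
      using mod_hom_smult[OF dh c2_closed cl] mod_hom_closed[OF dh cl] c2_closed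
      by (intro D2.M.finsum_cong') auto
    finally show ?thesis unfolding X2_def using Suc by (simp add: yv)
  qed
  have X1c: "X1 n v (k, g, p, f) \<in> carrier (DD (n + 1) k p)" and X2c: "X2 n v (k, g, p, f) \<in> carrier (DD (n + 1) k p)"
    using V_proj_closed mod_hom_closed[OF X1_hom v] mod_hom_closed[OF X2_hom v] by auto
  have "Y (n + 1) (C n v) (k, g, p, f) = ?d (C n v (k, g, p, f))" by (simp add: Y_def)
  also have "\<dots> = ?d (X1 n v (k, g, p, f)) \<oplus>\<^bsub>DD (n + 1 + 1) k p\<^esub> ?d (X2 n v (k, g, p, f))"
    unfolding C_def V_simps by (rule mod_hom_add[OF dh X1c X2c])
  finally show "C (n + 1) (Y n v) b = Y (n + 1) (C n v) b"
    unfolding b C_def V_simps x1 x2 by simp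
qed

text \<open>The pure squares vanish by \<open>c1_square\<close> and \<open>c2_square\<close>, the
  mixed terms cancel by \<open>anticommute\<close>. The restriction to basis elements comes from the
  first two.\<close>

lemma C_C:
  assumes v: "v \<in> carrier (V n)" and gf: "g \<in> S k" "f \<in> T p"
  shows "C (n + 1) (C n v) (k, g, p, f) = \<zero>\<^bsub>DD (n + 1 + 1) k p\<^esub>"
proof -
  let ?M = "DD (n + 1 + 1) k p"
  interpret M: pmodule R ?M by (rule DD_pmodule)
  have vc: "v (k, g, p, f) \<in> carrier (DD n k p)" for k g p f by (rule V_proj_closed[OF v])
  have X1v: "X1 n v \<in> carrier (V (n + 1))" and X2v: "X2 n v \<in> carrier (V (n + 1))"
    using mod_hom_closed[OF X1_hom v] mod_hom_closed[OF X2_hom v] by auto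
  have Mp: "DD (n + 1) k (Suc p) = ?M" "DD n k (Suc (Suc p)) = ?M" by (simp_all add: DD_Suc_p)
  have vpp: "v (k, g, Suc (Suc p), f') \<in> carrier ?M" for f' using vc[of k g "Suc (Suc p)"] Mp by simp
  have 11: "X1 (n + 1) (X1 n v) (k, g, p, f) = \<zero>\<^bsub>?M\<^esub>"
  proof -
    have "X1 (n + 1) (X1 n v) (k, g, p, f) = (\<Oplus>\<^bsub>?M\<^esub>f'\<in>T (Suc p). c1 p f' f \<odot>\<^bsub>?M\<^esub>
        (\<Oplus>\<^bsub>?M\<^esub>f''\<in>T (Suc (Suc p)). c1 (Suc p) f'' f' \<odot>\<^bsub>?M\<^esub> v (k, g, Suc (Suc p), f'')))"
      by (simp add: X1_apply Mp)
    also have "\<dots> = (\<Oplus>\<^bsub>?M\<^esub>f''\<in>T (Suc (Suc p)). (\<Oplus>f'\<in>T (Suc p). c1 p f' f \<otimes> c1 (Suc p) f'' f') \<odot>\<^bsub>?M\<^esub> v (k, g, Suc (Suc p), f''))"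
      by (rule M.finsum_smult_finsum) (use fin c1_closed vpp in auto)
    also have "\<dots> = (\<Oplus>\<^bsub>?M\<^esub>f''\<in>T (Suc (Suc p)). \<zero>\<^bsub>?M\<^esub>)"
      using c1_square[OF gf(2)] vpp by (intro M.M.finsum_cong') auto
    finally show ?thesis by simp
  qed
  have 22: "X2 (n + 1) (X2 n v) (k, g, p, f) = \<zero>\<^bsub>?M\<^esub>"
  proof (cases k)
    case 0
    thus ?thesis by (simp add: X2_def)
  next
    case (Suc k')
    show ?thesis
    proof (cases k')
      case 0
      have "X2 (n + 1) (X2 n v) (k, g, p, f) = (\<Oplus>\<^bsub>?M\<^esub>g'\<in>S 0. c2 0 p g g' \<odot>\<^bsub>?M\<^esub> \<zero>\<^bsub>?M\<^esub>)"
        using Suc 0 by (simp add: X2_def DD_Suc_k)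
      also have "\<dots> = (\<Oplus>\<^bsub>?M\<^esub>g'\<in>S 0. \<zero>\<^bsub>?M\<^esub>)" using c2_closed by (intro M.M.finsum_cong') auto
      finally show ?thesis by simp
    next
      fix l assume l: "k' = Suc l"
      have Ml: "DD (n + 1) (Suc l) p = ?M" "DD n l p = ?M" using Suc l by (simp_all add: DD_Suc_k)
      have vl: "v (l, g', p, f) \<in> carrier ?M" for g' using vc[of l g' p f] Ml by simp
      have "X2 (n + 1) (X2 n v) (k, g, p, f) = (\<Oplus>\<^bsub>?M\<^esub>g'\<in>S (Suc l). c2 (Suc l) p g g' \<odot>\<^bsub>?M\<^esub>
          (\<Oplus>\<^bsub>?M\<^esub>g''\<in>S l. c2 l p g' g'' \<odot>\<^bsub>?M\<^esub> v (l, g'', p, f)))"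
        using Suc l Ml by (simp add: X2_def)
      also have "\<dots> = (\<Oplus>\<^bsub>?M\<^esub>g''\<in>S l. (\<Oplus>g'\<in>S (Suc l). c2 (Suc l) p g g' \<otimes> c2 l p g' g'') \<odot>\<^bsub>?M\<^esub> v (l, g'', p, f))"
        by (rule M.finsum_smult_finsum) (use fin c2_closed vl in auto)
      also have "\<dots> = (\<Oplus>\<^bsub>?M\<^esub>g''\<in>S l. \<zero>\<^bsub>?M\<^esub>)"
      proof -
        have "(\<Oplus>g'\<in>S (Suc l). c2 (Suc l) p g g' \<otimes> c2 l p g' g'') = \<zero>" if "g'' \<in> S l" for g''
          using c2_square[of g l g'' p] gf(1) Suc l that by simp
        thus ?thesis using vl by (intro M.M.finsum_cong') auto
      qed
      finally show ?thesis by simp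
    qed
  qed
  have 12: "X1 (n + 1) (X2 n v) (k, g, p, f) \<oplus>\<^bsub>?M\<^esub> X2 (n + 1) (X1 n v) (k, g, p, f) = \<zero>\<^bsub>?M\<^esub>"
  proof (cases k)
    case 0
    have "X1 (n + 1) (X2 n v) (k, g, p, f) = (\<Oplus>\<^bsub>?M\<^esub>f'\<in>T (Suc p). c1 p f' f \<odot>\<^bsub>?M\<^esub> \<zero>\<^bsub>?M\<^esub>)"
      using 0 Mp(1) by (simp add: X1_apply X2_apply)
    also have "\<dots> = (\<Oplus>\<^bsub>?M\<^esub>f'\<in>T (Suc p). \<zero>\<^bsub>?M\<^esub>)" using c1_closed by (intro M.M.finsum_cong') auto
    finally have "X1 (n + 1) (X2 n v) (k, g, p, f) = \<zero>\<^bsub>?M\<^esub>" by simp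
    moreover have "X2 (n + 1) (X1 n v) (k, g, p, f) = \<zero>\<^bsub>?M\<^esub>" using 0 by (simp add: X2_apply)
    ultimately show ?thesis by simp
  next
    case (Suc k')
    have Mk: "DD (n + 1) k' p = ?M" "DD n k' (Suc p) = ?M" using Suc by (simp_all add: DD_Suc_k DD_Suc_p)
    have vk: "v (k', g', Suc p, f') \<in> carrier ?M" for g' f' using vc[of k' g' "Suc p" f'] Mk by simp
    let ?y = "\<lambda>f' g'. (c1 p f' f \<otimes> c2 k' (Suc p) g g') \<odot>\<^bsub>?M\<^esub> v (k', g', Suc p, f')"
    let ?y' = "\<lambda>f' g'. (c2 k' p g g' \<otimes> c1 p f' f) \<odot>\<^bsub>?M\<^esub> v (k', g', Suc p, f')"
    have "X1 (n + 1) (X2 n v) (k, g, p, f) = (\<Oplus>\<^bsub>?M\<^esub>f'\<in>T (Suc p). c1 p f' f \<odot>\<^bsub>?M\<^esub>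
        (\<Oplus>\<^bsub>?M\<^esub>g'\<in>S k'. c2 k' (Suc p) g g' \<odot>\<^bsub>?M\<^esub> v (k', g', Suc p, f')))"
      using Suc Mp by (simp add: X1_def X2_def)
    also have "\<dots> = (\<Oplus>\<^bsub>?M\<^esub>f'\<in>T (Suc p). \<Oplus>\<^bsub>?M\<^esub>g'\<in>S k'. ?y f' g')"
    proof (rule M.M.finsum_cong')
      fix f' assume "f' \<in> T (Suc p)"
      have "c1 p f' f \<odot>\<^bsub>?M\<^esub> (\<Oplus>\<^bsub>?M\<^esub>g'\<in>S k'. c2 k' (Suc p) g g' \<odot>\<^bsub>?M\<^esub> v (k', g', Suc p, f')) =
        (\<Oplus>\<^bsub>?M\<^esub>g'\<in>S k'. c1 p f' f \<odot>\<^bsub>?M\<^esub> (c2 k' (Suc p) g g' \<odot>\<^bsub>?M\<^esub> v (k', g', Suc p, f')))"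
        using c1_closed c2_closed vk fin by (intro M.finsum_smult_ldistr) auto
      also have "\<dots> = (\<Oplus>\<^bsub>?M\<^esub>g'\<in>S k'. ?y f' g')"
        using c1_closed c2_closed vk by (intro M.M.finsum_cong') (auto simp: M.smult_assoc1)
      finally show "c1 p f' f \<odot>\<^bsub>?M\<^esub> (\<Oplus>\<^bsub>?M\<^esub>g'\<in>S k'. c2 k' (Suc p) g g' \<odot>\<^bsub>?M\<^esub> v (k', g', Suc p, f')) =
        (\<Oplus>\<^bsub>?M\<^esub>g'\<in>S k'. ?y f' g')" .
    qed (use c1_closed c2_closed vk in \<open>auto intro!: M.M.finsum_closed\<close>)
    finally have e1: "X1 (n + 1) (X2 n v) (k, g, p, f) = (\<Oplus>\<^bsub>?M\<^esub>f'\<in>T (Suc p). \<Oplus>\<^bsub>?M\<^esub>g'\<in>S k'. ?y f' g')" .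
    have "X2 (n + 1) (X1 n v) (k, g, p, f) = (\<Oplus>\<^bsub>?M\<^esub>g'\<in>S k'. c2 k' p g g' \<odot>\<^bsub>?M\<^esub>
        (\<Oplus>\<^bsub>?M\<^esub>f'\<in>T (Suc p). c1 p f' f \<odot>\<^bsub>?M\<^esub> v (k', g', Suc p, f')))"
      using Suc Mk by (simp add: X1_def X2_def)
    also have "\<dots> = (\<Oplus>\<^bsub>?M\<^esub>g'\<in>S k'. \<Oplus>\<^bsub>?M\<^esub>f'\<in>T (Suc p). ?y' f' g')"
    proof (rule M.M.finsum_cong')
      fix g' assume "g' \<in> S k'"
      have "c2 k' p g g' \<odot>\<^bsub>?M\<^esub> (\<Oplus>\<^bsub>?M\<^esub>f'\<in>T (Suc p). c1 p f' f \<odot>\<^bsub>?M\<^esub> v (k', g', Suc p, f')) =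
        (\<Oplus>\<^bsub>?M\<^esub>f'\<in>T (Suc p). c2 k' p g g' \<odot>\<^bsub>?M\<^esub> (c1 p f' f \<odot>\<^bsub>?M\<^esub> v (k', g', Suc p, f')))"
        using c1_closed c2_closed vk fin by (intro M.finsum_smult_ldistr) auto
      also have "\<dots> = (\<Oplus>\<^bsub>?M\<^esub>f'\<in>T (Suc p). ?y' f' g')"
        using c1_closed c2_closed vk by (intro M.M.finsum_cong') (auto simp: M.smult_assoc1)
      finally show "c2 k' p g g' \<odot>\<^bsub>?M\<^esub> (\<Oplus>\<^bsub>?M\<^esub>f'\<in>T (Suc p). c1 p f' f \<odot>\<^bsub>?M\<^esub> v (k', g', Suc p, f')) =
        (\<Oplus>\<^bsub>?M\<^esub>f'\<in>T (Suc p). ?y' f' g')" .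
    qed (use c1_closed c2_closed vk in \<open>auto intro!: M.M.finsum_closed\<close>)
    also have "\<dots> = (\<Oplus>\<^bsub>?M\<^esub>f'\<in>T (Suc p). \<Oplus>\<^bsub>?M\<^esub>g'\<in>S k'. ?y' f' g')"
      using c1_closed c2_closed vk fin by (intro M.finsum_swap) auto
    finally have e2: "X2 (n + 1) (X1 n v) (k, g, p, f) = (\<Oplus>\<^bsub>?M\<^esub>f'\<in>T (Suc p). \<Oplus>\<^bsub>?M\<^esub>g'\<in>S k'. ?y' f' g')" .
    have yy: "?y f' g' \<oplus>\<^bsub>?M\<^esub> ?y' f' g' = \<zero>\<^bsub>?M\<^esub>" for f' g'
      using M.smult_l_distr[of "c1 p f' f \<otimes> c2 k' (Suc p) g g'" "c2 k' p g g' \<otimes> c1 p f' f" "v (k', g', Suc p, f')"]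
        anticommute[of p f' f k' g g'] c1_closed c2_closed vk by simp
    have inner: "(\<Oplus>\<^bsub>?M\<^esub>g'\<in>S k'. ?y f' g') \<oplus>\<^bsub>?M\<^esub> (\<Oplus>\<^bsub>?M\<^esub>g'\<in>S k'. ?y' f' g') = \<zero>\<^bsub>?M\<^esub>" for f'
    proof -
      have "(\<Oplus>\<^bsub>?M\<^esub>g'\<in>S k'. ?y f' g') \<oplus>\<^bsub>?M\<^esub> (\<Oplus>\<^bsub>?M\<^esub>g'\<in>S k'. ?y' f' g') = (\<Oplus>\<^bsub>?M\<^esub>g'\<in>S k'. ?y f' g' \<oplus>\<^bsub>?M\<^esub> ?y' f' g')"
        using c1_closed c2_closed vk by (intro M.M.finsum_addf[symmetric]) auto
      also have "\<dots> = (\<Oplus>\<^bsub>?M\<^esub>g'\<in>S k'. \<zero>\<^bsub>?M\<^esub>)" by (simp add: yy)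
      finally show ?thesis by simp
    qed
    have "X1 (n + 1) (X2 n v) (k, g, p, f) \<oplus>\<^bsub>?M\<^esub> X2 (n + 1) (X1 n v) (k, g, p, f) =
      (\<Oplus>\<^bsub>?M\<^esub>f'\<in>T (Suc p). (\<Oplus>\<^bsub>?M\<^esub>g'\<in>S k'. ?y f' g') \<oplus>\<^bsub>?M\<^esub> (\<Oplus>\<^bsub>?M\<^esub>g'\<in>S k'. ?y' f' g'))"
      unfolding e1 e2 using c1_closed c2_closed vk
      by (intro M.M.finsum_addf[symmetric]) (auto intro!: M.M.finsum_closed)
    thus ?thesis by (simp add: inner)
  qed
  have cl: "X1 (n + 1) (X1 n v) (k, g, p, f) \<in> carrier ?M" "X1 (n + 1) (X2 n v) (k, g, p, f) \<in> carrier ?M"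
    "X2 (n + 1) (X1 n v) (k, g, p, f) \<in> carrier ?M" "X2 (n + 1) (X2 n v) (k, g, p, f) \<in> carrier ?M"
    using V_proj_closed mod_hom_closed[OF X1_hom X1v] mod_hom_closed[OF X1_hom X2v]
      mod_hom_closed[OF X2_hom X1v] mod_hom_closed[OF X2_hom X2v] by auto
  have "C (n + 1) (C n v) (k, g, p, f) =
    (X1 (n + 1) (X1 n v) (k, g, p, f) \<oplus>\<^bsub>?M\<^esub> X1 (n + 1) (X2 n v) (k, g, p, f)) \<oplus>\<^bsub>?M\<^esub>
    (X2 (n + 1) (X1 n v) (k, g, p, f) \<oplus>\<^bsub>?M\<^esub> X2 (n + 1) (X2 n v) (k, g, p, f))"
    unfolding C_def using mod_hom_add[OF X1_hom X1v X2v] mod_hom_add[OF X2_hom X1v X2v] by (simp add: V_simps)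
  thus ?thesis using 12 cl(2,3) by (simp add: 11 22)
qed

text \<open>Both parts of \<open>C\<close> read components whose level \<open>int k - int p\<close>
  is smaller by one. \<open>Y\<close> preserves the level; it is the filtration along which
  \<open>clear_below\<close> proceeds.\<close>

lemma C_low:
  assumes u: "\<forall>k p. \<forall>g\<in>S k. \<forall>f\<in>T p. int k - int p < j \<longrightarrow> u (k, g, p, f) = \<zero>\<^bsub>DD n k p\<^esub>"
    and gf: "g \<in> S k" "f \<in> T p" "int k - int p \<le> j"
  shows "C n u (k, g, p, f) = \<zero>\<^bsub>DD (n + 1) k p\<^esub>"
proof -
  interpret M: pmodule R "DD (n + 1) k p" by (rule DD_pmodule)
  have "u (k, g, Suc p, f') = \<zero>\<^bsub>DD (n + 1) k p\<^esub>" if "f' \<in> T (Suc p)" for f'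
    using u gf that by (simp add: DD_Suc_p)
  hence "X1 n u (k, g, p, f) = (\<Oplus>\<^bsub>DD (n + 1) k p\<^esub>f'\<in>T (Suc p). \<zero>\<^bsub>DD (n + 1) k p\<^esub>)"
    unfolding X1_apply using c1_closed by (intro M.M.finsum_cong') auto
  hence 1: "X1 n u (k, g, p, f) = \<zero>\<^bsub>DD (n + 1) k p\<^esub>" by simp
  have 2: "X2 n u (k, g, p, f) = \<zero>\<^bsub>DD (n + 1) k p\<^esub>"
  proof (cases k)
    case 0
    thus ?thesis by (simp add: X2_def)
  next
    fix k' assume k: "k = Suc k'"
    have "u (k', g', p, f) = \<zero>\<^bsub>DD (n + 1) k p\<^esub>" if "g' \<in> S k'" for g'
      using u gf that k by (simp add: DD_Suc_k)
    hence "X2 n u (k, g, p, f) = (\<Oplus>\<^bsub>DD (n + 1) k p\<^esub>g'\<in>S k'. \<zero>\<^bsub>DD (n + 1) k p\<^esub>)"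
      unfolding X2_apply(2)[OF k] using c2_closed by (intro M.M.finsum_cong') auto
    thus ?thesis by simp
  qed
  show ?thesis unfolding C_def V_simps 1 2 by simp
qed

text \<open>Where \<open>D\<close> is exact, the lowest nonzero component of a solution of \<open>(C + d) v = U\<close> can be
  removed by adding some \<open>(C - d) u\<close>.\<close>

lemma clear_below:
  assumes v: "v \<in> carrier (V n)"
    and rel: "\<forall>k p. \<forall>g\<in>S k. \<forall>f\<in>T p. (C n v \<oplus>\<^bsub>V (n + 1)\<^esub> Y n v) (k, g, p, f) = U (k, g, p, f)"
    and U: "\<forall>k p. \<forall>g\<in>S k. \<forall>f\<in>T p. int k - int p < b \<longrightarrow> U (k, g, p, f) = \<zero>\<^bsub>DD (n + 1) k p\<^esub>"
    and exact: "\<forall>e > n - b + 1. cocycles D e \<subseteq> coboundaries D e"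
    and bounded: "\<exists>c. \<forall>e > c. zero_module (obj D e)"
  shows "\<exists>v\<in>carrier (V n). (\<forall>k p. \<forall>g\<in>S k. \<forall>f\<in>T p. (C n v \<oplus>\<^bsub>V (n + 1)\<^esub> Y n v) (k, g, p, f) = U (k, g, p, f)) \<and>
    (\<forall>k p. \<forall>g\<in>S k. \<forall>f\<in>T p. int k - int p < b - 1 \<longrightarrow> v (k, g, p, f) = \<zero>\<^bsub>DD n k p\<^esub>)"
proof -
  obtain c where c: "\<forall>e > c. zero_module (obj D e)" using bounded by blast
  \<comment> \<open>Below level \<open>a\<close> the term of \<open>D\<close> has degree above
    \<open>c\<close> and is zero, so every \<open>v\<close> starts the induction. The minimum with
    \<open>b\<close> ensures \<open>a \<le> b - 1\<close>.\<close>
  define a where "a = min (n - c) b - 1"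
  let ?P = "\<lambda>j v. v \<in> carrier (V n) \<and>
    (\<forall>k p. \<forall>g\<in>S k. \<forall>f\<in>T p. (C n v \<oplus>\<^bsub>V (n + 1)\<^esub> Y n v) (k, g, p, f) = U (k, g, p, f)) \<and>
    (\<forall>k p. \<forall>g\<in>S k. \<forall>f\<in>T p. int k - int p < j \<longrightarrow> v (k, g, p, f) = \<zero>\<^bsub>DD n k p\<^esub>)"
  have "\<exists>v. ?P (a + int i) v" if "a + int i \<le> b - 1" for i
    using that
  proof (induction i)
    case 0
    have "v (k, g, p, f) = \<zero>\<^bsub>DD n k p\<^esub>" if "int k - int p < a + int 0" for k g p f
    proof -
      have "n - int k + int p > c" using that by (simp add: a_def)
      hence "zero_module (DD n k p)" using c by (simp add: DD_def)
      thus ?thesis using V_proj_closed[OF v, of k g p f] by (simp add: zero_module_def)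
    qed
    thus ?case using v rel by blast
  next
    case (Suc i)
    define j where "j = a + int i"
    have jb: "j < b - 1" using Suc.prems by (simp add: j_def)
    have "a + int i \<le> b - 1" using Suc.prems by simp
    from Suc.IH[OF this] obtain w where wP: "?P (a + int i) w" by (elim exE)
    note w = conjunct1[OF wP] conjunct1[OF conjunct2[OF wP]]
      and w0 = conjunct2[OF conjunct2[OF wP], folded j_def]
    \<comment> \<open>At the lowest level \<open>j\<close>, both \<open>C w\<close> and
      \<open>U\<close> vanish, so the relation leaves \<open>d w = 0\<close> there. The degree
      \<open>n - j\<close> exceeds \<open>n - b + 1\<close>, where cocycles of \<open>D\<close> are
      coboundaries.\<close>
    have ex: "\<exists>y\<in>carrier (DD (n - 1) k p). diff D (n - 1 - int k + int p) y = w (k, g, p, f)"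
      if gf: "g \<in> S k" "f \<in> T p" "int k - int p = j" for k g p f
    proof -
      let ?e = "n - int k + int p"
      interpret M: pmodule R "DD (n + 1) k p" by (rule DD_pmodule)
      have wc: "w (k, g, p, f) \<in> carrier (obj D ?e)" using V_proj_closed[OF w(1)] by (simp add: DD_def)
      have Yc: "Y n w (k, g, p, f) \<in> carrier (DD (n + 1) k p)" by (rule V_proj_closed[OF mod_hom_closed[OF Y_hom w(1)]])
      have "C n w (k, g, p, f) \<oplus>\<^bsub>DD (n + 1) k p\<^esub> Y n w (k, g, p, f) = \<zero>\<^bsub>DD (n + 1) k p\<^esub>"
        using w(2) U gf jb by (simp add: V_simps)
      hence "Y n w (k, g, p, f) = \<zero>\<^bsub>DD (n + 1) k p\<^esub>" using C_low[OF w0 gf(1,2)] gf(3) Yc by simp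
      hence "w (k, g, p, f) \<in> cocycles D ?e" using wc by (simp add: cocycles_def Y_def DD_next)
      moreover have "?e > n - b + 1" using gf(3) jb by simp
      ultimately have "w (k, g, p, f) \<in> coboundaries D ?e" using exact by blast
      moreover have "?e - 1 = n - 1 - int k + int p" by simp
      ultimately show ?thesis unfolding coboundaries_def DD_def by (auto simp only: image_iff)
    qed
    define u where "u = (\<lambda>(k, g, p, f). if g \<in> S k \<and> f \<in> T p \<and> int k - int p = j then
      (SOME y. y \<in> carrier (DD (n - 1) k p) \<and> diff D (n - 1 - int k + int p) y = w (k, g, p, f)) else \<zero>\<^bsub>DD (n - 1) k p\<^esub>)"
    have uj: "u (k, g, p, f) \<in> carrier (DD (n - 1) k p) \<and> diff D (n - 1 - int k + int p) (u (k, g, p, f)) = w (k, g, p, f)"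
      if gf: "g \<in> S k" "f \<in> T p" "int k - int p = j" for k g p f
      using someI_ex[of "\<lambda>y. y \<in> carrier (DD (n - 1) k p) \<and> diff D (n - 1 - int k + int p) y = w (k, g, p, f)"]
        ex[OF gf] gf unfolding u_def by auto
    have u0: "u (k, g, p, f) = \<zero>\<^bsub>DD (n - 1) k p\<^esub>" if "\<not> (g \<in> S k \<and> f \<in> T p \<and> int k - int p = j)" for k g p f
      unfolding u_def prod.case using that by (rule if_not_P)
    have uV: "u \<in> carrier (V (n - 1))"
      unfolding V_carrier
    proof (intro allI)
      fix k g p f
      interpret M: pmodule R "DD (n - 1) k p" by (rule DD_pmodule)
      show "u (k, g, p, f) \<in> carrier (DD (n - 1) k p)"
        using uj[of g k f p] u0[of g k f p] by (cases "g \<in> S k \<and> f \<in> T p \<and> int k - int p = j") auto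
    qed
    have n1: "n - 1 + 1 = n" by simp
    interpret V: pmodule R "V n" by (rule V_pmodule)
    interpret V1: pmodule R "V (n + 1)" by (rule V_pmodule)
    have Cu: "C (n - 1) u \<in> carrier (V n)" and Yu: "Y (n - 1) u \<in> carrier (V n)"
      using mod_hom_closed[OF C_hom uV] mod_hom_closed[OF Y_hom uV] by (simp_all add: n1)
    \<comment> \<open>Adding \<open>(C - d) u\<close> preserves the relation because
      \<open>(C + d) (C - d) = 0\<close>. At level \<open>j\<close> it contributes
      \<open>- d u = - w\<close>, while \<open>C u\<close> appears at level \<open>j + 1\<close>
      only.\<close>
    let ?z = "C (n - 1) u \<ominus>\<^bsub>V n\<^esub> Y (n - 1) u"
    let ?w = "w \<oplus>\<^bsub>V n\<^esub> ?z"
    have zV: "?z \<in> carrier (V n)" and wV: "?w \<in> carrier (V n)" using Cu Yu w by simp_all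
    have CY: "C n (Y (n - 1) u) = Y n (C (n - 1) u)" using C_Y[OF uV] by (simp add: n1)
    have YY: "Y n (Y (n - 1) u) = \<zero>\<^bsub>V (n + 1)\<^esub>" using Y_Y[OF uV] by (simp add: n1)
    have rel': "(C n ?w \<oplus>\<^bsub>V (n + 1)\<^esub> Y n ?w) (k, g, p, f) = U (k, g, p, f)" if gf: "g \<in> S k" "f \<in> T p" for k g p f
    proof -
      interpret M: pmodule R "DD (n + 1) k p" by (rule DD_pmodule)
      let ?b = "(k, g, p, f)"
      note cl = mod_hom_closed[OF C_hom w(1)] mod_hom_closed[OF Y_hom w(1)]
        mod_hom_closed[OF C_hom Cu] mod_hom_closed[OF C_hom Yu] mod_hom_closed[OF Y_hom Cu]
      have CC: "C n (C (n - 1) u) ?b = \<zero>\<^bsub>DD (n + 1) k p\<^esub>" using C_C[OF uV gf] by (simp add: n1)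
      have "C n ?w = C n w \<oplus>\<^bsub>V (n + 1)\<^esub> (C n (C (n - 1) u) \<ominus>\<^bsub>V (n + 1)\<^esub> C n (Y (n - 1) u))"
        using mod_hom_add[OF C_hom w(1) zV] mod_hom_diff[OF V_module V_module C_hom Cu Yu] by simp
      hence 1: "C n ?w ?b = C n w ?b \<oplus>\<^bsub>DD (n + 1) k p\<^esub> (\<zero>\<^bsub>DD (n + 1) k p\<^esub> \<ominus>\<^bsub>DD (n + 1) k p\<^esub> C n (Y (n - 1) u) ?b)"
        using cl by (simp add: V_simps V_minus CC)
      have "Y n ?w = Y n w \<oplus>\<^bsub>V (n + 1)\<^esub> (Y n (C (n - 1) u) \<ominus>\<^bsub>V (n + 1)\<^esub> \<zero>\<^bsub>V (n + 1)\<^esub>)"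
        using mod_hom_add[OF Y_hom w(1) zV] mod_hom_diff[OF V_module V_module Y_hom Cu Yu] YY by simp
      hence 2: "Y n ?w ?b = Y n w ?b \<oplus>\<^bsub>DD (n + 1) k p\<^esub> C n (Y (n - 1) u) ?b"
        using cl CY by (simp add: V_simps V1.diff_zero)
      have x: "C n w ?b \<in> carrier (DD (n + 1) k p)" "Y n w ?b \<in> carrier (DD (n + 1) k p)"
        "C n (Y (n - 1) u) ?b \<in> carrier (DD (n + 1) k p)"
        using V_proj_closed cl by auto
      have "(C n ?w \<oplus>\<^bsub>V (n + 1)\<^esub> Y n ?w) ?b = C n w ?b \<oplus>\<^bsub>DD (n + 1) k p\<^esub> Y n w ?b"
        unfolding V_simps 1 2 using x
        by (simp add: a_minus_def M.M.a_ac M.M.r_neg1 M.M.r_neg2 M.M.r_neg)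
      thus ?thesis using w(2) gf by (simp add: V_simps)
    qed
    have van: "?w (k, g, p, f) = \<zero>\<^bsub>DD n k p\<^esub>" if gf: "g \<in> S k" "f \<in> T p" "int k - int p < j + 1" for k g p f
    proof -
      interpret M: pmodule R "DD n k p" by (rule DD_pmodule)
      let ?b = "(k, g, p, f)"
      have "C (n - 1) u ?b = \<zero>\<^bsub>DD n k p\<^esub>"
      proof -
        have up: "u (k, g, Suc p, f') = \<zero>\<^bsub>DD (n - 1 + 1) k p\<^esub>" for f'
          using u0[of g k f' "Suc p"] gf(3) by (simp add: DD_Suc_p)
        hence "X1 (n - 1) u ?b = (\<Oplus>\<^bsub>DD (n - 1 + 1) k p\<^esub>f'\<in>T (Suc p). \<zero>\<^bsub>DD (n - 1 + 1) k p\<^esub>)"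
          unfolding X1_apply using c1_closed by (simp del: diff_add_cancel)
        hence 1: "X1 (n - 1) u ?b = \<zero>\<^bsub>DD n k p\<^esub>" by simp
        have 2: "X2 (n - 1) u ?b = \<zero>\<^bsub>DD n k p\<^esub>"
        proof (cases k)
          case 0
          thus ?thesis by (simp add: X2_def)
        next
          fix k' assume k: "k = Suc k'"
          have "DD (n - 1 + 1) (Suc k') p = DD (n - 1) k' p" by (rule DD_Suc_k)
          hence up: "u (k', g', p, f) = \<zero>\<^bsub>DD (n - 1 + 1) k p\<^esub>" for g'
            using u0[of g' k' f p] gf(3) k by simp
          hence "X2 (n - 1) u ?b = (\<Oplus>\<^bsub>DD (n - 1 + 1) k p\<^esub>g'\<in>S k'. \<zero>\<^bsub>DD (n - 1 + 1) k p\<^esub>)"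
            unfolding X2_apply(2)[OF k] using c2_closed by (simp del: diff_add_cancel)
          thus ?thesis by simp
        qed
        have "C (n - 1) u ?b = X1 (n - 1) u ?b \<oplus>\<^bsub>DD (n - 1 + 1) k p\<^esub> X2 (n - 1) u ?b" by (simp only: C_def V_simps)
        thus ?thesis by (simp add: 1 2)
      qed
      moreover have "Y (n - 1) u ?b = w ?b"
      proof (cases "int k - int p = j")
        case True
        thus ?thesis using uj[OF gf(1,2)] by (simp add: Y_def)
      next
        case False
        hence "u ?b = \<zero>\<^bsub>DD (n - 1) k p\<^esub>" using u0 by simp
        hence "Y (n - 1) u ?b = \<zero>\<^bsub>DD (n - 1 + 1) k p\<^esub>"
          using mod_hom_zero[OF DD_module DD_module Y_diff_hom, of "n - 1" k p] by (simp add: Y_def)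
        moreover have "w ?b = \<zero>\<^bsub>DD n k p\<^esub>" using w0 gf False by simp
        ultimately show ?thesis by simp
      qed
      moreover have "w ?b \<in> carrier (DD n k p)" by (rule V_proj_closed[OF w(1)])
      ultimately have "?w ?b = w ?b \<oplus>\<^bsub>DD n k p\<^esub> (\<zero>\<^bsub>DD n k p\<^esub> \<ominus>\<^bsub>DD n k p\<^esub> w ?b)"
        by (simp only: V_simps V_minus[OF Cu Yu])
      thus ?thesis using \<open>w ?b \<in> carrier (DD n k p)\<close> by (simp add: a_minus_def M.M.r_neg)
    qed
    have "?P (j + 1) ?w" using wV rel' van by blast
    moreover have "j + 1 = a + int (Suc i)" by (simp add: j_def)
    ultimately show ?case by (intro exI[of _ ?w]) simp
  qed
  from this[of "nat (b - 1 - a)"] obtain w where "?P (a + int (nat (b - 1 - a))) w" by (auto simp: a_def)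
  moreover have "a + int (nat (b - 1 - a)) = b - 1" by (simp add: a_def)
  ultimately show ?thesis by auto
qed

end

section \<open>Tensor products\<close>

lemma (in pmodule) quotient_lift:
  fixes L :: "('a, 'l) module"
  assumes H: "submodule H R M" and L: "module R L" and \<phi>: "\<phi> \<in> mod_hom R M L"
    and zero: "\<And>x. x \<in> H \<Longrightarrow> \<phi> x = \<zero>\<^bsub>L\<^esub>"
  shows "\<exists>h\<in>mod_hom R (quotient_module M H) L. \<forall>x\<in>carrier M. h (H +> x) = \<phi> x"
proof -
  interpret L: pmodule R L by (rule pmodule.intro) fact
  define h where "h X = \<phi> (SOME x. x \<in> carrier M \<and> H +> x = X)" for X
  have h: "h (H +> x) = \<phi> x" if x: "x \<in> carrier M" for x
  proof -
    define y where "y = (SOME y. y \<in> carrier M \<and> H +> y = H +> x)"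
    have y: "y \<in> carrier M \<and> H +> y = H +> x"
      unfolding y_def by (rule someI[of _ x]) (simp add: x)
    hence "y \<ominus> x \<in> H" using coset_eq_iff[OF H, of y x] x by simp
    hence "\<phi> (y \<ominus> x) = \<zero>\<^bsub>L\<^esub>" by (rule zero)
    moreover have "\<phi> (y \<ominus> x) = \<phi> y \<ominus>\<^bsub>L\<^esub> \<phi> x"
      using y x by (intro mod_hom_diff[OF module_axioms L \<phi>]) auto
    ultimately have "\<phi> y = \<phi> x" using y x mod_hom_closed[OF \<phi>] L.diff_eq_zero_iff by simp
    thus ?thesis by (simp add: h_def y_def)
  qed
  have "h \<in> mod_hom R (quotient_module M H) L"
  proof (rule mod_homI)
    fix X assume "X \<in> carrier (quotient_module M H)"
    then obtain x where x: "x \<in> carrier M" "X = H +> x" by (auto simp: quotient_carrier)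
    show "h X \<in> carrier L" using x h mod_hom_closed[OF \<phi>] by simp
    {
      fix Y assume "Y \<in> carrier (quotient_module M H)"
      then obtain y where y: "y \<in> carrier M" "Y = H +> y" by (auto simp: quotient_carrier)
      show "h (X \<oplus>\<^bsub>quotient_module M H\<^esub> Y) = h X \<oplus>\<^bsub>L\<^esub> h Y"
        using x y by (simp add: quotient_add[OF H] h mod_hom_add[OF \<phi>])
    }
    fix a assume "a \<in> carrier R"
    thus "h (a \<odot>\<^bsub>quotient_module M H\<^esub> X) = a \<odot>\<^bsub>L\<^esub> h X"
      using x by (simp add: quotient_smult[OF H] h mod_hom_smult[OF \<phi>])
  qed
  thus ?thesis using h by blast
qed

locale tensor_product = cring R
  for R :: "('a, 'r) ring_scheme" (structure) +
  fixes M :: "('a, 'm) module" and N :: "('a, 'n) module"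
  assumes M: "module R M" and N: "module R N"
begin

sublocale M: pmodule R M by (rule pmodule.intro) (rule M)
sublocale N: pmodule R N by (rule pmodule.intro) (rule N)
sublocale F: pmodule R "free_module R (carrier M \<times> carrier N)" by (rule free_pmodule)

abbreviation F :: "('a, 'm \<times> 'n \<Rightarrow> 'a) module" where "F \<equiv> free_module R (carrier M \<times> carrier N)"
abbreviation H :: "('m \<times> 'n \<Rightarrow> 'a) set" where "H \<equiv> tensor_submodule R M N"
abbreviation pure :: "'m \<Rightarrow> 'n \<Rightarrow> ('m \<times> 'n \<Rightarrow> 'a) set" where "pure \<equiv> pure_tensor R M N"

lemma gen_closed: "x \<in> carrier M \<Longrightarrow> y \<in> carrier N \<Longrightarrow> free_gen R (x, y) \<in> carrier F"
  by (intro free_gen_carrier) simp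

lemma relations_carrier: "tensor_relations R M N \<subseteq> carrier F"
  unfolding tensor_relations_def Let_def
  by (auto intro!: F.M.minus_closed F.M.a_closed F.smult_closed gen_closed)

lemma H_submodule: "submodule H R F"
  unfolding tensor_submodule_def by (rule F.span_submodule[OF relations_carrier])

lemma relations_H: "tensor_relations R M N \<subseteq> H"
  unfolding tensor_submodule_def by (rule F.span_incl)

lemma tensor_is_module: "module R (tensor R M N)"
  unfolding tensor_def by (rule F.quotient_is_module[OF H_submodule])

lemma proj_hom: "(\<lambda>u. H +>\<^bsub>F\<^esub> u) \<in> mod_hom R F (tensor R M N)"
  unfolding tensor_def by (rule F.quotient_proj[OF H_submodule])

lemma pure_closed: "x \<in> carrier M \<Longrightarrow> y \<in> carrier N \<Longrightarrow> pure x y \<in> carrier (tensor R M N)"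
  unfolding pure_tensor_def by (rule mod_hom_closed[OF proj_hom gen_closed])

lemma pure_relation:
  assumes "u \<ominus>\<^bsub>F\<^esub> w \<in> tensor_relations R M N" "u \<in> carrier F" "w \<in> carrier F"
  shows "H +>\<^bsub>F\<^esub> u = H +>\<^bsub>F\<^esub> w"
  using F.coset_eq_iff[OF H_submodule assms(2,3)] relations_H assms(1) by blast

lemma pure_bilinear:
  assumes "x \<in> carrier M" "y \<in> carrier N"
  shows "x' \<in> carrier M \<Longrightarrow> pure (x \<oplus>\<^bsub>M\<^esub> x') y = pure x y \<oplus>\<^bsub>tensor R M N\<^esub> pure x' y"
    and "y' \<in> carrier N \<Longrightarrow> pure x (y \<oplus>\<^bsub>N\<^esub> y') = pure x y \<oplus>\<^bsub>tensor R M N\<^esub> pure x y'"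
    and "a \<in> carrier R \<Longrightarrow> pure (a \<odot>\<^bsub>M\<^esub> x) y = a \<odot>\<^bsub>tensor R M N\<^esub> pure x y"
    and "a \<in> carrier R \<Longrightarrow> pure x (a \<odot>\<^bsub>N\<^esub> y) = a \<odot>\<^bsub>tensor R M N\<^esub> pure x y"
proof -
  let ?e = "free_gen R :: 'm \<times> 'n \<Rightarrow> _"
  note add = mod_hom_add[OF proj_hom] and sm = mod_hom_smult[OF proj_hom]
  {
    assume x': "x' \<in> carrier M"
    have "?e (x \<oplus>\<^bsub>M\<^esub> x', y) \<ominus>\<^bsub>F\<^esub> (?e (x, y) \<oplus>\<^bsub>F\<^esub> ?e (x', y)) \<in> tensor_relations R M N"
      unfolding tensor_relations_def Let_def using assms x' by blast
    from pure_relation[OF this] show "pure (x \<oplus>\<^bsub>M\<^esub> x') y = pure x y \<oplus>\<^bsub>tensor R M N\<^esub> pure x' y"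
      unfolding pure_tensor_def using assms x' by (simp add: add gen_closed)
  next
    assume y': "y' \<in> carrier N"
    have "?e (x, y \<oplus>\<^bsub>N\<^esub> y') \<ominus>\<^bsub>F\<^esub> (?e (x, y) \<oplus>\<^bsub>F\<^esub> ?e (x, y')) \<in> tensor_relations R M N"
      unfolding tensor_relations_def Let_def using assms y' by blast
    from pure_relation[OF this] show "pure x (y \<oplus>\<^bsub>N\<^esub> y') = pure x y \<oplus>\<^bsub>tensor R M N\<^esub> pure x y'"
      unfolding pure_tensor_def using assms y' by (simp add: add gen_closed)
  next
    assume a: "a \<in> carrier R"
    have "?e (a \<odot>\<^bsub>M\<^esub> x, y) \<ominus>\<^bsub>F\<^esub> a \<odot>\<^bsub>F\<^esub> ?e (x, y) \<in> tensor_relations R M N"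
      unfolding tensor_relations_def Let_def using assms a by blast
    from pure_relation[OF this] show "pure (a \<odot>\<^bsub>M\<^esub> x) y = a \<odot>\<^bsub>tensor R M N\<^esub> pure x y"
      unfolding pure_tensor_def using assms a by (simp add: sm gen_closed)
    have "?e (x, a \<odot>\<^bsub>N\<^esub> y) \<ominus>\<^bsub>F\<^esub> a \<odot>\<^bsub>F\<^esub> ?e (x, y) \<in> tensor_relations R M N"
      unfolding tensor_relations_def Let_def using assms a by blast
    from pure_relation[OF this] show "pure x (a \<odot>\<^bsub>N\<^esub> y) = a \<odot>\<^bsub>tensor R M N\<^esub> pure x y"
      unfolding pure_tensor_def using assms a by (simp add: sm gen_closed)
  }
qed

lemma tensor_hom_eq:
  fixes L :: "('a, 'l) module"
  assumes L: "module R L" and h: "h \<in> mod_hom R (tensor R M N) L" "h' \<in> mod_hom R (tensor R M N) L"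
    and eq: "\<And>x y. x \<in> carrier M \<Longrightarrow> y \<in> carrier N \<Longrightarrow> h (pure x y) = h' (pure x y)"
    and u: "u \<in> carrier (tensor R M N)"
  shows "h u = h' u"
proof -
  interpret L: pmodule R L by (rule pmodule.intro) fact
  obtain w where w: "w \<in> carrier F" "u = H +>\<^bsub>F\<^esub> w"
    using u unfolding tensor_def F.quotient_carrier by blast
  have "h (H +>\<^bsub>F\<^esub> w) = h' (H +>\<^bsub>F\<^esub> w)"
  proof (rule L.hom_free_eq[OF mod_hom_compose[OF proj_hom h(1)] mod_hom_compose[OF proj_hom h(2)] _ w(1)])
    fix s assume "s \<in> carrier M \<times> carrier N"
    thus "h (H +>\<^bsub>F\<^esub> free_gen R s) = h' (H +>\<^bsub>F\<^esub> free_gen R s)"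
      using eq[of "fst s" "snd s"] by (auto simp: pure_tensor_def)
  qed
  thus ?thesis using w by simp
qed

lemma tensor_lift:
  fixes L :: "('a, 'l) module"
  assumes L: "module R L"
    and b: "\<And>y. y \<in> carrier N \<Longrightarrow> (\<lambda>x. b x y) \<in> mod_hom R M L"
      "\<And>x. x \<in> carrier M \<Longrightarrow> b x \<in> mod_hom R N L"
  shows "\<exists>h\<in>mod_hom R (tensor R M N) L. \<forall>x\<in>carrier M. \<forall>y\<in>carrier N. h (pure x y) = b x y"
proof -
  interpret L: pmodule R L by (rule pmodule.intro) fact
  define \<phi> where "\<phi> = lin_ext R L (\<lambda>(x, y). b x y)"
  have bc: "b x y \<in> carrier L" if "x \<in> carrier M" "y \<in> carrier N" for x y
    by (rule mod_hom_closed[OF b(1)[OF that(2)] that(1)])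
  have \<phi>: "\<phi> \<in> mod_hom R F L" unfolding \<phi>_def by (rule L.lin_ext_hom) (auto intro: bc)
  have gen: "\<phi> (free_gen R (x, y)) = b x y" if "x \<in> carrier M" "y \<in> carrier N" for x y
    unfolding \<phi>_def using L.lin_ext_gen[of "\<lambda>(x, y). b x y" "(x, y)"] bc[OF that] by simp
  note hd = mod_hom_diff[OF F.module_axioms L \<phi>] and ha = mod_hom_add[OF \<phi>] and hs = mod_hom_smult[OF \<phi>]
  note ba = mod_hom_add[OF b(1)] mod_hom_add[OF b(2)] and bs = mod_hom_smult[OF b(1)] mod_hom_smult[OF b(2)]
  have "tensor_relations R M N \<subseteq> {u \<in> carrier F. \<phi> u = \<zero>\<^bsub>L\<^esub>}"
  proof (intro subsetI CollectI conjI)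
    fix u assume u: "u \<in> tensor_relations R M N"
    thus "u \<in> carrier F" using relations_carrier by blast
    show "\<phi> u = \<zero>\<^bsub>L\<^esub>"
      using u unfolding tensor_relations_def Let_def
      by (elim UnE CollectE exE conjE)
         (simp_all add: hd ha hs gen gen_closed bc ba bs L.diff_self)
  qed
  hence H0: "H \<subseteq> {u \<in> carrier F. \<phi> u = \<zero>\<^bsub>L\<^esub>}"
    unfolding tensor_submodule_def by (intro F.span_minimal kernel_submodule F.module_axioms L \<phi>)
  obtain h where h: "h \<in> mod_hom R (tensor R M N) L" "\<forall>u\<in>carrier F. h (H +>\<^bsub>F\<^esub> u) = \<phi> u"
    using F.quotient_lift[OF H_submodule L \<phi>] H0 unfolding tensor_def by blast
  have "h (pure x y) = b x y" if "x \<in> carrier M" "y \<in> carrier N" for x y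
    unfolding pure_tensor_def using h(2) gen_closed[OF that] gen[OF that] by simp
  thus ?thesis using h(1) by blast
qed

lemma pure_hom_left: "y \<in> carrier N \<Longrightarrow> (\<lambda>x. pure x y) \<in> mod_hom R M (tensor R M N)"
  by (rule mod_homI) (rule pure_closed pure_bilinear(1,3), assumption+)+

lemma pure_hom_right: "x \<in> carrier M \<Longrightarrow> pure x \<in> mod_hom R N (tensor R M N)"
  by (rule mod_homI) (rule pure_closed pure_bilinear(2,4), assumption+)+

end

text \<open>\<open>tensor_map\<close> is a definite description: existence comes from
  \<open>tensor_lift\<close>, uniqueness from \<open>tensor_hom_eq\<close> together with
  extensionality, which fixes the values outside the carrier.\<close>

lemma (in cring) tensor_map:
  fixes M :: "('a, 'm) module" and N :: "('a, 'n) module"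
    and M' :: "('a, 'k) module" and N' :: "('a, 'l) module"
  assumes mods: "module R M" "module R N" "module R M'" "module R N'"
    and f: "f \<in> mod_hom R M M'" and g: "g \<in> mod_hom R N N'"
  shows "tensor_map R M N M' N' f g \<in> mod_hom R (tensor R M N) (tensor R M' N')"
    and "\<And>x y. x \<in> carrier M \<Longrightarrow> y \<in> carrier N \<Longrightarrow>
      tensor_map R M N M' N' f g (pure_tensor R M N x y) = pure_tensor R M' N' (f x) (g y)"
proof -
  have T: "tensor_product R M N" and T': "tensor_product R M' N'"
    by (intro tensor_product.intro tensor_product_axioms.intro is_cring mods)+
  note Tm = tensor_product.tensor_is_module[OF T] and Tm' = tensor_product.tensor_is_module[OF T']
  let ?P = "\<lambda>h. h \<in> mod_hom R (tensor R M N) (tensor R M' N') \<inter> extensional (carrier (tensor R M N)) \<and>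
    (\<forall>x \<in> carrier M. \<forall>y \<in> carrier N. h (pure_tensor R M N x y) = pure_tensor R M' N' (f x) (g y))"
  have "\<exists>h\<in>mod_hom R (tensor R M N) (tensor R M' N'). \<forall>x\<in>carrier M. \<forall>y\<in>carrier N.
      h (pure_tensor R M N x y) = pure_tensor R M' N' (f x) (g y)"
  proof (rule tensor_product.tensor_lift[OF T Tm', of "\<lambda>x y. pure_tensor R M' N' (f x) (g y)"])
    fix y assume "y \<in> carrier N"
    from mod_hom_compose[OF f tensor_product.pure_hom_left[OF T' mod_hom_closed[OF g this]]]
    show "(\<lambda>x. pure_tensor R M' N' (f x) (g y)) \<in> mod_hom R M (tensor R M' N')" .
  next
    fix x assume "x \<in> carrier M"
    from mod_hom_compose[OF g tensor_product.pure_hom_right[OF T' mod_hom_closed[OF f this]]]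
    show "(\<lambda>y. pure_tensor R M' N' (f x) (g y)) \<in> mod_hom R N (tensor R M' N')" .
  qed
  then obtain h where h: "h \<in> mod_hom R (tensor R M N) (tensor R M' N')"
    "\<forall>x\<in>carrier M. \<forall>y\<in>carrier N. h (pure_tensor R M N x y) = pure_tensor R M' N' (f x) (g y)" by blast
  let ?h = "restrict h (carrier (tensor R M N))"
  have Ph: "?P ?h"
  proof (intro conjI IntI ballI)
    show "?h \<in> mod_hom R (tensor R M N) (tensor R M' N')"
      by (rule mod_hom_cong[OF Tm h(1)]) simp
    show "?h (pure_tensor R M N x y) = pure_tensor R M' N' (f x) (g y)"
      if "x \<in> carrier M" "y \<in> carrier N" for x y
      using h(2) tensor_product.pure_closed[OF T that] that by simp
  qed simp
  have "?P (tensor_map R M N M' N' f g)"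
    unfolding tensor_map_def
  proof (rule theI[of ?P, OF Ph])
    fix k assume k: "?P k"
    show "k = ?h"
    proof (rule extensionalityI)
      show "k \<in> extensional (carrier (tensor R M N))" using k by (simp only: Int_iff)
      show "?h \<in> extensional (carrier (tensor R M N))" by simp
      fix u assume u: "u \<in> carrier (tensor R M N)"
      show "k u = ?h u"
      proof (rule tensor_product.tensor_hom_eq[OF T Tm' IntD1[OF conjunct1[OF k]] IntD1[OF conjunct1[OF Ph]] _ u])
        show "k (pure_tensor R M N x y) = ?h (pure_tensor R M N x y)" if "x \<in> carrier M" "y \<in> carrier N" for x y
          using conjunct2[OF k] conjunct2[OF Ph] that by (simp only:)
      qed
    qed
  qed
  thus "tensor_map R M N M' N' f g \<in> mod_hom R (tensor R M N) (tensor R M' N')"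
    "\<And>x y. x \<in> carrier M \<Longrightarrow> y \<in> carrier N \<Longrightarrow>
      tensor_map R M N M' N' f g (pure_tensor R M N x y) = pure_tensor R M' N' (f x) (g y)" by simp_all
qed

text \<open>Formulated for bare records, in view of \<open>hom_complex\<close>: a coboundary
  \<open>w\<close> that acts as a neutral element on \<open>u\<close> suffices to see that
  \<open>u\<close> lies in its own coset, which is the set of coboundaries.\<close>

lemma coboundary_if_zero_cohomology:
  assumes zero: "zero_module (cohomology C n)" and u: "u \<in> cocycles C n"
    and w: "w \<in> coboundaries C n" "w \<oplus>\<^bsub>obj C n\<^esub> u = u"
  shows "u \<in> coboundaries C n"
proof -
  have "coboundaries C n +>\<^bsub>obj C n\<^esub> u \<in> carrier (cohomology C n)"
    using u by (auto simp: cohomology_def quotient_module_def A_RCOSETS_def RCOSETS_def a_r_coset_def)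
      (auto simp: r_coset_def)
  hence "coboundaries C n +>\<^bsub>obj C n\<^esub> u = coboundaries C n"
    using zero by (simp add: zero_module_def) (simp add: cohomology_def quotient_module_def)
  moreover have "w \<oplus>\<^bsub>obj C n\<^esub> u \<in> coboundaries C n +>\<^bsub>obj C n\<^esub> u"
    using w(1) by (auto simp: a_r_coset_def')
  ultimately show ?thesis using w(2) by simp
qed

section \<open>Coordinates of linear maps, and signs\<close>

context cring
begin

lemma free_finsum_coord:
  assumes "\<And>i. i \<in> A \<Longrightarrow> y i \<in> carrier (free_module R S)" "finite A"
  shows "(\<Oplus>\<^bsub>free_module R S\<^esub>i\<in>A. y i) s = (\<Oplus>i\<in>A. y i s)"
  using assms(2,1)
proof (induction A)
  case empty
  interpret F: pmodule R "free_module R S" by (rule free_pmodule)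
  show ?case by (simp add: free_simps(1))
next
  case (insert a A)
  interpret F: pmodule R "free_module R S" by (rule free_pmodule)
  have "(\<Oplus>\<^bsub>free_module R S\<^esub>i\<in>insert a A. y i) = y a \<oplus>\<^bsub>free_module R S\<^esub> (\<Oplus>\<^bsub>free_module R S\<^esub>i\<in>A. y i)"
    using insert by (intro F.M.finsum_insert) auto
  moreover have "(\<Oplus>i\<in>insert a A. y i s) = y a s \<oplus> (\<Oplus>i\<in>A. y i s)"
    using insert by (intro finsum_insert) (auto simp: free_carrier)
  ultimately show ?case using insert by (simp add: free_simps)
qed

lemma hom_free_coord:
  assumes h: "h \<in> mod_hom R (free_module R S) (free_module R T)" and S: "finite S"
    and w: "w \<in> carrier (free_module R S)"
  shows "h w t = (\<Oplus>s\<in>S. w s \<otimes> h (free_gen R s) t)"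
proof -
  let ?T = "free_module R T"
  interpret T: pmodule R ?T by (rule free_pmodule)
  have wc: "w s \<in> carrier R" for s using w by (simp add: free_carrier)
  have hc: "h (free_gen R s) \<in> carrier ?T" if "s \<in> S" for s by (rule mod_hom_closed[OF h free_gen_carrier[OF that]])
  have "h w = lin_ext R ?T (\<lambda>s. h (free_gen R s)) w" by (rule T.hom_free_expand[OF h w])
  also have "\<dots> = (\<Oplus>\<^bsub>?T\<^esub>s\<in>S. w s \<odot>\<^bsub>?T\<^esub> h (free_gen R s))"
    using S w hc wc by (intro T.lin_ext_sum) (auto simp: free_carrier[of w])
  finally have "h w t = (\<Oplus>s\<in>S. (w s \<odot>\<^bsub>?T\<^esub> h (free_gen R s)) t)"
    using free_finsum_coord[of S "\<lambda>s. w s \<odot>\<^bsub>?T\<^esub> h (free_gen R s)" T t] hc wc S by simp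
  thus ?thesis by (simp add: free_simps)
qed

lemma hom_free_expand_finite:
  assumes L: "module R L" and h: "h \<in> mod_hom R (free_module R S) L" and S: "finite S"
    and w: "w \<in> carrier (free_module R S)"
  shows "h w = (\<Oplus>\<^bsub>L\<^esub>s\<in>S. w s \<odot>\<^bsub>L\<^esub> h (free_gen R s))"
proof -
  interpret L: pmodule R L by (rule pmodule.intro) fact
  have "h w = lin_ext R L (\<lambda>s. h (free_gen R s)) w" by (rule L.hom_free_expand[OF h w])
  also have "\<dots> = (\<Oplus>\<^bsub>L\<^esub>s\<in>S. w s \<odot>\<^bsub>L\<^esub> h (free_gen R s))"
    using S w mod_hom_closed[OF h free_gen_carrier] by (intro L.lin_ext_sum) (auto simp: free_carrier)
  finally show ?thesis .
qed

text \<open>The ring element by which \<open>signed\<close> multiplies; in this form signs pass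
  through linear maps.\<close>

definition sign :: "int \<Rightarrow> 'a" where
  "sign n = (if even n then \<one> else \<ominus> \<one>)"

lemma sign_closed [simp]: "sign n \<in> carrier R"
  by (simp add: sign_def)

lemma sign_square: "sign n \<otimes> sign n = \<one>"
  by (simp add: sign_def l_minus)

lemma sign_Suc: "sign (int (Suc p)) = \<ominus> sign (int p)"
  by (simp add: sign_def)

lemma sign_uminus: "sign (- n) = sign n"
  by (simp add: sign_def)

end

context pmodule
begin

lemma signed_eq: "x \<in> carrier M \<Longrightarrow> signed M n x = R.sign n \<odot> x"
  by (simp add: signed_def R.sign_def smult_l_minus)

lemma signed_zero: "signed M n \<zero> = \<zero>"
  by (simp add: signed_def minus_zero')

end

section \<open>The total tensor complex\<close>

locale tensor_of_complexes = cring R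
  for R :: "('a, 'r) ring_scheme" (structure) +
  fixes X :: "('a, 'x) cochain_complex" and Y :: "('a, 'y) cochain_complex"
  assumes X: "is_complex R X" and Y: "is_complex R Y"
begin

abbreviation W :: "('a, int \<Rightarrow> ('x \<times> 'y \<Rightarrow> 'a) set) cochain_complex" where
  "W \<equiv> tensor_complex R X Y"

text \<open>Both partial differentials are indexed by their target: \<open>dX n p\<close> and
  \<open>dY n p\<close> end in \<open>X\<^sup>p \<otimes> Y\<^sup>n\<close>, so that the two
  summands of the total differential share their indices.\<close>

definition dX :: "int \<Rightarrow> int \<Rightarrow> ('x \<times> 'y \<Rightarrow> 'a) set \<Rightarrow> ('x \<times> 'y \<Rightarrow> 'a) set" where
  "dX n p = tensor_map R (obj X (p - 1)) (obj Y n) (obj X p) (obj Y n) (diff X (p - 1)) (\<lambda>y. y)"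

definition dY :: "int \<Rightarrow> int \<Rightarrow> ('x \<times> 'y \<Rightarrow> 'a) set \<Rightarrow> ('x \<times> 'y \<Rightarrow> 'a) set" where
  "dY n p = tensor_map R (obj X p) (obj Y (n - 1)) (obj X p) (obj Y n) (\<lambda>x. x) (diff Y (n - 1))"

lemma XY_tensor: "tensor_product R (obj X p) (obj Y n)"
  by (intro tensor_product.intro tensor_product_axioms.intro is_cring is_complexD(1)[OF X] is_complexD(1)[OF Y])

lemma XY_module: "module R (tensor R (obj X p) (obj Y n))"
  by (rule tensor_product.tensor_is_module[OF XY_tensor])

lemma dX_hom: "dX n p \<in> mod_hom R (tensor R (obj X (p - 1)) (obj Y n)) (tensor R (obj X p) (obj Y n))"
  unfolding dX_def
  by (intro tensor_map is_complexD(1)[OF X] is_complexD(1)[OF Y] diff_prev[OF X] mod_hom_id)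

lemma dX_pure:
  assumes "x \<in> carrier (obj X (p - 1))" "y \<in> carrier (obj Y n)"
  shows "dX n p (pure_tensor R (obj X (p - 1)) (obj Y n) x y) = pure_tensor R (obj X p) (obj Y n) (diff X (p - 1) x) y"
  unfolding dX_def
  by (rule tensor_map(2)[OF is_complexD(1)[OF X] is_complexD(1)[OF Y] is_complexD(1)[OF X] is_complexD(1)[OF Y]
      diff_prev[OF X] mod_hom_id assms])

lemma dY_hom: "dY n p \<in> mod_hom R (tensor R (obj X p) (obj Y (n - 1))) (tensor R (obj X p) (obj Y n))"
  unfolding dY_def
  by (intro tensor_map is_complexD(1)[OF X] is_complexD(1)[OF Y] diff_prev[OF Y] mod_hom_id)

lemma dY_pure:
  assumes "x \<in> carrier (obj X p)" "y \<in> carrier (obj Y (n - 1))"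
  shows "dY n p (pure_tensor R (obj X p) (obj Y (n - 1)) x y) = pure_tensor R (obj X p) (obj Y n) x (diff Y (n - 1) y)"
  unfolding dY_def
  by (rule tensor_map(2)[OF is_complexD(1)[OF X] is_complexD(1)[OF Y] is_complexD(1)[OF X] is_complexD(1)[OF Y]
      mod_hom_id diff_prev[OF Y] assms])

lemma W_module: "module R (obj W n)"
  unfolding tensor_complex_def cochain_complex.simps by (intro sum_module_module is_cring XY_module)

lemma W_carrier:
  "z \<in> carrier (obj W n) \<longleftrightarrow> (\<forall>p. z p \<in> carrier (tensor R (obj X p) (obj Y (n - p)))) \<and>
     finite {p. z p \<noteq> \<zero>\<^bsub>tensor R (obj X p) (obj Y (n - p))\<^esub>}"
  by (simp add: tensor_complex_def sum_module_simps)

lemma W_comp: "z \<in> carrier (obj W n) \<Longrightarrow> n - p = e \<Longrightarrow> z p \<in> carrier (tensor R (obj X p) (obj Y e))"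
  using W_carrier by blast

lemma W_simps:
  "\<zero>\<^bsub>obj W n\<^esub> = (\<lambda>p. \<zero>\<^bsub>tensor R (obj X p) (obj Y (n - p))\<^esub>)"
  "add (obj W n) z w = (\<lambda>p. z p \<oplus>\<^bsub>tensor R (obj X p) (obj Y (n - p))\<^esub> w p)"
  "smult (obj W n) a z = (\<lambda>p. a \<odot>\<^bsub>tensor R (obj X p) (obj Y (n - p))\<^esub> z p)"
  by (simp_all add: tensor_complex_def sum_module_simps)

lemma W_proj: "n - p = e \<Longrightarrow> (\<lambda>z. z p) \<in> mod_hom R (obj W n) (tensor R (obj X p) (obj Y e))"
  using sum_proj[of p R "\<lambda>p. tensor R (obj X p) (obj Y (n - p))"] by (simp add: tensor_complex_def)

lemma W_diff:
  assumes "n + 1 - p = e"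
  shows "diff W n z p = dX e p (z (p - 1)) \<oplus>\<^bsub>tensor R (obj X p) (obj Y e)\<^esub>
    signed (tensor R (obj X p) (obj Y e)) p (dY e p (z p))"
proof -
  have "n - p = e - 1" using assms by simp
  thus ?thesis by (simp only: tensor_complex_def dX_def dY_def cochain_complex.simps assms)
qed

lemma W_diff_hom: "diff W n \<in> mod_hom R (obj W n) (obj W (n + 1))"
proof -
  have comp: "(\<lambda>z. diff W n z p) \<in> mod_hom R (obj W n) (tensor R (obj X p) (obj Y (n + 1 - p)))" for p
  proof -
    define e where "e = n + 1 - p"
    have e: "n - (p - 1) = e" "n - p = e - 1" by (simp_all add: e_def)
    interpret T: pmodule R "tensor R (obj X p) (obj Y e)" by (rule pmodule.intro) (rule XY_module)
    have 1: "(\<lambda>z. dX e p (z (p - 1))) \<in> mod_hom R (obj W n) (tensor R (obj X p) (obj Y e))"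
      by (rule mod_hom_compose[OF W_proj[OF e(1)] dX_hom])
    have 2: "(\<lambda>z. dY e p (z p)) \<in> mod_hom R (obj W n) (tensor R (obj X p) (obj Y e))"
      by (rule mod_hom_compose[OF W_proj[OF e(2)] dY_hom])
    have "(\<lambda>z. dX e p (z (p - 1)) \<oplus>\<^bsub>tensor R (obj X p) (obj Y e)\<^esub> sign p \<odot>\<^bsub>tensor R (obj X p) (obj Y e)\<^esub> dY e p (z p))
        \<in> mod_hom R (obj W n) (tensor R (obj X p) (obj Y e))"
      by (intro mod_hom_plus mod_hom_scale T.module_axioms 1 2 sign_closed)
    thus ?thesis
      unfolding e_def[symmetric] W_diff[OF e_def[symmetric]]
      by (rule mod_hom_cong[OF W_module]) (simp add: T.signed_eq[OF mod_hom_closed[OF 2]])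
  qed
  have supp: "finite {p. diff W n z p \<noteq> \<zero>\<^bsub>tensor R (obj X p) (obj Y (n + 1 - p))\<^esub>}" if z: "z \<in> carrier (obj W n)" for z
  proof (rule finite_subset)
    let ?Z = "{p. z p \<noteq> \<zero>\<^bsub>tensor R (obj X p) (obj Y (n - p))\<^esub>}"
    show "finite (?Z \<union> (\<lambda>p. p + 1) ` ?Z)" using z W_carrier by blast
    show "{p. diff W n z p \<noteq> \<zero>\<^bsub>tensor R (obj X p) (obj Y (n + 1 - p))\<^esub>} \<subseteq> ?Z \<union> (\<lambda>p. p + 1) ` ?Z"
    proof (intro subsetI, rule ccontr)
      fix p assume p: "p \<in> {p. diff W n z p \<noteq> \<zero>\<^bsub>tensor R (obj X p) (obj Y (n + 1 - p))\<^esub>}"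
        and np: "p \<notin> ?Z \<union> (\<lambda>p. p + 1) ` ?Z"
      define e where "e = n + 1 - p"
      have e: "n - (p - 1) = e" "n - p = e - 1" by (simp_all add: e_def)
      interpret T: pmodule R "tensor R (obj X p) (obj Y e)" by (rule pmodule.intro) (rule XY_module)
      have "p - 1 \<notin> ?Z" using np by (auto simp: image_iff)
      hence z1: "z (p - 1) = \<zero>\<^bsub>tensor R (obj X (p - 1)) (obj Y e)\<^esub>" by (simp only: mem_Collect_eq e not_not)
      have z0: "z p = \<zero>\<^bsub>tensor R (obj X p) (obj Y (e - 1))\<^esub>" using np by (simp add: e)
      have "diff W n z p = \<zero>\<^bsub>tensor R (obj X p) (obj Y e)\<^esub>"
        unfolding W_diff[OF e_def[symmetric]] z1 z0
          mod_hom_zero[OF XY_module XY_module dX_hom] mod_hom_zero[OF XY_module XY_module dY_hom] T.signed_zero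
        by simp
      thus False using p by (simp add: e_def)
    qed
  qed
  show ?thesis
  proof (rule mod_homI)
    fix z w a assume z: "z \<in> carrier (obj W n)"
    show "diff W n z \<in> carrier (obj W (n + 1))" using mod_hom_closed[OF comp z] supp[OF z] W_carrier by blast
    show "diff W n (z \<oplus>\<^bsub>obj W n\<^esub> w) = diff W n z \<oplus>\<^bsub>obj W (n + 1)\<^esub> diff W n w" if "w \<in> carrier (obj W n)"
      using mod_hom_add[OF comp z that] by (intro ext) (simp add: W_simps)
    show "diff W n (a \<odot>\<^bsub>obj W n\<^esub> z) = a \<odot>\<^bsub>obj W (n + 1)\<^esub> diff W n z" if "a \<in> carrier R"
      using mod_hom_smult[OF comp that z] by (intro ext) (simp add: W_simps)
  qed
qed

lemma W_diff_zero: "diff W n \<zero>\<^bsub>obj W n\<^esub> = \<zero>\<^bsub>obj W (n + 1)\<^esub>"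
  by (rule mod_hom_zero[OF W_module W_module W_diff_hom])

end

text \<open>The one place where the products of homomorphism modules in \<open>hom_complex\<close>
  are unfolded. Afterwards the vanishing of \<open>Ext\<close> is available as a family
  \<open>h\<close> with a boundary formula.\<close>

lemma (in cring) hom_complex_boundary:
  fixes P :: "('a, 'p) cochain_complex" and W :: "('a, 'w) cochain_complex"
  assumes P: "is_complex R P" and W: "\<And>n. module R (obj W n)"
    and dW: "\<And>n. diff W n \<zero>\<^bsub>obj W n\<^esub> = \<zero>\<^bsub>obj W (n + 1)\<^esub>"
    and zero: "zero_module (cohomology (hom_complex R P W) n)"
    and u: "\<And>p. u p \<in> mod_hom R (obj P p) (obj W (p + n))" "\<And>p. u p \<in> extensional (carrier (obj P p))"
    and cyc: "\<And>p x. x \<in> carrier (obj P p) \<Longrightarrow>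
      diff W (p + n) (u p x) \<ominus>\<^bsub>obj W (p + n + 1)\<^esub>
        signed (obj W (p + n + 1)) n (u (p + 1) (diff P p x)) = \<zero>\<^bsub>obj W (p + n + 1)\<^esub>"
  shows "\<exists>h. (\<forall>p. h p \<in> mod_hom R (obj P p) (obj W (p + (n - 1)))) \<and>
    (\<forall>p. \<forall>x\<in>carrier (obj P p). u p x = diff W (p + (n - 1)) (h p x) \<ominus>\<^bsub>obj W (p + n)\<^esub>
      signed (obj W (p + n)) (n - 1) (h (p + 1) (diff P p x)))"
proof -
  let ?H = "hom_complex R P W"
  have Wp: "pmodule R (obj W n)" for n by (rule pmodule.intro) (rule W)
  have carr: "f \<in> carrier (obj ?H n) \<longleftrightarrow>
      (\<forall>p. f p \<in> mod_hom R (obj P p) (obj W (p + n)) \<inter> extensional (carrier (obj P p)))" for f n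
    by (simp add: hom_complex_def product_module_def hom_module_def)
  have zeroH: "\<zero>\<^bsub>obj ?H n\<^esub> = (\<lambda>p. \<lambda>x\<in>carrier (obj P p). \<zero>\<^bsub>obj W (p + n)\<^esub>)" for n
    by (simp add: hom_complex_def product_module_def hom_module_def)
  have addH: "f \<oplus>\<^bsub>obj ?H n\<^esub> g = (\<lambda>p. \<lambda>x\<in>carrier (obj P p). f p x \<oplus>\<^bsub>obj W (p + n)\<^esub> g p x)" for f g n
    by (simp add: hom_complex_def product_module_def hom_module_def)
  have diffH: "diff ?H n f = (\<lambda>p. \<lambda>x\<in>carrier (obj P p). diff W (p + n) (f p x) \<ominus>\<^bsub>obj W (p + n + 1)\<^esub>
      signed (obj W (p + n + 1)) n (f (p + 1) (diff P p x)))" for f n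
    by (simp add: hom_complex_def)
  have n1: "n - 1 + 1 = n" "p + (n - 1) + 1 = p + n" for p by simp_all
  have zc: "\<zero>\<^bsub>obj ?H (n - 1)\<^esub> \<in> carrier (obj ?H (n - 1))"
    unfolding carr zeroH
  proof (intro allI IntI)
    fix p
    show "(\<lambda>x\<in>carrier (obj P p). \<zero>\<^bsub>obj W (p + (n - 1))\<^esub>) \<in> mod_hom R (obj P p) (obj W (p + (n - 1)))"
      by (rule mod_hom_cong[OF is_complexD(1)[OF P] mod_hom_zero_map[OF W]]) simp
  qed simp
  have dz: "diff ?H (n - 1) \<zero>\<^bsub>obj ?H (n - 1)\<^esub> = \<zero>\<^bsub>obj ?H n\<^esub>"
  proof (rule ext, rule ext)
    fix p x
    show "diff ?H (n - 1) \<zero>\<^bsub>obj ?H (n - 1)\<^esub> p x = \<zero>\<^bsub>obj ?H n\<^esub> p x"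
    proof (cases "x \<in> carrier (obj P p)")
      case True
      have d: "diff P p x \<in> carrier (obj P (p + 1))" by (rule mod_hom_closed[OF is_complexD(2)[OF P] True])
      interpret W: pmodule R "obj W (p + n)" by (rule Wp)
      have "p + 1 + (n - 1) = p + n" by simp
      thus ?thesis using True d dW[of "p + (n - 1)"]
        by (simp add: diffH zeroH n1 W.signed_zero W.diff_self del: diff_add_cancel)
    qed (simp add: diffH zeroH)
  qed
  have "u \<in> carrier (obj ?H n)" using u by (simp add: carr)
  moreover have "diff ?H n u = \<zero>\<^bsub>obj ?H (n + 1)\<^esub>"
    unfolding diffH zeroH using cyc by (intro ext) (simp add: restrict_def add.assoc)
  ultimately have uc: "u \<in> cocycles ?H n" by (simp add: cocycles_def)
  have "\<zero>\<^bsub>obj ?H n\<^esub> \<in> coboundaries ?H n" unfolding coboundaries_def dz[symmetric] using zc by (rule imageI)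
  moreover have "\<zero>\<^bsub>obj ?H n\<^esub> \<oplus>\<^bsub>obj ?H n\<^esub> u = u"
  proof (rule ext, rule ext)
    fix p x
    interpret W: pmodule R "obj W (p + n)" by (rule Wp)
    show "(\<zero>\<^bsub>obj ?H n\<^esub> \<oplus>\<^bsub>obj ?H n\<^esub> u) p x = u p x"
      using mod_hom_closed[OF u(1)[of p], of x] extensional_arb[OF u(2)[of p], of x]
      by (cases "x \<in> carrier (obj P p)") (simp_all add: addH zeroH)
  qed
  ultimately have "u \<in> coboundaries ?H n" by (rule coboundary_if_zero_cohomology[OF zero uc])
  then obtain h where h: "h \<in> carrier (obj ?H (n - 1))" "u = diff ?H (n - 1) h"
    unfolding coboundaries_def by blast
  have "\<forall>p. h p \<in> mod_hom R (obj P p) (obj W (p + (n - 1)))" using h(1) carr by blast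
  moreover have "u p x = diff W (p + (n - 1)) (h p x) \<ominus>\<^bsub>obj W (p + n)\<^esub>
      signed (obj W (p + n)) (n - 1) (h (p + 1) (diff P p x))" if "x \<in> carrier (obj P p)" for p x
    unfolding h(2) diffH n1 using that by simp
  ultimately show ?thesis by blast
qed

text \<open>The signs in \<open>double_complex_relation\<close>: \<open>s\<close> and
  \<open>t\<close> are the signs of \<open>p\<close> and \<open>n\<close>, and \<open>a\<close>,
  \<open>b\<close>, \<open>c\<close> are the contributions of the differentials of \<open>F\<close>,
  \<open>D\<close> and \<open>G\<close>.\<close>

lemma (in pmodule) sign_rearrange:
  assumes "a \<in> carrier M" "b \<in> carrier M" "c \<in> carrier M" "s \<in> carrier R" "t \<in> carrier R" "s \<otimes>\<^bsub>R\<^esub> s = \<one>\<^bsub>R\<^esub>"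
  shows "(s \<odot> a \<oplus> (\<ominus>\<^bsub>R\<^esub> (s \<otimes>\<^bsub>R\<^esub> t)) \<odot> c) \<oplus> b = s \<odot> ((a \<oplus> s \<odot> b) \<ominus> t \<odot> c)"
proof -
  have "s \<odot> (s \<odot> b) = b" using assms by (simp add: smult_assoc1[symmetric])
  thus ?thesis using assms
    by (simp add: smult_r_distr smult_assoc1 smult_l_minus smult_r_minus a_minus_def M.a_ac)
qed

text \<open>\<open>P\<close> and \<open>X\<close> are meant to be the given resolutions of
  \<open>N\<close> and \<open>M\<close>. Cochains on \<open>P\<close> with values in
  \<open>X \<otimes> D\<close> are restricted along \<open>\<beta>\<close> and pushed forward along
  \<open>\<alpha>\<close>, which makes them functions on pairs of basis elements. The degree
  \<open>n\<close> is that of the bounding cochain, one less than that of the cocycle it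
  bounds.\<close>

locale resolved_double_complex = tensor_of_complexes R X D
  for R :: "('a, 'r) ring_scheme" (structure) and X :: "('a, 'x) cochain_complex"
    and D :: "('a, 'd) cochain_complex" +
  fixes P :: "nat \<Rightarrow> ('a, 'p) module" and dP :: "nat \<Rightarrow> 'p \<Rightarrow> 'p"
    and S :: "nat \<Rightarrow> 'g set" and dG :: "nat \<Rightarrow> ('g \<Rightarrow> 'a) \<Rightarrow> 'g \<Rightarrow> 'a" and \<beta> :: "nat \<Rightarrow> ('g \<Rightarrow> 'a) \<Rightarrow> 'p"
    and T :: "nat \<Rightarrow> 'f set" and dF :: "nat \<Rightarrow> ('f \<Rightarrow> 'a) \<Rightarrow> 'f \<Rightarrow> 'a" and \<alpha> :: "nat \<Rightarrow> 'x \<Rightarrow> 'f \<Rightarrow> 'a"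
    and n :: int
  assumes P: "module R (P k)" "dP k \<in> mod_hom R (P (Suc k)) (P k)"
    and finite_bases: "finite (S k)" "finite (T p)"
    and dG: "dG k \<in> mod_hom R (free_module R (S (Suc k))) (free_module R (S k))"
      "x \<in> carrier (free_module R (S (Suc (Suc k)))) \<Longrightarrow> dG k (dG (Suc k) x) = \<zero>\<^bsub>free_module R (S k)\<^esub>"
    and \<beta>: "\<beta> k \<in> mod_hom R (free_module R (S k)) (P k)"
      "w \<in> carrier (free_module R (S (Suc k))) \<Longrightarrow> dP k (\<beta> (Suc k) w) = \<beta> k (dG k w)"
    and dF: "dF p \<in> mod_hom R (free_module R (T (Suc p))) (free_module R (T p))"
      "y \<in> carrier (free_module R (T (Suc (Suc p)))) \<Longrightarrow> dF p (dF (Suc p) y) = \<zero>\<^bsub>free_module R (T p)\<^esub>"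
    and \<alpha>: "\<alpha> p \<in> mod_hom R (obj X (- int p)) (free_module R (T p))"
      "z \<in> carrier (obj X (- int (Suc p))) \<Longrightarrow> dF p (\<alpha> (Suc p) z) = \<alpha> p (diff X (- int (Suc p)) z)"
begin

text \<open>\<open>A\<close> and \<open>B\<close> are the matrices of the two differentials, set to
  zero at labels outside the source basis so that all entries lie in the ring.\<close>

definition A :: "nat \<Rightarrow> 'f \<Rightarrow> 'f \<Rightarrow> 'a" where
  "A p f' f = (if f' \<in> T (Suc p) then dF p (free_gen R f') f else \<zero>)"

definition B :: "nat \<Rightarrow> 'g \<Rightarrow> 'g \<Rightarrow> 'a" where
  "B k g g' = (if g \<in> S (Suc k) then dG k (free_gen R g) g' else \<zero>)"

text \<open>The differential of \<open>F \<otimes> D\<close> puts the sign of \<open>p\<close> on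
  the differential of \<open>D\<close>, and that of the Hom complex puts minus the sign of
  \<open>n\<close> on the differential of \<open>G\<close>. Multiplying the equation by the sign of
  \<open>p\<close> frees \<open>Y\<close> from signs and leaves those of \<open>c1\<close> and
  \<open>c2\<close>.\<close>

definition c1 :: "nat \<Rightarrow> 'f \<Rightarrow> 'f \<Rightarrow> 'a" where
  "c1 p f' f = sign (int p) \<otimes> A p f' f"

definition c2 :: "nat \<Rightarrow> nat \<Rightarrow> 'g \<Rightarrow> 'g \<Rightarrow> 'a" where
  "c2 k p g g' = \<ominus> (sign (int p) \<otimes> sign n) \<otimes> B k g g'"

lemma dF_gen: "f' \<in> T (Suc p) \<Longrightarrow> dF p (free_gen R f') \<in> carrier (free_module R (T p))"
  by (rule mod_hom_closed[OF dF(1) free_gen_carrier])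

lemma dG_gen: "g \<in> S (Suc k) \<Longrightarrow> dG k (free_gen R g) \<in> carrier (free_module R (S k))"
  by (rule mod_hom_closed[OF dG(1) free_gen_carrier])

lemma A_closed [simp]: "A p f' f \<in> carrier R"
  using dF_gen[of f' p] by (simp add: A_def free_carrier)

lemma B_closed [simp]: "B k g g' \<in> carrier R"
  using dG_gen[of g k] by (simp add: B_def free_carrier)

lemma A_square:
  assumes "f'' \<in> T (Suc (Suc p))"
  shows "(\<Oplus>f'\<in>T (Suc p). A p f' f \<otimes> A (Suc p) f'' f') = \<zero>"
proof -
  have w: "dF (Suc p) (free_gen R f'') \<in> carrier (free_module R (T (Suc p)))" by (rule dF_gen[OF assms])
  have "dF p (dF (Suc p) (free_gen R f'')) f = (\<Oplus>f'\<in>T (Suc p). dF (Suc p) (free_gen R f'') f' \<otimes> dF p (free_gen R f') f)"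
    by (rule hom_free_coord[OF dF(1) finite_bases(2) w])
  also have "\<dots> = (\<Oplus>f'\<in>T (Suc p). A p f' f \<otimes> A (Suc p) f'' f')"
    using w dF_gen assms by (intro finsum_cong') (auto simp: A_def m_comm free_carrier)
  finally show ?thesis using dF(2)[OF free_gen_carrier[OF assms]] by (simp add: free_simps)
qed

lemma B_square:
  assumes "g \<in> S (Suc (Suc k))"
  shows "(\<Oplus>g'\<in>S (Suc k). B (Suc k) g g' \<otimes> B k g' g'') = \<zero>"
proof -
  have w: "dG (Suc k) (free_gen R g) \<in> carrier (free_module R (S (Suc k)))" by (rule dG_gen[OF assms])
  have "dG k (dG (Suc k) (free_gen R g)) g'' = (\<Oplus>g'\<in>S (Suc k). dG (Suc k) (free_gen R g) g' \<otimes> dG k (free_gen R g') g'')"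
    by (rule hom_free_coord[OF dG(1) finite_bases(1) w])
  also have "\<dots> = (\<Oplus>g'\<in>S (Suc k). B (Suc k) g g' \<otimes> B k g' g'')"
    using w dG_gen assms by (intro finsum_cong') (auto simp: B_def free_carrier)
  finally show ?thesis using dG(2)[OF free_gen_carrier[OF assms]] by (simp add: free_simps)
qed

lemma double_complex: "free_double_complex R D S T c1 c2"
proof (intro free_double_complex.intro free_double_complex_axioms.intro is_cring)
  show "is_complex R D" by (rule Y)
  show "finite (S k)" "finite (T p)" for k p by (rule finite_bases)+
  show "c1 p f' f \<in> carrier R" "c2 k p g g' \<in> carrier R" for p f' f k g g'
    by (simp_all add: c1_def c2_def)
  fix p k
  {
    fix f f'' assume f'': "f'' \<in> T (Suc (Suc p))"
    have "(\<Oplus>f'\<in>T (Suc p). c1 p f' f \<otimes> c1 (Suc p) f'' f') =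
      (\<Oplus>f'\<in>T (Suc p). (sign (int p) \<otimes> sign (int (Suc p))) \<otimes> (A p f' f \<otimes> A (Suc p) f'' f'))"
      by (intro finsum_cong') (auto simp: c1_def m_ac)
    also have "\<dots> = (sign (int p) \<otimes> sign (int (Suc p))) \<otimes> (\<Oplus>f'\<in>T (Suc p). A p f' f \<otimes> A (Suc p) f'' f')"
      by (intro finsum_rdistr[symmetric] finite_bases) auto
    finally show "(\<Oplus>f'\<in>T (Suc p). c1 p f' f \<otimes> c1 (Suc p) f'' f') = \<zero>" using A_square[OF f''] by simp
  }
  {
    fix g g'' assume g: "g \<in> S (Suc (Suc k))"
    let ?s = "\<ominus> (sign (int p) \<otimes> sign n)"
    have "(\<Oplus>g'\<in>S (Suc k). c2 (Suc k) p g g' \<otimes> c2 k p g' g'') =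
      (\<Oplus>g'\<in>S (Suc k). (?s \<otimes> ?s) \<otimes> (B (Suc k) g g' \<otimes> B k g' g''))"
    proof (rule finsum_cong')
      have "(s \<otimes> a) \<otimes> (s \<otimes> b) = (s \<otimes> s) \<otimes> (a \<otimes> b)"
        if "s \<in> carrier R" "a \<in> carrier R" "b \<in> carrier R" for s a b
        using that by (simp add: m_ac)
      thus "c2 (Suc k) p g g' \<otimes> c2 k p g' g'' = (?s \<otimes> ?s) \<otimes> (B (Suc k) g g' \<otimes> B k g' g'')" for g'
        unfolding c2_def by this simp_all
    qed auto
    also have "\<dots> = (?s \<otimes> ?s) \<otimes> (\<Oplus>g'\<in>S (Suc k). B (Suc k) g g' \<otimes> B k g' g'')"
      by (intro finsum_rdistr[symmetric] finite_bases) auto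
    finally show "(\<Oplus>g'\<in>S (Suc k). c2 (Suc k) p g g' \<otimes> c2 k p g' g'') = \<zero>" using B_square[OF g] by simp
  }
  fix f' f g g'
  show "c1 p f' f \<otimes> c2 k (Suc p) g g' \<oplus> c2 k p g g' \<otimes> c1 p f' f = \<zero>"
    unfolding c1_def c2_def sign_Suc by (simp add: l_minus r_minus m_ac r_neg)
qed

sublocale DC: free_double_complex R D S T c1 c2
  by (rule double_complex)

text \<open>\<open>contract p f\<close> takes the coordinate at \<open>f\<close> of the image of \<open>X\<^sup>-\<^sup>p \<otimes> D\<^sup>e\<close> in \<open>F\<^sub>p \<otimes> D\<^sup>e\<close>.\<close>

definition contract :: "nat \<Rightarrow> 'f \<Rightarrow> int \<Rightarrow> ('x \<times> 'd \<Rightarrow> 'a) set \<Rightarrow> 'd" where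
  "contract p f e = (SOME h. h \<in> mod_hom R (tensor R (obj X (- int p)) (obj D e)) (obj D e) \<and>
     (\<forall>x\<in>carrier (obj X (- int p)). \<forall>y\<in>carrier (obj D e).
        h (pure_tensor R (obj X (- int p)) (obj D e) x y) = \<alpha> p x f \<odot>\<^bsub>obj D e\<^esub> y))"

lemma D_pmodule: "pmodule R (obj D e)"
  by (rule pmodule.intro) (rule is_complexD(1)[OF Y])

lemma \<alpha>_coord: "x \<in> carrier (obj X (- int p)) \<Longrightarrow> \<alpha> p x f \<in> carrier R"
  using mod_hom_closed[OF \<alpha>(1)] by (simp add: free_carrier)

lemma contract:
  "contract p f e \<in> mod_hom R (tensor R (obj X (- int p)) (obj D e)) (obj D e)"
  "x \<in> carrier (obj X (- int p)) \<Longrightarrow> y \<in> carrier (obj D e) \<Longrightarrow>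
    contract p f e (pure_tensor R (obj X (- int p)) (obj D e) x y) = \<alpha> p x f \<odot>\<^bsub>obj D e\<^esub> y"
proof -
  interpret De: pmodule R "obj D e" by (rule D_pmodule)
  have "\<exists>h\<in>mod_hom R (tensor R (obj X (- int p)) (obj D e)) (obj D e).
    \<forall>x\<in>carrier (obj X (- int p)). \<forall>y\<in>carrier (obj D e).
      h (pure_tensor R (obj X (- int p)) (obj D e) x y) = \<alpha> p x f \<odot>\<^bsub>obj D e\<^esub> y"
  proof (rule tensor_product.tensor_lift[OF XY_tensor De.module_axioms, where b = "\<lambda>x y. \<alpha> p x f \<odot>\<^bsub>obj D e\<^esub> y"])
    fix y assume "y \<in> carrier (obj D e)"
    thus "(\<lambda>x. \<alpha> p x f \<odot>\<^bsub>obj D e\<^esub> y) \<in> mod_hom R (obj X (- int p)) (obj D e)"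
      by (intro mod_homI)
         (simp_all add: \<alpha>_coord mod_hom_add[OF \<alpha>(1)] mod_hom_smult[OF \<alpha>(1)] free_simps De.smult_l_distr De.smult_assoc1)
  next
    fix x assume "x \<in> carrier (obj X (- int p))"
    thus "(\<lambda>y. \<alpha> p x f \<odot>\<^bsub>obj D e\<^esub> y) \<in> mod_hom R (obj D e) (obj D e)"
      by (intro mod_hom_scale De.module_axioms mod_hom_id \<alpha>_coord)
  qed
  hence "contract p f e \<in> mod_hom R (tensor R (obj X (- int p)) (obj D e)) (obj D e) \<and>
    (\<forall>x\<in>carrier (obj X (- int p)). \<forall>y\<in>carrier (obj D e).
      contract p f e (pure_tensor R (obj X (- int p)) (obj D e) x y) = \<alpha> p x f \<odot>\<^bsub>obj D e\<^esub> y)"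
    unfolding contract_def Bex_def by (rule someI_ex)
  thus "contract p f e \<in> mod_hom R (tensor R (obj X (- int p)) (obj D e)) (obj D e)"
    "x \<in> carrier (obj X (- int p)) \<Longrightarrow> y \<in> carrier (obj D e) \<Longrightarrow>
      contract p f e (pure_tensor R (obj X (- int p)) (obj D e) x y) = \<alpha> p x f \<odot>\<^bsub>obj D e\<^esub> y"
    by simp_all
qed

lemma contract_dY:
  assumes u: "u \<in> carrier (tensor R (obj X (- int p)) (obj D (e - 1)))"
  shows "contract p f e (dY e (- int p) u) = diff D (e - 1) (contract p f (e - 1) u)"
proof (rule tensor_product.tensor_hom_eq[OF XY_tensor is_complexD(1)[OF Y] mod_hom_compose[OF dY_hom contract(1)]
      mod_hom_compose[OF contract(1) diff_prev[OF Y]] _ u])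
  fix x y assume x: "x \<in> carrier (obj X (- int p))" and y: "y \<in> carrier (obj D (e - 1))"
  have dy: "diff D (e - 1) y \<in> carrier (obj D e)" by (rule mod_hom_closed[OF diff_prev[OF Y] y])
  show "contract p f e (dY e (- int p) (pure_tensor R (obj X (- int p)) (obj D (e - 1)) x y)) =
    diff D (e - 1) (contract p f (e - 1) (pure_tensor R (obj X (- int p)) (obj D (e - 1)) x y))"
    unfolding dY_pure[OF x y] contract(2)[OF x y] contract(2)[OF x dy]
    by (rule mod_hom_smult[OF diff_prev[OF Y] \<alpha>_coord[OF x] y, symmetric])
qed

text \<open>As \<open>\<alpha>\<close> is a chain map, the differential of \<open>X\<close> becomes
  that of \<open>F\<close>, expressed by its matrix.\<close>

lemma contract_dX:
  assumes u: "u \<in> carrier (tensor R (obj X (- int (Suc p))) (obj D e))"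
  shows "contract p f e (dX e (- int p) u) =
    (\<Oplus>\<^bsub>obj D e\<^esub>f'\<in>T (Suc p). A p f' f \<odot>\<^bsub>obj D e\<^esub> contract (Suc p) f' e u)"
proof -
  interpret De: pmodule R "obj D e" by (rule D_pmodule)
  let ?W = "tensor R (obj X (- int (Suc p))) (obj D e)"
  have e: "- int p - 1 = - int (Suc p)" by simp
  note dX = dX_hom[of e "- int p", unfolded e] and dXp = dX_pure[of _ "- int p" _ e, unfolded e]
  show ?thesis
  proof (rule tensor_product.tensor_hom_eq[OF XY_tensor De.module_axioms mod_hom_compose[OF dX contract(1)] _ _ u])
    show "(\<lambda>u. \<Oplus>\<^bsub>obj D e\<^esub>f'\<in>T (Suc p). A p f' f \<odot>\<^bsub>obj D e\<^esub> contract (Suc p) f' e u) \<in> mod_hom R ?W (obj D e)"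
      by (intro De.mod_hom_finsum_map XY_module finite_bases mod_hom_scale De.module_axioms contract(1) A_closed)
  next
    fix x y assume x: "x \<in> carrier (obj X (- int (Suc p)))" and y: "y \<in> carrier (obj D e)"
    let ?a = "\<alpha> (Suc p) x"
    have a: "?a \<in> carrier (free_module R (T (Suc p)))" by (rule mod_hom_closed[OF \<alpha>(1) x])
    hence ac: "?a f' \<in> carrier R" for f' by (simp add: free_carrier)
    have dx: "diff X (- int (Suc p)) x \<in> carrier (obj X (- int p))"
      using mod_hom_closed[OF diff_prev[OF X, of "- int p", unfolded e] x] .
    have "contract p f e (dX e (- int p) (pure_tensor R (obj X (- int (Suc p))) (obj D e) x y)) =
      dF p ?a f \<odot>\<^bsub>obj D e\<^esub> y"
      unfolding dXp[OF x y] contract(2)[OF dx y] \<alpha>(2)[OF x] ..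
    also have "dF p ?a f = (\<Oplus>f'\<in>T (Suc p). ?a f' \<otimes> dF p (free_gen R f') f)"
      by (rule hom_free_coord[OF dF(1) finite_bases(2) a])
    also have "\<dots> = (\<Oplus>f'\<in>T (Suc p). A p f' f \<otimes> ?a f')"
      using ac dF_gen by (intro finsum_cong') (auto simp: A_def m_comm free_carrier)
    also have "\<dots> \<odot>\<^bsub>obj D e\<^esub> y = (\<Oplus>\<^bsub>obj D e\<^esub>f'\<in>T (Suc p). (A p f' f \<otimes> ?a f') \<odot>\<^bsub>obj D e\<^esub> y)"
      using ac y by (intro De.finsum_smult_rdistr[symmetric] finite_bases) auto
    also have "\<dots> = (\<Oplus>\<^bsub>obj D e\<^esub>f'\<in>T (Suc p). A p f' f \<odot>\<^bsub>obj D e\<^esub>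
        contract (Suc p) f' e (pure_tensor R (obj X (- int (Suc p))) (obj D e) x y))"
      unfolding contract(2)[OF x y] using ac y by (intro De.M.finsum_cong') (auto simp: De.smult_assoc1)
    finally show "contract p f e (dX e (- int p) (pure_tensor R (obj X (- int (Suc p))) (obj D e) x y)) =
      (\<Oplus>\<^bsub>obj D e\<^esub>f'\<in>T (Suc p). A p f' f \<odot>\<^bsub>obj D e\<^esub>
        contract (Suc p) f' e (pure_tensor R (obj X (- int (Suc p))) (obj D e) x y))" .
  qed
qed

definition \<Phi> :: "int \<Rightarrow> nat \<Rightarrow> 'f \<Rightarrow> (int \<Rightarrow> ('x \<times> 'd \<Rightarrow> 'a) set) \<Rightarrow> 'd" where
  "\<Phi> l p f z = contract p f (l + int p) (z (- int p))"

lemma \<Phi>_hom: "\<Phi> l p f \<in> mod_hom R (obj W l) (obj D (l + int p))"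
  unfolding \<Phi>_def by (rule mod_hom_compose[OF W_proj contract(1)]) simp

lemma \<Phi>_diff:
  assumes z: "z \<in> carrier (obj W l)"
  shows "\<Phi> (l + 1) p f (diff W l z) =
    (\<Oplus>\<^bsub>obj D (l + 1 + int p)\<^esub>f'\<in>T (Suc p). A p f' f \<odot>\<^bsub>obj D (l + 1 + int p)\<^esub> \<Phi> l (Suc p) f' z)
    \<oplus>\<^bsub>obj D (l + 1 + int p)\<^esub> sign (int p) \<odot>\<^bsub>obj D (l + 1 + int p)\<^esub> diff D (l + int p) (\<Phi> l p f z)"
proof -
  define e where "e = l + 1 + int p"
  have e: "l + 1 - - int p = e" "l + int p = e - 1" "l + int (Suc p) = e" "- int p - 1 = - int (Suc p)"
    by (simp_all add: e_def)
  let ?T = "tensor R (obj X (- int p)) (obj D e)"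
  interpret T: pmodule R ?T by (rule pmodule.intro) (rule XY_module)
  have z1: "z (- int (Suc p)) \<in> carrier (tensor R (obj X (- int (Suc p))) (obj D e))"
    and z0: "z (- int p) \<in> carrier (tensor R (obj X (- int p)) (obj D (e - 1)))"
    by (rule W_comp[OF z]; simp add: e_def)+
  have c1: "dX e (- int p) (z (- int (Suc p))) \<in> carrier ?T"
    using mod_hom_closed[OF dX_hom[of e "- int p", unfolded e(4)] z1] .
  have c0: "dY e (- int p) (z (- int p)) \<in> carrier ?T" by (rule mod_hom_closed[OF dY_hom z0])
  have "\<Phi> (l + 1) p f (diff W l z) = contract p f e (diff W l z (- int p))" by (simp add: \<Phi>_def e_def)
  also have "diff W l z (- int p) = dX e (- int p) (z (- int (Suc p))) \<oplus>\<^bsub>?T\<^esub> sign (int p) \<odot>\<^bsub>?T\<^esub> dY e (- int p) (z (- int p))"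
    unfolding W_diff[OF e(1)] e(4) T.signed_eq[OF c0] sign_uminus ..
  also have "contract p f e \<dots> = contract p f e (dX e (- int p) (z (- int (Suc p)))) \<oplus>\<^bsub>obj D e\<^esub>
    sign (int p) \<odot>\<^bsub>obj D e\<^esub> contract p f e (dY e (- int p) (z (- int p)))"
    using c1 c0 by (simp add: mod_hom_add[OF contract(1)] mod_hom_smult[OF contract(1)])
  finally show ?thesis
    unfolding contract_dX[OF z1] contract_dY[OF z0] \<Phi>_def e_def[symmetric] e(2,3) .
qed

text \<open>The boundary formula for \<open>h\<close> is evaluated at the images of the basis
  elements of \<open>G\<close>, contracted to coordinates and multiplied by the sign of
  \<open>p\<close>. At \<open>k = 0\<close> there is no term coming from \<open>P\<close> in the
  next degree, hence the separate hypothesis \<open>u0\<close>.\<close>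

lemma double_complex_relation:
  assumes h: "\<And>k. h k \<in> mod_hom R (P k) (obj W (n - int k))"
    and u0: "\<And>x. x \<in> carrier (P 0) \<Longrightarrow> u 0 x = diff W (n - int 0) (h 0 x)"
    and uSuc: "\<And>k x. x \<in> carrier (P (Suc k)) \<Longrightarrow> u (Suc k) x =
      diff W (n - int (Suc k)) (h (Suc k) x) \<ominus>\<^bsub>obj W (n - int k)\<^esub> signed (obj W (n - int k)) n (h k (dP k x))"
  shows "\<exists>v\<in>carrier (DC.V n). \<forall>k p. \<forall>g\<in>S k. \<forall>f\<in>T p.
    (DC.C n v \<oplus>\<^bsub>DC.V (n + 1)\<^esub> DC.Y n v) (k, g, p, f) =
      sign (int p) \<odot>\<^bsub>DC.DD (n + 1) k p\<^esub> \<Phi> (n - int k + 1) p f (u k (\<beta> k (free_gen R g)))"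
proof -
  define v where "v = (\<lambda>(k, g, p, f). if g \<in> S k then \<Phi> (n - int k) p f (h k (\<beta> k (free_gen R g))) else \<zero>\<^bsub>DC.DD n k p\<^esub>)"
  have \<beta>g: "\<beta> k (free_gen R g) \<in> carrier (P k)" if "g \<in> S k" for k g
    by (rule mod_hom_closed[OF \<beta>(1) free_gen_carrier[OF that]])
  have hg: "h k (\<beta> k (free_gen R g)) \<in> carrier (obj W (n - int k))" if "g \<in> S k" for k g
    by (rule mod_hom_closed[OF h \<beta>g[OF that]])
  have vg: "v (k, g, p, f) = \<Phi> (n - int k) p f (h k (\<beta> k (free_gen R g)))" if "g \<in> S k" for k g p f
    using that by (simp add: v_def)
  have v: "v \<in> carrier (DC.V n)"
    unfolding DC.V_carrier
  proof (intro allI)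
    fix k g p f
    interpret M: pmodule R "DC.DD n k p" by (rule DC.DD_pmodule)
    have "\<Phi> (n - int k) p f (h k (\<beta> k (free_gen R g))) \<in> carrier (DC.DD n k p)" if "g \<in> S k"
      using mod_hom_closed[OF \<Phi>_hom hg[OF that]] by (simp add: DC.DD_def)
    thus "v (k, g, p, f) \<in> carrier (DC.DD n k p)" by (simp add: v_def)
  qed
  have rel: "(DC.C n v \<oplus>\<^bsub>DC.V (n + 1)\<^esub> DC.Y n v) (k, g, p, f) =
      sign (int p) \<odot>\<^bsub>DC.DD (n + 1) k p\<^esub> \<Phi> (n - int k + 1) p f (u k (\<beta> k (free_gen R g)))"
    if g: "g \<in> S k" and f: "f \<in> T p" for k g p f
  proof -
    define l where "l = n - int k"
    define M where "M = DC.DD (n + 1) k p"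
    have M: "obj D (l + 1 + int p) = M" by (simp add: M_def DC.DD_def l_def algebra_simps)
    interpret M: pmodule R M unfolding M_def by (rule DC.DD_pmodule)
    interpret Wl: pmodule R "obj W (l + 1)" by (rule pmodule.intro) (rule W_module)
    let ?y = "\<beta> k (free_gen R g)"
    let ?a = "\<Oplus>\<^bsub>M\<^esub>f'\<in>T (Suc p). A p f' f \<odot>\<^bsub>M\<^esub> v (k, g, Suc p, f')"
    let ?b = "DC.Y n v (k, g, p, f)"
    have vc: "v (k, g, Suc p, f') \<in> carrier M" for f'
      unfolding M_def using DC.V_proj_closed[OF v, of k g "Suc p" f'] by (simp add: DC.DD_Suc_p)
    have a: "?a \<in> carrier M" using vc by (intro M.M.finsum_closed) auto
    have b: "?b \<in> carrier M" unfolding M_def by (rule DC.V_proj_closed[OF mod_hom_closed[OF DC.Y_hom v]])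
    have b': "?b = diff D (l + int p) (\<Phi> l p f (h k ?y))" by (simp add: DC.Y_def vg[OF g] l_def)
    have hl: "h k ?y \<in> carrier (obj W l)" unfolding l_def by (rule hg[OF g])
    have \<Phi>d: "\<Phi> (l + 1) p f (diff W l (h k ?y)) = ?a \<oplus>\<^bsub>M\<^esub> sign (int p) \<odot>\<^bsub>M\<^esub> ?b"
      unfolding \<Phi>_diff[OF hl] M b' by (simp only: vg[OF g] l_def)
    have X1: "DC.X1 n v (k, g, p, f) = sign (int p) \<odot>\<^bsub>M\<^esub> ?a"
    proof -
      have "DC.X1 n v (k, g, p, f) = (\<Oplus>\<^bsub>M\<^esub>f'\<in>T (Suc p). sign (int p) \<odot>\<^bsub>M\<^esub> (A p f' f \<odot>\<^bsub>M\<^esub> v (k, g, Suc p, f')))"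
        unfolding DC.X1_apply M_def[symmetric] c1_def using vc
        by (intro M.M.finsum_cong') (auto simp: M.smult_assoc1)
      also have "\<dots> = sign (int p) \<odot>\<^bsub>M\<^esub> ?a"
        using vc finite_bases(2) by (intro M.finsum_smult_ldistr[symmetric]) auto
      finally show ?thesis .
    qed
    \<comment> \<open>\<open>c\<close> stands for the term in which \<open>h\<close> is applied
      after the differential of \<open>G\<close>; for \<open>k = 0\<close> this term is absent and
      zero takes its place.\<close>
    have "\<exists>c\<in>carrier M. DC.X2 n v (k, g, p, f) = (\<ominus> (sign (int p) \<otimes> sign n)) \<odot>\<^bsub>M\<^esub> c \<and>
      \<Phi> (l + 1) p f (u k ?y) = (?a \<oplus>\<^bsub>M\<^esub> sign (int p) \<odot>\<^bsub>M\<^esub> ?b) \<ominus>\<^bsub>M\<^esub> sign n \<odot>\<^bsub>M\<^esub> c"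
    proof (cases k)
      case 0
      have X2: "DC.X2 n v (k, g, p, f) = \<zero>\<^bsub>M\<^esub>" unfolding M_def 0 by (rule DC.X2_apply(1))
      have "u k ?y = diff W l (h k ?y)" using u0 \<beta>g[OF g] unfolding l_def 0 by blast
      hence U: "\<Phi> (l + 1) p f (u k ?y) = ?a \<oplus>\<^bsub>M\<^esub> sign (int p) \<odot>\<^bsub>M\<^esub> ?b" by (simp only: \<Phi>d)
      show ?thesis unfolding X2 U using a b by (intro bexI[of _ "\<zero>\<^bsub>M\<^esub>"]) (simp_all add: M.diff_zero)
    next
      case (Suc k')
      have l': "n - int k' = l + 1" "n - int (Suc k') = l" by (simp_all add: l_def Suc)
      have gS: "g \<in> S (Suc k')" using g Suc by simp
      let ?w = "dG k' (free_gen R g)"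
      have w: "?w \<in> carrier (free_module R (S k'))" by (rule dG_gen[OF gS])
      have hy: "h k' (\<beta> k' ?w) \<in> carrier (obj W (l + 1))"
        using mod_hom_closed[OF h mod_hom_closed[OF \<beta>(1) w]] unfolding l' .
      define c where "c = \<Phi> (l + 1) p f (h k' (\<beta> k' ?w))"
      have c: "c \<in> carrier M" unfolding c_def M[symmetric] by (rule mod_hom_closed[OF \<Phi>_hom hy])
      have comp: "(\<lambda>w. \<Phi> (l + 1) p f (h k' (\<beta> k' w))) \<in> mod_hom R (free_module R (S k')) M"
        using mod_hom_compose[OF mod_hom_compose[OF \<beta>(1) h] \<Phi>_hom, of k' p f] unfolding l' M .
      have vk: "v (k', g', p, f) \<in> carrier M" for g'
        unfolding M_def using DC.V_proj_closed[OF v, of k' g' p f] by (simp add: DC.DD_Suc_k Suc)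
      have "c = (\<Oplus>\<^bsub>M\<^esub>g'\<in>S k'. ?w g' \<odot>\<^bsub>M\<^esub> \<Phi> (l + 1) p f (h k' (\<beta> k' (free_gen R g'))))"
        unfolding c_def by (rule hom_free_expand_finite[OF M.module_axioms comp finite_bases(1) w])
      also have "\<dots> = (\<Oplus>\<^bsub>M\<^esub>g'\<in>S k'. B k' g g' \<odot>\<^bsub>M\<^esub> v (k', g', p, f))"
      proof (rule M.M.finsum_cong')
        show "?w g' \<odot>\<^bsub>M\<^esub> \<Phi> (l + 1) p f (h k' (\<beta> k' (free_gen R g'))) = B k' g g' \<odot>\<^bsub>M\<^esub> v (k', g', p, f)"
          if "g' \<in> S k'" for g' unfolding vg[OF that] B_def using gS by (simp only: if_True l')
      qed (use vk in auto)
      finally have cs: "c = (\<Oplus>\<^bsub>M\<^esub>g'\<in>S k'. B k' g g' \<odot>\<^bsub>M\<^esub> v (k', g', p, f))" .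
      let ?s = "\<ominus> (sign (int p) \<otimes> sign n)"
      have "DC.X2 n v (k, g, p, f) = (\<Oplus>\<^bsub>M\<^esub>g'\<in>S k'. ?s \<odot>\<^bsub>M\<^esub> (B k' g g' \<odot>\<^bsub>M\<^esub> v (k', g', p, f)))"
        unfolding DC.X2_apply(2)[OF Suc] M_def[symmetric] c2_def using vk
        by (intro M.M.finsum_cong') (auto simp: M.smult_assoc1)
      also have "\<dots> = ?s \<odot>\<^bsub>M\<^esub> c"
        unfolding cs using vk finite_bases(1) by (intro M.finsum_smult_ldistr[symmetric]) auto
      finally have X2: "DC.X2 n v (k, g, p, f) = ?s \<odot>\<^bsub>M\<^esub> c" .
      have dW: "diff W l (h k ?y) \<ominus>\<^bsub>obj W (l + 1)\<^esub> signed (obj W (l + 1)) n (h k' (\<beta> k' ?w)) = u k ?y"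
        using uSuc[OF \<beta>g[OF gS]] unfolding \<beta>(2)[OF free_gen_carrier[OF gS]] l' Suc by simp
      have dWc: "diff W l (h k ?y) \<in> carrier (obj W (l + 1))" by (rule mod_hom_closed[OF W_diff_hom hl])
      have "\<Phi> (l + 1) p f (u k ?y) = \<Phi> (l + 1) p f (diff W l (h k ?y)) \<ominus>\<^bsub>M\<^esub> sign n \<odot>\<^bsub>M\<^esub> c"
        unfolding dW[symmetric] Wl.signed_eq[OF hy]
          mod_hom_diff[OF Wl.module_axioms is_complexD(1)[OF Y] \<Phi>_hom dWc Wl.smult_closed[OF sign_closed hy]]
          mod_hom_smult[OF \<Phi>_hom sign_closed hy] M c_def ..
      thus ?thesis using X2 c unfolding \<Phi>d by blast
    qed
    then obtain c where c: "c \<in> carrier M" "DC.X2 n v (k, g, p, f) = (\<ominus> (sign (int p) \<otimes> sign n)) \<odot>\<^bsub>M\<^esub> c"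
      "\<Phi> (l + 1) p f (u k ?y) = (?a \<oplus>\<^bsub>M\<^esub> sign (int p) \<odot>\<^bsub>M\<^esub> ?b) \<ominus>\<^bsub>M\<^esub> sign n \<odot>\<^bsub>M\<^esub> c" by (elim bexE conjE)
    show ?thesis
      unfolding DC.V_simps DC.C_def l_def[symmetric] M_def[symmetric] X1 c(2,3)
      by (rule M.sign_rearrange[OF a b c(1)]) (simp_all add: sign_square)
  qed
  show ?thesis using v rel by blast
qed

end

context free_double_complex
begin

text \<open>At level \<open>b\<close>, the value of \<open>U\<close> is a sum of three terms.
  \<open>Y\<close> contributes a coboundary; \<open>X1\<close> and \<open>X2\<close> have
  coefficients in \<open>I\<close> and read components of level \<open>b - 1\<close>. The latter are
  cocycles, since at that level \<open>U\<close> vanishes and so does \<open>C v\<close>, everything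
  lower having been cleared.\<close>

lemma value_in_submodule:
  assumes v: "v \<in> carrier (V n)"
    and rel: "\<forall>k p. \<forall>g\<in>S k. \<forall>f\<in>T p. (C n v \<oplus>\<^bsub>V (n + 1)\<^esub> Y n v) (k, g, p, f) = U (k, g, p, f)"
    and low: "\<forall>k p. \<forall>g\<in>S k. \<forall>f\<in>T p. int k - int p < b - 1 \<longrightarrow> v (k, g, p, f) = \<zero>\<^bsub>DD n k p\<^esub>"
    and U: "\<forall>k p. \<forall>g\<in>S k. \<forall>f\<in>T p. int k - int p = b - 1 \<longrightarrow> U (k, g, p, f) = \<zero>\<^bsub>DD (n + 1) k p\<^esub>"
    and gf: "g \<in> S k" "f \<in> T p" "int k - int p = b"
    and I: "\<And>f'. f' \<in> T (Suc p) \<Longrightarrow> c1 p f' f \<in> I" "\<And>k' g'. k = Suc k' \<Longrightarrow> g' \<in> S k' \<Longrightarrow> c2 k' p g g' \<in> I"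
    and H: "submodule H R (obj D (n + 1 - b))" "coboundaries D (n + 1 - b) \<subseteq> H"
      "\<And>a y. a \<in> I \<Longrightarrow> y \<in> cocycles D (n + 1 - b) \<Longrightarrow> a \<odot>\<^bsub>obj D (n + 1 - b)\<^esub> y \<in> H"
  shows "U (k, g, p, f) \<in> H"
proof -
  define M where "M = obj D (n + 1 - b)"
  have M: "DD (n + 1) k p = M" using gf(3) by (simp add: DD_def M_def algebra_simps)
  interpret M: pmodule R M unfolding M[symmetric] by (rule DD_pmodule)
  note H' = H(1)[folded M_def]
  have cyc: "v (k', g', p', f') \<in> cocycles D (n + 1 - b)"
    if g'f': "g' \<in> S k'" "f' \<in> T p'" "int k' - int p' = b - 1" for k' g' p' f'
  proof -
    interpret N: pmodule R "DD (n + 1) k' p'" by (rule DD_pmodule)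
    have e: "n - int k' + int p' = n + 1 - b" using g'f'(3) by simp
    have Yc: "Y n v (k', g', p', f') \<in> carrier (DD (n + 1) k' p')" by (rule V_proj_closed[OF mod_hom_closed[OF Y_hom v]])
    have "C n v (k', g', p', f') = \<zero>\<^bsub>DD (n + 1) k' p'\<^esub>" by (rule C_low[OF low g'f'(1,2)]) (simp add: g'f'(3))
    moreover have "C n v (k', g', p', f') \<oplus>\<^bsub>DD (n + 1) k' p'\<^esub> Y n v (k', g', p', f') = \<zero>\<^bsub>DD (n + 1) k' p'\<^esub>"
      using rel U g'f' by (simp add: V_simps)
    ultimately have "Y n v (k', g', p', f') = \<zero>\<^bsub>DD (n + 1) k' p'\<^esub>" using Yc by simp
    hence "diff D (n + 1 - b) (v (k', g', p', f')) = \<zero>\<^bsub>obj D (n + 1 - b + 1)\<^esub>"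
      unfolding Y_def prod.case DD_next e .
    moreover have "v (k', g', p', f') \<in> carrier (obj D (n + 1 - b))"
      using V_proj_closed[OF v, of k' g' p' f'] unfolding DD_def e .
    ultimately show ?thesis by (simp only: cocycles_def mem_Collect_eq)
  qed
  note H3 = H(3)[folded M_def]
  have X1: "X1 n v (k, g, p, f) \<in> H"
    unfolding X1_apply M
  proof (intro M.submodule_finsum[OF H'] Pi_I)
    fix f' assume f': "f' \<in> T (Suc p)"
    show "c1 p f' f \<odot>\<^bsub>M\<^esub> v (k, g, Suc p, f') \<in> H"
      using gf(3) by (intro H3 I(1)[OF f'] cyc[OF gf(1) f']) simp
  qed
  have X2: "X2 n v (k, g, p, f) \<in> H"
  proof (cases k)
    case 0
    show ?thesis using M.submodule_zero[OF H'] M unfolding 0 X2_apply(1) by simp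
  next
    case (Suc k')
    show ?thesis
      unfolding X2_apply(2)[OF Suc] M
    proof (intro M.submodule_finsum[OF H'] Pi_I)
      fix g' assume g': "g' \<in> S k'"
      show "c2 k' p g g' \<odot>\<^bsub>M\<^esub> v (k', g', p, f) \<in> H"
        using gf(3) Suc by (intro H3 I(2)[OF Suc g'] cyc[OF g' gf(2)]) simp
    qed
  qed
  have Y: "Y n v (k, g, p, f) \<in> H"
  proof -
    have e: "n - int k + int p = n + 1 - b - 1" using gf(3) by simp
    have "v (k, g, p, f) \<in> carrier (obj D (n + 1 - b - 1))"
      using V_proj_closed[OF v, of k g p f] unfolding DD_def e .
    hence "Y n v (k, g, p, f) \<in> coboundaries D (n + 1 - b)"
      unfolding Y_def prod.case e coboundaries_def by (rule imageI)
    thus ?thesis using H(2) by blast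
  qed
  have "U (k, g, p, f) = (X1 n v (k, g, p, f) \<oplus>\<^bsub>M\<^esub> X2 n v (k, g, p, f)) \<oplus>\<^bsub>M\<^esub> Y n v (k, g, p, f)"
    using rel[rule_format, OF gf(1,2)] unfolding C_def V_simps M by simp
  thus ?thesis using M.submoduleE(5)[OF H'] X1 X2 Y by simp
qed

end

section \<open>The test cocycle and the nonvanishing of Ext\<close>

lemma (in noetherian_local_ring) coord_notin_m:
  assumes "u \<in> carrier (free_module R S)" "s \<in> S" "u \<ominus>\<^bsub>free_module R S\<^esub> free_gen R s \<in> ideal_coords R S m"
  shows "u s \<notin> m"
proof
  interpret F: pmodule R "free_module R S" by (rule free_pmodule)
  interpret m: ideal m R by (rule m_ideal)
  note g = free_gen_carrier[OF assms(2)]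
  let ?d = "u \<ominus>\<^bsub>free_module R S\<^esub> free_gen R s"
  assume "u s \<in> m"
  have d: "?d s \<in> m" using assms(3) by (simp add: ideal_coords_def)
  have "u = ?d \<oplus>\<^bsub>free_module R S\<^esub> free_gen R s" using F.diff_add_cancel'[OF assms(1) g] by simp
  define \<delta> where "\<delta> = ?d s"
  have "u s = \<delta> \<oplus> \<one>" unfolding \<delta>_def using \<open>u = _\<close> by (metis free_simps(2) free_gen_def)
  moreover have \<delta>: "\<delta> \<in> m" unfolding \<delta>_def by (rule d)
  ultimately have "\<one> = u s \<ominus> \<delta>" using m_sub[OF \<delta>] by (simp add: a_minus_def a_comm[of \<delta>] a_assoc r_neg)
  moreover have "u s \<ominus> \<delta> \<in> m"
    using \<open>u s \<in> m\<close> \<delta> unfolding a_minus_def by (intro m.a_closed m.a_inv_closed)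
  ultimately show False using one_notin_m by simp
qed

text \<open>Finite projective dimension makes the set in \<open>proj_dim\<close> nonempty, so
  \<open>SOME\<close> selects an actual resolution.\<close>

lemma resolution_exists:
  fixes M :: "('a, 'm) module"
  assumes "proj_dim R M < \<infinity>"
  shows "\<exists>e. projective_resolution R M (resolution R M) e"
proof -
  let ?S = "{enat n | n. \<exists>(P :: ('a, 'm \<times> nat \<Rightarrow> 'a) cochain_complex) e.
        projective_resolution R M P e \<and> (\<forall>k < - int n. zero_module (obj P k))}"
  have "?S \<noteq> {}"
  proof
    assume "?S = {}"
    hence "proj_dim R M = \<infinity>" unfolding proj_dim_def by (simp only: Inf_empty top_enat_def)
    thus False using assms by simp
  qed
  then obtain P :: "('a, 'm \<times> nat \<Rightarrow> 'a) cochain_complex" where "\<exists>e. projective_resolution R M P e" by blast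
  thus ?thesis unfolding resolution_def by (rule someI)
qed

lemma (in noetherian_local_ring) resolution_props:
  fixes M :: "('a, 'm) module"
  assumes M: "module R M" and pd: "proj_dim R M < \<infinity>"
  shows "is_complex R (resolution R M)" "\<And>n. n > 0 \<Longrightarrow> zero_module (obj (resolution R M) n)"
    "\<And>n. free_retract R (obj (resolution R M) n)"
    "\<exists>e. resolves R M (\<lambda>k. obj (resolution R M) (- int k)) (\<lambda>k. diff (resolution R M) (- int (Suc k))) e"
proof -
  obtain e where e: "projective_resolution R M (resolution R M) e" using resolution_exists[OF pd] by blast
  thus "is_complex R (resolution R M)" "\<And>n. n > 0 \<Longrightarrow> zero_module (obj (resolution R M) n)"
    "\<And>n. free_retract R (obj (resolution R M) n)"
    using one_neq_zero by (auto simp: projective_resolution_def intro: projective_free_retract)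
  show "\<exists>e. resolves R M (\<lambda>k. obj (resolution R M) (- int k)) (\<lambda>k. diff (resolution R M) (- int (Suc k))) e"
    using resolves_if_projective_resolution[OF M e] by blast
qed

text \<open>An element \<open>x\<close> with the same image in \<open>M\<close> as a basis element
  of \<open>F\<^sub>0\<close> is mapped by \<open>\<alpha>\<close> to that basis element modulo the
  kernel of \<open>eF\<close>, thus modulo \<open>m F\<^sub>0\<close>; its coordinate there is a
  unit.\<close>

lemma (in noetherian_local_ring) minimal_generator:
  fixes M :: "('a, 'm) module" and Q :: "nat \<Rightarrow> ('a, 'q) module"
  assumes M: "module R M" "\<not> zero_module M" and Q: "resolves R M Q dQ eQ"
    and F: "resolves R M (\<lambda>k. free_module R (T k)) dF eF"
    and ker: "\<forall>x\<in>carrier (free_module R (T 0)). eF x = \<zero>\<^bsub>M\<^esub> \<longrightarrow> x \<in> ideal_coords R (T 0) m"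
    and \<alpha>: "\<alpha> \<in> mod_hom R (Q 0) (free_module R (T 0))" "\<forall>x\<in>carrier (Q 0). eF (\<alpha> x) = eQ x"
  shows "\<exists>x\<in>carrier (Q 0). \<exists>f\<in>T 0. \<alpha> x f \<notin> m"
proof -
  interpret M: pmodule R M by (rule pmodule.intro) fact
  interpret F: pmodule R "free_module R (T 0)" by (rule free_pmodule)
  note rQ = resolvesD[OF Q] and rF = resolvesD[OF F]
  have "T 0 \<noteq> {}"
  proof
    assume "T 0 = {}"
    hence "carrier (free_module R (T 0)) = {\<zero>\<^bsub>free_module R (T 0)\<^esub>}" by (simp add: free_empty free_simps)
    hence "carrier M = {\<zero>\<^bsub>M\<^esub>}"
      using rF(4) mod_hom_zero[OF F.module_axioms M.module_axioms rF(3)] by auto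
    thus False using M(2) by (simp add: zero_module_def)
  qed
  then obtain f where f: "f \<in> T 0" by blast
  let ?g = "free_gen R f"
  have g: "?g \<in> carrier (free_module R (T 0))" by (rule free_gen_carrier[OF f])
  have "eF ?g \<in> eQ ` carrier (Q 0)" using mod_hom_closed[OF rF(3) g] rQ(4) by simp
  then obtain x where x: "x \<in> carrier (Q 0)" "eQ x = eF ?g" by (metis imageE)
  have ax: "\<alpha> x \<in> carrier (free_module R (T 0))" by (rule mod_hom_closed[OF \<alpha>(1) x(1)])
  have "eF (\<alpha> x \<ominus>\<^bsub>free_module R (T 0)\<^esub> ?g) = eF (\<alpha> x) \<ominus>\<^bsub>M\<^esub> eF ?g"
    by (rule mod_hom_diff[OF F.module_axioms M.module_axioms rF(3) ax g])
  also have "\<dots> = \<zero>\<^bsub>M\<^esub>" using \<alpha>(2) x M.diff_self[OF mod_hom_closed[OF rF(3) g]] by simp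
  finally have "\<alpha> x \<ominus>\<^bsub>free_module R (T 0)\<^esub> ?g \<in> ideal_coords R (T 0) m"
    using ker F.M.minus_closed[OF ax g] by blast
  from coord_notin_m[OF ax f this] show ?thesis using x(1) f by blast
qed

theorem ext_nonvanishing:
  fixes R :: "('a, 'r) ring_scheme" and D :: "('a, 'd) cochain_complex"
    and M :: "('a, 'm) module" and N :: "('a, 'n) module" and S :: "nat \<Rightarrow> 's set"
  assumes loc: "noetherian_local_ring R m" and depth: "depth R m = enat r"
    and norm: "normalized_dualizing_complex R m t D"
    and M: "finitely_generated R M" "\<not> zero_module M" "proj_dim R M < \<infinity>"
    and N: "module R N" "proj_dim R N < \<infinity>"
    and G: "resolves R N (\<lambda>k. free_module R (S k)) d e" and fin: "\<forall>k. finite (S k)"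
    and min: "\<forall>k. \<forall>x\<in>carrier (free_module R (S (Suc k))). d k x \<in> ideal_coords R (S k) m"
    and q: "S q \<noteq> {}" "S (Suc q) = {}"
  shows "\<not> zero_module (Ext R N (derived_tensor R M D) (int t - int r + int q))"
proof
  interpret noetherian_local_ring R m by (rule loc)
  define s where "s = int t - int r"
  define j where "j = s + int q"
  define n where "n = j - 1"
  define P where "P = resolution R N"
  define Q where "Q = resolution R M"
  assume "zero_module (Ext R N (derived_tensor R M D) (int t - int r + int q))"
  hence zero: "zero_module (cohomology (hom_complex R P (tensor_complex R Q D)) j)"
    by (simp add: Ext_def derived_tensor_def P_def Q_def j_def s_def)
  have Mm: "module R M" using M(1) by (simp add: finitely_generated_def)
  note rpP = resolution_props[OF N, folded P_def] and rpQ = resolution_props[OF Mm M(3), folded Q_def]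
  obtain eP where rP: "resolves R N (\<lambda>k. obj P (- int k)) (\<lambda>k. diff P (- int (Suc k))) eP" using rpP(4) by blast
  obtain eQ where rQ: "resolves R M (\<lambda>k. obj Q (- int k)) (\<lambda>k. diff Q (- int (Suc k))) eQ" using rpQ(4) by blast
  have D: "is_complex R D" and bd: "\<exists>c. \<forall>e>c. zero_module (obj D e)"
    using norm by (auto simp: normalized_dualizing_complex_def dualizing_complex_def)
  note top = normalized_dualizing_top[OF loc depth norm, folded s_def]
  obtain z where z: "z \<in> cocycles D s" and znot: "z \<notin> module_span R (obj D s)
      ({a \<odot>\<^bsub>obj D s\<^esub> y | a y. a \<in> m \<and> y \<in> cocycles D s} \<union> coboundaries D s)" using top(2) by blast
  have zc: "z \<in> carrier (obj D s)" and dz: "diff D s z = \<zero>\<^bsub>obj D (s + 1)\<^esub>"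
    using z by (simp_all add: cocycles_def)
  from minimal_comparison[OF N(1) rpP(3) rP G min] obtain a b where
    a: "\<And>k. a k \<in> mod_hom R (obj P (- int k)) (free_module R (S k))" and
    b: "\<And>k. b k \<in> mod_hom R (free_module R (S k)) (obj P (- int k))" and
    ad: "\<And>k x. x \<in> carrier (obj P (- int (Suc k))) \<Longrightarrow> d k (a (Suc k) x) = a k (diff P (- int (Suc k)) x)" and
    bd': "\<And>k x. x \<in> carrier (free_module R (S (Suc k))) \<Longrightarrow> diff P (- int (Suc k)) (b (Suc k) x) = b k (d k x)" and
    ab: "\<And>k x. x \<in> carrier (free_module R (S k)) \<Longrightarrow> a k (b k x) \<ominus>\<^bsub>free_module R (S k)\<^esub> x \<in> ideal_coords R (S k) m"
    by (elim exE conjE) blast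
  have "inj (\<lambda>k. k :: nat)" by simp
  from minimal_resolution[OF M(1) this] obtain rk dF eF where
    F': "resolves R M (\<lambda>k. free_module R ((\<lambda>k. k) ` {..<rk k :: nat})) dF eF" and
    kerF': "\<forall>x\<in>carrier (free_module R ((\<lambda>k. k) ` {..<rk 0})). eF x = \<zero>\<^bsub>M\<^esub> \<longrightarrow> x \<in> ideal_coords R ((\<lambda>k. k) ` {..<rk 0}) m" and
    minF': "\<forall>k. \<forall>x\<in>carrier (free_module R ((\<lambda>k. k) ` {..<rk (Suc k)})). dF k x \<in> ideal_coords R ((\<lambda>k. k) ` {..<rk k}) m"
    by (elim exE conjE)
  define T where "T k = (\<lambda>k. k) ` {..<rk k}" for k
  note F = F'[folded T_def] and kerF = kerF'[folded T_def] and minF = minF'[folded T_def]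
  have finT: "finite (T k)" for k by (simp add: T_def)
  from comparison[OF Mm rpQ(3) rQ F] obtain \<alpha> where
    \<alpha>: "\<And>k. \<alpha> k \<in> mod_hom R (obj Q (- int k)) (free_module R (T k))" and
    \<alpha>0: "\<forall>x\<in>carrier (obj Q (- int 0)). eF (\<alpha> 0 x) = eQ x" and
    \<alpha>d: "\<And>k x. x \<in> carrier (obj Q (- int (Suc k))) \<Longrightarrow> dF k (\<alpha> (Suc k) x) = \<alpha> k (diff Q (- int (Suc k)) x)"
    by (elim exE conjE) blast
  obtain x f where x: "x \<in> carrier (obj Q (- int 0))" and f: "f \<in> T 0" and xf: "\<alpha> 0 x f \<notin> m"
    using minimal_generator[OF Mm M(2) rQ F kerF \<alpha> \<alpha>0] by blast
  obtain g where g: "g \<in> S q" using q(1) by blast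
  let ?y = "b q (free_gen R g)"
  have y: "?y \<in> carrier (obj P (- int q))" by (rule mod_hom_closed[OF b free_gen_carrier[OF g]])
  \<comment> \<open>The coordinate at \<open>g\<close> after the map to \<open>G\<^sub>q\<close>, a
    linear form on the degree \<open>-q\<close> term of the chosen resolution of \<open>N\<close>.
    At \<open>?y\<close>, the image of the basis element \<open>g\<close>, its value is
    \<open>1\<close> modulo \<open>m\<close>.\<close>
  define \<kappa> where "\<kappa> w = a q w g" for w
  have \<kappa>y: "\<kappa> ?y \<notin> m"
    unfolding \<kappa>_def by (rule coord_notin_m[OF mod_hom_closed[OF a y] g ab[OF free_gen_carrier[OF g]]])
  have \<kappa>c: "\<kappa> w \<in> carrier R" if "w \<in> carrier (obj P (- int q))" for w
    unfolding \<kappa>_def using mod_hom_closed[OF a that] by (simp add: free_carrier)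

  interpret W: tensor_of_complexes R Q D
    by (intro tensor_of_complexes.intro tensor_of_complexes_axioms.intro is_cring rpQ(1) D)
  have Wp: "pmodule R (obj W.W l)" for l by (rule pmodule.intro) (rule W.W_module)
  interpret Ws: pmodule R "obj W.W s" by (rule Wp)
  have x0: "x \<in> carrier (obj Q 0)" using x by simp
  \<comment> \<open>The element \<open>x \<otimes> z\<close> of the total complex. It is a cocycle
    because \<open>Q\<close> is zero in degree \<open>1\<close> and \<open>z\<close> is a cocycle of
    \<open>D\<close>.\<close>
  define \<tau> where "\<tau> p = (if p = 0 then pure_tensor R (obj Q 0) (obj D s) x z
    else \<zero>\<^bsub>tensor R (obj Q p) (obj D (s - p))\<^esub>)" for p
  have \<tau>c: "\<tau> \<in> carrier (obj W.W s)"
    unfolding W.W_carrier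
  proof (intro conjI allI)
    fix p
    interpret T: pmodule R "tensor R (obj Q p) (obj D (s - p))" by (rule pmodule.intro) (rule W.XY_module)
    show "\<tau> p \<in> carrier (tensor R (obj Q p) (obj D (s - p)))"
      using tensor_product.pure_closed[OF W.XY_tensor x0 zc] by (cases "p = 0") (simp_all add: \<tau>_def)
  next
    have "{p. \<tau> p \<noteq> \<zero>\<^bsub>tensor R (obj Q p) (obj D (s - p))\<^esub>} \<subseteq> {0}" by (auto simp: \<tau>_def)
    thus "finite {p. \<tau> p \<noteq> \<zero>\<^bsub>tensor R (obj Q p) (obj D (s - p))\<^esub>}" by (rule finite_subset) simp
  qed
  have d\<tau>: "diff W.W s \<tau> = \<zero>\<^bsub>obj W.W (s + 1)\<^esub>"
  proof
    fix p
    define l where "l = s + 1 - p"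
    interpret T: pmodule R "tensor R (obj Q p) (obj D l)" by (rule pmodule.intro) (rule W.XY_module)
    have l: "s - (p - 1) = l" "s - p = l - 1" by (simp_all add: l_def)
    have pz: "pure_tensor R (obj Q i) (obj D k) u w = \<zero>\<^bsub>tensor R (obj Q i) (obj D k)\<^esub>"
      if "u \<in> carrier (obj Q i)" "w \<in> carrier (obj D k)" "u = \<zero>\<^bsub>obj Q i\<^esub> \<or> w = \<zero>\<^bsub>obj D k\<^esub>" for i k u w
      using mod_hom_zero[OF is_complexD(1)[OF rpQ(1)] W.XY_module tensor_product.pure_hom_left[OF W.XY_tensor that(2)]]
        mod_hom_zero[OF is_complexD(1)[OF D] W.XY_module tensor_product.pure_hom_right[OF W.XY_tensor that(1)]] that(3)
      by auto
    have 1: "W.dX l p (\<tau> (p - 1)) = \<zero>\<^bsub>tensor R (obj Q p) (obj D l)\<^esub>"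
    proof (cases "p = 1")
      case True
      have ls: "l = s" by (simp add: l_def True)
      have dx: "diff Q 0 x \<in> carrier (obj Q 1)" using mod_hom_closed[OF is_complexD(2)[OF rpQ(1)] x0] by simp
      moreover have "zero_module (obj Q 1)" using rpQ(2) by simp
      ultimately have "diff Q 0 x = \<zero>\<^bsub>obj Q 1\<^esub>" by (simp add: zero_module_def)
      thus ?thesis using W.dX_pure[of x 1 z s] x0 zc pz[OF dx zc] by (simp add: True ls \<tau>_def)
    next
      case False
      hence "\<tau> (p - 1) = \<zero>\<^bsub>tensor R (obj Q (p - 1)) (obj D l)\<^esub>" unfolding \<tau>_def l by simp
      thus ?thesis using mod_hom_zero[OF W.XY_module W.XY_module W.dX_hom] by simp
    qed
    have 2: "W.dY l p (\<tau> p) = \<zero>\<^bsub>tensor R (obj Q p) (obj D l)\<^esub>"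
    proof (cases "p = 0")
      case True
      have ls: "l - 1 = s" "l = s + 1" by (simp_all add: l_def True)
      have dzc: "diff D s z \<in> carrier (obj D (s + 1))" by (rule mod_hom_closed[OF is_complexD(2)[OF D] zc])
      show ?thesis
        using W.dY_pure[of x 0 z l] x0 zc pz[OF x0 dzc] dz by (simp add: True ls \<tau>_def)
    next
      case False
      hence "\<tau> p = \<zero>\<^bsub>tensor R (obj Q p) (obj D (l - 1))\<^esub>" unfolding \<tau>_def l by simp
      thus ?thesis using mod_hom_zero[OF W.XY_module W.XY_module W.dY_hom] by simp
    qed
    show "diff W.W s \<tau> p = \<zero>\<^bsub>obj W.W (s + 1)\<^esub> p"
      unfolding W.W_diff[OF l_def[symmetric]] 1 2 T.signed_zero W.W_simps l_def[symmetric] by simp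
  qed
  \<comment> \<open>The test cocycle of degree \<open>j = s + q\<close>: it is concentrated in
    degree \<open>-q\<close> of \<open>P\<close>, where it sends \<open>w\<close> to
    \<open>\<kappa> w\<close> times \<open>\<tau>\<close>.\<close>
  define u where "u p = (\<lambda>w\<in>carrier (obj P p). if p = - int q then \<kappa> w \<odot>\<^bsub>obj W.W s\<^esub> \<tau> else \<zero>\<^bsub>obj W.W (p + j)\<^esub>)" for p
  have js: "- int q + j = s" by (simp add: j_def)
  have u0: "u p w = \<zero>\<^bsub>obj W.W (p + j)\<^esub>" if "w \<in> carrier (obj P p)" "p \<noteq> - int q" for p w
    using that by (simp add: u_def)
  have uq: "u (- int q) w = \<kappa> w \<odot>\<^bsub>obj W.W s\<^esub> \<tau>" if "w \<in> carrier (obj P (- int q))" for w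
    using that by (simp add: u_def)
  have uhom: "u p \<in> mod_hom R (obj P p) (obj W.W (p + j))" for p
  proof (cases "p = - int q")
    case True
    have "(\<lambda>w. \<kappa> w \<odot>\<^bsub>obj W.W s\<^esub> \<tau>) \<in> mod_hom R (obj P (- int q)) (obj W.W s)"
      using \<tau>c \<kappa>c
      by (intro mod_homI)
         (simp_all add: mod_hom_add[OF a] mod_hom_smult[OF a] \<kappa>_def free_simps Ws.smult_l_distr Ws.smult_assoc1)
    thus ?thesis unfolding True js by (rule mod_hom_cong[OF is_complexD(1)[OF rpP(1)]]) (rule uq)
  next
    case False
    show ?thesis by (rule mod_hom_cong[OF is_complexD(1)[OF rpP(1)] mod_hom_zero_map[OF W.W_module]]) (rule u0[OF _ False])
  qed
  have cyc: "diff W.W (p + j) (u p w) \<ominus>\<^bsub>obj W.W (p + j + 1)\<^esub>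
      signed (obj W.W (p + j + 1)) j (u (p + 1) (diff P p w)) = \<zero>\<^bsub>obj W.W (p + j + 1)\<^esub>"
    if w: "w \<in> carrier (obj P p)" for p w
  proof -
    interpret W1: pmodule R "obj W.W (p + j + 1)" by (rule Wp)
    have 1: "diff W.W (p + j) (u p w) = \<zero>\<^bsub>obj W.W (p + j + 1)\<^esub>"
    proof (cases "p = - int q")
      case True
      have w': "w \<in> carrier (obj P (- int q))" using w True by simp
      interpret W2: pmodule R "obj W.W (s + 1)" by (rule Wp)
      show ?thesis
        unfolding True js uq[OF w'] mod_hom_smult[OF W.W_diff_hom \<kappa>c[OF w'] \<tau>c] d\<tau> using \<kappa>c[OF w'] by simp
    next
      case False
      show ?thesis unfolding u0[OF w False] by (rule W.W_diff_zero)
    qed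
    have dw: "diff P p w \<in> carrier (obj P (p + 1))" by (rule mod_hom_closed[OF is_complexD(2)[OF rpP(1)] w])
    have 2: "u (p + 1) (diff P p w) = \<zero>\<^bsub>obj W.W (p + j + 1)\<^esub>"
    proof (cases "p + 1 = - int q")
      case True
      hence p: "p = - int (Suc q)" by simp
      have p1: "- int (Suc q) + 1 = - int q" "- int (Suc q) + j + 1 = s" by (simp_all add: j_def)
      have w': "w \<in> carrier (obj P (- int (Suc q)))" using w p by simp
      have dw': "diff P (- int (Suc q)) w \<in> carrier (obj P (- int q))" using dw unfolding p p1 .
      \<comment> \<open>Since \<open>G\<^sub>q\<^sub>+\<^sub>1 = 0\<close>, the form
        \<open>\<kappa>\<close> vanishes on boundaries coming from degree \<open>-(q + 1)\<close>;
        this makes \<open>u\<close> a cocycle.\<close>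
      have "a (Suc q) w = \<zero>\<^bsub>free_module R (S (Suc q))\<^esub>"
        using mod_hom_closed[OF a w'] unfolding q(2) free_empty free_simps by simp
      hence "d q (a (Suc q) w) = \<zero>\<^bsub>free_module R (S q)\<^esub>"
        using mod_hom_zero[OF free_is_module free_is_module resolvesD(2)[OF G]] by simp
      hence \<kappa>0: "\<kappa> (diff P (- int (Suc q)) w) = \<zero>\<^bsub>R\<^esub>" unfolding \<kappa>_def ad[OF w', symmetric] by (simp add: free_simps)
      thus ?thesis unfolding p p1 uq[OF dw'] \<kappa>0 using \<tau>c by simp
    next
      case False
      have "p + 1 + j = p + j + 1" by simp
      thus ?thesis using u0[OF dw False] by (simp only:)
    qed
    show ?thesis unfolding 1 2 W1.signed_zero by (rule W1.diff_self) simp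
  qed
  have uext: "u p \<in> extensional (carrier (obj P p))" for p by (simp add: u_def)
  have "\<exists>h. (\<forall>p. h p \<in> mod_hom R (obj P p) (obj W.W (p + (j - 1)))) \<and>
    (\<forall>p. \<forall>x\<in>carrier (obj P p). u p x = diff W.W (p + (j - 1)) (h p x) \<ominus>\<^bsub>obj W.W (p + j)\<^esub>
      signed (obj W.W (p + j)) (j - 1) (h (p + 1) (diff P p x)))"
    by (rule hom_complex_boundary[where u = u, OF rpP(1) W.W_module W.W_diff_zero zero]) (fact uhom uext cyc)+
  then obtain h where h: "\<And>p. h p \<in> mod_hom R (obj P p) (obj W.W (p + (j - 1)))" and
    uh: "\<And>p x. x \<in> carrier (obj P p) \<Longrightarrow> u p x = diff W.W (p + (j - 1)) (h p x) \<ominus>\<^bsub>obj W.W (p + j)\<^esub>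
      signed (obj W.W (p + j)) (j - 1) (h (p + 1) (diff P p x))"
    by (elim exE conjE) blast

  interpret RD: resolved_double_complex R Q D "\<lambda>k. obj P (- int k)" "\<lambda>k. diff P (- int (Suc k))" S d b T dF \<alpha> n
    using fin finT resolvesD(1,2)[OF rP] resolvesD(2,6)[OF G] resolvesD(2,6)[OF F] b bd' \<alpha> \<alpha>d
    by (intro resolved_double_complex.intro resolved_double_complex_axioms.intro W.tensor_of_complexes_axioms)
       (simp_all only: simp_thms)
  have "\<exists>v\<in>carrier (RD.DC.V n). \<forall>k p. \<forall>g\<in>S k. \<forall>f\<in>T p.
    (RD.DC.C n v \<oplus>\<^bsub>RD.DC.V (n + 1)\<^esub> RD.DC.Y n v) (k, g, p, f) =
      sign (int p) \<odot>\<^bsub>RD.DC.DD (n + 1) k p\<^esub> RD.\<Phi> (n - int k + 1) p f (u (- int k) (b k (free_gen R g)))"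
  proof (rule RD.double_complex_relation[of "\<lambda>k. h (- int k)" "\<lambda>k. u (- int k)"])
    have e: "- int k + (j - 1) = n - int k" for k by (simp add: n_def)
    show "h (- int k) \<in> mod_hom R (obj P (- int k)) (obj W.W (n - int k))" for k
      using h[of "- int k"] unfolding e .
    show "u (- int 0) w = diff W.W (n - int 0) (h (- int 0) w)" if w: "w \<in> carrier (obj P (- int 0))" for w
    proof -
      interpret W0: pmodule R "obj W.W (- int 0 + j)" by (rule Wp)
      \<comment> \<open>In the boundary formula at degree \<open>0\<close>, the component of
        \<open>h\<close> in degree \<open>1\<close> is applied to an element of the zero module and
        drops out.\<close>
      have "diff P 0 w \<in> carrier (obj P 1)" using mod_hom_closed[OF is_complexD(2)[OF rpP(1)], of w 0] w by simp
      moreover have "zero_module (obj P 1)" using rpP(2) by simp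
      ultimately have dw: "diff P (- int 0) w = \<zero>\<^bsub>obj P 1\<^esub>" by (simp add: zero_module_def)
      have e1: "- int 0 + 1 = 1" "1 + (j - 1) = - int 0 + j" by simp_all
      have h1: "h 1 \<zero>\<^bsub>obj P 1\<^esub> = \<zero>\<^bsub>obj W.W (- int 0 + j)\<^esub>"
        using mod_hom_zero[OF is_complexD(1)[OF rpP(1)] W.W_module h[of 1]] unfolding e1 .
      have "diff W.W (n - int 0) (h (- int 0) w) \<in> carrier (obj W.W (- int 0 + j))"
        using mod_hom_closed[OF W.W_diff_hom mod_hom_closed[OF h[of "- int 0", unfolded e] w]]
        by (simp add: n_def)
      thus ?thesis unfolding uh[OF w] dw e1 h1 W0.signed_zero e by (rule W0.diff_zero)
    qed
    fix k w assume w: "w \<in> carrier (obj P (- int (Suc k)))"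
    have e2: "- int (Suc k) + j = n - int k" "- int (Suc k) + 1 = - int k" "j - 1 = n" by (simp_all add: n_def)
    have e3: "- int (Suc k) + n = n - int (Suc k)" by simp
    show "u (- int (Suc k)) w = diff W.W (n - int (Suc k)) (h (- int (Suc k)) w) \<ominus>\<^bsub>obj W.W (n - int k)\<^esub>
      signed (obj W.W (n - int k)) n (h (- int k) (diff P (- int (Suc k)) w))"
      using uh[OF w] unfolding e2 e3 .
  qed
  then obtain v where v: "v \<in> carrier (RD.DC.V n)" and vrel: "\<forall>k p. \<forall>g\<in>S k. \<forall>f\<in>T p.
    (RD.DC.C n v \<oplus>\<^bsub>RD.DC.V (n + 1)\<^esub> RD.DC.Y n v) (k, g, p, f) =
      sign (int p) \<odot>\<^bsub>RD.DC.DD (n + 1) k p\<^esub> RD.\<Phi> (n - int k + 1) p f (u (- int k) (b k (free_gen R g)))"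
    by (elim bexE)
  define U where "U = (\<lambda>(k, g, p, f). sign (int p) \<odot>\<^bsub>RD.DC.DD (n + 1) k p\<^esub>
    RD.\<Phi> (n - int k + 1) p f (u (- int k) (b k (free_gen R g))))"
  have vrel': "\<forall>k p. \<forall>g\<in>S k. \<forall>f\<in>T p.
    (RD.DC.C n v \<oplus>\<^bsub>RD.DC.V (n + 1)\<^esub> RD.DC.Y n v) (k, g, p, f) = U (k, g, p, f)"
    using vrel by (simp only: U_def prod.case)
  have U0: "U (k, g', p, f') = \<zero>\<^bsub>RD.DC.DD (n + 1) k p\<^esub>"
    if g': "g' \<in> S k" and kp: "\<not> (k = q \<and> p = 0)" for k p g' f'
  proof -
    have e: "n - int k + 1 + int p = n + 1 - int k + int p" "- int k + j = n - int k + 1" by (simp_all add: n_def)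
    interpret U: pmodule R "RD.DC.DD (n + 1) k p" by (rule RD.DC.DD_pmodule)
    have w: "b k (free_gen R g') \<in> carrier (obj P (- int k))" by (rule mod_hom_closed[OF b free_gen_carrier[OF g']])
    have "RD.\<Phi> (n - int k + 1) p f' (u (- int k) (b k (free_gen R g'))) = \<zero>\<^bsub>RD.DC.DD (n + 1) k p\<^esub>"
    proof (cases "k = q")
      case False
      hence "- int k \<noteq> - int q" by simp
      hence "u (- int k) (b k (free_gen R g')) = \<zero>\<^bsub>obj W.W (n - int k + 1)\<^esub>" using u0[OF w] unfolding e by blast
      thus ?thesis
        using mod_hom_zero[OF W.W_module is_complexD(1)[OF D] RD.\<Phi>_hom[of "n - int k + 1" p f']]
        unfolding RD.DC.DD_def e by simp
    next
      case True
      hence p: "p \<noteq> 0" using kp by simp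
      interpret T: pmodule R "tensor R (obj Q (- int p)) (obj D (s + int p))" by (rule pmodule.intro) (rule W.XY_module)
      have "u (- int k) (b k (free_gen R g')) (- int p) = \<zero>\<^bsub>tensor R (obj Q (- int p)) (obj D (s - - int p))\<^esub>"
        using uq[of "b q (free_gen R g')"] w True p \<kappa>c[of "b q (free_gen R g')"] by (simp add: W.W_simps \<tau>_def)
      moreover have "s - - int p = n + 1 - int k + int p" using True by (simp add: n_def j_def)
      ultimately show ?thesis
        using mod_hom_zero[OF W.XY_module is_complexD(1)[OF D] RD.contract(1)]
        unfolding RD.\<Phi>_def RD.DC.DD_def e by simp
    qed
    thus ?thesis unfolding U_def prod.case by simp
  qed
  \<comment> \<open>The value at the corner: each of the two comparison maps contributes one factor
    outside \<open>m\<close>.\<close>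
  have Uq: "U (q, g, 0, f) = (\<kappa> ?y \<otimes>\<^bsub>R\<^esub> \<alpha> 0 x f) \<odot>\<^bsub>obj D s\<^esub> z"
  proof -
    interpret Ds: pmodule R "obj D s" by (rule pmodule.intro) (rule is_complexD(1)[OF D])
    have e: "n - int q + 1 = s" "n + 1 - int q + int 0 = s" "s + int 0 = s" by (simp_all add: n_def j_def)
    have xc: "\<alpha> 0 x f \<in> carrier R" using mod_hom_closed[OF \<alpha> x] by (simp add: free_carrier)
    have "RD.\<Phi> s 0 f \<tau> = \<alpha> 0 x f \<odot>\<^bsub>obj D s\<^esub> z"
      using RD.contract(2)[OF x zc, of f] by (simp add: RD.\<Phi>_def \<tau>_def)
    moreover have "RD.\<Phi> s 0 f (\<kappa> ?y \<odot>\<^bsub>obj W.W s\<^esub> \<tau>) = \<kappa> ?y \<odot>\<^bsub>obj D s\<^esub> RD.\<Phi> s 0 f \<tau>"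
      using mod_hom_smult[OF RD.\<Phi>_hom \<kappa>c[OF y] \<tau>c, of 0 f] unfolding e .
    ultimately show ?thesis
      unfolding U_def prod.case RD.DC.DD_def e uq[OF y]
      using \<kappa>c[OF y] xc zc by (simp add: sign_def Ds.smult_assoc1)
  qed
  \<comment> \<open>\<open>U\<close> is concentrated at \<open>k = q\<close>, \<open>p = 0\<close>,
    hence at level \<open>q\<close>; with \<open>b = q\<close>, exactness of \<open>D\<close> is
    required precisely above degree \<open>n - q + 1 = s\<close>.\<close>
  have "\<exists>v\<in>carrier (RD.DC.V n). (\<forall>k p. \<forall>g\<in>S k. \<forall>f\<in>T p.
      (RD.DC.C n v \<oplus>\<^bsub>RD.DC.V (n + 1)\<^esub> RD.DC.Y n v) (k, g, p, f) = U (k, g, p, f)) \<and>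
    (\<forall>k p. \<forall>g\<in>S k. \<forall>f\<in>T p. int k - int p < int q - 1 \<longrightarrow> v (k, g, p, f) = \<zero>\<^bsub>RD.DC.DD n k p\<^esub>)"
  proof (rule RD.DC.clear_below[OF v vrel' _ _ bd])
    show "\<forall>k p. \<forall>g\<in>S k. \<forall>f\<in>T p. int k - int p < int q \<longrightarrow> U (k, g, p, f) = \<zero>\<^bsub>RD.DC.DD (n + 1) k p\<^esub>"
      by (intro allI ballI impI U0) auto
    have "n - int q + 1 = s" by (simp add: n_def j_def)
    thus "\<forall>l > n - int q + 1. cocycles D l \<subseteq> coboundaries D l" using top(1) by simp
  qed
  then obtain v' where v': "v' \<in> carrier (RD.DC.V n)" and rel': "\<forall>k p. \<forall>g\<in>S k. \<forall>f\<in>T p.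
      (RD.DC.C n v' \<oplus>\<^bsub>RD.DC.V (n + 1)\<^esub> RD.DC.Y n v') (k, g, p, f) = U (k, g, p, f)"
    and low: "\<forall>k p. \<forall>g\<in>S k. \<forall>f\<in>T p. int k - int p < int q - 1 \<longrightarrow> v' (k, g, p, f) = \<zero>\<^bsub>RD.DC.DD n k p\<^esub>"
    by (elim bexE conjE)
  interpret Ds: pmodule R "obj D s" by (rule pmodule.intro) (rule is_complexD(1)[OF D])
  let ?X = "{a \<odot>\<^bsub>obj D s\<^esub> y | a y. a \<in> m \<and> y \<in> cocycles D s} \<union> coboundaries D s"
  have Xc: "?X \<subseteq> carrier (obj D s)"
    using Ds.submoduleE(1)[OF coboundaries_submodule[OF D]] m_sub Ds.smult_closed by (auto simp: cocycles_def)
  note H = Ds.span_submodule[OF Xc]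
  have sn: "n + 1 - int q = s" by (simp add: n_def j_def)
  interpret mi: ideal m R by (rule m_ideal)
  have c1m: "RD.c1 0 f' f \<in> m" if f': "f' \<in> T (Suc 0)" for f'
  proof -
    have "dF 0 (free_gen R f') f \<in> m" using minF free_gen_carrier[OF f'] by (simp add: ideal_coords_def)
    thus ?thesis using f' mi.I_l_closed by (simp add: RD.c1_def RD.A_def)
  qed
  have c2m: "RD.c2 k 0 g g' \<in> m" if k: "q = Suc k" for k g'
  proof -
    have "free_gen R g \<in> carrier (free_module R (S (Suc k)))" using free_gen_carrier[OF g] k by simp
    hence "d k (free_gen R g) g' \<in> m" using min by (simp add: ideal_coords_def)
    thus ?thesis using g k mi.I_l_closed by (simp add: RD.c2_def RD.B_def)
  qed
  \<comment> \<open>By minimality of both resolutions the coefficients entering the corner lie in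
    \<open>m\<close>, so a unit times \<open>z\<close> falls into the span of \<open>m Z + B\<close>
    that \<open>z\<close> was chosen to avoid.\<close>
  have "U (q, g, 0, f) \<in> module_span R (obj D s) ?X"
  proof (rule RD.DC.value_in_submodule[OF v' rel' low _ g f, unfolded sn])
    show "\<forall>k p. \<forall>g\<in>S k. \<forall>f\<in>T p. int k - int p = int q - 1 \<longrightarrow> U (k, g, p, f) = \<zero>\<^bsub>RD.DC.DD (n + 1) k p\<^esub>"
      by (intro allI ballI impI U0) auto
    show "int q - int 0 = int q" by simp
    show "RD.c1 0 f' f \<in> m" if "f' \<in> T (Suc 0)" for f' by (rule c1m[OF that])
    show "RD.c2 k 0 g g' \<in> m" if "q = Suc k" "g' \<in> S k" for k g' by (rule c2m[OF that(1)])
    show "submodule (module_span R (obj D s) ?X) R (obj D s)" by (rule H)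
    show "coboundaries D s \<subseteq> module_span R (obj D s) ?X"
      using Ds.span_incl[of ?X] by (rule subset_trans[rotated]) simp
    show "a \<odot>\<^bsub>obj D s\<^esub> y \<in> module_span R (obj D s) ?X" if "a \<in> m" "y \<in> cocycles D s" for a y
      by (rule subsetD[OF Ds.span_incl]) (use that in blast)
  qed
  hence Uc: "(\<kappa> ?y \<otimes>\<^bsub>R\<^esub> \<alpha> 0 x f) \<odot>\<^bsub>obj D s\<^esub> z \<in> module_span R (obj D s) ?X" unfolding Uq .
  have xc: "\<alpha> 0 x f \<in> carrier R" using mod_hom_closed[OF \<alpha> x] by (simp add: free_carrier)
  have unit: "c \<in> Units R" if c: "c \<in> carrier R" "c \<notin> m" for c
  proof -
    obtain c' where c': "c' \<in> carrier R" "c' \<otimes>\<^bsub>R\<^esub> c = \<one>\<^bsub>R\<^esub>" using unit_if_notin_m[OF c] by metis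
    hence "c \<otimes>\<^bsub>R\<^esub> c' = \<one>\<^bsub>R\<^esub>" using m_comm[OF c(1) c'(1)] by simp
    thus ?thesis using c(1) c' unfolding Units_def by blast
  qed
  let ?c = "\<kappa> ?y \<otimes>\<^bsub>R\<^esub> \<alpha> 0 x f"
  have cu: "?c \<in> Units R" by (intro Units_m_closed unit \<kappa>c[OF y] xc \<kappa>y xf)
  have "inv\<^bsub>R\<^esub> ?c \<odot>\<^bsub>obj D s\<^esub> (?c \<odot>\<^bsub>obj D s\<^esub> z) \<in> module_span R (obj D s) ?X"
    by (rule Ds.submoduleE(4)[OF H Units_inv_closed[OF cu] Uc])
  moreover have "inv\<^bsub>R\<^esub> ?c \<odot>\<^bsub>obj D s\<^esub> (?c \<odot>\<^bsub>obj D s\<^esub> z) = z"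
    unfolding Ds.smult_assoc1[OF Units_inv_closed[OF cu] Units_closed[OF cu] zc, symmetric] Units_l_inv[OF cu]
    by (rule Ds.smult_one[OF zc])
  ultimately show False using znot by simp
qed

theorem theorem5p1:
  fixes R :: "('a, 'r) ring_scheme" and m :: "'a set"
    and D :: "('a, 'd) cochain_complex"
    and M :: "('a, 'm) module" and N :: "('a, 'n) module"
    and t r i :: nat
  assumes "noetherian_local_ring R m"
    and "krull_dim R = enat t"
    and "depth R m = enat r" and "1 \<le> r"
    and "normalized_dualizing_complex R m t D"
    and "finitely_generated R M" and "\<not> zero_module M"
    and "finitely_generated R N"
    and "proj_dim R M < \<infinity>" and "proj_dim R N < \<infinity>"
    and "1 \<le> i" and "i \<le> r"
    and "\<forall>j \<in> {int t - int r + int i .. int t}.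
           zero_module (Ext R N (derived_tensor R M D) j)"
  shows "proj_dim R N < enat i"
proof (rule ccontr)
  assume pd: "\<not> proj_dim R N < enat i"
  interpret noetherian_local_ring R m by fact
  from minimal_resolution_of_large_length[OF assms(8,10,11) pd assms(3)]
  obtain S :: "nat \<Rightarrow> ('n \<times> nat) set" and d e q where G: "resolves R N (\<lambda>k. free_module R (S k)) d e"
    "\<forall>k. finite (S k)" "\<forall>k. \<forall>x\<in>carrier (free_module R (S (Suc k))). d k x \<in> ideal_coords R (S k) m"
    "S q \<noteq> {}" "S (Suc q) = {}" and q: "i \<le> q" "q \<le> r" by (elim exE conjE)
  have "module R N" using assms(8) by (simp add: finitely_generated_def)
  from ext_nonvanishing[OF assms(1,3,5-7,9) this assms(10) G]
  have "\<not> zero_module (Ext R N (derived_tensor R M D) (int t - int r + int q))" .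
  \<comment> \<open>\<open>i \<le> q \<le> r\<close> puts the degree \<open>t - r + q\<close> into
    the range in which \<open>Ext\<close> is assumed to vanish.\<close>
  moreover have "int t - int r + int q \<in> {int t - int r + int i .. int t}" using q by simp
  ultimately show False using assms(13) by blast
qed

end
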